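(* Let $X$ be a separable $1$-exact operator system. Then $X$ is nuclear if and only if there exist a complete order embedding $\phi : X \to \mathbb{GS}$ and a unital completely positive projection of $\mathbb{GS}$ onto the range of $\phi$, where $\mathbb{GS}$ denotes the Gurarij operator system.
   Context: An operator system is a closed subspace $X$ of $B(H)$, for a complex Hilbert space $H$, that contains the identity operator (the unit) and is closed under adjoints; it carries the positive cones on $M_n(X)\subset B(H^{\oplus n})$ and the corresponding matrix norms. A linear map between operator systems is unital if it maps the unit to the unit, and completely positive if all its entrywise matrix amplifications map positive elements to positive elements; a ucp map is a unital completely positive linear map. A complete order isomorphism is a surjective ucp map with ucp inverse, and a complete order embedding is a complete order isomorphism onto its image. $M_n$ denotes the complex $n\times n$ matrices. For a linear map $\varphi$, $\|\varphi\|_{cb}$ is the supremum of the norms of its matrix amplifications; for injective $\varphi$, $\varphi^{-1}$ denotes the inverse regarded as a map from the range of $\varphi$ to its domain. A finite-dimensional operator system $X$ is $1$-exact if for every $\varepsilon>0$ there exist $n\in\mathbb{N}$ and an injective ucp map $\varphi: X\to M_n$ such that $\|\varphi^{-1}\|_{cb}\le 1+\varepsilon$. An arbitrary operator system is $1$-exact if all its finite-dimensional subsystems are $1$-exact. An operator system $X$ is nuclear if for every finite subset $A$ of $X$ and every $\varepsilon>0$ there exist $n\in\mathbb{N}$ and ucp maps $\varphi: X\to M_n$ and $\psi: M_n\to X$ such that $\|(\psi\circ\varphi)(x)-x\|\le\varepsilon$ for every $x\in A$. (It is known that an operator system is $1$-exact, respectively nuclear, in this sense if and only if it is so as an operator space,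 i.e. in the sense obtained by replacing ucp maps with completely contractive linear maps.) The Gurarij operator system $\mathbb{GS}$ is the separable $1$-exact operator system, known to exist and to be unique up to complete order isomorphism, with the following property: for all finite-dimensional $1$-exact operator systems $E\subset F$, every complete order embedding $\phi: E\to\mathbb{GS}$, and every $\varepsilon>0$, there exists a complete order embedding $\psi: F\to\mathbb{GS}$ such that $\|\psi|_E-\phi\|\le\varepsilon$. *)

theory Defs
  imports "HOL-Analysis.Analysis" "Jordan_Normal_Form.Matrix"
begin

section \<open>Complex Hilbert spaces\<close>

class scaleC =
  fixes scaleC :: "complex \<Rightarrow> 'a \<Rightarrow> 'a" (infixr "*\<^sub>C" 75)

text \<open>The complex inner product is linear in its first argument; norm and topology are those
  of the underlying real inner product space, whose inner product is the real part.\<close>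

class chilbert_space = scaleC + real_inner + complete_space +
  fixes cinner :: "'a \<Rightarrow> 'a \<Rightarrow> complex"
  assumes scaleC_add_right: "c *\<^sub>C (x + y) = c *\<^sub>C x + c *\<^sub>C y"
    and scaleC_add_left: "(c + d) *\<^sub>C x = c *\<^sub>C x + d *\<^sub>C x"
    and scaleC_scaleC: "c *\<^sub>C (d *\<^sub>C x) = (c * d) *\<^sub>C x"
    and scaleR_scaleC: "r *\<^sub>R x = complex_of_real r *\<^sub>C x"
    and cinner_commute: "cinner x y = cnj (cinner y x)"
    and cinner_add_left: "cinner (x + y) z = cinner x z + cinner y z"
    and cinner_scaleC_left: "cinner (c *\<^sub>C x) y = c * cinner x y"
    and inner_eq_Re_cinner: "inner x y = Re (cinner x y)"

instance chilbert_space \<subseteq> banach ..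

lemma scaleC_one: "1 *\<^sub>C x = (x :: 'a :: chilbert_space)"
  using scaleR_scaleC[of 1 x] by simp

lemma norm_scaleC: "norm (c *\<^sub>C x) = cmod c * norm (x :: 'a :: chilbert_space)"
proof -
  have im: "Im (cinner x x) = 0"
    using arg_cong[OF cinner_commute[of x x], of Im] by simp
  have "cinner (c *\<^sub>C x) (c *\<^sub>C x) = c * cnj (cinner (c *\<^sub>C x) x)"
    by (metis cinner_scaleC_left cinner_commute)
  also have "\<dots> = c * cnj c * cnj (cinner x x)"
    by (simp add: cinner_scaleC_left)
  finally have "cinner (c *\<^sub>C x) (c *\<^sub>C x) = complex_of_real ((cmod c)\<^sup>2) * cnj (cinner x x)"
    by (simp only: complex_norm_square)
  hence "Re (cinner (c *\<^sub>C x) (c *\<^sub>C x)) = (cmod c)\<^sup>2 * Re (cinner x x)"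
    using im by simp
  thus ?thesis
    by (simp add: norm_eq_sqrt_inner inner_eq_Re_cinner real_sqrt_mult)
qed

lemma bounded_linear_scaleC: "bounded_linear (\<lambda>x :: 'a :: chilbert_space. c *\<^sub>C x)"
proof (rule bounded_linear_intro)
  show "c *\<^sub>C (x + y) = c *\<^sub>C x + c *\<^sub>C y" for x y :: 'a
    by (rule scaleC_add_right)
  show "c *\<^sub>C (r *\<^sub>R x) = r *\<^sub>R (c *\<^sub>C x)" for r and x :: 'a
    by (simp add: scaleR_scaleC scaleC_scaleC mult.commute)
  show "norm (c *\<^sub>C x) \<le> norm x * cmod c" for x :: 'a
    by (simp add: norm_scaleC)
qed

instantiation blinfun :: (real_normed_vector, chilbert_space) scaleC
begin
lift_definition scaleC_blinfun :: "complex \<Rightarrow> 'a \<Rightarrow>\<^sub>L 'b \<Rightarrow> 'a \<Rightarrow>\<^sub>L 'b" is "\<lambda>c T x. c *\<^sub>C T x"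
  by (rule bounded_linear_compose[OF bounded_linear_scaleC])
instance ..
end

instantiation complex :: scaleC
begin
definition scaleC_complex :: "complex \<Rightarrow> complex \<Rightarrow> complex" where "scaleC_complex c z = c * z"
instance ..
end

instantiation mat :: (scaleC) scaleC
begin
definition scaleC_mat :: "complex \<Rightarrow> 'a mat \<Rightarrow> 'a mat" where "scaleC_mat c A = map_mat (scaleC c) A"
instance ..
end

interpretation op_space: vector_space
  "scaleC :: complex \<Rightarrow> ('a :: real_normed_vector \<Rightarrow>\<^sub>L 'b :: chilbert_space) \<Rightarrow> 'a \<Rightarrow>\<^sub>L 'b"
  by standard (transfer, simp add: scaleC_add_right scaleC_add_left scaleC_scaleC scaleC_one)+

section \<open>The Hilbert space of square-summable sequences\<close>

typedef ell2 = "{f :: nat \<Rightarrow> complex. summable (\<lambda>n. (cmod (f n))\<^sup>2)}"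
  morphisms ell2_nth Abs_ell2
  by (rule exI[of _ "\<lambda>_. 0"]) simp

setup_lifting type_definition_ell2

lemma ell2_summable_add:
  fixes f g :: "nat \<Rightarrow> complex"
  assumes "summable (\<lambda>n. (cmod (f n))\<^sup>2)" "summable (\<lambda>n. (cmod (g n))\<^sup>2)"
  shows "summable (\<lambda>n. (cmod (f n + g n))\<^sup>2)"
proof (rule summable_comparison_test')
  show "summable (\<lambda>n. 2 * (cmod (f n))\<^sup>2 + 2 * (cmod (g n))\<^sup>2)"
    by (intro summable_add summable_mult assms)
  fix n :: nat
  have "(cmod (f n + g n))\<^sup>2 \<le> (cmod (f n) + cmod (g n))\<^sup>2"
    by (intro power_mono norm_triangle_ineq) simp
  also have "\<dots> \<le> 2 * (cmod (f n))\<^sup>2 + 2 * (cmod (g n))\<^sup>2"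
    using sum_squares_bound[of "cmod (f n)" "cmod (g n)"] by (simp add: power2_sum)
  finally show "norm ((cmod (f n + g n))\<^sup>2) \<le> 2 * (cmod (f n))\<^sup>2 + 2 * (cmod (g n))\<^sup>2"
    by simp
qed

lemma ell2_summable_mult:
  fixes f g :: "nat \<Rightarrow> complex"
  assumes "summable (\<lambda>n. (cmod (f n))\<^sup>2)" "summable (\<lambda>n. (cmod (g n))\<^sup>2)"
  shows "summable (\<lambda>n. f n * cnj (g n))"
proof (rule summable_comparison_test')
  show "summable (\<lambda>n. (cmod (f n))\<^sup>2 + (cmod (g n))\<^sup>2)"
    by (intro summable_add assms)
  fix n :: nat
  have "0 \<le> cmod (f n) * cmod (g n)" by simp
  thus "norm (f n * cnj (g n)) \<le> (cmod (f n))\<^sup>2 + (cmod (g n))\<^sup>2"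
    using sum_squares_bound[of "cmod (f n)" "cmod (g n)"]
    by (simp only: norm_mult complex_mod_cnj)
qed

lemma ell2_summable_scale:
  fixes f :: "nat \<Rightarrow> complex"
  assumes "summable (\<lambda>n. (cmod (f n))\<^sup>2)"
  shows "summable (\<lambda>n. (cmod (c * f n))\<^sup>2)"
  using assms by (simp add: norm_mult power_mult_distrib summable_mult)

instantiation ell2 :: "{scaleC, real_inner}"
begin

lift_definition zero_ell2 :: ell2 is "\<lambda>_. 0" by simp
lift_definition plus_ell2 :: "ell2 \<Rightarrow> ell2 \<Rightarrow> ell2" is "\<lambda>f g n. f n + g n"
  by (rule ell2_summable_add)
lift_definition scaleC_ell2 :: "complex \<Rightarrow> ell2 \<Rightarrow> ell2" is "\<lambda>c f n. c * f n"
  by (rule ell2_summable_scale)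
lift_definition uminus_ell2 :: "ell2 \<Rightarrow> ell2" is "\<lambda>f n. - f n" by simp
lift_definition ell2_cinner :: "ell2 \<Rightarrow> ell2 \<Rightarrow> complex" is "\<lambda>f g. \<Sum>n. f n * cnj (g n)" .
definition minus_ell2 :: "ell2 \<Rightarrow> ell2 \<Rightarrow> ell2" where "minus_ell2 f g = f + - g"
definition scaleR_ell2 :: "real \<Rightarrow> ell2 \<Rightarrow> ell2" where "scaleR_ell2 r f = complex_of_real r *\<^sub>C f"
definition inner_ell2 :: "ell2 \<Rightarrow> ell2 \<Rightarrow> real" where "inner_ell2 f g = Re (ell2_cinner f g)"
definition norm_ell2 :: "ell2 \<Rightarrow> real" where "norm_ell2 f = sqrt (inner f f)"
definition sgn_ell2 :: "ell2 \<Rightarrow> ell2" where "sgn_ell2 f = inverse (norm f) *\<^sub>R f"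
definition dist_ell2 :: "ell2 \<Rightarrow> ell2 \<Rightarrow> real" where "dist_ell2 f g = norm (f - g)"
definition uniformity_ell2 :: "(ell2 \<times> ell2) filter"
  where "uniformity_ell2 = (INF e\<in>{0<..}. principal {(f, g). dist f g < e})"
definition open_ell2 :: "ell2 set \<Rightarrow> bool"
  where "open_ell2 U \<longleftrightarrow> (\<forall>f\<in>U. eventually (\<lambda>(f', g). f' = f \<longrightarrow> g \<in> U) uniformity)"

lemma inner_ell2_self: "inner f f = (\<Sum>n. (cmod (ell2_nth f n))\<^sup>2)" for f :: ell2
  unfolding inner_ell2_def
proof (transfer)
  fix f :: "nat \<Rightarrow> complex" assume "summable (\<lambda>n. (cmod (f n))\<^sup>2)"
  thus "Re (\<Sum>n. f n * cnj (f n)) = (\<Sum>n. (cmod (f n))\<^sup>2)"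
    by (simp add: complex_norm_square[symmetric] suminf_of_real[symmetric] del: of_real_power)
qed

lemma ell2_cinner_commute: "ell2_cinner x y = cnj (ell2_cinner y x)"
proof transfer
    fix f g :: "nat \<Rightarrow> complex"
    assume "summable (\<lambda>n. (cmod (f n))\<^sup>2)" "summable (\<lambda>n. (cmod (g n))\<^sup>2)"
    hence "summable (\<lambda>n. g n * cnj (f n))" by (intro ell2_summable_mult)
    hence "(\<lambda>n. cnj (g n * cnj (f n))) sums cnj (\<Sum>n. g n * cnj (f n))"
      by (simp only: sums_cnj summable_sums)
    thus "(\<Sum>n. f n * cnj (g n)) = cnj (\<Sum>n. g n * cnj (f n))"
      by (simp add: sums_iff mult.commute)
qed

lemma ell2_cinner_add: "ell2_cinner (x + y) z = ell2_cinner x z + ell2_cinner y z"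
    by transfer (simp add: ring_distribs suminf_add ell2_summable_mult)

lemma ell2_cinner_scale: "ell2_cinner (c *\<^sub>C x) y = c * ell2_cinner x y"
    by transfer (simp add: mult.assoc suminf_mult ell2_summable_mult)

instance
proof
  fix r s :: real and x y z :: ell2
  show "x + y + z = x + (y + z)" by transfer (simp add: algebra_simps)
  show "x + y = y + x" by transfer (simp add: algebra_simps)
  show "0 + x = x" by transfer simp
  show "- x + x = 0" by transfer simp
  show "x - y = x + - y" by (rule minus_ell2_def)
  show "r *\<^sub>R (x + y) = r *\<^sub>R x + r *\<^sub>R y"
    unfolding scaleR_ell2_def by transfer (simp add: algebra_simps)
  show "(r + s) *\<^sub>R x = r *\<^sub>R x + s *\<^sub>R x"
    unfolding scaleR_ell2_def by transfer (simp add: algebra_simps)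
  show "r *\<^sub>R s *\<^sub>R x = (r * s) *\<^sub>R x"
    unfolding scaleR_ell2_def by transfer (simp add: algebra_simps)
  show "1 *\<^sub>R x = x"
    unfolding scaleR_ell2_def by transfer simp
  show "sgn x = inverse (norm x) *\<^sub>R x" by (rule sgn_ell2_def)
  show "dist x y = norm (x - y)" by (rule dist_ell2_def)
  show "uniformity = (INF e\<in>{0<..}. principal {(f, g :: ell2). dist f g < e})"
    by (rule uniformity_ell2_def)
  show "open U \<longleftrightarrow> (\<forall>f\<in>U. \<forall>\<^sub>F (f', g) in uniformity. f' = f \<longrightarrow> g \<in> U)" for U :: "ell2 set"
    by (rule open_ell2_def)
  show "inner x y = inner y x"
    unfolding inner_ell2_def by (subst ell2_cinner_commute) simp
  show "inner (x + y) z = inner x z + inner y z"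
    unfolding inner_ell2_def ell2_cinner_add by simp
  show "inner (r *\<^sub>R x) y = r * inner x y"
    unfolding inner_ell2_def scaleR_ell2_def ell2_cinner_scale by simp
  show "0 \<le> inner x x"
    unfolding inner_ell2_self using ell2_nth[of x] by (intro suminf_nonneg) auto
  show "inner x x = 0 \<longleftrightarrow> x = 0"
    unfolding inner_ell2_self
    by transfer (subst suminf_eq_zero_iff, auto)
  show "norm x = sqrt (inner x x)" by (rule norm_ell2_def)
qed

end

instantiation ell2 :: chilbert_space
begin

definition cinner_ell2 :: "ell2 \<Rightarrow> ell2 \<Rightarrow> complex" where "cinner_ell2 = ell2_cinner"

instance
proof
  fix c d :: complex and r :: real and x y z :: ell2
  show "c *\<^sub>C (x + y) = c *\<^sub>C x + c *\<^sub>C y" by transfer (simp add: algebra_simps)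
  show "(c + d) *\<^sub>C x = c *\<^sub>C x + d *\<^sub>C x" by transfer (simp add: algebra_simps)
  show "c *\<^sub>C d *\<^sub>C x = (c * d) *\<^sub>C x" by transfer (simp add: algebra_simps)
  show "r *\<^sub>R x = complex_of_real r *\<^sub>C x" by (rule scaleR_ell2_def)
  show "cinner x y = cnj (cinner y x)"
    unfolding cinner_ell2_def by (rule ell2_cinner_commute)
  show "cinner (x + y) z = cinner x z + cinner y z"
    unfolding cinner_ell2_def by (rule ell2_cinner_add)
  show "cinner (c *\<^sub>C x) y = c * cinner x y"
    unfolding cinner_ell2_def by (rule ell2_cinner_scale)
  show "inner x y = Re (cinner x y)"
    unfolding cinner_ell2_def by (rule inner_ell2_def)
next
  fix X :: "nat \<Rightarrow> ell2"
  assume "Cauchy X"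
  have nth_diff: "ell2_nth (f - g) i = ell2_nth f i - ell2_nth g i" for f g i
    unfolding minus_ell2_def by transfer simp
  have normsq: "(norm f)\<^sup>2 = (\<Sum>n. (cmod (ell2_nth f n))\<^sup>2)" for f :: ell2
    unfolding norm_ell2_def inner_ell2_self using ell2_nth[of f]
    by (intro real_sqrt_pow2 suminf_nonneg) auto
  have part: "(\<Sum>i<k. (cmod (ell2_nth f i))\<^sup>2) \<le> (norm f)\<^sup>2" for f k
    unfolding normsq using ell2_nth[of f] by (intro sum_le_suminf) auto
  have nonneg: "0 \<le> norm f" for f :: ell2
    unfolding norm_ell2_def inner_ell2_self using ell2_nth[of f]
    by (intro real_sqrt_ge_zero suminf_nonneg) auto
  have coord: "cmod (ell2_nth f i) \<le> norm f" for f i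
  proof (rule power2_le_imp_le)
    have "(cmod (ell2_nth f i))\<^sup>2 \<le> (\<Sum>j<Suc i. (cmod (ell2_nth f j))\<^sup>2)"
      by (intro member_le_sum) auto
    also note part
    finally show "(cmod (ell2_nth f i))\<^sup>2 \<le> (norm f)\<^sup>2" .
  qed (rule nonneg)
  have C: "\<exists>N. \<forall>m\<ge>N. \<forall>n\<ge>N. norm (X m - X n) < e" if "e > 0" for e
    using \<open>Cauchy X\<close> that unfolding Cauchy_def dist_ell2_def by blast
  have "Cauchy (\<lambda>n. ell2_nth (X n) i)" for i
    unfolding Cauchy_def dist_norm nth_diff[symmetric] using C coord by (meson order_le_less_trans)
  then obtain l where l: "(\<lambda>n. ell2_nth (X n) i) \<longlonglongrightarrow> l i" for i
    unfolding Cauchy_convergent_iff convergent_def by metis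
  have bnd: "\<exists>N. \<forall>m\<ge>N. \<forall>k. (\<Sum>i<k. (cmod (ell2_nth (X m) i - l i))\<^sup>2) \<le> e\<^sup>2" if e: "e > 0" for e
  proof -
    obtain N where N: "\<And>m n. m \<ge> N \<Longrightarrow> n \<ge> N \<Longrightarrow> norm (X m - X n) < e" using C[OF e] by blast
    have "(\<Sum>i<k. (cmod (ell2_nth (X m) i - l i))\<^sup>2) \<le> e\<^sup>2" if m: "m \<ge> N" for m k
    proof (rule tendsto_upperbound)
      show "(\<lambda>n. \<Sum>i<k. (cmod (ell2_nth (X m) i - ell2_nth (X n) i))\<^sup>2)
          \<longlonglongrightarrow> (\<Sum>i<k. (cmod (ell2_nth (X m) i - l i))\<^sup>2)"
        by (intro tendsto_intros l)
      show "\<forall>\<^sub>F n in sequentially. (\<Sum>i<k. (cmod (ell2_nth (X m) i - ell2_nth (X n) i))\<^sup>2) \<le> e\<^sup>2"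
        unfolding eventually_sequentially
      proof (intro exI allI impI)
        fix n assume "n \<ge> N"
        have "(\<Sum>i<k. (cmod (ell2_nth (X m) i - ell2_nth (X n) i))\<^sup>2) \<le> (norm (X m - X n))\<^sup>2"
          using part[of "X m - X n" k] by (simp add: nth_diff)
        also have "\<dots> \<le> e\<^sup>2" using N[OF m \<open>n \<ge> N\<close>] nonneg by (intro power_mono) auto
        finally show "(\<Sum>i<k. (cmod (ell2_nth (X m) i - ell2_nth (X n) i))\<^sup>2) \<le> e\<^sup>2" .
      qed
    qed simp
    thus ?thesis by blast
  qed
  have sm: "summable (\<lambda>i. (cmod (ell2_nth (X m) i - l i))\<^sup>2)"
    if "\<forall>k. (\<Sum>i<k. (cmod (ell2_nth (X m) i - l i))\<^sup>2) \<le> e\<^sup>2" for m and e :: real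
    using that by (intro summableI_nonneg_bounded[of _ "e\<^sup>2"]) auto
  obtain N1 where N1: "\<forall>m\<ge>N1. \<forall>k. (\<Sum>i<k. (cmod (ell2_nth (X m) i - l i))\<^sup>2) \<le> 1\<^sup>2"
    using bnd[of 1] by auto
  have "summable (\<lambda>i. (cmod (ell2_nth (X N1) i + - (ell2_nth (X N1) i - l i)))\<^sup>2)"
    using ell2_nth[of "X N1"] sm[of N1 1] N1
    by (intro ell2_summable_add) (simp_all only: norm_minus_cancel, auto)
  hence l2: "summable (\<lambda>i. (cmod (l i))\<^sup>2)" by simp
  define L where "L = Abs_ell2 l"
  have L: "ell2_nth L i = l i" for i unfolding L_def using l2 by (simp add: Abs_ell2_inverse)
  have "X \<longlonglongrightarrow> L"
    unfolding lim_sequentially dist_ell2_def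
  proof (intro allI impI)
    fix e :: real assume e: "e > 0"
    obtain N where N: "\<forall>m\<ge>N. \<forall>k. (\<Sum>i<k. (cmod (ell2_nth (X m) i - l i))\<^sup>2) \<le> (e/2)\<^sup>2"
      using bnd[of "e/2"] e by auto
    have "norm (X m - L) < e" if "m \<ge> N" for m
    proof -
      have "(norm (X m - L))\<^sup>2 \<le> (e/2)\<^sup>2"
        unfolding normsq nth_diff L using N that by (intro suminf_le_const sm[of m "e/2"]) auto
      hence "norm (X m - L) \<le> e/2" by (rule power2_le_imp_le) (use e in simp)
      thus ?thesis using e by simp
    qed
    thus "\<exists>N. \<forall>m\<ge>N. norm (X m - L) < e" by blast
  qed
  thus "convergent X" by (auto simp: convergent_def)
qed

end

section \<open>Operator systems\<close>

text \<open>Elements of \<open>'h \<Rightarrow>\<^sub>L 'h\<close> are only real-linear, so complex linearity is part of the definition.\<close>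

definition clinear_op :: "('h :: chilbert_space \<Rightarrow>\<^sub>L 'h) \<Rightarrow> bool" where
  "clinear_op T \<longleftrightarrow> (\<forall>c h. blinfun_apply T (c *\<^sub>C h) = c *\<^sub>C blinfun_apply T h)"

definition is_adjoint :: "('h :: chilbert_space \<Rightarrow>\<^sub>L 'h) \<Rightarrow> ('h \<Rightarrow>\<^sub>L 'h) \<Rightarrow> bool" where
  "is_adjoint S T \<longleftrightarrow> (\<forall>h k. cinner (blinfun_apply S h) k = cinner h (blinfun_apply T k))"

definition operator_system :: "('h :: chilbert_space \<Rightarrow>\<^sub>L 'h) set \<Rightarrow> bool" where
  "operator_system X \<longleftrightarrow>
     (\<forall>T\<in>X. clinear_op T) \<and> op_space.subspace X \<and> closed X \<and>
     id_blinfun \<in> X \<and> (\<forall>T\<in>X. \<exists>S\<in>X. is_adjoint S T)"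

definition finite_dim :: "('h :: chilbert_space \<Rightarrow>\<^sub>L 'h) set \<Rightarrow> bool" where
  "finite_dim X \<longleftrightarrow> (\<exists>B. finite B \<and> X = op_space.span B)"

text \<open>The data through which operator systems and matrix algebras enter the notions below:
  underlying set, unit, positive cones and norms on \<open>k \<times> k\<close> matrices. Such matrices are functions
  \<open>x :: nat \<Rightarrow> nat \<Rightarrow> 'x\<close> of which only the entries \<open>x i j\<close> with \<open>i, j < k\<close> matter.\<close>

record 'x matrix_system =
  elems :: "'x set"
  unit_elem :: 'x
  mpos :: "nat \<Rightarrow> (nat \<Rightarrow> nat \<Rightarrow> 'x) \<Rightarrow> bool"
  mnorm :: "nat \<Rightarrow> (nat \<Rightarrow> nat \<Rightarrow> 'x) \<Rightarrow> real"

text \<open>A \<open>k \<times> k\<close> matrix of operators on \<open>H\<close> acts on the \<open>k\<close>-fold Hilbert space direct sum of \<open>H\<close>,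
  whose elements are families \<open>h\<close> with norm \<open>L2_set (\<lambda>j. norm (h j)) {..<k}\<close>.\<close>

definition op_mpos :: "nat \<Rightarrow> (nat \<Rightarrow> nat \<Rightarrow> 'h :: chilbert_space \<Rightarrow>\<^sub>L 'h) \<Rightarrow> bool" where
  "op_mpos k x \<longleftrightarrow>
     (\<forall>h :: nat \<Rightarrow> 'h. (\<Sum>i<k. cinner (\<Sum>j<k. blinfun_apply (x i j) (h j)) (h i)) \<in> \<real>\<^sub>\<ge>\<^sub>0)"

definition op_mnorm :: "nat \<Rightarrow> (nat \<Rightarrow> nat \<Rightarrow> 'h :: chilbert_space \<Rightarrow>\<^sub>L 'h) \<Rightarrow> real" where
  "op_mnorm k x =
     (SUP h \<in> {h :: nat \<Rightarrow> 'h. L2_set (\<lambda>j. norm (h j)) {..<k} \<le> 1}.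
        L2_set (\<lambda>i. norm (\<Sum>j<k. blinfun_apply (x i j) (h j))) {..<k})"

definition op_sys ::
    "('h :: chilbert_space \<Rightarrow>\<^sub>L 'h) set \<Rightarrow> ('h \<Rightarrow>\<^sub>L 'h) matrix_system" where
  "op_sys X = \<lparr>elems = X, unit_elem = id_blinfun, mpos = op_mpos, mnorm = op_mnorm\<rparr>"

text \<open>\<open>mat_sys n\<close> is \<open>M\<^sub>n = B(\<complex>\<^sup>n)\<close>; a \<open>k \<times> k\<close> matrix \<open>A\<close> over it acts on vectors \<open>v\<close> with
  coordinates \<open>v i a\<close>, \<open>i < k\<close>, \<open>a < n\<close>.\<close>

definition mat_act ::
    "nat \<Rightarrow> nat \<Rightarrow> (nat \<Rightarrow> nat \<Rightarrow> complex mat) \<Rightarrow> (nat \<Rightarrow> nat \<Rightarrow> complex) \<Rightarrow> nat \<Rightarrow> nat \<Rightarrow> complex" where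
  "mat_act n k A v i a = (\<Sum>j<k. \<Sum>b<n. A i j $$ (a, b) * v j b)"

definition vec_norm :: "nat \<Rightarrow> nat \<Rightarrow> (nat \<Rightarrow> nat \<Rightarrow> complex) \<Rightarrow> real" where
  "vec_norm n k v = L2_set (\<lambda>(i, a). cmod (v i a)) ({..<k} \<times> {..<n})"

definition mat_mpos :: "nat \<Rightarrow> nat \<Rightarrow> (nat \<Rightarrow> nat \<Rightarrow> complex mat) \<Rightarrow> bool" where
  "mat_mpos n k A \<longleftrightarrow>
     (\<forall>v :: nat \<Rightarrow> nat \<Rightarrow> complex. (\<Sum>i<k. \<Sum>a<n. mat_act n k A v i a * cnj (v i a)) \<in> \<real>\<^sub>\<ge>\<^sub>0)"

definition mat_mnorm :: "nat \<Rightarrow> nat \<Rightarrow> (nat \<Rightarrow> nat \<Rightarrow> complex mat) \<Rightarrow> real" where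
  "mat_mnorm n k A = (SUP v \<in> {v. vec_norm n k v \<le> 1}. vec_norm n k (mat_act n k A v))"

definition mat_sys :: "nat \<Rightarrow> complex mat matrix_system" where
  "mat_sys n =
     \<lparr>elems = carrier_mat n n, unit_elem = 1\<^sub>m n, mpos = mat_mpos n, mnorm = mat_mnorm n\<rparr>"

definition subsystem :: "'x matrix_system \<Rightarrow> 'x set \<Rightarrow> 'x matrix_system" where
  "subsystem S Y = S\<lparr>elems := Y\<rparr>"

section \<open>Maps between operator systems\<close>

definition matrices_over :: "'x matrix_system \<Rightarrow> nat \<Rightarrow> (nat \<Rightarrow> nat \<Rightarrow> 'x) set" where
  "matrices_over S k = {x. \<forall>i<k. \<forall>j<k. x i j \<in> elems S}"

definition amplify :: "('x \<Rightarrow> 'y) \<Rightarrow> (nat \<Rightarrow> nat \<Rightarrow> 'x) \<Rightarrow> nat \<Rightarrow> nat \<Rightarrow> 'y" where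
  "amplify \<phi> x = (\<lambda>i j. \<phi> (x i j))"

definition linear_map ::
    "('x :: {plus, scaleC}) matrix_system \<Rightarrow> ('y :: {plus, scaleC}) matrix_system \<Rightarrow> ('x \<Rightarrow> 'y) \<Rightarrow> bool" where
  "linear_map S T \<phi> \<longleftrightarrow>
     (\<forall>x\<in>elems S. \<phi> x \<in> elems T) \<and>
     (\<forall>x\<in>elems S. \<forall>y\<in>elems S. \<phi> (x + y) = \<phi> x + \<phi> y) \<and>
     (\<forall>c. \<forall>x\<in>elems S. \<phi> (c *\<^sub>C x) = c *\<^sub>C \<phi> x)"

definition ucp ::
    "('x :: {plus, scaleC}) matrix_system \<Rightarrow> ('y :: {plus, scaleC}) matrix_system \<Rightarrow> ('x \<Rightarrow> 'y) \<Rightarrow> bool" where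
  "ucp S T \<phi> \<longleftrightarrow>
     linear_map S T \<phi> \<and> \<phi> (unit_elem S) = unit_elem T \<and>
     (\<forall>k. \<forall>x\<in>matrices_over S k. mpos S k x \<longrightarrow> mpos T k (amplify \<phi> x))"

definition complete_order_iso ::
    "('x :: {plus, scaleC}) matrix_system \<Rightarrow> ('y :: {plus, scaleC}) matrix_system \<Rightarrow> ('x \<Rightarrow> 'y) \<Rightarrow> bool" where
  "complete_order_iso S T \<phi> \<longleftrightarrow>
     bij_betw \<phi> (elems S) (elems T) \<and> ucp S T \<phi> \<and> ucp T S (inv_into (elems S) \<phi>)"

definition complete_order_embedding ::
    "('x :: {plus, scaleC}) matrix_system \<Rightarrow> ('y :: {plus, scaleC}) matrix_system \<Rightarrow> ('x \<Rightarrow> 'y) \<Rightarrow> bool" where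
  "complete_order_embedding S T \<phi> \<longleftrightarrow>
     \<phi> ` elems S \<subseteq> elems T \<and> complete_order_iso S (subsystem T (\<phi> ` elems S)) \<phi>"

definition cb_norm :: "'x matrix_system \<Rightarrow> 'y matrix_system \<Rightarrow> ('x \<Rightarrow> 'y) \<Rightarrow> ennreal" where
  "cb_norm S T \<phi> =
     (SUP k. SUP x \<in> {x \<in> matrices_over S k. mnorm S k x \<le> 1}. ennreal (mnorm T k (amplify \<phi> x)))"

definition ucp_projection_onto ::
    "('x :: {plus, scaleC}) matrix_system \<Rightarrow> 'x set \<Rightarrow> ('x \<Rightarrow> 'x) \<Rightarrow> bool" where
  "ucp_projection_onto S Y P \<longleftrightarrow>
     ucp S S P \<and> (\<forall>x\<in>elems S. P (P x) = P x) \<and> P ` elems S = Y"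

section \<open>Exactness, nuclearity, and the Gurarij operator system\<close>

text \<open>The matrix size is required to be positive; this only excludes the zero system (on a
  zero-dimensional space), for which there is no unital linear map into \<open>M\<^sub>n\<close>.\<close>

definition one_exact_fd :: "('h :: chilbert_space \<Rightarrow>\<^sub>L 'h) set \<Rightarrow> bool" where
  "one_exact_fd E \<longleftrightarrow>
     (\<forall>\<epsilon>>0. \<exists>n>0. \<exists>\<phi>. ucp (op_sys E) (mat_sys n) \<phi> \<and> inj_on \<phi> E \<and>
        cb_norm (subsystem (mat_sys n) (\<phi> ` E)) (op_sys E) (inv_into E \<phi>) \<le> ennreal (1 + \<epsilon>))"

definition one_exact :: "('h :: chilbert_space \<Rightarrow>\<^sub>L 'h) set \<Rightarrow> bool" where
  "one_exact X \<longleftrightarrow> (\<forall>E\<subseteq>X. operator_system E \<and> finite_dim E \<longrightarrow> one_exact_fd E)"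

definition nuclear :: "('h :: chilbert_space \<Rightarrow>\<^sub>L 'h) set \<Rightarrow> bool" where
  "nuclear X \<longleftrightarrow>
     (\<forall>A\<subseteq>X. finite A \<longrightarrow> (\<forall>\<epsilon>>0. \<exists>n>0. \<exists>\<phi> \<psi>.
        ucp (op_sys X) (mat_sys n) \<phi> \<and> ucp (mat_sys n) (op_sys X) \<psi> \<and>
        (\<forall>x\<in>A. norm (\<psi> (\<phi> x) - x) \<le> \<epsilon>)))"

text \<open>A definition cannot quantify over all Hilbert space types. Letting \<open>E \<subseteq> F\<close> range over
  operator systems on the single space \<open>\<ell>\<^sup>2\<close> loses nothing: a finite-dimensional operator system
  on a nonzero Hilbert space is completely order isomorphic to one on a separable Hilbert space
  and, after passing to a countably infinite multiple of the latter, to one on \<open>\<ell>\<^sup>2\<close>.\<close>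

definition gurarij_operator_system :: "('g :: chilbert_space \<Rightarrow>\<^sub>L 'g) set \<Rightarrow> bool" where
  "gurarij_operator_system G \<longleftrightarrow>
     operator_system G \<and> separable_space (top_of_set G) \<and> one_exact G \<and>
     (\<forall>(E :: (ell2 \<Rightarrow>\<^sub>L ell2) set) F \<phi> \<epsilon>.
        operator_system E \<and> finite_dim E \<and> one_exact_fd E \<and>
        operator_system F \<and> finite_dim F \<and> one_exact_fd F \<and> E \<subseteq> F \<and>
        complete_order_embedding (op_sys E) (op_sys G) \<phi> \<and> 0 < \<epsilon> \<longrightarrow>
        (\<exists>\<psi>. complete_order_embedding (op_sys F) (op_sys G) \<psi> \<and>
           (\<forall>x\<in>E. norm (\<psi> x - \<phi> x) \<le> \<epsilon> * norm x)))"

end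

theory Submission
  imports Defs "HOL-Library.Function_Algebras"
begin

text \<open>The heart of the proof is an approximate pushout. Given a finite subset \<open>B\<close> of \<open>GS\<close> and a ucp map
  \<open>\<tau>\<close> from \<open>GS\<close> to \<open>M\<^sub>m\<close>, there are ucp maps \<open>\<rho>\<close> from \<open>GS\<close> to some \<open>M\<^sub>n\<close> and \<open>\<Psi>\<close> from \<open>M\<^sub>n\<^sub>+\<^sub>m\<close> to \<open>GS\<close>
  such that \<open>\<Psi>\<close> has a ucp left inverse \<open>L\<close> and \<open>\<Psi> (\<rho> b \<oplus> \<tau> b) \<approx> b\<close> for \<open>b\<close> in \<open>B\<close>. For this, take almost
  isometric ucp maps \<open>\<Theta> k\<close> of a finite-dimensional system \<open>E\<close> containing \<open>B\<close> into matrix algebras, with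
  \<open>\<Theta> 0 = \<rho> \<oplus> \<tau>\<close>. Since the inverse of \<open>\<Theta> k\<close> is almost completely positive, a Hahn-Banach argument yields ucp
  maps \<open>\<gamma> k\<close> with \<open>\<gamma> k \<circ> \<Theta> k \<approx> \<Theta> (k + 1)\<close>, with an error that does not depend on the matrix sizes. Then
  \<open>x \<mapsto> \<Oplus>\<^sub>k \<Theta> k x\<close> and \<open>a \<mapsto> \<Oplus>\<^sub>k \<gamma> (k - 1) (\<dots> (\<gamma> 0 a))\<close> map \<open>E\<close> and \<open>M\<^sub>n\<^sub>+\<^sub>m\<close> into the block diagonal operators
  on \<open>\<ell>\<^sup>2\<close> and almost agree along \<open>\<Theta> 0\<close>. The sum of their ranges is 1-exact, because the late blocks of an
  element are almost determined by the early ones, so the Gurarij property carries it into \<open>GS\<close>.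

  The case \<open>m = 0\<close> shows that \<open>GS\<close> is nuclear, and nuclearity passes to the range of a ucp projection.
  Conversely, let \<open>\<phi>\<close> and \<open>Q\<close> be ucp maps between \<open>X\<close> and \<open>GS\<close> with \<open>Q \<circ> \<phi>\<close> close to the identity on a finite
  set, and factor the identity of \<open>X\<close> approximately as \<open>s \<circ> r\<close> through \<open>M\<^sub>m\<close>. With \<open>\<tau> = r \<circ> Q\<close>, the maps
  \<open>a \<mapsto> \<Psi> (\<rho> (\<phi> a) \<oplus> r a)\<close> and \<open>g \<mapsto> s (p (L g))\<close>, where \<open>p\<close> cuts down to \<open>M\<^sub>m\<close>, are close to \<open>\<phi>\<close> and \<open>Q\<close> and
  compose almost to the identity on a larger finite set. Iterating gives in the limit \<open>Q \<circ> \<phi> = id\<close>, and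
  \<open>\<phi> \<circ> Q\<close> is the projection.\<close>

section \<open>The Riesz extension theorem\<close>

text \<open>The Gurarij property only extends embeddings between finite-dimensional 1-exact systems,
  so the amalgam of \<open>E\<close> with a matrix algebra must itself be 1-exact, which an abstract
  pushout does not provide. The concrete amalgam meets two opposite demands. Along the chain the
  errors \<open>\<delta> / 2 ^ k\<close> tend to 0, so the late blocks determine positivity on
  \<open>E\<close> exactly; their sum stays of order \<open>\<delta>\<close>, so the two maps into
  the amalgam almost agree.

  The errors are measured in the order rather than entry by entry, because the matrix sizes along
  the chain are not under control. This is why \<open>ucp_pair_extension\<close> allows arbitrary
  scalar matrices as order bounds: its error is \<open>\<delta>\<close> times a difference of two
  ucp maps, whatever the size.

  Putting \<open>\<tau>\<close> into the first term of the chain makes a given factorization through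
  matrices a corner of the new one. Hence the new composite in \<open>approx_retract_step\<close> is
  exactly \<open>s\<close> after \<open>r\<close>, however bad the previous pair was, and the
  iteration improves.\<close>

instantiation "fun" :: (type, real_vector) real_vector
begin
definition scaleR_fun :: "real \<Rightarrow> ('a \<Rightarrow> 'b) \<Rightarrow> 'a \<Rightarrow> 'b" where
  "scaleR_fun r f = (\<lambda>x. r *\<^sub>R f x)"
instance
  by standard (simp_all add: scaleR_fun_def fun_eq_iff scaleR_add_right scaleR_add_left)
end

text \<open>One step of the Riesz extension. Functionals are kept as graphs so that Zorn's lemma can
  form unions. Call u below v if v - u lies in C: the new value at v has to separate the values at
  elements below v from those at elements above v, and \<open>dom\<close> supplies elements of both
  kinds.\<close>

lemma positive_graph_extend:
  fixes C :: "'v::real_vector set" and U :: "('v \<times> real) set"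
  assumes U: "subspace U" and Cadd: "\<And>x y. x \<in> C \<Longrightarrow> y \<in> C \<Longrightarrow> x + y \<in> C"
    and Cscale: "\<And>r x. 0 \<le> r \<Longrightarrow> x \<in> C \<Longrightarrow> r *\<^sub>R x \<in> C"
    and pos: "\<And>w t. (w, t) \<in> U \<Longrightarrow> w \<in> C \<Longrightarrow> 0 \<le> t"
    and dom: "\<And>v. \<exists>w t. (w, t) \<in> U \<and> w - v \<in> C"
  shows "\<exists>U' s. subspace U' \<and> U \<subseteq> U' \<and> (v, s) \<in> U' \<and> (\<forall>w t. (w, t) \<in> U' \<longrightarrow> w \<in> C \<longrightarrow> 0 \<le> t)"
proof -
  define L where "L = {t. \<exists>u. (u, t) \<in> U \<and> v - u \<in> C}"
  have le: "t \<le> t'" if "(u, t) \<in> U" "v - u \<in> C" "(u', t') \<in> U" "u' - v \<in> C" for u t u' t'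
  proof -
    have "(u' - u, t' - t) \<in> U" using subspace_diff[OF U that(3,1)] by simp
    moreover have "u' - u \<in> C" using Cadd[OF that(2,4)] by simp
    ultimately show ?thesis using pos by fastforce
  qed
  obtain w1 t1 where w1: "(w1, t1) \<in> U" "w1 - v \<in> C" using dom by blast
  \<comment> \<open>Dominating -v yields an element below v, namely -w2, so the supremum is taken
    over a nonempty set.\<close>
  obtain w2 t2 where w2: "(w2, t2) \<in> U" "w2 - (-v) \<in> C" using dom by blast
  have Lne: "- t2 \<in> L" unfolding L_def using w2 subspace_neg[OF U w2(1)] by (auto simp: add.commute)
  have bdd: "bdd_above L" unfolding bdd_above_def L_def using le[OF _ _ w1] by blast
  define s where "s = Sup L"
  have s1: "t \<le> s" if "(u, t) \<in> U" "v - u \<in> C" for u t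
    unfolding s_def using that by (intro cSup_upper bdd) (auto simp: L_def)
  have s2: "s \<le> t" if "(u, t) \<in> U" "u - v \<in> C" for u t
    unfolding s_def using that le Lne by (intro cSup_least) (auto simp: L_def)
  define U' where "U' = {x + y |x y. x \<in> U \<and> y \<in> span {(v, s)}}"
  have "subspace U'" unfolding U'_def by (intro subspace_sums U subspace_span)
  moreover have "U \<subseteq> U'"
  proof
    fix x assume "x \<in> U"
    then have "x + 0 \<in> U'" unfolding U'_def by (blast intro: span_zero)
    then show "x \<in> U'" by simp
  qed
  moreover have "(v, s) \<in> U'"
  proof -
    have "0 + (v, s) \<in> U'" unfolding U'_def using subspace_0[OF U] by (blast intro: span_base)
    then show ?thesis by simp
  qed
  moreover have "0 \<le> t" if wt: "(w, t) \<in> U'" "w \<in> C" for w t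
  proof -
    obtain x y where xy: "x \<in> U" "y \<in> span {(v, s)}" "(w, t) = x + y"
      using wt(1) unfolding U'_def by blast
    obtain r where "y = r *\<^sub>R (v, s)" using xy(2) unfolding span_singleton by blast
    then obtain u t0 where u: "(u, t0) \<in> U" "w = u + r *\<^sub>R v" "t = t0 + r * s"
      using xy by (cases x) auto
    have sc: "(k *\<^sub>R u, k * t0) \<in> U" for k using subspace_scale[OF U u(1), of k] by simp
    \<comment> \<open>After division by the absolute value of \<open>r\<close>, membership of w in C
      says that v lies above a multiple of u if \<open>r\<close> is positive, and below one if
      \<open>r\<close> is negative.\<close>
    consider "r = 0" | "r > 0" | "r < 0" by linarith
    then show ?thesis
    proof cases
      case 1 then show ?thesis using u wt pos by simp
    next
      case 2
      have "(1 / r) *\<^sub>R w \<in> C" using 2 wt(2) by (intro Cscale) auto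
      then have "v - (- 1 / r) *\<^sub>R u \<in> C" using 2 u(2) by (simp add: scaleR_add_right add.commute)
      from s1[OF sc this] have "- 1 / r * t0 \<le> s" .
      then show ?thesis using 2 u(3) by (simp add: field_simps)
    next
      case 3
      have "(- 1 / r) *\<^sub>R w \<in> C" using 3 wt(2) by (intro Cscale) (auto simp: field_simps)
      then have "(- 1 / r) *\<^sub>R u - v \<in> C" using 3 u(2) by (simp add: scaleR_add_right)
      from s2[OF sc this] have "s \<le> - 1 / r * t0" .
      then show ?thesis using 3 u(3) by (simp add: field_simps)
    qed
  qed
  ultimately show ?thesis by blast
qed

text \<open>As 0 lies in C, positivity applied to (0, t) and (0, -t) forces t = 0, so positive
  graphs are single-valued. This lets \<open>W\<close> be prescribed later through parameters that
  are not unique. A maximal positive graph is total by \<open>positive_graph_extend\<close>.\<close>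

lemma riesz_extension:
  fixes C :: "'v::real_vector set" and W :: "('v \<times> real) set"
  assumes W: "subspace W" and Cadd: "\<And>x y. x \<in> C \<Longrightarrow> y \<in> C \<Longrightarrow> x + y \<in> C"
    and Cscale: "\<And>r x. 0 \<le> r \<Longrightarrow> x \<in> C \<Longrightarrow> r *\<^sub>R x \<in> C"
    and pos: "\<And>w t. (w, t) \<in> W \<Longrightarrow> w \<in> C \<Longrightarrow> 0 \<le> t"
    and dom: "\<And>v. \<exists>w t. (w, t) \<in> W \<and> w - v \<in> C"
  shows "\<exists>f. linear f \<and> (\<forall>w t. (w, t) \<in> W \<longrightarrow> f w = t) \<and> (\<forall>x\<in>C. 0 \<le> f x)"
proof -
  define A where "A = {U. subspace U \<and> W \<subseteq> U \<and> (\<forall>w t. (w, t) \<in> U \<longrightarrow> w \<in> C \<longrightarrow> 0 \<le> t)}"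
  have "\<exists>M\<in>A. \<forall>X\<in>A. M \<subseteq> X \<longrightarrow> X = M"
  proof (rule subset_Zorn_nonempty)
    show "A \<noteq> {}" using W pos unfolding A_def by blast
    fix \<C> assume c: "\<C> \<noteq> {}" "subset.chain A \<C>"
    have 1: "subspace U" "W \<subseteq> U" "\<And>w t. (w, t) \<in> U \<Longrightarrow> w \<in> C \<Longrightarrow> 0 \<le> t" if "U \<in> \<C>" for U
      using c(2) that unfolding subset_chain_def A_def by blast+
    have "subspace (\<Union>\<C>)"
    proof (rule subspaceI)
      show "0 \<in> \<Union>\<C>" using c(1) 1(1) subspace_0 by blast
      fix x y assume "x \<in> \<Union>\<C>" "y \<in> \<Union>\<C>"
      then obtain U V where "x \<in> U" "y \<in> V" "U \<in> \<C>" "V \<in> \<C>" by blast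
      moreover from this have "U \<subseteq> V \<or> V \<subseteq> U" using c(2) unfolding subset_chain_def by blast
      ultimately show "x + y \<in> \<Union>\<C>" using 1(1) subspace_add by blast
    next
      fix r x assume "x \<in> \<Union>\<C>"
      then show "r *\<^sub>R x \<in> \<Union>\<C>" using 1(1) subspace_scale by blast
    qed
    then show "\<Union>\<C> \<in> A" using 1 c(1) unfolding A_def by blast
  qed
  then obtain M where M: "M \<in> A" "\<And>X. X \<in> A \<Longrightarrow> M \<subseteq> X \<Longrightarrow> X = M" by blast
  have Ms: "subspace M" and WM: "W \<subseteq> M" and Mp: "\<And>w t. (w, t) \<in> M \<Longrightarrow> w \<in> C \<Longrightarrow> 0 \<le> t"
    using M(1) unfolding A_def by blast+
  have tot: "\<exists>t. (v, t) \<in> M" for v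
  proof -
    have "\<And>v. \<exists>w t. (w, t) \<in> M \<and> w - v \<in> C" using dom WM by blast
    then have "\<exists>U' s. subspace U' \<and> M \<subseteq> U' \<and> (v, s) \<in> U' \<and> (\<forall>w t. (w, t) \<in> U' \<longrightarrow> w \<in> C \<longrightarrow> 0 \<le> t)"
      by (intro positive_graph_extend[OF Ms]) (use Cadd Cscale Mp in auto)
    then obtain U' s where U': "subspace U'" "M \<subseteq> U'" "(v, s) \<in> U'" "\<And>w t. (w, t) \<in> U' \<Longrightarrow> w \<in> C \<Longrightarrow> 0 \<le> t"
      by blast
    then have "U' \<in> A" using WM unfolding A_def by blast
    then show ?thesis using M(2) U' by blast
  qed
  obtain c where "c \<in> C" using dom by blast
  then have C0: "0 \<in> C" using Cscale[of 0 c] by simp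
  have uniq: "t = t'" if "(v, t) \<in> M" "(v, t') \<in> M" for v t t'
  proof -
    have "(0, t - t') \<in> M" "(0, t' - t) \<in> M"
      using subspace_diff[OF Ms that] subspace_diff[OF Ms that(2,1)] by simp_all
    then have "0 \<le> t - t'" "0 \<le> t' - t" using Mp C0 by blast+
    then show ?thesis by simp
  qed
  define f where "f v = (THE t. (v, t) \<in> M)" for v
  have f: "(v, f v) \<in> M" for v
    unfolding f_def using tot[of v] uniq by (metis theI)
  have feq: "f v = t" if "(v, t) \<in> M" for v t using uniq that f by blast
  have "linear f"
  proof (rule linearI)
    show "f (x + y) = f x + f y" for x y
      using subspace_add[OF Ms f[of x] f[of y]] by (intro feq) simp
    show "f (r *\<^sub>R x) = r *\<^sub>R f x" for r x
      using subspace_scale[OF Ms f[of x], of r] by (intro feq) simp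
  qed
  then show ?thesis using feq f WM Mp by blast
qed

section \<open>Forms of operator matrices\<close>

lemma scaleC_blinfun_apply [simp]: "blinfun_apply (c *\<^sub>C T) h = c *\<^sub>C blinfun_apply T h"
  by (transfer) simp

lemma scaleC_zero_right [simp]: "c *\<^sub>C (0 :: 'a :: chilbert_space) = 0"
  using scaleC_add_right[of c 0 0] by simp

lemma scaleC_zero_left [simp]: "0 *\<^sub>C (x :: 'a :: chilbert_space) = 0"
  using scaleC_add_left[of 0 0 x] by simp

lemma scaleC_minus1: "(-1) *\<^sub>C x = - (x :: 'a :: chilbert_space)"
  using scaleR_scaleC[of "-1" x] by simp

lemma cinner_add_right: "cinner z (x + y) = cinner z x + cinner z (y :: 'a :: chilbert_space)"
  by (metis cinner_commute cinner_add_left complex_cnj_add)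

lemma cinner_scaleC_right: "cinner x (c *\<^sub>C y) = cnj c * cinner x (y :: 'a :: chilbert_space)"
  by (metis cinner_commute cinner_scaleC_left complex_cnj_mult)

lemma cinner_zero_left [simp]: "cinner 0 (x :: 'a :: chilbert_space) = 0"
  using cinner_add_left[of 0 0 x] by simp

lemma cinner_zero_right [simp]: "cinner (x :: 'a :: chilbert_space) 0 = 0"
  using cinner_add_right[of x 0 0] by simp

lemma cinner_minus_left [simp]: "cinner (- x) (y :: 'a :: chilbert_space) = - cinner x y"
  using cinner_scaleC_left[of "-1" x y] by (simp add: scaleC_minus1)

lemma cinner_minus_right [simp]: "cinner x (- y :: 'a :: chilbert_space) = - cinner x y"
  using cinner_scaleC_right[of x "-1" y] by (simp add: scaleC_minus1)

lemma cinner_diff_left: "cinner (x - y) (z :: 'a :: chilbert_space) = cinner x z - cinner y z"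
  using cinner_add_left[of x "- y" z] by simp

lemma cinner_sum_left: "cinner (\<Sum>i\<in>A. f i) (z :: 'a :: chilbert_space) = (\<Sum>i\<in>A. cinner (f i) z)"
  by (induction A rule: infinite_finite_induct) (auto simp: cinner_add_left)

lemma cinner_sum_right: "cinner (z :: 'a :: chilbert_space) (\<Sum>i\<in>A. f i) = (\<Sum>i\<in>A. cinner z (f i))"
  by (induction A rule: infinite_finite_induct) (auto simp: cinner_add_right)

lemma cinner_self: "cinner x x = of_real ((norm (x :: 'a :: chilbert_space))\<^sup>2)"
proof (rule complex_eqI)
  show "Re (cinner x x) = Re (of_real ((norm x)\<^sup>2))"
    by (simp add: inner_eq_Re_cinner[symmetric] power2_norm_eq_inner)
  show "Im (cinner x x) = Im (of_real ((norm x)\<^sup>2))"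
    using arg_cong[OF cinner_commute[of x x], of Im] by simp
qed

text \<open>Real parts of the sesquilinear form of an operator matrix. Positivity and norm bounds are
  expressed through them, since maps preserving positivity of the real part need not be checked for
  self-adjointness separately.\<close>

definition rform :: "nat \<Rightarrow> (nat \<Rightarrow> nat \<Rightarrow> 'h::chilbert_space \<Rightarrow>\<^sub>L 'h) \<Rightarrow> (nat \<Rightarrow> 'h) \<Rightarrow> (nat \<Rightarrow> 'h) \<Rightarrow> real" where
  "rform k x h g = (\<Sum>i<k. \<Sum>j<k. inner (blinfun_apply (x i j) (h j)) (g i))"

definition rpos :: "nat \<Rightarrow> (nat \<Rightarrow> nat \<Rightarrow> 'h::chilbert_space \<Rightarrow>\<^sub>L 'h) \<Rightarrow> bool" where
  "rpos k x \<longleftrightarrow> (\<forall>h. 0 \<le> rform k x h h)"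

definition nsq :: "nat \<Rightarrow> (nat \<Rightarrow> 'h::real_normed_vector) \<Rightarrow> real" where
  "nsq k h = (\<Sum>i<k. (norm (h i))\<^sup>2)"

text \<open>For nonnegative c this says that the operator norm of the matrix is at most c. Half the
  sum of squares may replace the product of the norms because h and g can be rescaled separately
  (\<open>rform_bound\<close>, \<open>rbndI\<close>); in this shape the bound is positivity of a
  form in twice as many vectors.\<close>

definition rbnd :: "nat \<Rightarrow> (nat \<Rightarrow> nat \<Rightarrow> 'h::chilbert_space \<Rightarrow>\<^sub>L 'h) \<Rightarrow> real \<Rightarrow> bool" where
  "rbnd k x c \<longleftrightarrow> (\<forall>h g. 2 * rform k x h g \<le> c * (nsq k h + nsq k g))"

lemma rform_cong:
  assumes "\<And>i j. i < k \<Longrightarrow> j < k \<Longrightarrow> x i j = y i j" "\<And>i. i < k \<Longrightarrow> h i = h' i" "\<And>i. i < k \<Longrightarrow> g i = g' i"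
  shows "rform k x h g = rform k y h' g'"
  unfolding rform_def using assms by (intro sum.cong refl) auto

lemma rpos_cong: "(\<And>i j. i < k \<Longrightarrow> j < k \<Longrightarrow> x i j = y i j) \<Longrightarrow> rpos k x \<longleftrightarrow> rpos k y"
  unfolding rpos_def using rform_cong[of k x y] by metis

lemma rbnd_cong: "(\<And>i j. i < k \<Longrightarrow> j < k \<Longrightarrow> x i j = y i j) \<Longrightarrow> rbnd k x c \<longleftrightarrow> rbnd k y c"
  unfolding rbnd_def using rform_cong[of k x y] by metis

lemma rform_add: "rform k (\<lambda>i j. x i j + y i j) h g = rform k x h g + rform k y h g"
  by (simp add: rform_def blinfun.add_left inner_add_left sum.distrib)

lemma rform_diff: "rform k (\<lambda>i j. x i j - y i j) h g = rform k x h g - rform k y h g"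
  by (simp add: rform_def blinfun.diff_left inner_diff_left sum_subtractf)

lemma rform_scaleR: "rform k (\<lambda>i j. r *\<^sub>R x i j) h g = r * rform k x h g"
  by (simp add: rform_def blinfun.scaleR_left sum_distrib_left)

lemma rform_scaleC: "rform k (\<lambda>i j. c *\<^sub>C x i j) h g = Re c * rform k x h g + Im c * rform k (\<lambda>i j. \<i> *\<^sub>C x i j) h g"
proof -
  have "inner (c *\<^sub>C u) v = Re c * inner u v + Im c * inner (\<i> *\<^sub>C u) v" for u v :: 'a
    by (simp add: inner_eq_Re_cinner cinner_scaleC_left)
  then show ?thesis by (simp add: rform_def sum.distrib sum_distrib_left)
qed

lemma rform_vec_add_left: "rform k x (\<lambda>i. h i + h' i) g = rform k x h g + rform k x h' g"
  by (simp add: rform_def blinfun.add_right inner_add_left sum.distrib)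

lemma rform_vec_add_right: "rform k x h (\<lambda>i. g i + g' i) = rform k x h g + rform k x h g'"
  by (simp add: rform_def inner_add_right sum.distrib)

lemma rform_vec_scale_left: "rform k x (\<lambda>i. r *\<^sub>R h i) g = r * rform k x h g"
  by (simp add: rform_def blinfun.scaleR_right sum_distrib_left)

lemma rform_vec_scale_right: "rform k x h (\<lambda>i. r *\<^sub>R g i) = r * rform k x h g"
  by (simp add: rform_def sum_distrib_left)

lemma rform_vec_minus_left: "rform k x (\<lambda>i. - h i) g = - rform k x h g"
  using rform_vec_scale_left[of k x "-1" h g] by simp

text \<open>The matrix \<alpha> tensor 1. Amplified unital linear maps fix it, so it serves as an
  order bound that makes sense in all operator systems at once.\<close>

definition scal :: "(nat \<Rightarrow> nat \<Rightarrow> complex) \<Rightarrow> nat \<Rightarrow> nat \<Rightarrow> 'h::chilbert_space \<Rightarrow>\<^sub>L 'h" where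
  "scal \<alpha> = (\<lambda>i j. \<alpha> i j *\<^sub>C id_blinfun)"

abbreviation unit_scal :: "complex \<Rightarrow> nat \<Rightarrow> nat \<Rightarrow> 'h::chilbert_space \<Rightarrow>\<^sub>L 'h" where
  "unit_scal c \<equiv> scal (\<lambda>i j. if i = j then c else 0)"

lemma scal_apply [simp]: "blinfun_apply (scal \<alpha> i j) h = \<alpha> i j *\<^sub>C h"
  by (simp add: scal_def)

lemma rform_scal_diag: "rform k (unit_scal (of_real r)) h g = r * (\<Sum>i<k. inner (h i) (g i))"
proof -
  have "inner ((if i = j then of_real r else 0) *\<^sub>C h j) (g i) = (if i = j then r * inner (h i) (g i) else 0)" for i j
    by (simp flip: scaleR_scaleC)
  then show ?thesis by (simp add: rform_def sum_distrib_left)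
qed

lemma nsq_inner: "nsq k h = (\<Sum>i<k. inner (h i) (h i :: 'h :: real_inner))"
  by (simp add: nsq_def power2_norm_eq_inner)

lemma nsq_nonneg [simp]: "0 \<le> nsq k h"
  by (simp add: nsq_def sum_nonneg)

lemma nsq_scale: "nsq k (\<lambda>i. r *\<^sub>R h i) = r\<^sup>2 * nsq k h"
  by (simp add: nsq_def power_mult_distrib sum_distrib_left)

lemma nsq_minus [simp]: "nsq k (\<lambda>i. - h i) = nsq k h"
  by (simp add: nsq_def)

lemma rbnd_mono: "rbnd k x c \<Longrightarrow> c \<le> d \<Longrightarrow> rbnd k x d"
  unfolding rbnd_def by (meson add_nonneg_nonneg mult_right_mono nsq_nonneg order_trans)

lemma rbnd_add: "rbnd k x c \<Longrightarrow> rbnd k y d \<Longrightarrow> rbnd k (\<lambda>i j. x i j + y i j) (c + d)"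
  unfolding rbnd_def rform_add by (simp add: distrib_left distrib_right) (smt (verit))

lemma rbnd_scaleR:
  assumes "rbnd k x c" shows "rbnd k (\<lambda>i j. r *\<^sub>R x i j) (\<bar>r\<bar> * c)"
  unfolding rbnd_def rform_scaleR
proof (intro allI)
  fix h g :: "nat \<Rightarrow> 'a"
  have "2 * rform k x (\<lambda>i. sgn r *\<^sub>R h i) g \<le> c * (nsq k (\<lambda>i. sgn r *\<^sub>R h i) + nsq k g)"
    using assms unfolding rbnd_def by blast
  then have "\<bar>r\<bar> * (2 * (sgn r * rform k x h g)) \<le> \<bar>r\<bar> * (c * (nsq k (\<lambda>i. sgn r *\<^sub>R h i) + nsq k g))"
    unfolding rform_vec_scale_left by (intro mult_left_mono) auto
  moreover have "\<bar>r\<bar> * nsq k (\<lambda>i. sgn r *\<^sub>R h i) = \<bar>r\<bar> * nsq k h"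
    unfolding nsq_scale by (cases "r = 0") (auto simp: sgn_if)
  moreover have "\<bar>r\<bar> * sgn r = r" by (simp add: abs_mult_sgn mult.commute)
  ultimately show "2 * (r * rform k x h g) \<le> \<bar>r\<bar> * c * (nsq k h + nsq k g)"
    by (simp add: algebra_simps) (metis (no_types, opaque_lifting) mult.assoc mult.commute mult.left_commute)
qed

lemma rbnd_diff: "rbnd k x c \<Longrightarrow> rbnd k y d \<Longrightarrow> rbnd k (\<lambda>i j. x i j - y i j) (c + d)"
  using rbnd_add[of k x c "\<lambda>i j. (-1) *\<^sub>R y i j" d] rbnd_scaleR[of k y d "-1"] by simp

lemma rform_bound:
  assumes "rbnd k x c" "0 \<le> c"
  shows "\<bar>rform k x h g\<bar> \<le> c * (sqrt (nsq k h) * sqrt (nsq k g))"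
proof -
  have *: "rform k x h g \<le> c * (sqrt (nsq k h) * sqrt (nsq k g))" for h g
  proof (cases "nsq k h = 0 \<or> nsq k g = 0")
    case True
    then have "(\<forall>i<k. h i = 0) \<or> (\<forall>i<k. g i = 0)" by (auto simp: nsq_def sum_nonneg_eq_0_iff)
    then have "rform k x h g = 0" unfolding rform_def by (auto simp: blinfun.zero_right)
    then show ?thesis using assms by simp
  next
    case False
    then have p: "nsq k h > 0" "nsq k g > 0" using nsq_nonneg by (metis less_eq_real_def)+
    define a b where "a = sqrt (nsq k h)" "b = sqrt (nsq k g)"
    have ab: "a > 0" "b > 0" "nsq k h = a\<^sup>2" "nsq k g = b\<^sup>2" using p by (auto simp: a_b_def)
    \<comment> \<open>For normalised vectors the sum of squares is 2, and undoing the normalisation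
      makes the bound homogeneous.\<close>
    have "2 * rform k x (\<lambda>i. (1/a) *\<^sub>R h i) (\<lambda>i. (1/b) *\<^sub>R g i)
        \<le> c * (nsq k (\<lambda>i. (1/a) *\<^sub>R h i) + nsq k (\<lambda>i. (1/b) *\<^sub>R g i))"
      using assms unfolding rbnd_def by blast
    then have "2 * ((1/a) * ((1/b) * rform k x h g)) \<le> c * (1 + 1)"
      unfolding rform_vec_scale_left rform_vec_scale_right nsq_scale using ab by (simp add: power_divide)
    then have "rform k x h g \<le> c * (a * b)" using ab by (simp add: field_simps)
    then show ?thesis by (simp add: a_b_def)
  qed
  show ?thesis using *[of h g] *[of "\<lambda>i. - h i" g] by (simp add: rform_vec_minus_left abs_le_iff)
qed

lemma rbndI:
  assumes "\<And>h g. rform k x h g \<le> c * (sqrt (nsq k h) * sqrt (nsq k g))" "0 \<le> c"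
  shows "rbnd k x c"
  unfolding rbnd_def
proof (intro allI)
  fix h g :: "nat \<Rightarrow> 'a"
  have "2 * (sqrt (nsq k h) * sqrt (nsq k g)) \<le> nsq k h + nsq k g"
    using sum_squares_bound[of "sqrt (nsq k h)" "sqrt (nsq k g)"] by simp
  then have "c * (2 * (sqrt (nsq k h) * sqrt (nsq k g))) \<le> c * (nsq k h + nsq k g)"
    using assms(2) by (rule mult_left_mono)
  then show "2 * rform k x h g \<le> c * (nsq k h + nsq k g)" using assms(1)[of h g] by simp
qed

lemma rbnd_one: "rbnd 1 (\<lambda>i j. T) (norm T)"
proof (rule rbndI)
  fix h g :: "nat \<Rightarrow> 'a"
  have "inner (blinfun_apply T (h 0)) (g 0) \<le> norm (blinfun_apply T (h 0)) * norm (g 0)"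
    by (rule norm_cauchy_schwarz)
  also have "\<dots> \<le> norm T * norm (h 0) * norm (g 0)"
    by (intro mult_right_mono norm_blinfun) auto
  finally show "rform 1 (\<lambda>i j. T) h g \<le> norm T * (sqrt (nsq 1 h) * sqrt (nsq 1 g))"
    by (simp add: rform_def nsq_def mult.assoc)
qed simp

lemma norm_le_rbnd:
  assumes "rbnd 1 (\<lambda>i j. T) c" "0 \<le> c" shows "norm T \<le> c"
proof (rule norm_blinfun_bound[OF assms(2)])
  fix v
  let ?w = "blinfun_apply T v"
  have "rform 1 (\<lambda>i j. T) (\<lambda>_. v) (\<lambda>_. ?w) \<le> c * (sqrt (nsq 1 (\<lambda>_. v)) * sqrt (nsq 1 (\<lambda>_. ?w)))"
    using rform_bound[OF assms] by (metis abs_le_iff)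
  then have "norm ?w * norm ?w \<le> (c * norm v) * norm ?w"
    by (simp add: rform_def nsq_def power2_norm_eq_inner[symmetric] power2_eq_square mult.assoc)
  then show "norm ?w \<le> c * norm v"
    using assms(2) by (cases "norm ?w = 0") auto
qed

text \<open>The constant is crude and depends on k. It serves to place every operator matrix below a
  multiple of the unit and to know that suprema are finite.\<close>

lemma rbnd_ex: "\<exists>c\<ge>0. rbnd k x c"
proof -
  let ?c = "\<Sum>i<k. \<Sum>j<k. norm (x i j)"
  have "rform k x h g \<le> ?c * (sqrt (nsq k h) * sqrt (nsq k g))" for h g
  proof -
    have le: "norm (f i) \<le> sqrt (nsq k f)" if "i < k" for f :: "nat \<Rightarrow> 'a" and i
      unfolding nsq_def using that by (intro real_le_rsqrt member_le_sum) auto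
    have "rform k x h g \<le> (\<Sum>i<k. \<Sum>j<k. norm (x i j) * (sqrt (nsq k h) * sqrt (nsq k g)))"
      unfolding rform_def
    proof (intro sum_mono)
      fix i j assume "i \<in> {..<k}" "j \<in> {..<k}"
      have "inner (blinfun_apply (x i j) (h j)) (g i) \<le> norm (x i j) * norm (h j) * norm (g i)"
        by (meson norm_cauchy_schwarz norm_blinfun mult_right_mono norm_ge_zero order_trans)
      also have "\<dots> \<le> norm (x i j) * (sqrt (nsq k h) * sqrt (nsq k g))"
        unfolding mult.assoc using \<open>i \<in> _\<close> \<open>j \<in> _\<close> by (intro mult_left_mono mult_mono le) auto
      finally show "inner (blinfun_apply (x i j) (h j)) (g i) \<le> norm (x i j) * (sqrt (nsq k h) * sqrt (nsq k g))" .
    qed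
    then show ?thesis by (simp add: sum_distrib_right)
  qed
  moreover have "0 \<le> ?c" by (intro sum_nonneg) auto
  ultimately show ?thesis using rbndI by blast
qed

section \<open>Maps preserving positivity of the real part\<close>

text \<open>Operator systems before closedness is imposed. Ranges of ucp maps and spans are
  recognised at this level first; closedness is added where finite dimension provides it or limits
  call for it.\<close>

definition osys :: "('h :: chilbert_space \<Rightarrow>\<^sub>L 'h) set \<Rightarrow> bool" where
  "osys E \<longleftrightarrow> (\<forall>T\<in>E. clinear_op T) \<and> op_space.subspace E \<and> id_blinfun \<in> E \<and>
    (\<forall>T\<in>E. \<exists>S\<in>E. is_adjoint S T)"

lemma operator_system_iff: "operator_system X \<longleftrightarrow> osys X \<and> closed X"
  unfolding operator_system_def osys_def by blast

lemma osysD: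
  assumes "osys E"
  shows "T \<in> E \<Longrightarrow> clinear_op T" "op_space.subspace E" "id_blinfun \<in> E"
    "T \<in> E \<Longrightarrow> \<exists>S\<in>E. is_adjoint S T"
  using assms unfolding osys_def by blast+

lemma op_scaleR_scaleC: "r *\<^sub>R T = complex_of_real r *\<^sub>C (T :: 'a::real_normed_vector \<Rightarrow>\<^sub>L 'b::chilbert_space)"
  by (rule blinfun_eqI) (simp add: scaleR_scaleC blinfun.scaleR_left)

text \<open>The working form of ucp maps between operators. Membership of the values in a target
  system is kept apart, and positivity is that of the real part; \<open>rucp_ucp\<close> and
  \<open>ucp_rucp\<close> give the passage to and from \<open>ucp\<close>.\<close>

definition rucp :: "('h::chilbert_space \<Rightarrow>\<^sub>L 'h) set \<Rightarrow> (('h \<Rightarrow>\<^sub>L 'h) \<Rightarrow> ('k::chilbert_space \<Rightarrow>\<^sub>L 'k)) \<Rightarrow> bool" where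
  "rucp E \<phi> \<longleftrightarrow> (\<forall>x\<in>E. clinear_op (\<phi> x)) \<and> (\<forall>x\<in>E. \<forall>y\<in>E. \<phi> (x + y) = \<phi> x + \<phi> y) \<and>
    (\<forall>c. \<forall>x\<in>E. \<phi> (c *\<^sub>C x) = c *\<^sub>C \<phi> x) \<and> \<phi> id_blinfun = id_blinfun \<and>
    (\<forall>k x. (\<forall>i<k. \<forall>j<k. x i j \<in> E) \<longrightarrow> rpos k x \<longrightarrow> rpos k (\<lambda>i j. \<phi> (x i j)))"

lemma rucpD:
  assumes "rucp E \<phi>"
  shows "x \<in> E \<Longrightarrow> clinear_op (\<phi> x)" "x \<in> E \<Longrightarrow> y \<in> E \<Longrightarrow> \<phi> (x + y) = \<phi> x + \<phi> y"
    "x \<in> E \<Longrightarrow> \<phi> (c *\<^sub>C x) = c *\<^sub>C \<phi> x" "\<phi> id_blinfun = id_blinfun"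
    "(\<And>i j. i < k \<Longrightarrow> j < k \<Longrightarrow> X i j \<in> E) \<Longrightarrow> rpos k X \<Longrightarrow> rpos k (\<lambda>i j. \<phi> (X i j))"
  using assms unfolding rucp_def by simp_all

lemma rucp_scaleR: "rucp E \<phi> \<Longrightarrow> x \<in> E \<Longrightarrow> \<phi> (r *\<^sub>R x) = r *\<^sub>R \<phi> x"
  by (simp add: op_scaleR_scaleC rucpD(3))

lemma rucp_zero: "rucp E \<phi> \<Longrightarrow> op_space.subspace E \<Longrightarrow> \<phi> 0 = 0"
  using rucp_scaleR[of E \<phi> 0 0] op_space.subspace_0[of E] by simp

lemma rucp_diff:
  assumes "rucp E \<phi>" "op_space.subspace E" "x \<in> E" "y \<in> E"
  shows "\<phi> (x - y) = \<phi> x - \<phi> y"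
proof -
  have "(-1) *\<^sub>R y \<in> E" unfolding op_scaleR_scaleC by (rule op_space.subspace_scale[OF assms(2,4)])
  then have "\<phi> (x + (-1) *\<^sub>R y) = \<phi> x + (-1) *\<^sub>R \<phi> y"
    unfolding rucp_scaleR[OF assms(1,4), symmetric] by (rule rucpD(2)[OF assms(1,3)])
  then show ?thesis by simp
qed

lemma subspace_scaleR: "op_space.subspace E \<Longrightarrow> x \<in> E \<Longrightarrow> r *\<^sub>R x \<in> E"
  unfolding op_scaleR_scaleC by (rule op_space.subspace_scale)

section \<open>The off-diagonal trick and complete contractivity\<close>

lemma sum_lessThan_add: "(\<Sum>i<k+l. f i) = (\<Sum>i<k. f i) + (\<Sum>i<l. f (k + i :: nat) :: 'a::comm_monoid_add)"
  by (induction l) (auto simp: add.assoc)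

text \<open>The block matrix with rows \<open>(c, -2x)\<close> and \<open>(0, c)\<close>, which turns norm bounds into positivity of a
  matrix of twice the size.\<close>

definition paulsen :: "nat \<Rightarrow> (nat \<Rightarrow> nat \<Rightarrow> 'h::chilbert_space \<Rightarrow>\<^sub>L 'h) \<Rightarrow> real \<Rightarrow> nat \<Rightarrow> nat \<Rightarrow> 'h \<Rightarrow>\<^sub>L 'h" where
  "paulsen k x c = (\<lambda>i j. if i = j then c *\<^sub>R id_blinfun else if i < k \<and> k \<le> j then (-2) *\<^sub>R x i (j - k) else 0)"

lemma rform_paulsen:
  "rform (k + k) (paulsen k x c) h h = c * (nsq k h + nsq k (\<lambda>i. h (k + i))) - 2 * rform k x (\<lambda>i. h (k + i)) h"
proof -
  have 1: "(\<Sum>j<k. inner (blinfun_apply (paulsen k x c i j) (h j)) (h i)) = c * inner (h i) (h i)" if "i < k" for i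
  proof -
    have "(\<Sum>j<k. inner (blinfun_apply (paulsen k x c i j) (h j)) (h i)) = (\<Sum>j<k. if i = j then c * inner (h i) (h i) else 0)"
      by (intro sum.cong refl) (auto simp: paulsen_def blinfun.scaleR_left)
    then show ?thesis using that by simp
  qed
  have 2: "(\<Sum>j<k. inner (blinfun_apply (paulsen k x c i (k + j)) (h (k + j))) (h i)) = - 2 * (\<Sum>j<k. inner (blinfun_apply (x i j) (h (k + j))) (h i))" if "i < k" for i
    using that unfolding sum_distrib_left by (intro sum.cong refl) (auto simp: paulsen_def blinfun.scaleR_left blinfun.minus_left)
  have 3: "(\<Sum>j<k. inner (blinfun_apply (paulsen k x c (k + i) j) (h j)) (h (k + i))) = 0" for i
    by (intro sum.neutral ballI) (auto simp: paulsen_def)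
  have 4: "(\<Sum>j<k. inner (blinfun_apply (paulsen k x c (k + i) (k + j)) (h (k + j))) (h (k + i))) = c * inner (h (k + i)) (h (k + i))" if "i < k" for i
  proof -
    have "(\<Sum>j<k. inner (blinfun_apply (paulsen k x c (k + i) (k + j)) (h (k + j))) (h (k + i))) = (\<Sum>j<k. if i = j then c * inner (h (k + i)) (h (k + i)) else 0)"
      by (intro sum.cong refl) (auto simp: paulsen_def blinfun.scaleR_left)
    then show ?thesis using that by simp
  qed
  show ?thesis
    unfolding rform_def sum_lessThan_add nsq_inner
    by (simp add: 1 2 3 4 sum.distrib sum_distrib_left distrib_left sum_subtractf sum_negf)
qed

text \<open>The usual trick uses the corners x and its adjoint. For the real part of the form both
  corners contribute equally, so one corner with weight 2 does the same, and no adjoints of the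
  entries are required.\<close>

lemma rpos_paulsen: "rpos (k + k) (paulsen k x c) \<longleftrightarrow> rbnd k x c"
proof
  assume L: "rpos (k + k) (paulsen k x c)"
  show "rbnd k x c" unfolding rbnd_def
  proof (intro allI)
    fix h g :: "nat \<Rightarrow> 'a"
    define H where "H i = (if i < k then g i else h (i - k))" for i
    have "0 \<le> rform (k + k) (paulsen k x c) H H" using L unfolding rpos_def by blast
    moreover have "rform k x (\<lambda>i. H (k + i)) H = rform k x h g"
      by (intro rform_cong) (auto simp: H_def)
    moreover have "nsq k H = nsq k g" "nsq k (\<lambda>i. H (k + i)) = nsq k h"
      by (auto simp: nsq_def H_def)
    ultimately show "2 * rform k x h g \<le> c * (nsq k h + nsq k g)"
      unfolding rform_paulsen by (simp add: add.commute)
  qed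
next
  assume "rbnd k x c"
  then have "2 * rform k x (\<lambda>i. h (k + i)) h \<le> c * (nsq k (\<lambda>i. h (k + i)) + nsq k h)" for h
    unfolding rbnd_def by blast
  then show "rpos (k + k) (paulsen k x c)"
    unfolding rpos_def rform_paulsen by (smt (verit) add.commute)
qed

text \<open>Complete contractivity: the entries of \<open>paulsen\<close> are multiples of the unit,
  of 0 and of entries of x, so the map carries this matrix to the one of the image, and positivity
  on twice the size is preserved.\<close>

lemma rucp_rbnd:
  assumes \<phi>: "rucp E \<phi>" and E: "op_space.subspace E" "id_blinfun \<in> E"
    and x: "\<And>i j. i < k \<Longrightarrow> j < k \<Longrightarrow> x i j \<in> E" and b: "rbnd k x c"
  shows "rbnd k (\<lambda>i j. \<phi> (x i j)) c"
proof -
  have mem: "paulsen k x c i j \<in> E" if "i < k + k" "j < k + k" for i j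
    using that x E by (auto simp: paulsen_def intro!: subspace_scaleR op_space.subspace_0 simp del: scaleR_minus_left)
  have "rpos (k + k) (\<lambda>i j. \<phi> (paulsen k x c i j))"
    using b by (intro rucpD(5)[OF \<phi>] mem) (simp_all add: rpos_paulsen)
  also have "?this \<longleftrightarrow> rpos (k + k) (paulsen k (\<lambda>i j. \<phi> (x i j)) c)"
    using x E by (intro rpos_cong) (auto simp: paulsen_def rucp_scaleR[OF \<phi>] rucpD(4)[OF \<phi>] rucp_zero[OF \<phi>] simp del: scaleR_minus_left)
  finally show ?thesis by (simp add: rpos_paulsen)
qed

lemma rucp_norm_le:
  assumes "rucp E \<phi>" "op_space.subspace E" "id_blinfun \<in> E" "T \<in> E"
  shows "norm (\<phi> T) \<le> norm T"
  using rucp_rbnd[OF assms(1-3), of 1 "\<lambda>i j. T" "norm T"] assms(4)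
  by (intro norm_le_rbnd) (simp_all add: rbnd_one[simplified])

section \<open>Positivity and positivity of the real part\<close>

lemma rform_ii_neg_Im:
  "rform k (\<lambda>i j. \<i> *\<^sub>C x i j) h g = - Im (\<Sum>i<k. cinner (\<Sum>j<k. blinfun_apply (x i j) (h j)) (g i))"
  by (simp add: rform_def inner_eq_Re_cinner cinner_scaleC_left cinner_sum_left sum_negf Im_sum)

lemma rform_Re:
  "rform k x h g = Re (\<Sum>i<k. cinner (\<Sum>j<k. blinfun_apply (x i j) (h j)) (g i))"
  by (simp add: rform_def inner_eq_Re_cinner cinner_sum_left Re_sum)

lemma op_mpos_iff: "op_mpos k x \<longleftrightarrow> (\<forall>h. 0 \<le> rform k x h h \<and> rform k (\<lambda>i j. \<i> *\<^sub>C x i j) h h = 0)"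
  unfolding op_mpos_def rform_ii_neg_Im rform_Re by (simp add: complex_nonneg_Reals_iff)

lemma op_mpos_rpos: "op_mpos k x \<Longrightarrow> rpos k x"
  by (simp add: op_mpos_iff rpos_def)

text \<open>The imaginary part of a form is, up to sign, the real part after multiplication by the
  imaginary unit. Nonnegativity for both signs makes it vanish. Complex linearity thus lets
  \<open>rucp\<close> control full positivity.\<close>

lemma op_mpos_iff_rpos:
  "op_mpos k x \<longleftrightarrow> rpos k x \<and> rpos k (\<lambda>i j. \<i> *\<^sub>C x i j) \<and> rpos k (\<lambda>i j. (-\<i>) *\<^sub>C x i j)"
proof -
  have "rform k (\<lambda>i j. (-\<i>) *\<^sub>C x i j) h h = - rform k (\<lambda>i j. \<i> *\<^sub>C x i j) h h" for h
    using rform_scaleC[of k "-\<i>" x h h] by simp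
  then show ?thesis unfolding op_mpos_iff rpos_def by (auto intro: antisym)
qed

lemma rucp_ucp:
  assumes \<phi>: "rucp E \<phi>" and E: "op_space.subspace E" and F: "\<phi> ` E \<subseteq> F"
  shows "ucp (op_sys E) (op_sys F) \<phi>"
proof -
  have "op_mpos k (\<lambda>i j. \<phi> (x i j))" if x: "\<forall>i<k. \<forall>j<k. x i j \<in> E" "op_mpos k x" for k x
  proof -
    have "rpos k (\<lambda>i j. \<phi> (c *\<^sub>C x i j))" if "rpos k (\<lambda>i j. c *\<^sub>C x i j)" for c
      using x(1) that E by (intro rucpD(5)[OF \<phi>] op_space.subspace_scale) auto
    then have "rpos k (\<lambda>i j. c *\<^sub>C \<phi> (x i j))" if "rpos k (\<lambda>i j. c *\<^sub>C x i j)" for c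
      using rpos_cong[of k "\<lambda>i j. \<phi> (c *\<^sub>C x i j)" "\<lambda>i j. c *\<^sub>C \<phi> (x i j)"] x(1) that by (simp add: rucpD(3)[OF \<phi>])
    moreover have "rpos k (\<lambda>i j. \<phi> (x i j))" using x by (intro rucpD(5)[OF \<phi>] op_mpos_rpos) auto
    ultimately show ?thesis using x(2) unfolding op_mpos_iff_rpos by blast
  qed
  then show ?thesis
    using \<phi> F unfolding ucp_def linear_map_def amplify_def
    by (auto simp: rucp_def op_sys_def matrices_over_def)
qed

text \<open>A matrix x with positive real part is not positive itself, but its sum with its adjoint
  is. This controls the sum of the real forms of the two images; it remains to see that these two
  forms are equal, that is, that the map respects adjoints on the level of forms.\<close>

lemma ucp_rucp:
  fixes \<phi> :: "('h::chilbert_space \<Rightarrow>\<^sub>L 'h) \<Rightarrow> ('k::chilbert_space \<Rightarrow>\<^sub>L 'k)"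
  assumes u: "ucp (op_sys E) (op_sys F) \<phi>" and E: "osys E" and F: "\<And>T. T \<in> F \<Longrightarrow> clinear_op T"
  shows "rucp E \<phi>"
proof -
  note E' = osysD[OF E]
  have add: "\<phi> (a + b) = \<phi> a + \<phi> b" if "a \<in> E" "b \<in> E" for a b
    using u that by (auto simp: ucp_def linear_map_def op_sys_def)
  have sc: "\<phi> (c *\<^sub>C a) = c *\<^sub>C \<phi> a" if "a \<in> E" for c a
    using u that by (auto simp: ucp_def linear_map_def op_sys_def)
  have one: "\<phi> id_blinfun = id_blinfun"
    using u by (auto simp: ucp_def op_sys_def)
  have pos: "op_mpos k (\<lambda>i j. \<phi> (x i j))" if "\<And>i j. x i j \<in> E" "op_mpos k x" for k x
    using u that by (auto simp: ucp_def op_sys_def matrices_over_def amplify_def)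
  obtain ad where ad: "\<And>T. T \<in> E \<Longrightarrow> ad T \<in> E" "\<And>T. T \<in> E \<Longrightarrow> is_adjoint (ad T) T"
    using E'(4) by metis
  have main: "rpos k (\<lambda>i j. \<phi> (x i j))" if x: "\<And>i j. x i j \<in> E" "rpos k x" for k x
  proof -
    define xs where "xs i j = ad (x j i)" for i j
    have xsE: "xs i j \<in> E" for i j unfolding xs_def using ad x by blast
    have adj: "cinner (blinfun_apply (xs i j) u) v = cnj (cinner (blinfun_apply (x j i) v) u)" for i j u v
      using ad(2)[OF x(1)[of j i]] unfolding is_adjoint_def xs_def by (metis cinner_commute)
    have f1: "rform k xs h h = rform k x h h" for h
    proof -
      have "rform k xs h h = (\<Sum>i<k. \<Sum>j<k. inner (blinfun_apply (x j i) (h i)) (h j))"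
        unfolding rform_def inner_eq_Re_cinner adj by simp
      also have "\<dots> = rform k x h h" unfolding rform_def by (rule sum.swap)
      finally show ?thesis .
    qed
    have f2: "rform k (\<lambda>i j. \<i> *\<^sub>C xs i j) h h = - rform k (\<lambda>i j. \<i> *\<^sub>C x i j) h h" for h
    proof -
      have "rform k (\<lambda>i j. \<i> *\<^sub>C xs i j) h h = - (\<Sum>i<k. \<Sum>j<k. inner (\<i> *\<^sub>C blinfun_apply (x j i) (h i)) (h j))"
        unfolding rform_def inner_eq_Re_cinner by (simp add: adj cinner_scaleC_left sum_negf)
      also have "(\<Sum>i<k. \<Sum>j<k. inner (\<i> *\<^sub>C blinfun_apply (x j i) (h i)) (h j)) = rform k (\<lambda>i j. \<i> *\<^sub>C x i j) h h"
        unfolding rform_def scaleC_blinfun_apply by (rule sum.swap)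
      finally show ?thesis .
    qed
    define y where "y i j = x i j + xs i j" for i j
    have yE: "y i j \<in> E" for i j unfolding y_def by (intro op_space.subspace_add[OF E'(2)] x xsE)
    have "op_mpos k y"
      unfolding op_mpos_iff
    proof (intro allI conjI)
      fix h
      show "0 \<le> rform k y h h" using x(2)[unfolded rpos_def, rule_format, of h] f1[of h] unfolding y_def rform_add by linarith
      show "rform k (\<lambda>i j. \<i> *\<^sub>C y i j) h h = 0"
        unfolding y_def op_space.scale_right_distrib rform_add f2 by simp
    qed
    then have p1: "op_mpos k (\<lambda>i j. \<phi> (y i j))" by (intro pos yE)
    \<comment> \<open>The imaginary unit times the difference of x and its adjoint is self-adjoint,
      and a large multiple of the unit makes it positive. That the image of the sum has a real form
      says that x and its adjoint have images with the same real form.\<close>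
    define z where "z i j = \<i> *\<^sub>C x i j + (-\<i>) *\<^sub>C xs i j" for i j
    have zE: "z i j \<in> E" for i j
      unfolding z_def by (intro op_space.subspace_add[OF E'(2)] op_space.subspace_scale[OF E'(2)] x xsE)
    obtain K where K: "0 \<le> K" "rbnd k z K" using rbnd_ex by blast
    define w where "w i j = z i j + unit_scal (of_real K) i j" for i j
    have sE: "unit_scal (of_real K) i j \<in> E" for i j
      unfolding scal_def by (intro op_space.subspace_scale[OF E'(2)] E'(3))
    have wE: "w i j \<in> E" for i j
      unfolding w_def by (intro op_space.subspace_add[OF E'(2)] zE sE)
    have i_unit: "rform k (\<lambda>i j. \<i> *\<^sub>C unit_scal (of_real K) i j) h h = 0" for h :: "nat \<Rightarrow> 'l :: chilbert_space"
    proof -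
      have "inner (\<i> *\<^sub>C unit_scal (of_real K) i j (h j)) (h i) = 0" for i j
        by (auto simp: inner_eq_Re_cinner cinner_scaleC_left cinner_self)
      then show ?thesis unfolding rform_def by simp
    qed
    have "op_mpos k w"
      unfolding op_mpos_iff
    proof (intro allI conjI)
      fix h
      have "- rform k z h h \<le> K * nsq k h"
        using K(2)[unfolded rbnd_def, rule_format, of "\<lambda>i. - h i" h] unfolding rform_vec_minus_left nsq_minus distrib_left by linarith
      then show "0 \<le> rform k w h h"
        unfolding w_def rform_add rform_scal_diag nsq_inner by linarith
      have "rform k (\<lambda>i j. \<i> *\<^sub>C z i j) h h = - rform k x h h + rform k xs h h"
        unfolding z_def op_space.scale_right_distrib rform_add op_space.scale_scale
        using rform_scaleC[of k "-1" x h h] rform_scaleC[of k 1 xs h h] by simp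
      then show "rform k (\<lambda>i j. \<i> *\<^sub>C w i j) h h = 0"
        unfolding w_def op_space.scale_right_distrib rform_add i_unit f1[of h] by linarith
    qed
    then have p2: "op_mpos k (\<lambda>i j. \<phi> (w i j))" by (intro pos wE)
    have \<phi>w: "\<phi> (w i j) = \<i> *\<^sub>C \<phi> (x i j) + (-\<i>) *\<^sub>C \<phi> (xs i j) + unit_scal (of_real K) i j" for i j
    proof -
      have "\<phi> (unit_scal (of_real K) i j) = unit_scal (of_real K) i j"
        unfolding scal_def by (simp add: sc[OF E'(3)] one)
      then show ?thesis
        unfolding w_def z_def using x(1) xsE
        by (simp add: add sc sE op_space.subspace_add[OF E'(2)] op_space.subspace_scale[OF E'(2)] del: op_space.scale_minus_left)
    qed
    show ?thesis unfolding rpos_def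
    proof
      fix h
      have "rform k (\<lambda>i j. \<i> *\<^sub>C \<phi> (w i j)) h h = 0" using p2 unfolding op_mpos_iff by blast
      then have "rform k (\<lambda>i j. \<phi> (x i j)) h h = rform k (\<lambda>i j. \<phi> (xs i j)) h h"
        unfolding \<phi>w op_space.scale_right_distrib rform_add op_space.scale_scale
        using rform_scaleC[of k "-1" "\<lambda>i j. \<phi> (x i j)" h h] rform_scaleC[of k 1 "\<lambda>i j. \<phi> (xs i j)" h h]
        by (simp add: i_unit)
      moreover have "0 \<le> rform k (\<lambda>i j. \<phi> (x i j)) h h + rform k (\<lambda>i j. \<phi> (xs i j)) h h"
        using op_mpos_rpos[OF p1] unfolding rpos_def y_def add[OF x(1) xsE] rform_add by blast
      ultimately show "0 \<le> rform k (\<lambda>i j. \<phi> (x i j)) h h" by simp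
    qed
  qed
  have "rpos k (\<lambda>i j. \<phi> (x i j))" if "\<forall>i<k. \<forall>j<k. x i j \<in> E" "rpos k x" for k x
  proof -
    \<comment> \<open>Zero entries outside the k x k block meet the demand of \<open>main\<close>
      that all entries lie in E.\<close>
    define x' where "x' i j = (if i < k \<and> j < k then x i j else 0)" for i j
    have "rpos k x'" using that(2) rpos_cong[of k x' x] by (simp add: x'_def)
    moreover have "x' i j \<in> E" for i j using that(1) op_space.subspace_0[OF E'(2)] by (auto simp: x'_def)
    ultimately have "rpos k (\<lambda>i j. \<phi> (x' i j))" by (intro main)
    then show ?thesis using rpos_cong[of k "\<lambda>i j. \<phi> (x' i j)" "\<lambda>i j. \<phi> (x i j)"] by (simp add: x'_def)
  qed
  moreover have "clinear_op (\<phi> a)" if "a \<in> E" for a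
    using u that F by (auto simp: ucp_def linear_map_def op_sys_def)
  ultimately show ?thesis unfolding rucp_def using add sc one by blast
qed

text \<open>Polarization: a sesquilinear form vanishing on the diagonal is antisymmetric, and
  replacing k by its multiple with the imaginary unit makes it symmetric as well.\<close>

lemma sesquilinear_diag_zero:
  fixes A B :: "'k::chilbert_space \<Rightarrow>\<^sub>L 'k"
  assumes "clinear_op A" "clinear_op B"
    and "\<And>h. cinner (blinfun_apply A h) h = cinner h (blinfun_apply B h)"
  shows "is_adjoint A B"
  unfolding is_adjoint_def
proof (intro allI)
  fix h k
  define D where "D u v = cinner (blinfun_apply A u) v - cinner u (blinfun_apply B v)" for u v
  have D0: "D u u = 0" for u using assms(3) by (simp add: D_def)
  have add: "D (u + v) w = D u w + D v w" "D w (u + v) = D w u + D w v" for u v w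
    by (simp_all add: D_def blinfun.add_right cinner_add_left cinner_add_right)
  have sc: "D (\<i> *\<^sub>C u) w = \<i> * D u w" "D w (\<i> *\<^sub>C u) = - \<i> * D w u" for u w
    using assms(1,2) by (simp_all add: D_def clinear_op_def cinner_scaleC_left cinner_scaleC_right algebra_simps)
  have "D h k + D k h = D (h + k) (h + k)"
    by (subst add(1), subst add(2), subst add(2)) (simp add: D0)
  then have "D h k + D k h = 0" by (simp only: D0)
  moreover have "- \<i> * D h k + \<i> * D k h = D (h + \<i> *\<^sub>C k) (h + \<i> *\<^sub>C k)"
    by (subst add(1), subst add(2), subst add(2), subst sc(1), subst sc(2), subst sc(1), subst D0, subst sc(2), subst D0) simp
  then have "D h k = D k h" unfolding D0 by simp
  ultimately have "D h k = 0" by simp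
  then show "cinner (blinfun_apply A h) k = cinner h (blinfun_apply B k)" by (simp add: D_def)
qed

text \<open>An operator whose real form vanishes is mapped to one of the same kind, by positivity
  for both signs. Apply this to S - T and to the imaginary unit times S + T, which are skew-adjoint
  if S is the adjoint of T.\<close>

lemma rucp_adjoint:
  assumes \<phi>: "rucp E \<phi>" and E: "op_space.subspace E" and ST: "S \<in> E" "T \<in> E" "is_adjoint S T"
  shows "is_adjoint (\<phi> S) (\<phi> T)"
proof (rule sesquilinear_diag_zero)
  show "clinear_op (\<phi> S)" "clinear_op (\<phi> T)" using rucpD(1)[OF \<phi>] ST by auto
  fix h
  have z: "inner (blinfun_apply (\<phi> A) h) h = 0" if A: "A \<in> E" "\<And>u. inner (blinfun_apply A u) u = 0" for A
  proof -
    have "rpos 1 (\<lambda>i j. \<phi> A)" using A by (intro rucpD(5)[OF \<phi>]) (auto simp: rpos_def rform_def)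
    moreover have "rpos 1 (\<lambda>i j. \<phi> ((-1) *\<^sub>R A))" using A
      by (intro rucpD(5)[OF \<phi>] subspace_scaleR[OF E]) (auto simp: rpos_def rform_def blinfun.minus_left)
    ultimately have "0 \<le> rform 1 (\<lambda>i j. \<phi> A) (\<lambda>_. h) (\<lambda>_. h)" "0 \<le> rform 1 (\<lambda>i j. \<phi> ((-1) *\<^sub>R A)) (\<lambda>_. h) (\<lambda>_. h)"
      unfolding rpos_def by blast+
    then show ?thesis unfolding rucp_scaleR[OF \<phi> A(1)] by (simp add: rform_def blinfun.minus_left)
  qed
  have sw: "cinner (blinfun_apply S u) u = cnj (cinner (blinfun_apply T u) u)" for u
    using ST(3) unfolding is_adjoint_def by (metis cinner_commute)
  have "inner (blinfun_apply (\<phi> (S - T)) h) h = 0"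
    by (intro z op_space.subspace_diff[OF E] ST) (simp add: blinfun.diff_left inner_eq_Re_cinner cinner_diff_left sw)
  moreover have "inner (blinfun_apply (\<phi> (\<i> *\<^sub>C (S + T))) h) h = 0"
    by (intro z op_space.subspace_scale[OF E] op_space.subspace_add[OF E] ST)
      (simp add: blinfun.add_left inner_eq_Re_cinner cinner_scaleC_left cinner_add_left sw)
  ultimately have "Re (cinner (blinfun_apply (\<phi> S) h) h) = Re (cinner (blinfun_apply (\<phi> T) h) h)"
    "Im (cinner (blinfun_apply (\<phi> S) h) h) = - Im (cinner (blinfun_apply (\<phi> T) h) h)"
    using op_space.subspace_add[OF E ST(1,2)]
    by (simp_all add: rucp_diff[OF \<phi> E] rucpD(2,3)[OF \<phi>] ST blinfun.diff_left blinfun.add_left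
        inner_eq_Re_cinner cinner_diff_left cinner_scaleC_left cinner_add_left)
  then show "cinner (blinfun_apply (\<phi> S) h) h = cinner h (blinfun_apply (\<phi> T) h)"
    by (subst cinner_commute[of h]) (simp add: complex_eq_iff)
qed

lemma ucp_compose:
  assumes "ucp S T \<phi>" "ucp T U \<psi>" shows "ucp S U (\<lambda>x. \<psi> (\<phi> x))"
  using assms unfolding ucp_def linear_map_def matrices_over_def amplify_def by simp

lemma ucp_cong:
  assumes "\<And>x. x \<in> elems S \<Longrightarrow> \<phi> x = \<psi> x" "ucp S T \<phi>" "unit_elem S \<in> elems S"
    "\<And>x y c. x \<in> elems S \<Longrightarrow> y \<in> elems S \<Longrightarrow> x + y \<in> elems S \<and> c *\<^sub>C x \<in> elems S"
    "\<And>k x y. (\<And>i j. i < k \<Longrightarrow> j < k \<Longrightarrow> x i j = y i j) \<Longrightarrow> mpos T k x \<Longrightarrow> mpos T k y"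
  shows "ucp S T \<psi>"
proof -
  have "mpos T k (amplify \<psi> x)" if "x \<in> matrices_over S k" "mpos S k x" for k x
    using assms(2) that assms(1) unfolding ucp_def
    by (intro assms(5)[of k "amplify \<phi> x" "amplify \<psi> x"]) (auto simp: amplify_def matrices_over_def)
  moreover have "linear_map S T \<psi>"
  proof -
    have lm: "\<forall>x\<in>elems S. \<phi> x \<in> elems T" "\<forall>x\<in>elems S. \<forall>y\<in>elems S. \<phi> (x + y) = \<phi> x + \<phi> y"
        "\<forall>c. \<forall>x\<in>elems S. \<phi> (c *\<^sub>C x) = c *\<^sub>C \<phi> x"
      using assms(2) unfolding ucp_def linear_map_def by blast+
    show ?thesis
      unfolding linear_map_def
    proof (intro conjI ballI allI)
      fix x y c assume x: "x \<in> elems S"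
      show "\<psi> x \<in> elems T" unfolding assms(1)[OF x, symmetric] using lm(1) x by blast
      show "\<psi> (c *\<^sub>C x) = c *\<^sub>C \<psi> x" using lm(3) x assms(1)[OF x] assms(1)[of "c *\<^sub>C x"] assms(4)[OF x x] by simp
      assume y: "y \<in> elems S"
      show "\<psi> (x + y) = \<psi> x + \<psi> y"
        using lm(2) x y assms(1)[OF x] assms(1)[OF y] assms(1)[of "x + y"] assms(4)[OF x y] by simp
    qed
  qed
  moreover have "\<psi> (unit_elem S) = unit_elem T" using assms(1,2,3) unfolding ucp_def by metis
  ultimately show ?thesis unfolding ucp_def by blast
qed

section \<open>Forms of complex matrices\<close>

definition cform :: "nat \<Rightarrow> (nat \<Rightarrow> nat \<Rightarrow> 'h::chilbert_space \<Rightarrow>\<^sub>L 'h) \<Rightarrow> (nat \<Rightarrow> 'h) \<Rightarrow> (nat \<Rightarrow> 'h) \<Rightarrow> complex" where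
  "cform k x h g = (\<Sum>i<k. cinner (\<Sum>j<k. blinfun_apply (x i j) (h j)) (g i))"

lemma rform_cform: "rform k x h g = Re (cform k x h g)"
  unfolding cform_def by (rule rform_Re)

definition mform :: "nat \<Rightarrow> nat \<Rightarrow> (nat \<Rightarrow> nat \<Rightarrow> complex mat) \<Rightarrow> (nat \<Rightarrow> nat \<Rightarrow> complex) \<Rightarrow> (nat \<Rightarrow> nat \<Rightarrow> complex) \<Rightarrow> complex" where
  "mform n k A v w = (\<Sum>i<k. \<Sum>a<n. mat_act n k A v i a * cnj (w i a))"

definition msq :: "nat \<Rightarrow> nat \<Rightarrow> (nat \<Rightarrow> nat \<Rightarrow> complex) \<Rightarrow> real" where
  "msq n k v = (\<Sum>i<k. \<Sum>a<n. (cmod (v i a))\<^sup>2)"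

definition mrp :: "nat \<Rightarrow> nat \<Rightarrow> (nat \<Rightarrow> nat \<Rightarrow> complex mat) \<Rightarrow> bool" where
  "mrp n k A \<longleftrightarrow> (\<forall>v. 0 \<le> Re (mform n k A v v))"

definition mbd :: "nat \<Rightarrow> nat \<Rightarrow> (nat \<Rightarrow> nat \<Rightarrow> complex mat) \<Rightarrow> real \<Rightarrow> bool" where
  "mbd n k A c \<longleftrightarrow> (\<forall>v w. 2 * Re (mform n k A v w) \<le> c * (msq n k v + msq n k w))"

lemma mat_act_cong:
  assumes "\<And>i j a b. i < k \<Longrightarrow> j < k \<Longrightarrow> a < n \<Longrightarrow> b < n \<Longrightarrow> A i j $$ (a, b) = B i j $$ (a, b)"
    "\<And>j b. j < k \<Longrightarrow> b < n \<Longrightarrow> v j b = v' j b" "i < k" "a < n"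
  shows "mat_act n k A v i a = mat_act n k B v' i a"
  unfolding mat_act_def using assms by (intro sum.cong refl) auto

lemma mform_cong:
  assumes "\<And>i j a b. i < k \<Longrightarrow> j < k \<Longrightarrow> a < n \<Longrightarrow> b < n \<Longrightarrow> A i j $$ (a, b) = B i j $$ (a, b)"
    "\<And>j b. j < k \<Longrightarrow> b < n \<Longrightarrow> v j b = v' j b" "\<And>j b. j < k \<Longrightarrow> b < n \<Longrightarrow> w j b = w' j b"
  shows "mform n k A v w = mform n k B v' w'"
  unfolding mform_def using assms mat_act_cong[OF assms(1,2)] by (intro sum.cong refl) auto

lemma mbd_cong: "(\<And>i j a b. i < k \<Longrightarrow> j < k \<Longrightarrow> a < n \<Longrightarrow> b < n \<Longrightarrow> A i j $$ (a, b) = B i j $$ (a, b)) \<Longrightarrow> mbd n k A c \<longleftrightarrow> mbd n k B c"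
  unfolding mbd_def using mform_cong[of k n A B] by simp

lemma mform_zero_left [simp]: "mform n k A (\<lambda>j b. 0) w = 0"
  by (simp add: mform_def mat_act_def)

lemma index_scaleC_mat [simp]: "a < dim_row A \<Longrightarrow> b < dim_col A \<Longrightarrow> (c *\<^sub>C A) $$ (a, b) = c * A $$ (a, b)"
  "dim_row (c *\<^sub>C A) = dim_row A" "dim_col (c *\<^sub>C A) = dim_col (A :: complex mat)"
  by (auto simp: scaleC_mat_def scaleC_complex_def)

lemma scaleC_mat_carrier [simp]: "c *\<^sub>C A \<in> carrier_mat n m \<longleftrightarrow> (A :: complex mat) \<in> carrier_mat n m"
  unfolding carrier_mat_def mem_Collect_eq index_scaleC_mat(2,3) ..

lemma mform_scaleC:
  assumes "\<And>i j. i < k \<Longrightarrow> j < k \<Longrightarrow> A i j \<in> carrier_mat n n"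
  shows "mform n k (\<lambda>i j. c *\<^sub>C A i j) v w = c * mform n k A v w"
proof -
  have "mat_act n k (\<lambda>i j. c *\<^sub>C A i j) v i a = c * mat_act n k A v i a" if "i < k" "a < n" for i a
  proof -
    have "(c *\<^sub>C A i j) $$ (a, b) * v j b = c * (A i j $$ (a, b) * v j b)" if "j < k" "b < n" for j b
      using assms[OF \<open>i < k\<close> \<open>j < k\<close>] \<open>a < n\<close> that by (simp add: mult.assoc)
    then show ?thesis unfolding mat_act_def sum_distrib_left by (intro sum.cong refl) auto
  qed
  then show ?thesis unfolding mform_def sum_distrib_left by (intro sum.cong refl) (auto simp: mult.assoc)
qed

lemma mat_mpos_mform: "mat_mpos n k A \<longleftrightarrow> (\<forall>v. mform n k A v v \<in> \<real>\<^sub>\<ge>\<^sub>0)"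
  unfolding mat_mpos_def mform_def ..

lemma mat_mpos_iff_mrp:
  assumes "\<And>i j. i < k \<Longrightarrow> j < k \<Longrightarrow> A i j \<in> carrier_mat n n"
  shows "mat_mpos n k A \<longleftrightarrow> mrp n k A \<and> mrp n k (\<lambda>i j. \<i> *\<^sub>C A i j) \<and> mrp n k (\<lambda>i j. (-\<i>) *\<^sub>C A i j)"
proof -
  have "mform n k (\<lambda>i j. c *\<^sub>C A i j) v w = c * mform n k A v w" for c v w
    by (rule mform_scaleC) (rule assms)
  then show ?thesis unfolding mat_mpos_mform mrp_def by (auto simp: complex_nonneg_Reals_iff intro: antisym)
qed

section \<open>Block diagonal operators on \<open>\<ell>\<^sup>2\<close>\<close>

text \<open>The first coordinate of block k when consecutive blocks of sizes d 0, d 1, ... fill up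
  the natural numbers.\<close>

definition offs :: "(nat \<Rightarrow> nat) \<Rightarrow> nat \<Rightarrow> nat" where
  "offs d k = (\<Sum>j<k. d j)"

definition blk :: "(nat \<Rightarrow> nat) \<Rightarrow> nat \<Rightarrow> nat" where
  "blk d i = (LEAST k. i < offs d (Suc k))"

lemma offs_mono: "k \<le> l \<Longrightarrow> offs d k \<le> offs d l"
  unfolding offs_def by (intro sum_mono2) auto

lemma offs_ge:
  assumes "\<forall>k. 0 < d k" shows "k \<le> offs d k"
proof (induction k)
  case (Suc k) then show ?case using assms[rule_format, of k] by (simp add: offs_def)
qed simp

lemma blk_offs:
  assumes "a < d k" shows "blk d (offs d k + a) = k"
  unfolding blk_def
proof (rule Least_equality)
  show "offs d k + a < offs d (Suc k)" using assms by (simp add: offs_def)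
  fix l assume l: "offs d k + a < offs d (Suc l)"
  show "k \<le> l"
  proof (rule ccontr)
    assume "\<not> k \<le> l"
    then have "offs d (Suc l) \<le> offs d k" by (intro offs_mono) auto
    then show False using l by simp
  qed
qed

lemma blk_bounds:
  assumes "\<forall>k. 0 < d k"
  shows "offs d (blk d i) \<le> i" "i - offs d (blk d i) < d (blk d i)"
proof -
  have ex: "\<exists>k. i < offs d (Suc k)" using offs_ge[OF assms, of "Suc i"] by (intro exI[of _ i]) simp
  have 1: "i < offs d (Suc (blk d i))" unfolding blk_def using ex by (rule LeastI_ex)
  show 2: "offs d (blk d i) \<le> i"
  proof (cases "blk d i")
    case (Suc k)
    then have "\<not> i < offs d (Suc k)" unfolding blk_def using not_less_Least by (metis lessI)
    then show ?thesis using Suc by simp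
  qed (simp add: offs_def)
  show "i - offs d (blk d i) < d (blk d i)" using 1 2 by (simp add: offs_def)
qed

lemma sum_offs: "(\<Sum>i<offs d K. F i) = (\<Sum>k<K. \<Sum>a<d k. F (offs d k + a) :: 'a::comm_monoid_add)"
proof (induction K)
  case (Suc K)
  have "offs d (Suc K) = offs d K + d K" by (simp add: offs_def)
  then show ?case using Suc by (simp add: sum_lessThan_add)
qed (simp add: offs_def)

definition bfun :: "(nat \<Rightarrow> nat) \<Rightarrow> (nat \<Rightarrow> complex mat) \<Rightarrow> (nat \<Rightarrow> complex) \<Rightarrow> nat \<Rightarrow> complex" where
  "bfun d z f i = (\<Sum>b<d (blk d i). z (blk d i) $$ (i - offs d (blk d i), b) * f (offs d (blk d i) + b))"

lemma bfun_offs: "a < d k \<Longrightarrow> bfun d z f (offs d k + a) = (\<Sum>b<d k. z k $$ (a, b) * f (offs d k + b))"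
  by (simp add: bfun_def blk_offs)

text \<open>The direct sum of the matrices z k. \<open>Abs_ell2\<close> and \<open>Blinfun\<close>
  return something meaningful when \<open>blocks\<close> holds, so every later statement carries
  that condition.\<close>

definition bop :: "(nat \<Rightarrow> nat) \<Rightarrow> (nat \<Rightarrow> complex mat) \<Rightarrow> ell2 \<Rightarrow>\<^sub>L ell2" where
  "bop d z = Blinfun (\<lambda>f. Abs_ell2 (bfun d z (ell2_nth f)))"

text \<open>Membership in the bounded product of the matrix algebras of sizes d k; C bounds the
  squares of the norms of all blocks at once.\<close>

definition blocks :: "(nat \<Rightarrow> nat) \<Rightarrow> (nat \<Rightarrow> complex mat) \<Rightarrow> bool" where
  "blocks d z \<longleftrightarrow> (\<forall>k. z k \<in> carrier_mat (d k) (d k)) \<and>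
    (\<exists>C\<ge>0. \<forall>k v. (\<Sum>a<d k. (cmod (\<Sum>b<d k. z k $$ (a, b) * v b))\<^sup>2) \<le> C * (\<Sum>b<d k. (cmod (v b))\<^sup>2))"

lemma ell2_summable: "summable (\<lambda>n. (cmod (ell2_nth f n))\<^sup>2)"
  using ell2_nth[of f] by simp

lemma ell2_norm_sq: "(norm f)\<^sup>2 = (\<Sum>n. (cmod (ell2_nth f n))\<^sup>2)"
  by (simp add: power2_norm_eq_inner inner_ell2_self)

lemma ell2_eqI: "(\<And>i. ell2_nth f i = ell2_nth g i) \<Longrightarrow> f = g"
  by (metis ell2_nth_inject ext)

lemma ell2_nth_add [simp]: "ell2_nth (f + g) i = ell2_nth f i + ell2_nth g i"
  by transfer simp
lemma ell2_nth_scaleC [simp]: "ell2_nth (c *\<^sub>C f) i = c * ell2_nth f i"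
  by transfer simp
lemma ell2_nth_scaleR [simp]: "ell2_nth (r *\<^sub>R f) i = of_real r * ell2_nth f i"
  by (simp add: scaleR_ell2_def)
lemma ell2_nth_zero [simp]: "ell2_nth 0 i = 0"
  by transfer simp
lemma ell2_nth_sum [simp]: "ell2_nth (\<Sum>s\<in>A. f s) i = (\<Sum>s\<in>A. ell2_nth (f s) i)"
  by (induction A rule: infinite_finite_induct) auto

lemma Re_mult_cnj: "Re (x * cnj x) = (cmod x)\<^sup>2"
  by (simp add: complex_mult_cnj cmod_power2)

lemma eventually_const_sum:
  fixes F :: "nat \<Rightarrow> 'a::{t2_space, comm_monoid_add}"
  assumes "(\<lambda>K. \<Sum>m<K. F m) \<longlonglongrightarrow> L" "\<And>m'. m' \<noteq> m \<Longrightarrow> F m' = 0"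
  shows "L = F m"
proof -
  have "(\<Sum>m'<K. F m') = F m" if "K \<ge> Suc m" for K
    using that sum.remove[of "{..<K}" m F] assms(2) by (simp add: sum.neutral)
  then have "(\<lambda>K. \<Sum>m<K. F m) \<longlonglongrightarrow> F m"
    by (intro tendsto_eventually eventually_sequentiallyI[of "Suc m"])
  then show ?thesis using assms(1) LIMSEQ_unique by blast
qed

context
  fixes d :: "nat \<Rightarrow> nat"
  assumes d: "\<forall>k. 0 < d k"
begin

lemma offs_tendsto: "filterlim (offs d) at_top sequentially"
  unfolding filterlim_at_top eventually_sequentially
proof (intro allI exI impI)
  fix Z n :: nat assume "Z \<le> n"
  then show "Z \<le> offs d n" using offs_ge[OF d, of n] by linarith
qed

lemma bfun_bounded:
  assumes z: "blocks d z"
  obtains C where "0 \<le> C" "\<And>f. summable (\<lambda>i. (cmod (bfun d z (ell2_nth f) i))\<^sup>2)"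
    "\<And>f. (\<Sum>i. (cmod (bfun d z (ell2_nth f) i))\<^sup>2) \<le> C * (norm f)\<^sup>2"
proof -
  obtain C where C: "C \<ge> 0" "\<And>k v. (\<Sum>a<d k. (cmod (\<Sum>b<d k. z k $$ (a, b) * v b))\<^sup>2) \<le> C * (\<Sum>b<d k. (cmod (v b))\<^sup>2)"
    using z unfolding blocks_def by blast
  have part: "(\<Sum>i<N. (cmod (bfun d z (ell2_nth f) i))\<^sup>2) \<le> C * (norm f)\<^sup>2" for f N
  proof -
    have "(\<Sum>i<N. (cmod (bfun d z (ell2_nth f) i))\<^sup>2) \<le> (\<Sum>i<offs d N. (cmod (bfun d z (ell2_nth f) i))\<^sup>2)"
      using offs_ge[OF d, of N] by (intro sum_mono2) auto
    also have "\<dots> = (\<Sum>k<N. \<Sum>a<d k. (cmod (\<Sum>b<d k. z k $$ (a, b) * ell2_nth f (offs d k + b)))\<^sup>2)"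
      unfolding sum_offs by (intro sum.cong refl) (simp add: bfun_offs)
    also have "\<dots> \<le> (\<Sum>k<N. C * (\<Sum>b<d k. (cmod (ell2_nth f (offs d k + b)))\<^sup>2))"
      by (intro sum_mono C(2))
    also have "\<dots> = C * (\<Sum>i<offs d N. (cmod (ell2_nth f i))\<^sup>2)"
      unfolding sum_offs sum_distrib_left ..
    also have "\<dots> \<le> C * (norm f)\<^sup>2"
      unfolding ell2_norm_sq by (intro mult_left_mono sum_le_suminf ell2_summable C(1)) auto
    finally show ?thesis .
  qed
  have s: "summable (\<lambda>i. (cmod (bfun d z (ell2_nth f) i))\<^sup>2)" for f
    by (intro summableI_nonneg_bounded[of _ "C * (norm f)\<^sup>2"] part) auto
  have "(\<Sum>i. (cmod (bfun d z (ell2_nth f) i))\<^sup>2) \<le> C * (norm f)\<^sup>2" for f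
    by (intro suminf_le_const s part)
  then show ?thesis using C(1) s that by blast
qed

lemma bop_apply:
  assumes z: "blocks d z"
  shows "ell2_nth (blinfun_apply (bop d z) f) i = bfun d z (ell2_nth f) i"
proof -
  obtain C where C: "0 \<le> C" "\<And>f. summable (\<lambda>i. (cmod (bfun d z (ell2_nth f) i))\<^sup>2)"
    "\<And>f. (\<Sum>i. (cmod (bfun d z (ell2_nth f) i))\<^sup>2) \<le> C * (norm f)\<^sup>2"
    using bfun_bounded[OF z] by blast
  have nth: "ell2_nth (Abs_ell2 (bfun d z (ell2_nth f))) = bfun d z (ell2_nth f)" for f
    using C(2) by (simp add: Abs_ell2_inverse)
  have "bounded_linear (\<lambda>f. Abs_ell2 (bfun d z (ell2_nth f)))"
  proof (rule bounded_linear_intro)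
    show "Abs_ell2 (bfun d z (ell2_nth (f + g))) = Abs_ell2 (bfun d z (ell2_nth f)) + Abs_ell2 (bfun d z (ell2_nth g))" for f g
      by (rule ell2_eqI) (simp add: nth, simp add: bfun_def distrib_left sum.distrib)
    show "Abs_ell2 (bfun d z (ell2_nth (r *\<^sub>R f))) = r *\<^sub>R Abs_ell2 (bfun d z (ell2_nth f))" for r f
      by (rule ell2_eqI) (simp add: nth, simp add: bfun_def sum_distrib_left mult.left_commute)
    show "norm (Abs_ell2 (bfun d z (ell2_nth f))) \<le> norm f * sqrt C" for f
    proof (rule power2_le_imp_le)
      show "(norm (Abs_ell2 (bfun d z (ell2_nth f))))\<^sup>2 \<le> (norm f * sqrt C)\<^sup>2"
        using C(1,3) by (simp add: ell2_norm_sq[of "Abs_ell2 _"] nth power_mult_distrib mult.commute)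
    qed (use C(1) in simp)
  qed
  then show ?thesis unfolding bop_def by (simp add: bounded_linear_Blinfun_apply nth)
qed

lemma blocks_add:
  assumes z: "blocks d z" and w: "blocks d w"
  shows "blocks d (\<lambda>k. z k + w k)" "bop d (\<lambda>k. z k + w k) = bop d z + bop d w"
proof -
  have car: "z k \<in> carrier_mat (d k) (d k)" "w k \<in> carrier_mat (d k) (d k)" for k
    using z w unfolding blocks_def by blast+
  obtain C where C: "C \<ge> 0" "\<And>k v. (\<Sum>a<d k. (cmod (\<Sum>b<d k. z k $$ (a, b) * v b))\<^sup>2) \<le> C * (\<Sum>b<d k. (cmod (v b))\<^sup>2)"
    using z unfolding blocks_def by blast
  obtain D where D: "D \<ge> 0" "\<And>k v. (\<Sum>a<d k. (cmod (\<Sum>b<d k. w k $$ (a, b) * v b))\<^sup>2) \<le> D * (\<Sum>b<d k. (cmod (v b))\<^sup>2)"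
    using w unfolding blocks_def by blast
  have e: "(\<Sum>b<d k. (z k + w k) $$ (a, b) * v b) = (\<Sum>b<d k. z k $$ (a, b) * v b) + (\<Sum>b<d k. w k $$ (a, b) * v b)"
    if "a < d k" for k a v
    using car[of k] that by (simp flip: sum.distrib add: algebra_simps)
  have "(\<Sum>a<d k. (cmod (\<Sum>b<d k. (z k + w k) $$ (a, b) * v b))\<^sup>2) \<le> (2 * C + 2 * D) * (\<Sum>b<d k. (cmod (v b))\<^sup>2)" for k v
  proof -
    have "(cmod (p + q))\<^sup>2 \<le> 2 * (cmod p)\<^sup>2 + 2 * (cmod q)\<^sup>2" for p q
    proof -
      have "(cmod (p + q))\<^sup>2 \<le> (cmod p + cmod q)\<^sup>2" by (intro power_mono norm_triangle_ineq) simp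
      also have "\<dots> \<le> 2 * (cmod p)\<^sup>2 + 2 * (cmod q)\<^sup>2"
        using sum_squares_bound[of "cmod p" "cmod q"] by (simp add: power2_sum)
      finally show ?thesis .
    qed
    then have "(\<Sum>a<d k. (cmod (\<Sum>b<d k. (z k + w k) $$ (a, b) * v b))\<^sup>2)
      \<le> (\<Sum>a<d k. 2 * (cmod (\<Sum>b<d k. z k $$ (a, b) * v b))\<^sup>2 + 2 * (cmod (\<Sum>b<d k. w k $$ (a, b) * v b))\<^sup>2)"
      by (intro sum_mono) (simp add: e)
    also have "\<dots> \<le> 2 * (C * (\<Sum>b<d k. (cmod (v b))\<^sup>2)) + 2 * (D * (\<Sum>b<d k. (cmod (v b))\<^sup>2))"
      unfolding sum.distrib sum_distrib_left[symmetric] by (intro add_mono mult_left_mono C D) auto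
    finally show ?thesis by (simp add: algebra_simps)
  qed
  moreover have "0 \<le> 2 * C + 2 * D" using C D by simp
  ultimately show b: "blocks d (\<lambda>k. z k + w k)"
    unfolding blocks_def using car by (intro conjI exI[of _ "2 * C + 2 * D"]) auto
  show "bop d (\<lambda>k. z k + w k) = bop d z + bop d w"
  proof (rule blinfun_eqI, rule ell2_eqI)
    fix f i
    show "ell2_nth (blinfun_apply (bop d (\<lambda>k. z k + w k)) f) i = ell2_nth (blinfun_apply (bop d z + bop d w) f) i"
      unfolding blinfun.add_left ell2_nth_add bop_apply[OF b] bop_apply[OF z] bop_apply[OF w]
      unfolding bfun_def by (rule e) (rule blk_bounds(2)[OF d])
  qed
qed

lemma blocks_scaleC:
  assumes z: "blocks d z"
  shows "blocks d (\<lambda>k. c *\<^sub>C z k)" "bop d (\<lambda>k. c *\<^sub>C z k) = c *\<^sub>C bop d z"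
proof -
  have car: "z k \<in> carrier_mat (d k) (d k)" for k using z unfolding blocks_def by blast
  obtain C where C: "C \<ge> 0" "\<And>k v. (\<Sum>a<d k. (cmod (\<Sum>b<d k. z k $$ (a, b) * v b))\<^sup>2) \<le> C * (\<Sum>b<d k. (cmod (v b))\<^sup>2)"
    using z unfolding blocks_def by blast
  have e: "(\<Sum>b<d k. (c *\<^sub>C z k) $$ (a, b) * v b) = c * (\<Sum>b<d k. z k $$ (a, b) * v b)" if "a < d k" for k a v
    using car[of k] that by (simp add: sum_distrib_left mult.assoc)
  have "(\<Sum>a<d k. (cmod (\<Sum>b<d k. (c *\<^sub>C z k) $$ (a, b) * v b))\<^sup>2) \<le> ((cmod c)\<^sup>2 * C) * (\<Sum>b<d k. (cmod (v b))\<^sup>2)" for k v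
  proof -
    have "(\<Sum>a<d k. (cmod (\<Sum>b<d k. (c *\<^sub>C z k) $$ (a, b) * v b))\<^sup>2) = (cmod c)\<^sup>2 * (\<Sum>a<d k. (cmod (\<Sum>b<d k. z k $$ (a, b) * v b))\<^sup>2)"
      unfolding sum_distrib_left[of "(cmod c)\<^sup>2"] by (intro sum.cong refl) (simp add: e norm_mult power_mult_distrib)
    also have "\<dots> \<le> (cmod c)\<^sup>2 * (C * (\<Sum>b<d k. (cmod (v b))\<^sup>2))" by (intro mult_left_mono C) auto
    finally show ?thesis by (simp add: mult.assoc)
  qed
  moreover have "0 \<le> (cmod c)\<^sup>2 * C" using C by simp
  ultimately show b: "blocks d (\<lambda>k. c *\<^sub>C z k)"
    unfolding blocks_def using car by (intro conjI exI[of _ "(cmod c)\<^sup>2 * C"]) auto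
  show "bop d (\<lambda>k. c *\<^sub>C z k) = c *\<^sub>C bop d z"
  proof (rule blinfun_eqI, rule ell2_eqI)
    fix f i
    show "ell2_nth (blinfun_apply (bop d (\<lambda>k. c *\<^sub>C z k)) f) i = ell2_nth (blinfun_apply (c *\<^sub>C bop d z) f) i"
      unfolding scaleC_blinfun_apply ell2_nth_scaleC bop_apply[OF b] bop_apply[OF z]
      unfolding bfun_def by (rule e) (rule blk_bounds(2)[OF d])
  qed
qed

lemma blocks_one: "blocks d (\<lambda>k. 1\<^sub>m (d k))" "bop d (\<lambda>k. 1\<^sub>m (d k)) = id_blinfun"
proof -
  have e: "(\<Sum>b<d k. 1\<^sub>m (d k) $$ (a, b) * v b) = v a" if "a < d k" for k a and v :: "nat \<Rightarrow> complex"
  proof -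
    have "(\<Sum>b<d k. 1\<^sub>m (d k) $$ (a, b) * v b) = (\<Sum>b<d k. if a = b then v b else 0)"
      using that by (intro sum.cong refl) auto
    then show ?thesis using that by simp
  qed
  have "(\<Sum>a<d k. (cmod (\<Sum>b<d k. 1\<^sub>m (d k) $$ (a, b) * v b))\<^sup>2) = (\<Sum>a<d k. (cmod (v a))\<^sup>2)" for k and v :: "nat \<Rightarrow> complex"
    by (intro sum.cong refl) (subst e, auto)
  then show b: "blocks d (\<lambda>k. 1\<^sub>m (d k))" unfolding blocks_def by (intro conjI exI[of _ 1]) auto
  show "bop d (\<lambda>k. 1\<^sub>m (d k)) = id_blinfun"
  proof (rule blinfun_eqI, rule ell2_eqI)
    fix f i
    have "bfun d (\<lambda>k. 1\<^sub>m (d k)) (ell2_nth f) i = ell2_nth f (offs d (blk d i) + (i - offs d (blk d i)))"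
      unfolding bfun_def by (rule e[OF blk_bounds(2)[OF d]])
    then show "ell2_nth (blinfun_apply (bop d (\<lambda>k. 1\<^sub>m (d k))) f) i = ell2_nth (blinfun_apply id_blinfun f) i"
      using blk_bounds(1)[OF d, of i] by (simp add: bop_apply[OF b])
  qed
qed

lemma clinear_bop: "blocks d z \<Longrightarrow> clinear_op (bop d z)"
  unfolding clinear_op_def
  by (intro allI ell2_eqI) (simp add: bop_apply, simp add: bfun_def sum_distrib_left mult.left_commute)

text \<open>Partial sums are taken at the ends of blocks, so that inner products and forms become
  limits of sums over whole blocks and inequalities can be passed on from the blocks.\<close>

lemma cinner_ell2_tendsto:
  "(\<lambda>K. \<Sum>m<K. \<Sum>a<d m. ell2_nth f (offs d m + a) * cnj (ell2_nth g (offs d m + a))) \<longlonglongrightarrow> cinner f g"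
proof -
  have "(\<lambda>n. ell2_nth f n * cnj (ell2_nth g n)) sums cinner f g"
    unfolding cinner_ell2_def ell2_cinner.rep_eq
    using ell2_summable_mult[OF ell2_summable ell2_summable] by (rule summable_sums)
  then have "(\<lambda>N. \<Sum>n<N. ell2_nth f n * cnj (ell2_nth g n)) \<longlonglongrightarrow> cinner f g" unfolding sums_def .
  from filterlim_compose[OF this offs_tendsto] show ?thesis by (simp add: sum_offs)
qed

definition bvec :: "nat \<Rightarrow> (nat \<Rightarrow> ell2) \<Rightarrow> nat \<Rightarrow> nat \<Rightarrow> complex" where
  "bvec m h j b = ell2_nth (h j) (offs d m + b)"

lemma nsq_tendsto: "(\<lambda>K. \<Sum>m<K. msq (d m) k (bvec m h)) \<longlonglongrightarrow> nsq k h"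
proof -
  have 1: "(\<lambda>K. Re (\<Sum>m<K. \<Sum>a<d m. ell2_nth (h i) (offs d m + a) * cnj (ell2_nth (h i) (offs d m + a)))) \<longlonglongrightarrow> (norm (h i))\<^sup>2" for i
    using tendsto_Re[OF cinner_ell2_tendsto[of "h i" "h i"]] by (simp add: cinner_self)
  have "(\<lambda>K. \<Sum>i<k. Re (\<Sum>m<K. \<Sum>a<d m. ell2_nth (h i) (offs d m + a) * cnj (ell2_nth (h i) (offs d m + a)))) \<longlonglongrightarrow> (\<Sum>i<k. (norm (h i))\<^sup>2)"
    by (intro tendsto_sum 1)
  moreover have "(\<Sum>i<k. Re (\<Sum>m<K. \<Sum>a<d m. ell2_nth (h i) (offs d m + a) * cnj (ell2_nth (h i) (offs d m + a)))) = (\<Sum>m<K. msq (d m) k (bvec m h))" for K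
    unfolding msq_def bvec_def Re_sum Re_mult_cnj by (rule sum.swap)
  ultimately show ?thesis by (simp add: nsq_def)
qed

lemma cform_tendsto:
  assumes z: "\<And>i j. i < k \<Longrightarrow> j < k \<Longrightarrow> blocks d (z i j)"
  shows "(\<lambda>K. \<Sum>m<K. mform (d m) k (\<lambda>i j. z i j m) (bvec m h) (bvec m g)) \<longlonglongrightarrow> cform k (\<lambda>i j. bop d (z i j)) h g"
proof -
  let ?u = "\<lambda>i. \<Sum>j<k. blinfun_apply (bop d (z i j)) (h j)"
  have "(\<lambda>K. \<Sum>i<k. \<Sum>m<K. \<Sum>a<d m. ell2_nth (?u i) (offs d m + a) * cnj (ell2_nth (g i) (offs d m + a)))
      \<longlonglongrightarrow> (\<Sum>i<k. cinner (?u i) (g i))"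
    by (intro tendsto_sum cinner_ell2_tendsto)
  moreover have "(\<Sum>i<k. \<Sum>m<K. \<Sum>a<d m. ell2_nth (?u i) (offs d m + a) * cnj (ell2_nth (g i) (offs d m + a)))
      = (\<Sum>m<K. mform (d m) k (\<lambda>i j. z i j m) (bvec m h) (bvec m g))" for K
  proof -
    have "ell2_nth (?u i) (offs d m + a) = mat_act (d m) k (\<lambda>i j. z i j m) (bvec m h) i a" if "i < k" "a < d m" for i m a
      using that unfolding ell2_nth_sum mat_act_def bvec_def by (intro sum.cong refl) (simp add: bop_apply[OF z] bfun_offs)
    then show ?thesis unfolding mform_def by (subst sum.swap) (intro sum.cong refl, simp add: bvec_def)
  qed
  ultimately show ?thesis by (simp add: cform_def)
qed

definition sv :: "nat \<Rightarrow> (nat \<Rightarrow> complex) \<Rightarrow> ell2" where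
  "sv m v = Abs_ell2 (\<lambda>i. if blk d i = m then v (i - offs d m) else 0)"

lemma sv_nth: "ell2_nth (sv m v) i = (if blk d i = m then v (i - offs d m) else 0)"
proof -
  have "finite {i. blk d i = m}"
  proof (rule finite_subset)
    show "{i. blk d i = m} \<subseteq> {..<offs d m + d m}" proof
      fix i assume "i \<in> {i. blk d i = m}"
      then show "i \<in> {..<offs d m + d m}" using blk_bounds[OF d, of i] by auto
    qed
  qed simp
  then have "summable (\<lambda>i. (cmod (if blk d i = m then v (i - offs d m) else 0))\<^sup>2)"
    by (intro summable_finite[of "{i. blk d i = m}"]) auto
  then show ?thesis unfolding sv_def by (simp add: Abs_ell2_inverse)
qed

lemma bvec_sv: "b < d m' \<Longrightarrow> bvec m' (\<lambda>j. sv m (v j)) j b = (if m' = m then v j b else 0)"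
  by (simp add: bvec_def sv_nth blk_offs)

lemma cform_sv:
  assumes z: "\<And>i j. i < k \<Longrightarrow> j < k \<Longrightarrow> blocks d (z i j)"
  shows "cform k (\<lambda>i j. bop d (z i j)) (\<lambda>j. sv m (v j)) (\<lambda>i. sv m (w i)) = mform (d m) k (\<lambda>i j. z i j m) v w"
proof -
  have "cform k (\<lambda>i j. bop d (z i j)) (\<lambda>j. sv m (v j)) (\<lambda>i. sv m (w i))
    = mform (d m) k (\<lambda>i j. z i j m) (bvec m (\<lambda>j. sv m (v j))) (bvec m (\<lambda>i. sv m (w i)))"
  proof (rule eventually_const_sum[OF cform_tendsto[OF z]])
    fix m' assume "m' \<noteq> m"
    then have "mform (d m') k (\<lambda>i j. z i j m') (bvec m' (\<lambda>j. sv m (v j))) (bvec m' (\<lambda>i. sv m (w i)))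
      = mform (d m') k (\<lambda>i j. z i j m') (\<lambda>j b. 0) (\<lambda>i b. 0)"
      by (intro mform_cong) (auto simp: bvec_sv)
    then show "mform (d m') k (\<lambda>i j. z i j m') (bvec m' (\<lambda>j. sv m (v j))) (bvec m' (\<lambda>i. sv m (w i))) = 0" by simp
  qed
  also have "\<dots> = mform (d m) k (\<lambda>i j. z i j m) v w" by (intro mform_cong) (auto simp: bvec_sv)
  finally show ?thesis .
qed

lemma nsq_sv: "nsq k (\<lambda>j. sv m (v j)) = msq (d m) k v"
proof -
  have "nsq k (\<lambda>j. sv m (v j)) = msq (d m) k (bvec m (\<lambda>j. sv m (v j)))"
    by (rule eventually_const_sum[OF nsq_tendsto]) (auto simp: msq_def bvec_sv)
  also have "\<dots> = msq (d m) k v" unfolding msq_def by (intro sum.cong refl) (auto simp: bvec_sv)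
  finally show ?thesis .
qed

text \<open>One direction tests on vectors \<open>sv\<close> supported in a single block, the other
  is the limit of finite sums of block forms. \<open>rbnd_bop\<close> has the same proof.\<close>

lemma rpos_bop:
  assumes z: "\<And>i j. i < k \<Longrightarrow> j < k \<Longrightarrow> blocks d (z i j)"
  shows "rpos k (\<lambda>i j. bop d (z i j)) \<longleftrightarrow> (\<forall>m. mrp (d m) k (\<lambda>i j. z i j m))"
proof
  have e: "cform k (\<lambda>i j. bop d (z i j)) (\<lambda>j. sv m (v j)) (\<lambda>i. sv m (w i)) = mform (d m) k (\<lambda>i j. z i j m) v w" for m v w
    by (rule cform_sv) (rule z)
  assume "rpos k (\<lambda>i j. bop d (z i j))"
  then have "0 \<le> Re (cform k (\<lambda>i j. bop d (z i j)) (\<lambda>j. sv m (v j)) (\<lambda>i. sv m (v i)))" for m v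
    unfolding rpos_def rform_cform by blast
  then show "\<forall>m. mrp (d m) k (\<lambda>i j. z i j m)" unfolding e mrp_def by blast
next
  assume *: "\<forall>m. mrp (d m) k (\<lambda>i j. z i j m)"
  show "rpos k (\<lambda>i j. bop d (z i j))" unfolding rpos_def rform_cform
  proof
    fix h
    show "0 \<le> Re (cform k (\<lambda>i j. bop d (z i j)) h h)"
    proof (rule tendsto_lowerbound[OF tendsto_Re[OF cform_tendsto[OF z]]])
      show "\<forall>\<^sub>F K in sequentially. 0 \<le> Re (\<Sum>m<K. mform (d m) k (\<lambda>i j. z i j m) (bvec m h) (bvec m h))"
        using * unfolding mrp_def by (intro always_eventually allI) (simp add: Re_sum sum_nonneg)
    qed simp_all
  qed
qed

lemma rbnd_bop:
  assumes z: "\<And>i j. i < k \<Longrightarrow> j < k \<Longrightarrow> blocks d (z i j)"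
  shows "rbnd k (\<lambda>i j. bop d (z i j)) c \<longleftrightarrow> (\<forall>m. mbd (d m) k (\<lambda>i j. z i j m) c)"
proof
  have e: "cform k (\<lambda>i j. bop d (z i j)) (\<lambda>j. sv m (v j)) (\<lambda>i. sv m (w i)) = mform (d m) k (\<lambda>i j. z i j m) v w" for m v w
    by (rule cform_sv) (rule z)
  assume "rbnd k (\<lambda>i j. bop d (z i j)) c"
  then have "2 * Re (cform k (\<lambda>i j. bop d (z i j)) (\<lambda>j. sv m (v j)) (\<lambda>i. sv m (w i)))
      \<le> c * (nsq k (\<lambda>j. sv m (v j)) + nsq k (\<lambda>j. sv m (w j)))" for m v w
    unfolding rbnd_def rform_cform by blast
  then show "\<forall>m. mbd (d m) k (\<lambda>i j. z i j m) c" unfolding e nsq_sv mbd_def by blast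
next
  assume *: "\<forall>m. mbd (d m) k (\<lambda>i j. z i j m) c"
  show "rbnd k (\<lambda>i j. bop d (z i j)) c" unfolding rbnd_def rform_cform
  proof (intro allI)
    fix h g
    show "2 * Re (cform k (\<lambda>i j. bop d (z i j)) h g) \<le> c * (nsq k h + nsq k g)"
    proof (rule LIMSEQ_le)
      show "(\<lambda>K. 2 * Re (\<Sum>m<K. mform (d m) k (\<lambda>i j. z i j m) (bvec m h) (bvec m g))) \<longlonglongrightarrow> 2 * Re (cform k (\<lambda>i j. bop d (z i j)) h g)"
        by (intro tendsto_intros cform_tendsto z)
      show "(\<lambda>K. c * ((\<Sum>m<K. msq (d m) k (bvec m h)) + (\<Sum>m<K. msq (d m) k (bvec m g)))) \<longlonglongrightarrow> c * (nsq k h + nsq k g)"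
        by (intro tendsto_intros nsq_tendsto)
      have "2 * Re (mform (d m) k (\<lambda>i j. z i j m) (bvec m h) (bvec m g)) \<le> c * (msq (d m) k (bvec m h) + msq (d m) k (bvec m g))" for m
        using * unfolding mbd_def by blast
      then have "(\<Sum>m<K. 2 * Re (mform (d m) k (\<lambda>i j. z i j m) (bvec m h) (bvec m g))) \<le> (\<Sum>m<K. c * (msq (d m) k (bvec m h) + msq (d m) k (bvec m g)))" for K
        by (intro sum_mono)
      then show "\<exists>N. \<forall>K\<ge>N. 2 * Re (\<Sum>m<K. mform (d m) k (\<lambda>i j. z i j m) (bvec m h) (bvec m g))
          \<le> c * ((\<Sum>m<K. msq (d m) k (bvec m h)) + (\<Sum>m<K. msq (d m) k (bvec m g)))"
        by (simp add: Re_sum sum_distrib_left sum.distrib distrib_left)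
    qed
  qed
qed

end

section \<open>Matrix algebras on \<open>\<ell>\<^sup>2\<close>\<close>

lemma blocks_const:
  assumes "A \<in> carrier_mat n n" shows "blocks (\<lambda>_. n) (\<lambda>_. A)"
proof -
  let ?C = "\<Sum>a<n. (L2_set (\<lambda>b. cmod (A $$ (a, b))) {..<n})\<^sup>2"
  have "(\<Sum>a<n. (cmod (\<Sum>b<n. A $$ (a, b) * v b))\<^sup>2) \<le> ?C * (\<Sum>b<n. (cmod (v b))\<^sup>2)" for v
    unfolding sum_distrib_right
  proof (intro sum_mono)
    fix a
    have "cmod (\<Sum>b<n. A $$ (a, b) * v b) \<le> (\<Sum>b<n. cmod (A $$ (a, b)) * cmod (v b))"
      by (rule order_trans[OF norm_sum]) (simp add: norm_mult)
    also have "\<dots> \<le> L2_set (\<lambda>b. cmod (A $$ (a, b))) {..<n} * L2_set (\<lambda>b. cmod (v b)) {..<n}"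
      using L2_set_mult_ineq[of "\<lambda>b. cmod (A $$ (a, b))" "\<lambda>b. cmod (v b)" "{..<n}"] by simp
    finally have "(cmod (\<Sum>b<n. A $$ (a, b) * v b))\<^sup>2 \<le> (L2_set (\<lambda>b. cmod (A $$ (a, b))) {..<n} * L2_set (\<lambda>b. cmod (v b)) {..<n})\<^sup>2"
      by (intro power_mono) auto
    also have "\<dots> = (L2_set (\<lambda>b. cmod (A $$ (a, b))) {..<n})\<^sup>2 * (\<Sum>b<n. (cmod (v b))\<^sup>2)"
      unfolding power_mult_distrib by (subst (2) L2_set_def) (simp add: sum_nonneg)
    finally show "(cmod (\<Sum>b<n. A $$ (a, b) * v b))\<^sup>2 \<le> (L2_set (\<lambda>b. cmod (A $$ (a, b))) {..<n})\<^sup>2 * (\<Sum>b<n. (cmod (v b))\<^sup>2)" .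
  qed
  moreover have "0 \<le> ?C" by (intro sum_nonneg) auto
  ultimately show ?thesis using assms unfolding blocks_def by blast
qed

lemma Re_of_real_mult: "Re (of_real r * z) = r * Re z"
  by simp

lemma blocks_mbd:
  assumes car: "\<And>k. z k \<in> carrier_mat (d k) (d k)" and b: "\<And>k. mbd (d k) 1 (\<lambda>_ _. z k) c" and c: "0 < c"
  shows "blocks d z"
proof -
  have "(\<Sum>a<d k. (cmod (\<Sum>b<d k. z k $$ (a, b) * v b))\<^sup>2) \<le> c\<^sup>2 * (\<Sum>b<d k. (cmod (v b))\<^sup>2)" (is "?L \<le> c\<^sup>2 * ?R") for k v
  proof -
    define u where "u a = (\<Sum>b<d k. z k $$ (a, b) * v b)" for a
    \<comment> \<open>Testing the image vector u scaled by 1 / c gives 2 L / c \<le> c R + L / c,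
      and therefore the bound c squared on the square sums.\<close>
    have "2 * Re (mform (d k) 1 (\<lambda>_ _. z k) (\<lambda>_. v) (\<lambda>_ a. of_real (1 / c) * u a))
        \<le> c * (msq (d k) 1 (\<lambda>_. v) + msq (d k) 1 (\<lambda>_ a. of_real (1 / c) * u a))"
      using b[of k] unfolding mbd_def by blast
    moreover have "mform (d k) 1 (\<lambda>_ _. z k) (\<lambda>_. v) (\<lambda>_ a. of_real (1 / c) * u a) = of_real (1 / c) * (\<Sum>a<d k. u a * cnj (u a))"
      by (simp add: mform_def mat_act_def u_def sum_distrib_left mult.left_commute)
    moreover have "Re (of_real (1 / c) * (\<Sum>a<d k. u a * cnj (u a))) = 1 / c * ?L"
      unfolding u_def[symmetric] by (simp only: Re_of_real_mult Re_sum Re_mult_cnj)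
    moreover have "msq (d k) 1 (\<lambda>_ a. of_real (1 / c) * u a) = (1 / c)\<^sup>2 * ?L"
      unfolding u_def[symmetric] msq_def using c by (simp add: norm_mult power_mult_distrib sum_distrib_left norm_divide power_divide)
    moreover have "msq (d k) 1 (\<lambda>_. v) = ?R" by (simp add: msq_def)
    ultimately have "2 * (1 / c * ?L) \<le> c * (?R + (1 / c)\<^sup>2 * ?L)" by (simp only:)
    then show ?thesis using c by (simp add: field_simps power2_eq_square)
  qed
  moreover have "0 \<le> c\<^sup>2" by simp
  ultimately show ?thesis using car unfolding blocks_def by blast
qed

text \<open>The map taking A to A \<oplus> A \<oplus> ..., which is unital, unlike the embedding as
  a corner. It turns matrices into operators, so that the notions for operators such as
  \<open>rucp\<close> and \<open>rbnd\<close> apply to maps into and out of matrix algebras.\<close>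

definition emb :: "nat \<Rightarrow> complex mat \<Rightarrow> ell2 \<Rightarrow>\<^sub>L ell2" where
  "emb n A = bop (\<lambda>_. n) (\<lambda>_. A)"

definition alg :: "nat \<Rightarrow> (ell2 \<Rightarrow>\<^sub>L ell2) set" where
  "alg n = emb n ` carrier_mat n n"

definition ket :: "nat \<Rightarrow> ell2" where
  "ket i = Abs_ell2 (\<lambda>j. if j = i then 1 else 0)"

text \<open>Compression to n coordinates starting at s. With s = 0 it inverts \<open>emb n\<close>;
  at the offset of a block it reads off that block of a \<open>bop\<close>.\<close>

definition comp_mat :: "nat \<Rightarrow> nat \<Rightarrow> ell2 \<Rightarrow>\<^sub>L ell2 \<Rightarrow> complex mat" where
  "comp_mat s n T = mat n n (\<lambda>(a, b). cinner (blinfun_apply T (ket (s + b))) (ket (s + a)))"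

lemma ket_nth: "ell2_nth (ket i) j = (if j = i then 1 else 0)"
proof -
  have "summable (\<lambda>j. (cmod (if j = i then 1 else 0))\<^sup>2)"
    by (intro summable_finite[of "{i}"]) auto
  then show ?thesis unfolding ket_def by (simp add: Abs_ell2_inverse)
qed

lemma cinner_ket: "cinner f (ket i) = ell2_nth f i"
proof -
  have "(\<Sum>n. ell2_nth f n * cnj (ell2_nth (ket i) n)) = (\<Sum>n\<in>{i}. ell2_nth f n * cnj (ell2_nth (ket i) n))"
    by (intro suminf_finite) (auto simp: ket_nth)
  then show ?thesis unfolding cinner_ell2_def ell2_cinner.rep_eq by (simp add: ket_nth)
qed

lemma comp_mat_carrier [simp]: "comp_mat s n T \<in> carrier_mat n n"
  by (simp add: comp_mat_def)

lemma comp_mat_index: "a < n \<Longrightarrow> b < n \<Longrightarrow> comp_mat s n T $$ (a, b) = ell2_nth (blinfun_apply T (ket (s + b))) (s + a)"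
  by (simp add: comp_mat_def cinner_ket)

lemma nsq_ket: "nsq k (\<lambda>j. \<Sum>b<n. v j b *\<^sub>C ket (s + b)) = msq n k v"
proof -
  have "(norm (\<Sum>b<n. v j b *\<^sub>C ket (s + b)))\<^sup>2 = (\<Sum>a<n. (cmod (v j a))\<^sup>2)" for j
  proof -
    let ?h = "\<Sum>b<n. v j b *\<^sub>C ket (s + b)"
    have nth: "ell2_nth ?h (s + a) = v j a" if "a < n" for a
    proof -
      have "ell2_nth ?h (s + a) = (\<Sum>b<n. if a = b then v j b else 0)"
        unfolding ell2_nth_sum by (intro sum.cong refl) (auto simp: ket_nth)
      then show ?thesis using that by simp
    qed
    have "cinner ?h ?h = (\<Sum>a<n. cnj (v j a) * ell2_nth ?h (s + a))"
      by (subst cinner_sum_right) (simp add: cinner_scaleC_right cinner_ket)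
    also have "\<dots> = (\<Sum>a<n. cnj (v j a) * v j a)" using nth by (intro sum.cong refl) auto
    finally have "Re (cinner ?h ?h) = (\<Sum>a<n. (cmod (v j a))\<^sup>2)"
      by (simp add: Re_mult_cnj mult.commute[of "cnj _"] del: complex_cnj_mult times_complex.sel)
    then show ?thesis by (simp add: cinner_self)
  qed
  then show ?thesis by (simp add: nsq_def msq_def)
qed

lemma mform_comp_mat:
  assumes "\<And>i j. i < k \<Longrightarrow> j < k \<Longrightarrow> clinear_op (x i j)"
  shows "mform n k (\<lambda>i j. comp_mat s n (x i j)) v w
    = cform k x (\<lambda>j. \<Sum>b<n. v j b *\<^sub>C ket (s + b)) (\<lambda>i. \<Sum>a<n. w i a *\<^sub>C ket (s + a))"
proof -
  have "(\<Sum>a<n. mat_act n k (\<lambda>i j. comp_mat s n (x i j)) v i a * cnj (w i a))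
      = cinner (\<Sum>j<k. blinfun_apply (x i j) (\<Sum>b<n. v j b *\<^sub>C ket (s + b))) (\<Sum>a<n. w i a *\<^sub>C ket (s + a))"
    if i: "i < k" for i
  proof -
    have "cinner (\<Sum>j<k. blinfun_apply (x i j) (\<Sum>b<n. v j b *\<^sub>C ket (s + b))) (ket (s + a)) = mat_act n k (\<lambda>i j. comp_mat s n (x i j)) v i a"
      if "a < n" for a
    proof -
      have "cinner (blinfun_apply (x i j) (\<Sum>b<n. v j b *\<^sub>C ket (s + b))) (ket (s + a)) = (\<Sum>b<n. comp_mat s n (x i j) $$ (a, b) * v j b)"
        if "j < k" for j
        using assms[OF i that] \<open>a < n\<close>
        by (simp add: blinfun.sum_right cinner_sum_left clinear_op_def cinner_scaleC_left comp_mat_def mult.commute)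
      then show ?thesis unfolding mat_act_def cinner_sum_left by (intro sum.cong refl) auto
    qed
    then show ?thesis
      by (simp add: cinner_sum_right cinner_scaleC_right mult.commute)
  qed
  then show ?thesis unfolding mform_def cform_def by (intro sum.cong refl) auto
qed

lemma ucp_comp_mat:
  assumes "\<And>T. T \<in> E \<Longrightarrow> clinear_op T"
  shows "ucp (op_sys E) (mat_sys n) (comp_mat s n)"
proof -
  have "mat_mpos n k (\<lambda>i j. comp_mat s n (x i j))" if "\<forall>i<k. \<forall>j<k. x i j \<in> E" "op_mpos k x" for k x
  proof -
    have "mform n k (\<lambda>i j. comp_mat s n (x i j)) v v
      = cform k x (\<lambda>j. \<Sum>b<n. v j b *\<^sub>C ket (s + b)) (\<lambda>i. \<Sum>a<n. v i a *\<^sub>C ket (s + a))" for v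
      using that(1) assms by (intro mform_comp_mat) auto
    then show ?thesis using that(2) unfolding mat_mpos_mform op_mpos_def cform_def by simp
  qed
  moreover have "comp_mat s n (S + T) = comp_mat s n S + comp_mat s n T" for S T
    by (rule eq_matI) (auto simp: comp_mat_def blinfun.add_left cinner_add_left)
  moreover have "comp_mat s n (c *\<^sub>C T) = c *\<^sub>C comp_mat s n T" for c T
    by (rule eq_matI) (auto simp: comp_mat_def cinner_scaleC_left)
  moreover have "comp_mat s n id_blinfun = 1\<^sub>m n"
    by (rule eq_matI) (auto simp: comp_mat_def cinner_ket ket_nth)
  ultimately show ?thesis
    unfolding ucp_def linear_map_def by (auto simp: op_sys_def mat_sys_def matrices_over_def amplify_def)
qed

lemma comp_mat_bop:
  assumes "\<forall>k. 0 < d k" "blocks d z"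
  shows "comp_mat (offs d k) (d k) (bop d z) = z k"
proof (rule eq_matI)
  have car: "z k \<in> carrier_mat (d k) (d k)" using assms unfolding blocks_def by blast
  show "dim_row (comp_mat (offs d k) (d k) (bop d z)) = dim_row (z k)"
    "dim_col (comp_mat (offs d k) (d k) (bop d z)) = dim_col (z k)"
    using car by (auto simp: comp_mat_def)
  fix a b assume "a < dim_row (z k)" "b < dim_col (z k)"
  then have ab: "a < d k" "b < d k" using car by auto
  have "(\<Sum>b'<d k. z k $$ (a, b') * ell2_nth (ket (offs d k + b)) (offs d k + b')) = (\<Sum>b'<d k. if b = b' then z k $$ (a, b') else 0)"
    by (intro sum.cong refl) (auto simp: ket_nth)
  also have "\<dots> = z k $$ (a, b)" using ab by simp
  finally show "comp_mat (offs d k) (d k) (bop d z) $$ (a, b) = z k $$ (a, b)"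
    using ab by (simp add: comp_mat_index bop_apply[OF assms] bfun_offs)
qed

lemma sv_ket:
  assumes d: "\<forall>k. 0 < d k" and m: "m < K"
  shows "sv d m v = (\<Sum>b<offs d K. ell2_nth (sv d m v) b *\<^sub>C ket (0 + b))"
proof (rule ell2_eqI)
  fix i
  have "ell2_nth (\<Sum>b<offs d K. ell2_nth (sv d m v) b *\<^sub>C ket (0 + b)) i = (\<Sum>b<offs d K. if i = b then ell2_nth (sv d m v) b else 0)"
    unfolding ell2_nth_sum by (intro sum.cong refl) (auto simp: ket_nth)
  also have "\<dots> = (if i < offs d K then ell2_nth (sv d m v) i else 0)" by simp
  also have "\<dots> = ell2_nth (sv d m v) i"
  proof -
    have "blk d i \<noteq> m" if "\<not> i < offs d K"
      using blk_bounds[OF d, of i] offs_mono[of "Suc m" K d] m that by (auto simp: offs_def)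
    then show ?thesis by (auto simp: sv_nth[OF d])
  qed
  finally show "ell2_nth (sv d m v) i = ell2_nth (\<Sum>b<offs d K. ell2_nth (sv d m v) b *\<^sub>C ket (0 + b)) i" ..
qed

text \<open>A vector supported in block m lies in the span of the first \<open>offs d K\<close>
  coordinates, so the compression contains the block as a corner and dominates its norm.\<close>

lemma mbd_comp_mat_bop:
  assumes d: "\<forall>k. 0 < d k" and z: "\<And>i j. i < k \<Longrightarrow> j < k \<Longrightarrow> blocks d (z i j)"
    and b: "mbd (offs d K) k (\<lambda>i j. comp_mat 0 (offs d K) (bop d (z i j))) c" and m: "m < K"
  shows "mbd (d m) k (\<lambda>i j. z i j m) c"
  unfolding mbd_def
proof (intro allI)
  fix v w
  let ?e = "\<lambda>v j b. ell2_nth (sv d m (v j)) b"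
  have "mform (d m) k (\<lambda>i j. z i j m) v w = cform k (\<lambda>i j. bop d (z i j)) (\<lambda>j. sv d m (v j)) (\<lambda>i. sv d m (w i))"
    using d z by (intro cform_sv[symmetric])
  also have "\<dots> = cform k (\<lambda>i j. bop d (z i j)) (\<lambda>j. \<Sum>b<offs d K. ?e v j b *\<^sub>C ket (0 + b)) (\<lambda>j. \<Sum>b<offs d K. ?e w j b *\<^sub>C ket (0 + b))"
    by (simp only: sv_ket[OF d m, symmetric])
  also have "\<dots> = mform (offs d K) k (\<lambda>i j. comp_mat 0 (offs d K) (bop d (z i j))) (?e v) (?e w)"
    using d z by (intro mform_comp_mat[symmetric] clinear_bop)
  finally have 1: "mform (d m) k (\<lambda>i j. z i j m) v w = mform (offs d K) k (\<lambda>i j. comp_mat 0 (offs d K) (bop d (z i j))) (?e v) (?e w)" .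
  have 2: "msq (offs d K) k (?e v) = msq (d m) k v" for v
  proof -
    have "msq (offs d K) k (?e v) = nsq k (\<lambda>j. \<Sum>b<offs d K. ?e v j b *\<^sub>C ket (0 + b))"
      by (rule nsq_ket[symmetric])
    also have "\<dots> = nsq k (\<lambda>j. sv d m (v j))" by (simp only: sv_ket[OF d m, symmetric])
    also have "\<dots> = msq (d m) k v" by (rule nsq_sv[OF d])
    finally show ?thesis .
  qed
  show "2 * Re (mform (d m) k (\<lambda>i j. z i j m) v w) \<le> c * (msq (d m) k v + msq (d m) k w)"
    using b[unfolded mbd_def, rule_format, of "?e v" "?e w"] unfolding 1 2 .
qed

lemma is_adjoint_bop:
  assumes d: "\<forall>k. 0 < d k" and z: "blocks d z" "blocks d z'"
    and adj: "\<And>k a b. a < d k \<Longrightarrow> b < d k \<Longrightarrow> z' k $$ (a, b) = cnj (z k $$ (b, a))"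
  shows "is_adjoint (bop d z') (bop d z)"
  unfolding is_adjoint_def
proof (intro allI)
  fix f g
  have fin: "mform (d m) 1 (\<lambda>_ _. z' m) v w = cnj (mform (d m) 1 (\<lambda>_ _. z m) w v)" for m v w
  proof -
    have "mform (d m) 1 (\<lambda>_ _. z' m) v w = (\<Sum>a<d m. \<Sum>b<d m. cnj (z m $$ (b, a)) * v 0 b * cnj (w 0 a))"
      by (simp add: mform_def mat_act_def sum_distrib_right adj)
    also have "\<dots> = (\<Sum>b<d m. \<Sum>a<d m. cnj (z m $$ (b, a)) * v 0 b * cnj (w 0 a))" by (rule sum.swap)
    also have "\<dots> = cnj (mform (d m) 1 (\<lambda>_ _. z m) w v)"
      by (simp add: mform_def mat_act_def sum_distrib_right sum_distrib_left cnj_sum mult.commute mult.left_commute)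
    finally show ?thesis .
  qed
  have 1: "(\<lambda>K. \<Sum>m<K. mform (d m) 1 (\<lambda>_ _. z' m) (bvec d m (\<lambda>_. f)) (bvec d m (\<lambda>_. g))) \<longlonglongrightarrow> cinner (blinfun_apply (bop d z') f) g"
    using cform_tendsto[OF d, of 1 "\<lambda>_ _. z'" "\<lambda>_. f" "\<lambda>_. g"] z by (simp add: cform_def)
  have "(\<lambda>K. \<Sum>m<K. mform (d m) 1 (\<lambda>_ _. z m) (bvec d m (\<lambda>_. g)) (bvec d m (\<lambda>_. f))) \<longlonglongrightarrow> cinner (blinfun_apply (bop d z) g) f"
    using cform_tendsto[OF d, of 1 "\<lambda>_ _. z" "\<lambda>_. g" "\<lambda>_. f"] z by (simp add: cform_def)
  from tendsto_cnj[OF this] have 2: "(\<lambda>K. \<Sum>m<K. mform (d m) 1 (\<lambda>_ _. z' m) (bvec d m (\<lambda>_. f)) (bvec d m (\<lambda>_. g))) \<longlonglongrightarrow> cinner f (blinfun_apply (bop d z) g)"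
    unfolding cnj_sum fin[symmetric] cinner_commute[of f] .
  show "cinner (blinfun_apply (bop d z') f) g = cinner f (blinfun_apply (bop d z) g)"
    using LIMSEQ_unique[OF 1 2] .
qed

context
  fixes n :: nat
  assumes n: "0 < n"
begin

lemma rpos_emb:
  assumes "\<And>i j. i < k \<Longrightarrow> j < k \<Longrightarrow> A i j \<in> carrier_mat n n"
  shows "rpos k (\<lambda>i j. emb n (A i j)) \<longleftrightarrow> mrp n k A"
  unfolding emb_def using n by (subst rpos_bop) (auto intro: blocks_const assms)

lemma rbnd_emb:
  assumes "\<And>i j. i < k \<Longrightarrow> j < k \<Longrightarrow> A i j \<in> carrier_mat n n"
  shows "rbnd k (\<lambda>i j. emb n (A i j)) c \<longleftrightarrow> mbd n k A c"
  unfolding emb_def using n by (subst rbnd_bop) (auto intro: blocks_const assms)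

lemma emb_add: "A \<in> carrier_mat n n \<Longrightarrow> B \<in> carrier_mat n n \<Longrightarrow> emb n (A + B) = emb n A + emb n B"
  unfolding emb_def using n blocks_add(2)[of "\<lambda>_. n" "\<lambda>_. A" "\<lambda>_. B"] by (simp add: blocks_const)

lemma emb_scaleC: "A \<in> carrier_mat n n \<Longrightarrow> emb n (c *\<^sub>C A) = c *\<^sub>C emb n A"
  unfolding emb_def using n blocks_scaleC(2)[of "\<lambda>_. n" "\<lambda>_. A" c] by (simp add: blocks_const)

lemma emb_one: "emb n (1\<^sub>m n) = id_blinfun"
  unfolding emb_def using n blocks_one(2)[of "\<lambda>_. n"] by simp

lemma clinear_emb: "A \<in> carrier_mat n n \<Longrightarrow> clinear_op (emb n A)"
  unfolding emb_def using n by (intro clinear_bop blocks_const) auto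

lemma comp_emb: "A \<in> carrier_mat n n \<Longrightarrow> comp_mat 0 n (emb n A) = A"
  unfolding emb_def using n comp_mat_bop[of "\<lambda>_. n" "\<lambda>_. A" 0] by (simp add: blocks_const offs_def)

lemma op_mpos_emb:
  assumes "\<And>i j. i < k \<Longrightarrow> j < k \<Longrightarrow> A i j \<in> carrier_mat n n"
  shows "op_mpos k (\<lambda>i j. emb n (A i j)) \<longleftrightarrow> mat_mpos n k A"
proof -
  have "rpos k (\<lambda>i j. c *\<^sub>C emb n (A i j)) \<longleftrightarrow> mrp n k (\<lambda>i j. c *\<^sub>C A i j)" for c
  proof -
    have "rpos k (\<lambda>i j. c *\<^sub>C emb n (A i j)) \<longleftrightarrow> rpos k (\<lambda>i j. emb n (c *\<^sub>C A i j))"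
      using assms by (intro rpos_cong) (simp add: emb_scaleC)
    then show ?thesis using assms by (subst (asm) rpos_emb) auto
  qed
  moreover have "rpos k (\<lambda>i j. emb n (A i j)) \<longleftrightarrow> mrp n k A" by (rule rpos_emb) (rule assms)
  moreover have "mat_mpos n k A \<longleftrightarrow> mrp n k A \<and> mrp n k (\<lambda>i j. \<i> *\<^sub>C A i j) \<and> mrp n k (\<lambda>i j. (-\<i>) *\<^sub>C A i j)"
    by (rule mat_mpos_iff_mrp) (rule assms)
  ultimately show ?thesis unfolding op_mpos_iff_rpos by (simp only:)
qed

lemma alg_carrier: "T \<in> alg n \<longleftrightarrow> comp_mat 0 n T \<in> carrier_mat n n \<and> T = emb n (comp_mat 0 n T)"
  unfolding alg_def using comp_emb by auto

lemma ucp_emb: "ucp (mat_sys n) (op_sys (alg n)) (emb n)"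
proof -
  have "op_mpos k (\<lambda>i j. emb n (x i j))" if "\<forall>i<k. \<forall>j<k. x i j \<in> carrier_mat n n" "mat_mpos n k x" for k x
    using that by (subst op_mpos_emb) auto
  then show ?thesis
    unfolding ucp_def linear_map_def
    by (auto simp: op_sys_def mat_sys_def matrices_over_def amplify_def alg_def emb_add emb_scaleC emb_one)
qed

lemma osys_alg: "osys (alg n)"
  unfolding osys_def
proof (intro conjI ballI)
  show "clinear_op T" if "T \<in> alg n" for T using that clinear_emb by (auto simp: alg_def)
  show "id_blinfun \<in> alg n" unfolding alg_def emb_one[symmetric] by simp
  show "op_space.subspace (alg n)"
  proof (rule op_space.subspaceI)
    have "0 *\<^sub>C id_blinfun = emb n (0 *\<^sub>C 1\<^sub>m n)" by (subst emb_scaleC) (simp_all add: emb_one)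
    moreover have "0 *\<^sub>C 1\<^sub>m n \<in> (carrier_mat n n :: complex mat set)" by simp
    ultimately show "0 \<in> alg n" unfolding alg_def op_space.scale_zero_left by blast
    show "S + T \<in> alg n" if "S \<in> alg n" "T \<in> alg n" for S T
      using that unfolding alg_def by (auto simp flip: emb_add)
    show "c *\<^sub>C T \<in> alg n" if "T \<in> alg n" for c T
      using that unfolding alg_def by (auto simp flip: emb_scaleC)
  qed
  fix T assume "T \<in> alg n"
  then obtain A where A: "A \<in> carrier_mat n n" "T = emb n A" unfolding alg_def by blast
  let ?B = "mat n n (\<lambda>(a, b). cnj (A $$ (b, a)))"
  have "is_adjoint (emb n ?B) T"
    unfolding A(2) emb_def using n A(1) by (intro is_adjoint_bop blocks_const) auto
  moreover have "emb n ?B \<in> alg n" unfolding alg_def by (rule imageI) simp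
  ultimately show "\<exists>S\<in>alg n. is_adjoint S T" by blast
qed

lemma ucp_mat_rucp:
  assumes "ucp (op_sys E) (mat_sys n) \<phi>" "osys E"
  shows "rucp E (\<lambda>x. emb n (\<phi> x))" "x \<in> E \<Longrightarrow> \<phi> x \<in> carrier_mat n n"
proof -
  show "rucp E (\<lambda>x. emb n (\<phi> x))"
    using ucp_compose[OF assms(1) ucp_emb] assms(2) osysD(1)[OF osys_alg] by (rule ucp_rucp)
  show "x \<in> E \<Longrightarrow> \<phi> x \<in> carrier_mat n n"
    using assms(1) by (auto simp: ucp_def linear_map_def op_sys_def mat_sys_def)
qed

lemma ucp_mat_sysI:
  assumes "ucp (op_sys E) (op_sys (alg n)) (\<lambda>x. emb n (\<phi> x))" "\<And>x. x \<in> E \<Longrightarrow> \<phi> x \<in> carrier_mat n n"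
    "op_space.subspace E" "id_blinfun \<in> E"
  shows "ucp (op_sys E) (mat_sys n) \<phi>"
proof (rule ucp_cong)
  show "ucp (op_sys E) (mat_sys n) (\<lambda>x. comp_mat 0 n (emb n (\<phi> x)))"
    by (rule ucp_compose[OF assms(1) ucp_comp_mat]) (rule osysD(1)[OF osys_alg])
  show "mpos (mat_sys n) k y" if "\<And>i j. i < k \<Longrightarrow> j < k \<Longrightarrow> x i j = y i j" "mpos (mat_sys n) k x" for k x y
  proof -
    have "mform n k x v v = mform n k y v v" for v using that(1) by (intro mform_cong) auto
    then show ?thesis using that(2) by (simp add: mat_sys_def mat_mpos_mform)
  qed
qed (use assms in \<open>auto simp: op_sys_def comp_emb intro: op_space.subspace_add op_space.subspace_scale\<close>)

lemma rucp_mat_sysI: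
  assumes "rucp E (\<lambda>x. emb n (\<phi> x))" "\<And>x. x \<in> E \<Longrightarrow> \<phi> x \<in> carrier_mat n n" "op_space.subspace E" "id_blinfun \<in> E"
  shows "ucp (op_sys E) (mat_sys n) \<phi>"
  using assms by (intro ucp_mat_sysI rucp_ucp) (auto simp: alg_def)

lemma ucp_from_mat:
  assumes "ucp (op_sys (alg n)) T \<psi>"
  shows "ucp (mat_sys n) T (\<lambda>A. \<psi> (emb n A))"
  using ucp_emb assms by (rule ucp_compose)

lemma mat_ucp_rucp:
  assumes "ucp (mat_sys n) (op_sys F) \<psi>" "\<And>T. T \<in> F \<Longrightarrow> clinear_op T"
  shows "rucp (alg n) (\<lambda>T. \<psi> (comp_mat 0 n T))"
proof -
  have "ucp (op_sys (alg n)) (mat_sys n) (comp_mat 0 n)" by (rule ucp_comp_mat) (rule osysD(1)[OF osys_alg])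
  from ucp_compose[OF this assms(1)] osys_alg assms(2) show ?thesis by (rule ucp_rucp)
qed

end

section \<open>Extension of ucp maps into matrix algebras\<close>

definition munit :: "nat \<Rightarrow> nat \<Rightarrow> 'x \<Rightarrow> nat \<Rightarrow> nat \<Rightarrow> 'x::zero" where
  "munit a b T = (\<lambda>i j. if i = a \<and> j = b then T else 0)"

lemma subspace_clinear: "op_space.subspace {T :: 'h::chilbert_space \<Rightarrow>\<^sub>L 'h. clinear_op T}"
  by (rule op_space.subspaceI)
    (auto simp: clinear_op_def blinfun.add_left scaleC_add_right scaleC_scaleC mult.commute)

lemma clinear_id: "clinear_op id_blinfun"
  by (simp add: clinear_op_def)

lemma munit_add: "munit a b (S + T) = munit a b S + (munit a b T :: nat \<Rightarrow> nat \<Rightarrow> 'x::monoid_add)"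
  by (auto simp: munit_def fun_eq_iff)

text \<open>Completely positive maps into \<open>M\<^sub>m\<close> correspond to positive functionals on \<open>m \<times> m\<close>
  matrices.\<close>

lemma functional_to_ucp:
  fixes F :: "(nat \<Rightarrow> nat \<Rightarrow> 'k::chilbert_space \<Rightarrow>\<^sub>L 'k) \<Rightarrow> real"
  assumes F: "linear F" and pos: "\<And>p. rpos m p \<Longrightarrow> 0 \<le> F p" and m: "0 < m" and c: "0 < c"
    and unit: "\<And>\<alpha>. F (scal \<alpha>) = c * Re (\<Sum>i<m. \<alpha> i i)"
  defines "\<gamma> \<equiv> \<lambda>T. mat m m (\<lambda>(a, b). (of_real (F (munit a b T)) - \<i> * of_real (F (munit a b (\<i> *\<^sub>C T)))) / of_real c)"
  shows "ucp (op_sys {T. clinear_op T}) (mat_sys m) \<gamma>"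
proof (rule rucp_mat_sysI[OF m])
  \<comment> \<open>The complex-linear functional with real part F; the entries of
    \<open>\<gamma> T\<close> are its values on matrices with the single entry T, divided by
    c.\<close>
  define s where "s p = complex_of_real (F p) - \<i> * of_real (F (\<lambda>i j. \<i> *\<^sub>C p i j))" for p
  have Fadd: "F (\<lambda>i j. p i j + q i j) = F p + F q" for p q
    using linear_add[OF F, of p q] by (simp add: plus_fun_def)
  have Fsc: "F (\<lambda>i j. r *\<^sub>R p i j) = r * F p" for r p
    using linear_scale[OF F, of r p] by (simp add: scaleR_fun_def)
  have sadd: "s (\<lambda>i j. p i j + q i j) = s p + s q" for p q
    by (simp add: s_def Fadd op_space.scale_right_distrib algebra_simps)
  have ssc: "s (\<lambda>i j. z *\<^sub>C p i j) = z * s p" for z p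
  proof -
    have "F (\<lambda>i j. w *\<^sub>C p i j) = Re w * F p + Im w * F (\<lambda>i j. \<i> *\<^sub>C p i j)" for w
    proof -
      have "w *\<^sub>C p i j = Re w *\<^sub>R p i j + Im w *\<^sub>R (\<i> *\<^sub>C p i j)" for i j
        unfolding op_scaleR_scaleC op_space.scale_scale op_space.scale_left_distrib[symmetric]
        by (simp add: complex_eq_iff)
      then show ?thesis by (simp add: Fadd Fsc)
    qed
    from this[of z] this[of "\<i> * z"] show ?thesis unfolding s_def op_space.scale_scale
      by (simp add: complex_eq_iff algebra_simps)
  qed
  have ssum: "s (\<lambda>i j. \<Sum>x\<in>A. p x i j) = (\<Sum>x\<in>A. s (p x))" for A and p :: "'z \<Rightarrow> _"
  proof (induction A rule: infinite_finite_induct)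
    case (insert x A) then show ?case by (simp add: sadd)
  next
    case empty show ?case using ssc[of 0 "\<lambda>i j. 0"] by simp
  next
    case (infinite A) then show ?case using ssc[of 0 "\<lambda>i j. 0"] by simp
  qed
  have mu: "munit a b (z *\<^sub>C T) = (\<lambda>i j. z *\<^sub>C munit a b T i j)" for a b z and T :: "'k \<Rightarrow>\<^sub>L 'k"
    by (auto simp: munit_def fun_eq_iff)
  have \<gamma>: "\<gamma> T $$ (a, b) = s (munit a b T) / of_real c" if "a < m" "b < m" for T a b
    using that unfolding \<gamma>_def s_def by (simp add: mu)
  have car: "\<gamma> T \<in> carrier_mat m m" for T unfolding \<gamma>_def by simp
  have \<gamma>add: "\<gamma> (S + T) = \<gamma> S + \<gamma> T" for S T
  proof (rule eq_matI)
    fix a b assume "a < dim_row (\<gamma> S + \<gamma> T)" "b < dim_col (\<gamma> S + \<gamma> T)"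
    then have ab: "a < m" "b < m" using car[of T] by auto
    then show "\<gamma> (S + T) $$ (a, b) = (\<gamma> S + \<gamma> T) $$ (a, b)"
      using car[of S] car[of T] sadd[of "munit a b S" "munit a b T"]
      by (simp add: \<gamma> munit_add plus_fun_def add_divide_distrib)
  qed (use car[of "S + T"] car[of T] in auto)
  have \<gamma>sc: "\<gamma> (z *\<^sub>C T) = z *\<^sub>C \<gamma> T" for z T
  proof (rule eq_matI)
    fix a b assume "a < dim_row (z *\<^sub>C \<gamma> T)" "b < dim_col (z *\<^sub>C \<gamma> T)"
    then have ab: "a < m" "b < m" using car[of T] by auto
    then show "\<gamma> (z *\<^sub>C T) $$ (a, b) = (z *\<^sub>C \<gamma> T) $$ (a, b)"
      using car[of T] by (simp add: \<gamma> mu ssc)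
  qed (use car[of "z *\<^sub>C T"] car[of T] in auto)
  have \<gamma>one: "\<gamma> id_blinfun = 1\<^sub>m m"
  proof (rule eq_matI)
    fix a b assume "a < dim_row (1\<^sub>m m :: complex mat)" "b < dim_col (1\<^sub>m m :: complex mat)"
    then have ab: "a < m" "b < m" by auto
    have e: "munit a b (z *\<^sub>C id_blinfun) = scal (\<lambda>i j. if i = a \<and> j = b then z else 0)" for z
      by (auto simp: munit_def scal_def fun_eq_iff)
    have t: "(\<Sum>i<m. if i = a \<and> i = b then z else 0) = (if a = b then z else 0 :: complex)" for z
      using ab by (cases "a = b") (auto intro!: sum.neutral)
    have "F (munit a b (z *\<^sub>C id_blinfun)) = c * Re (if a = b then z else 0)" for z
      unfolding e unit t ..
    from this[of 1] this[of \<i>] show "\<gamma> id_blinfun $$ (a, b) = 1\<^sub>m m $$ (a, b)"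
      using ab c by (simp add: \<gamma> s_def flip: mu)
  qed (use car[of id_blinfun] in auto)
  have pos': "mrp m k (\<lambda>i j. \<gamma> (x i j))" if x: "\<forall>i<k. \<forall>j<k. clinear_op (x i j)" "rpos k x" for k and x :: "nat \<Rightarrow> nat \<Rightarrow> 'k \<Rightarrow>\<^sub>L 'k"
    unfolding mrp_def
  proof
    fix v :: "nat \<Rightarrow> nat \<Rightarrow> complex"
    \<comment> \<open>Compressing x by v gives an m x m matrix whose value under F is c times the
      real form of the image of x at v. It is cut off outside m x m so that it is a finite sum of
      matrices with one entry; compression preserves positivity.\<close>
    define Y where "Y a b = (\<Sum>i<k. \<Sum>j<k. (v j b * cnj (v i a)) *\<^sub>C x i j)" for a b :: nat
    define Y' where "Y' a b = (if a < m \<and> b < m then Y a b else 0)" for a b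
    have Y'sum: "Y' = (\<lambda>i j. \<Sum>a<m. \<Sum>b<m. munit a b (Y a b) i j)"
    proof (intro ext)
      fix i j
      have "(\<Sum>a<m. \<Sum>b<m. munit a b (Y a b) i j) = (\<Sum>a<m. \<Sum>b<m. if a = i \<and> b = j then Y i j else 0)"
        by (intro sum.cong refl) (auto simp: munit_def)
      also have "\<dots> = (\<Sum>a<m. if a = i then (if j < m then Y i j else 0) else 0)"
        by (intro sum.cong refl) auto
      also have "\<dots> = Y' i j" by (auto simp: Y'_def)
      finally show "Y' i j = (\<Sum>a<m. \<Sum>b<m. munit a b (Y a b) i j)" ..
    qed
    have "mform m k (\<lambda>i j. \<gamma> (x i j)) v v = (\<Sum>i<k. \<Sum>a<m. \<Sum>j<k. \<Sum>b<m. (v j b * cnj (v i a)) * s (munit a b (x i j)) / of_real c)"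
      unfolding mform_def mat_act_def sum_distrib_right
      by (intro sum.cong refl) (simp add: \<gamma> mult_ac)
    also have "\<dots> = (\<Sum>i<k. \<Sum>a<m. \<Sum>b<m. \<Sum>j<k. (v j b * cnj (v i a)) * s (munit a b (x i j)) / of_real c)"
      by (intro sum.cong refl sum.swap)
    also have "\<dots> = (\<Sum>a<m. \<Sum>i<k. \<Sum>b<m. \<Sum>j<k. (v j b * cnj (v i a)) * s (munit a b (x i j)) / of_real c)"
      by (rule sum.swap)
    also have "\<dots> = (\<Sum>a<m. \<Sum>b<m. \<Sum>i<k. \<Sum>j<k. (v j b * cnj (v i a)) * s (munit a b (x i j)) / of_real c)"
      by (intro sum.cong refl sum.swap)
    also have "\<dots> = (\<Sum>a<m. \<Sum>b<m. s (munit a b (Y a b))) / of_real c"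
    proof -
      have "s (munit a b (Y a b)) = (\<Sum>i<k. \<Sum>j<k. (v j b * cnj (v i a)) * s (munit a b (x i j)))" for a b
      proof -
        have "munit a b (Y a b) = (\<lambda>i' j'. \<Sum>i<k. \<Sum>j<k. (v j b * cnj (v i a)) *\<^sub>C munit a b (x i j) i' j')"
          by (auto simp: munit_def Y_def fun_eq_iff)
        then show ?thesis by (simp only: ssum ssc)
      qed
      then show ?thesis by (simp add: sum_divide_distrib)
    qed
    also have "(\<Sum>a<m. \<Sum>b<m. s (munit a b (Y a b))) = s Y'"
      unfolding Y'sum ssum ..
    finally have "Re (mform m k (\<lambda>i j. \<gamma> (x i j)) v v) = F Y' / c"
      by (simp add: s_def)
    moreover have "rpos m Y'"
      unfolding rpos_def
    proof
      fix h :: "nat \<Rightarrow> 'k"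
      define H where "H i = (\<Sum>b<m. v i b *\<^sub>C h b)" for i
      have cl: "cinner (blinfun_apply (x i j) (H j)) (H i) = (\<Sum>a<m. \<Sum>b<m. (v j b * cnj (v i a)) * cinner (blinfun_apply (x i j) (h b)) (h a))"
        if "i < k" "j < k" for i j
      proof -
        have "blinfun_apply (x i j) (H j) = (\<Sum>b<m. v j b *\<^sub>C blinfun_apply (x i j) (h b))"
          unfolding H_def using x(1) that by (simp add: blinfun.sum_right clinear_op_def)
        then show ?thesis unfolding H_def
          by (simp add: cinner_sum_left cinner_sum_right cinner_scaleC_left cinner_scaleC_right sum_distrib_left mult_ac)
      qed
      have "rform m Y' h h = Re (\<Sum>a<m. \<Sum>b<m. cinner (blinfun_apply (Y a b) (h b)) (h a))"
        unfolding rform_def inner_eq_Re_cinner Re_sum by (intro sum.cong refl) (simp add: Y'_def)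
      also have "(\<Sum>a<m. \<Sum>b<m. cinner (blinfun_apply (Y a b) (h b)) (h a))
          = (\<Sum>a<m. \<Sum>b<m. \<Sum>i<k. \<Sum>j<k. (v j b * cnj (v i a)) * cinner (blinfun_apply (x i j) (h b)) (h a))"
        unfolding Y_def by (simp add: blinfun.sum_left cinner_sum_left cinner_scaleC_left)
      also have "\<dots> = (\<Sum>a<m. \<Sum>i<k. \<Sum>b<m. \<Sum>j<k. (v j b * cnj (v i a)) * cinner (blinfun_apply (x i j) (h b)) (h a))"
        by (intro sum.cong refl sum.swap)
      also have "\<dots> = (\<Sum>i<k. \<Sum>a<m. \<Sum>j<k. \<Sum>b<m. (v j b * cnj (v i a)) * cinner (blinfun_apply (x i j) (h b)) (h a))"
        by (subst sum.swap) (intro sum.cong refl sum.swap)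
      also have "\<dots> = (\<Sum>i<k. \<Sum>j<k. \<Sum>a<m. \<Sum>b<m. (v j b * cnj (v i a)) * cinner (blinfun_apply (x i j) (h b)) (h a))"
        by (intro sum.cong refl sum.swap)
      also have "\<dots> = (\<Sum>i<k. \<Sum>j<k. cinner (blinfun_apply (x i j) (H j)) (H i))"
        using cl by (intro sum.cong refl) auto
      also have "Re \<dots> = rform k x H H" by (simp add: rform_def inner_eq_Re_cinner Re_sum)
      finally show "0 \<le> rform m Y' h h" using x(2) unfolding rpos_def by simp
    qed
    ultimately show "0 \<le> Re (mform m k (\<lambda>i j. \<gamma> (x i j)) v v)" using pos c by simp
  qed
  show "rucp {T. clinear_op T} (\<lambda>x. emb m (\<gamma> x))"
    unfolding rucp_def
  proof (intro conjI ballI allI impI)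
    show "clinear_op (emb m (\<gamma> x))" for x using clinear_emb[OF m car] .
    show "emb m (\<gamma> (x + y)) = emb m (\<gamma> x) + emb m (\<gamma> y)" for x y
      unfolding \<gamma>add by (rule emb_add[OF m car car])
    show "emb m (\<gamma> (z *\<^sub>C x)) = z *\<^sub>C emb m (\<gamma> x)" for z x
      unfolding \<gamma>sc by (rule emb_scaleC[OF m car])
    show "emb m (\<gamma> id_blinfun) = id_blinfun" unfolding \<gamma>one by (rule emb_one[OF m])
    fix k and x :: "nat \<Rightarrow> nat \<Rightarrow> 'k \<Rightarrow>\<^sub>L 'k" assume "\<forall>i<k. \<forall>j<k. x i j \<in> {T. clinear_op T}" "rpos k x"
    then have "mrp m k (\<lambda>i j. \<gamma> (x i j))" using pos' by auto
    then show "rpos k (\<lambda>i j. emb m (\<gamma> (x i j)))" using rpos_emb[OF m car] by simp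
  qed
  show "\<gamma> x \<in> carrier_mat m m" for x by (rule car)
qed (use subspace_clinear clinear_id in auto)

lemma rpos_add: "rpos k x \<Longrightarrow> rpos k y \<Longrightarrow> rpos k (\<lambda>i j. x i j + y i j)"
  unfolding rpos_def rform_add by simp

lemma rpos_scaleR: "0 \<le> r \<Longrightarrow> rpos k x \<Longrightarrow> rpos k (\<lambda>i j. r *\<^sub>R x i j)"
  unfolding rpos_def rform_scaleR by simp

lemma rpos_unit_diff:
  assumes "rbnd k x K" shows "rpos k (\<lambda>i j. unit_scal (of_real K) i j - x i j)"
  unfolding rpos_def rform_diff rform_scal_diag nsq_inner[symmetric]
proof
  fix h
  show "0 \<le> K * nsq k h - rform k x h h"
    using assms[unfolded rbnd_def, rule_format, of h h] by (simp add: distrib_left)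
qed

lemma scal_add: "scal \<alpha> i j + scal \<beta> i j = scal (\<lambda>i j. \<alpha> i j + \<beta> i j) i j"
  by (simp add: scal_def op_space.scale_left_distrib)

lemma scal_scaleR: "r *\<^sub>R scal \<alpha> i j = scal (\<lambda>i j. of_real r * \<alpha> i j) i j"
  by (simp add: scal_def op_scaleR_scaleC)

lemma linear_pair_split:
  fixes f :: "'v::real_vector \<times> 'v \<Rightarrow> real"
  assumes "linear f"
  shows "linear (\<lambda>p. f (p, 0))" "linear (\<lambda>q. f (0, q))" "f (p, q) = f (p, 0) + f (0, q)"
proof -
  show "linear (\<lambda>p. f (p, 0))"
    using linear_add[OF assms, of "(_, 0)" "(_, 0)"] linear_scale[OF assms, of _ "(_, 0)"]
    by (intro linearI) simp_all
  show "linear (\<lambda>q. f (0, q))"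
    using linear_add[OF assms, of "(0, _)" "(0, _)"] linear_scale[OF assms, of _ "(0, _)"]
    by (intro linearI) simp_all
  show "f (p, q) = f (p, 0) + f (0, q)"
    using linear_add[OF assms, of "(p, 0)" "(0, q)"] by simp
qed

text \<open>The hypothesis on \<open>\<delta>\<close> says that the inverse of \<open>\<phi>\<close> is almost completely positive. For
  \<open>\<delta> = 0\<close> and \<open>\<phi>\<close> the identity the conclusion is Arveson's extension theorem. The pair of
  functionals is obtained by the Riesz extension theorem on pairs of \<open>m \<times> m\<close> matrices.\<close>

lemma ucp_pair_extension:
  fixes E :: "('h::chilbert_space \<Rightarrow>\<^sub>L 'h) set" and \<phi> :: "('h \<Rightarrow>\<^sub>L 'h) \<Rightarrow> ('k::chilbert_space \<Rightarrow>\<^sub>L 'k)"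
  assumes E: "osys E" and \<phi>: "rucp E \<phi>" and \<xi>: "ucp (op_sys E) (mat_sys m) \<xi>" and m: "0 < m"
    and \<delta>: "0 \<le> \<delta>"
    and P: "\<And>x \<alpha>. (\<And>i j. x i j \<in> E) \<Longrightarrow> rpos m (\<lambda>i j. \<phi> (x i j)) \<Longrightarrow>
      rpos m (\<lambda>i j. scal \<alpha> i j - \<phi> (x i j)) \<Longrightarrow> rpos m (\<lambda>i j. x i j + \<delta> *\<^sub>R scal \<alpha> i j)"
  shows "\<exists>\<gamma> \<gamma>'. ucp (op_sys {T :: 'k \<Rightarrow>\<^sub>L 'k. clinear_op T}) (mat_sys m) \<gamma> \<and>
    ucp (op_sys {T :: 'k \<Rightarrow>\<^sub>L 'k. clinear_op T}) (mat_sys m) \<gamma>' \<and>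
    (\<forall>x\<in>E. \<xi> x + of_real \<delta> *\<^sub>C \<gamma>' (\<phi> x) = of_real (1 + \<delta>) *\<^sub>C \<gamma> (\<phi> x))"
proof -
  note E' = osysD[OF E]
  note Eadd = op_space.subspace_add[OF E'(2)] and Esc = op_space.subspace_scale[OF E'(2)]
    and EscR = subspace_scaleR[OF E'(2)] and E0 = op_space.subspace_0[OF E'(2)]
  have \<xi>': "rucp E (\<lambda>x. emb m (\<xi> x))" "\<And>x. x \<in> E \<Longrightarrow> \<xi> x \<in> carrier_mat m m"
    using ucp_mat_rucp[OF m \<xi> E] by blast+
  have \<xi>add: "\<xi> (x + y) = \<xi> x + \<xi> y" if "x \<in> E" "y \<in> E" for x y
    using \<xi> that by (auto simp: ucp_def linear_map_def op_sys_def)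
  have \<xi>sc: "\<xi> (c *\<^sub>C x) = c *\<^sub>C \<xi> x" if "x \<in> E" for x c
    using \<xi> that by (auto simp: ucp_def linear_map_def op_sys_def)
  have \<xi>1: "\<xi> id_blinfun = 1\<^sub>m m"
    using \<xi> by (auto simp: ucp_def op_sys_def mat_sys_def)
  have Escal: "scal \<alpha> i j \<in> E" for \<alpha> i j unfolding scal_def by (intro Esc E'(3))
  have \<phi>scal: "\<phi> (scal \<alpha> i j) = scal \<alpha> i j" for \<alpha> i j
    unfolding scal_def by (simp add: rucpD(3)[OF \<phi> E'(3)] rucpD(4)[OF \<phi>])
  have \<phi>0: "\<phi> 0 = 0" by (rule rucp_zero[OF \<phi> E'(2)])
  define tr where "tr \<alpha> = (\<Sum>i<m. \<alpha> i i)" for \<alpha> :: "nat \<Rightarrow> nat \<Rightarrow> complex"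
  \<comment> \<open>The functional on m x m matrices over E that corresponds to \<xi>.\<close>
  define S where "S x = (\<Sum>i<m. \<Sum>j<m. \<xi> (x i j) $$ (i, j))" for x
  have Sadd: "S (\<lambda>i j. x i j + y i j) = S x + S y" if "\<And>i j. x i j \<in> E" "\<And>i j. y i j \<in> E" for x y
  proof -
    have "\<xi> (x i j + y i j) $$ (i, j) = \<xi> (x i j) $$ (i, j) + \<xi> (y i j) $$ (i, j)" if "i < m" "j < m" for i j
      using \<xi>add[of "x i j" "y i j"] \<xi>'(2)[of "x i j"] \<xi>'(2)[of "y i j"] \<open>\<And>i j. x i j \<in> E\<close> \<open>\<And>i j. y i j \<in> E\<close> that by simp
    then show ?thesis unfolding S_def sum.distrib[symmetric] by (intro sum.cong refl) auto
  qed
  have Ssc: "S (\<lambda>i j. c *\<^sub>C x i j) = c * S x" if "\<And>i j. x i j \<in> E" for x c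
  proof -
    have "\<xi> (c *\<^sub>C x i j) $$ (i, j) = c * \<xi> (x i j) $$ (i, j)" if "i < m" "j < m" for i j
      using \<xi>sc[of "x i j" c] \<xi>'(2)[of "x i j"] \<open>\<And>i j. x i j \<in> E\<close> that by simp
    then show ?thesis unfolding S_def sum_distrib_left by (intro sum.cong refl) auto
  qed
  have Sscal: "S (scal \<alpha>) = tr \<alpha>" for \<alpha>
  proof -
    have "\<xi> (scal \<alpha> i j) $$ (i, j) = (if i = j then \<alpha> i i else 0)" if "i < m" "j < m" for i j
      using that unfolding scal_def \<xi>sc[OF E'(3)] \<xi>1 by simp
    then have "S (scal \<alpha>) = (\<Sum>i<m. \<Sum>j<m. if i = j then \<alpha> i i else 0)"
      unfolding S_def by (intro sum.cong refl) auto
    then show ?thesis by (simp add: tr_def)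
  qed
  have Spos: "0 \<le> Re (S x)" if "\<And>i j. x i j \<in> E" "rpos m x" for x
  proof -
    have "rpos m (\<lambda>i j. emb m (\<xi> (x i j)))" using that by (intro rucpD(5)[OF \<xi>'(1)])
    then have "mrp m m (\<lambda>i j. \<xi> (x i j))" using rpos_emb[OF m, of m "\<lambda>i j. \<xi> (x i j)"] \<xi>'(2) that(1) by simp
    \<comment> \<open>At the sum of the vectors e_i tensor e_i the form of the amplified \<xi> takes
      the value S x.\<close>
    then have "0 \<le> Re (mform m m (\<lambda>i j. \<xi> (x i j)) (\<lambda>i a. if i = a then 1 else 0) (\<lambda>i a. if i = a then 1 else 0))"
      unfolding mrp_def by blast
    also have "mform m m (\<lambda>i j. \<xi> (x i j)) (\<lambda>i a. if i = a then 1 else 0) (\<lambda>i a. if i = a then 1 else 0) = S x"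
    proof -
      have "(\<Sum>a<m. mat_act m m (\<lambda>i j. \<xi> (x i j)) (\<lambda>i a. if i = a then 1 else 0) i a * cnj (if i = a then 1 else 0))
         = (\<Sum>a<m. if i = a then mat_act m m (\<lambda>i j. \<xi> (x i j)) (\<lambda>i a. if i = a then 1 else 0) i a else 0)" for i
        by (intro sum.cong refl) auto
      moreover have "(\<Sum>b<m. \<xi> (x i j) $$ (a, b) * (if j = b then 1 else 0)) = (\<Sum>b<m. if j = b then \<xi> (x i j) $$ (a, b) else 0)" for i j a
        by (intro sum.cong refl) auto
      ultimately show ?thesis unfolding mform_def S_def mat_act_def by simp
    qed
    finally show ?thesis .
  qed
  \<comment> \<open>A pair of functionals F, G is sought on matrices in the first and second
    component. The values encode three demands: F is 1 + \<delta> times the trace on scalars, G is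
    \<delta> times the trace on scalars, and F - G composed with \<phi> is the real part of
    S.\<close>
  define W where "W = {((\<lambda>i j. \<phi> (x i j) + scal \<alpha> i j, \<lambda>i j. scal \<beta> i j - \<phi> (x i j)),
      Re (S x + of_real (1 + \<delta>) * tr \<alpha> + of_real \<delta> * tr \<beta>)) | x \<alpha> \<beta>. \<forall>i j. x i j \<in> E}"
  have WI: "((p, q), t) \<in> W" if "\<And>i j. x i j \<in> E" "p = (\<lambda>i j. \<phi> (x i j) + scal \<alpha> i j)" "q = (\<lambda>i j. scal \<beta> i j - \<phi> (x i j))"
    "t = Re (S x + of_real (1 + \<delta>) * tr \<alpha> + of_real \<delta> * tr \<beta>)" for p q t x \<alpha> \<beta>
    unfolding W_def using that by blast
  have tradd: "tr (\<lambda>i j. \<alpha> i j + \<beta> i j) = tr \<alpha> + tr \<beta>" for \<alpha> \<beta> by (simp add: tr_def sum.distrib)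
  have trsc: "tr (\<lambda>i j. c * \<alpha> i j) = c * tr \<alpha>" for c \<alpha> by (simp add: tr_def sum_distrib_left)
  have S0: "S (\<lambda>i j. 0) = 0" using Ssc[of "\<lambda>i j. 0" 0] E0 by simp
  have tr0: "tr (\<lambda>i j. 0) = 0" by (simp add: tr_def)
  have scal0: "scal (\<lambda>i j. 0) i j = 0" for i j by (simp add: scal_def)
  define C where "C = {(p :: nat \<Rightarrow> nat \<Rightarrow> 'k \<Rightarrow>\<^sub>L 'k, q :: nat \<Rightarrow> nat \<Rightarrow> 'k \<Rightarrow>\<^sub>L 'k) | p q. rpos m p \<and> rpos m q}"
  have "\<exists>f. linear f \<and> (\<forall>w t. (w, t) \<in> W \<longrightarrow> f w = t) \<and> (\<forall>x\<in>C. 0 \<le> f x)"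
  proof (rule riesz_extension)
    show "subspace W"
    proof (rule subspaceI)
      show "0 \<in> W" unfolding zero_prod_def
        by (rule WI[of "\<lambda>i j. 0" _ "\<lambda>i j. 0" _ "\<lambda>i j. 0"]) (auto simp: E0 \<phi>0 scal0 S0 tr0 zero_fun_def)
      fix u v assume "u \<in> W" "v \<in> W"
      then obtain x \<alpha> \<beta> y \<alpha>' \<beta>' where
        u: "u = ((\<lambda>i j. \<phi> (x i j) + scal \<alpha> i j, \<lambda>i j. scal \<beta> i j - \<phi> (x i j)), Re (S x + of_real (1 + \<delta>) * tr \<alpha> + of_real \<delta> * tr \<beta>))"
          "\<forall>i j. x i j \<in> E"
        and v: "v = ((\<lambda>i j. \<phi> (y i j) + scal \<alpha>' i j, \<lambda>i j. scal \<beta>' i j - \<phi> (y i j)), Re (S y + of_real (1 + \<delta>) * tr \<alpha>' + of_real \<delta> * tr \<beta>'))"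
          "\<forall>i j. y i j \<in> E"
        unfolding W_def by blast
      show "u + v \<in> W" unfolding u(1) v(1) add_Pair
        by (rule WI[of "\<lambda>i j. x i j + y i j" _ "\<lambda>i j. \<alpha> i j + \<alpha>' i j" _ "\<lambda>i j. \<beta> i j + \<beta>' i j"])
          (use u(2) v(2) in \<open>auto simp: Eadd rucpD(2)[OF \<phi>] Sadd tradd plus_fun_def scal_add[symmetric] algebra_simps\<close>)
    next
      fix r u assume "u \<in> W"
      then obtain x \<alpha> \<beta> where
        u: "u = ((\<lambda>i j. \<phi> (x i j) + scal \<alpha> i j, \<lambda>i j. scal \<beta> i j - \<phi> (x i j)), Re (S x + of_real (1 + \<delta>) * tr \<alpha> + of_real \<delta> * tr \<beta>))"
          "\<forall>i j. x i j \<in> E"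
        unfolding W_def by blast
      have "S (\<lambda>i j. r *\<^sub>R x i j) = of_real r * S x" unfolding op_scaleR_scaleC using u(2) by (intro Ssc) auto
      then show "r *\<^sub>R u \<in> W" unfolding u(1) scaleR_Pair
        by (intro WI[of "\<lambda>i j. r *\<^sub>R x i j" _ "\<lambda>i j. of_real r * \<alpha> i j" _ "\<lambda>i j. of_real r * \<beta> i j"])
          (use u(2) in \<open>auto simp: EscR rucp_scaleR[OF \<phi>] trsc scaleR_fun_def scal_scaleR[symmetric] algebra_simps\<close>)
    qed
    show "u + v \<in> C" if "u \<in> C" "v \<in> C" for u v
      using that unfolding C_def by (auto simp: plus_fun_def intro: rpos_add)
    show "r *\<^sub>R u \<in> C" if "0 \<le> r" "u \<in> C" for r u
      using that unfolding C_def by (auto simp: scaleR_fun_def intro: rpos_scaleR)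
    show "0 \<le> t" if wt: "(w, t) \<in> W" "w \<in> C" for w t
    proof -
      obtain x \<alpha> \<beta> where x: "\<forall>i j. x i j \<in> E" and w: "w = (\<lambda>i j. \<phi> (x i j) + scal \<alpha> i j, \<lambda>i j. scal \<beta> i j - \<phi> (x i j))"
        and t: "t = Re (S x + of_real (1 + \<delta>) * tr \<alpha> + of_real \<delta> * tr \<beta>)"
        using wt(1) unfolding W_def by blast
      \<comment> \<open>With y = x + \<alpha> the two positivity assumptions say that \<phi> y lies
        between 0 and \<alpha> + \<beta>. So \<open>P\<close> applies, and S of its conclusion is
        exactly the prescribed value.\<close>
      define y where "y i j = x i j + scal \<alpha> i j" for i j
      have yE: "y i j \<in> E" for i j unfolding y_def using x Escal by (intro Eadd) auto
      have \<phi>y: "\<phi> (y i j) = \<phi> (x i j) + scal \<alpha> i j" for i j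
        unfolding y_def using x Escal by (simp add: rucpD(2)[OF \<phi>] \<phi>scal)
      have "rpos m (\<lambda>i j. y i j + \<delta> *\<^sub>R scal (\<lambda>i j. \<alpha> i j + \<beta> i j) i j)"
      proof (rule P[OF yE])
        show "rpos m (\<lambda>i j. \<phi> (y i j))" using wt(2) unfolding w C_def \<phi>y by blast
        have "rpos m (\<lambda>i j. scal \<beta> i j - \<phi> (x i j))" using wt(2) unfolding w C_def by blast
        then show "rpos m (\<lambda>i j. scal (\<lambda>i j. \<alpha> i j + \<beta> i j) i j - \<phi> (y i j))"
          unfolding \<phi>y scal_add[symmetric] by (simp add: algebra_simps)
      qed
      then have "0 \<le> Re (S (\<lambda>i j. y i j + \<delta> *\<^sub>R scal (\<lambda>i j. \<alpha> i j + \<beta> i j) i j))"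
        using yE Escal by (intro Spos Eadd EscR)
      also have "S (\<lambda>i j. y i j + \<delta> *\<^sub>R scal (\<lambda>i j. \<alpha> i j + \<beta> i j) i j) = S x + tr \<alpha> + of_real \<delta> * (tr \<alpha> + tr \<beta>)"
      proof -
        have "S (\<lambda>i j. y i j + \<delta> *\<^sub>R scal (\<lambda>i j. \<alpha> i j + \<beta> i j) i j)
            = S y + S (\<lambda>i j. \<delta> *\<^sub>R scal (\<lambda>i j. \<alpha> i j + \<beta> i j) i j)"
          using yE Escal by (intro Sadd EscR)
        also have "S y = S x + S (scal \<alpha>)" unfolding y_def using x Escal by (intro Sadd) auto
        also have "S (\<lambda>i j. \<delta> *\<^sub>R scal (\<lambda>i j. \<alpha> i j + \<beta> i j) i j) = of_real \<delta> * S (scal (\<lambda>i j. \<alpha> i j + \<beta> i j))"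
          unfolding op_scaleR_scaleC using Escal by (intro Ssc)
        finally show ?thesis unfolding Sscal tradd .
      qed
      finally show "0 \<le> t" unfolding t by (simp add: algebra_simps)
    qed
    \<comment> \<open>Pairs of multiples of the unit dominate everything and belong to the domain
      with x = 0.\<close>
    show "\<exists>w t. (w, t) \<in> W \<and> w - v \<in> C" for v
    proof -
      obtain p q where v: "v = (p, q)" by (cases v)
      obtain K L where K: "rbnd m p K" and L: "rbnd m q L" using rbnd_ex by metis
      have "((scal (\<lambda>i j. if i = j then of_real K else 0), scal (\<lambda>i j. if i = j then of_real L else 0)),
        Re (of_real (1 + \<delta>) * tr (\<lambda>i j. if i = j then of_real K else 0) + of_real \<delta> * tr (\<lambda>i j. if i = j then of_real L else 0))) \<in> W"
        by (rule WI[of "\<lambda>i j. 0"]) (auto simp: E0 \<phi>0 S0)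
      moreover have "(scal (\<lambda>i j. if i = j then of_real K else 0), scal (\<lambda>i j. if i = j then of_real L else 0)) - v \<in> C"
        using rpos_unit_diff[OF K] rpos_unit_diff[OF L] unfolding v C_def by (simp add: fun_diff_def)
      ultimately show ?thesis by blast
    qed
  qed
  then obtain f where f: "linear f" "\<And>w t. (w, t) \<in> W \<Longrightarrow> f w = t" "\<And>u. u \<in> C \<Longrightarrow> 0 \<le> f u" by blast
  define F where "F p = f (p, 0)" for p
  define G where "G q = f (0, q)" for q
  have lin: "linear F" "linear G" unfolding F_def G_def using linear_pair_split(1,2)[OF f(1)] by auto
  have rp0: "rpos m 0" by (simp add: rpos_def rform_def zero_fun_def)
  have Fpos: "0 \<le> F p" if "rpos m p" for p unfolding F_def using that rp0 by (intro f(3)) (simp add: C_def)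
  have Gpos: "0 \<le> G p" if "rpos m p" for p unfolding G_def using that rp0 by (intro f(3)) (simp add: C_def)
  have Funit: "F (scal \<alpha>) = (1 + \<delta>) * Re (\<Sum>i<m. \<alpha> i i)" for \<alpha>
  proof -
    have "((scal \<alpha>, 0), Re (of_real (1 + \<delta>) * tr \<alpha>)) \<in> W"
      by (rule WI[of "\<lambda>i j. 0" _ \<alpha> _ "\<lambda>i j. 0"]) (auto simp: E0 \<phi>0 S0 tr0 scal0 zero_fun_def)
    then show ?thesis unfolding F_def by (subst f(2)) (auto simp: tr_def)
  qed
  have Gunit: "G (scal \<beta>) = \<delta> * Re (\<Sum>i<m. \<beta> i i)" for \<beta>
  proof -
    have "((0, scal \<beta>), Re (of_real \<delta> * tr \<beta>)) \<in> W"
      by (rule WI[of "\<lambda>i j. 0" _ "\<lambda>i j. 0" _ \<beta>]) (auto simp: E0 \<phi>0 S0 tr0 scal0 zero_fun_def)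
    then show ?thesis unfolding G_def by (subst f(2)) (auto simp: tr_def)
  qed
  \<comment> \<open>The prescription with \<alpha> = \<beta> = 0 and with x in the single entry (a,
    b); this becomes the matrix identity between \<xi>, \<gamma> and \<gamma>'.\<close>
  have FG: "F (munit a b (\<phi> x)) - G (munit a b (\<phi> x)) = Re (\<xi> x $$ (a, b))" if "x \<in> E" "a < m" "b < m" for x a b
  proof -
    have ux: "\<phi> (munit a b x i j) = munit a b (\<phi> x) i j" for i j by (simp add: munit_def \<phi>0)
    have "((munit a b (\<phi> x), - munit a b (\<phi> x)), Re (S (munit a b x))) \<in> W"
      by (rule WI[of "munit a b x" _ "\<lambda>i j. 0" _ "\<lambda>i j. 0"]) (use that(1) in \<open>auto simp: ux munit_def E0 tr0 scal0 fun_Compl_def \<phi>0 fun_eq_iff\<close>)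
    then have "f (munit a b (\<phi> x), - munit a b (\<phi> x)) = Re (S (munit a b x))" by (rule f(2))
    moreover have "f (munit a b (\<phi> x), - munit a b (\<phi> x)) = F (munit a b (\<phi> x)) - G (munit a b (\<phi> x))"
      unfolding linear_pair_split(3)[OF f(1), of "munit a b (\<phi> x)" "- munit a b (\<phi> x)"] F_def[symmetric] G_def[symmetric]
      using linear_neg[OF lin(2)] by simp
    moreover have "S (munit a b x) = \<xi> x $$ (a, b)"
    proof -
      have \<xi>0: "\<xi> 0 $$ (i, j) = 0" if "i < m" "j < m" for i j
      proof -
        have "\<xi> 0 = 0 *\<^sub>C \<xi> 0" using \<xi>sc[OF E0, of 0] by (simp only: op_space.scale_zero_left)
        then have "\<xi> 0 $$ (i, j) = (0 *\<^sub>C \<xi> 0) $$ (i, j)" by (rule arg_cong)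
        also have "\<dots> = 0" using \<xi>'(2)[OF E0] that by simp
        finally show ?thesis .
      qed
      have "S (munit a b x) = (\<Sum>i<m. \<Sum>j<m. if i = a then (if j = b then \<xi> x $$ (a, b) else 0) else 0)"
        unfolding S_def by (intro sum.cong refl) (auto simp: munit_def \<xi>0)
      also have "\<dots> = (\<Sum>i<m. if i = a then \<xi> x $$ (a, b) else 0)"
        using that by (intro sum.cong refl) auto
      finally show ?thesis using that by simp
    qed
    ultimately show ?thesis by simp
  qed
  define \<gamma> where "\<gamma> T = mat m m (\<lambda>(a, b). (of_real (F (munit a b T)) - \<i> * of_real (F (munit a b (\<i> *\<^sub>C T)))) / of_real (1 + \<delta>))" for T
  \<comment> \<open>For \<delta> = 0 one cannot normalise G; its coefficient in the identity is 0,
    so \<gamma> stands in as a ucp map.\<close>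
  define \<gamma>' where "\<gamma>' = (if \<delta> = 0 then \<gamma> else (\<lambda>T. mat m m (\<lambda>(a, b). (of_real (G (munit a b T)) - \<i> * of_real (G (munit a b (\<i> *\<^sub>C T)))) / of_real \<delta>)))"
  have u: "ucp (op_sys {T :: 'k \<Rightarrow>\<^sub>L 'k. clinear_op T}) (mat_sys m) \<gamma>"
    unfolding \<gamma>_def using \<delta> by (intro functional_to_ucp[OF lin(1) Fpos m _ Funit]) auto
  have u': "ucp (op_sys {T :: 'k \<Rightarrow>\<^sub>L 'k. clinear_op T}) (mat_sys m) \<gamma>'"
  proof (cases "\<delta> = 0")
    case False
    then show ?thesis unfolding \<gamma>'_def if_not_P[OF False] using \<delta> by (intro functional_to_ucp[OF lin(2) Gpos m _ Gunit]) auto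
  qed (use u in \<open>simp add: \<gamma>'_def\<close>)
  \<comment> \<open>With \<delta> = 0 the positive functional G vanishes on scalars. Every matrix
    lies below a multiple of the unit, so G is nonpositive everywhere and hence 0.\<close>
  have G0: "G q = 0" if "\<delta> = 0" for q
  proof -
    have le: "G q \<le> 0" for q
    proof -
      obtain K where K: "rbnd m q K" using rbnd_ex by blast
      have "0 \<le> G (scal (\<lambda>i j. if i = j then of_real K else 0) - q)"
        using rpos_unit_diff[OF K] by (intro Gpos) (simp add: fun_diff_def)
      then show ?thesis using Gunit[of "\<lambda>i j. if i = j then of_real K else 0"] that by (simp add: linear_diff[OF lin(2)])
    qed
    show ?thesis using le[of q] le[of "- q"] by (simp add: linear_neg[OF lin(2)])
  qed
  have "\<xi> x + of_real \<delta> *\<^sub>C \<gamma>' (\<phi> x) = of_real (1 + \<delta>) *\<^sub>C \<gamma> (\<phi> x)" if x: "x \<in> E" for x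
  proof (rule eq_matI)
    have c: "\<gamma> T \<in> carrier_mat m m" "\<gamma>' T \<in> carrier_mat m m" for T unfolding \<gamma>_def \<gamma>'_def by auto
    fix a b assume "a < dim_row (of_real (1 + \<delta>) *\<^sub>C \<gamma> (\<phi> x))" "b < dim_col (of_real (1 + \<delta>) *\<^sub>C \<gamma> (\<phi> x))"
    then have ab: "a < m" "b < m" using c(1)[of "\<phi> x"] by auto
    have ix: "\<i> *\<^sub>C \<phi> x = \<phi> (\<i> *\<^sub>C x)" by (simp add: rucpD(3)[OF \<phi> x])
    have dg: "of_real \<delta> * \<gamma>' (\<phi> x) $$ (a, b) = of_real (G (munit a b (\<phi> x))) - \<i> * of_real (G (munit a b (\<i> *\<^sub>C \<phi> x)))"
      using ab G0 by (cases "\<delta> = 0") (simp_all add: \<gamma>'_def)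
    have g: "of_real (1 + \<delta>) * \<gamma> (\<phi> x) $$ (a, b) = of_real (F (munit a b (\<phi> x))) - \<i> * of_real (F (munit a b (\<i> *\<^sub>C \<phi> x)))"
    proof -
      have "complex_of_real (1 + \<delta>) \<noteq> 0" using \<delta> by (simp only: of_real_eq_0_iff)
      then show ?thesis using ab by (simp add: \<gamma>_def del: of_real_add)
    qed
    have 1: "F (munit a b (\<phi> x)) = G (munit a b (\<phi> x)) + Re (\<xi> x $$ (a, b))" using FG[OF x ab] by simp
    have "\<xi> (\<i> *\<^sub>C x) $$ (a, b) = \<i> * \<xi> x $$ (a, b)" unfolding \<xi>sc[OF x] using \<xi>'(2)[OF x] ab by simp
    then have 2: "F (munit a b (\<i> *\<^sub>C \<phi> x)) = G (munit a b (\<i> *\<^sub>C \<phi> x)) - Im (\<xi> x $$ (a, b))"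
      using FG[OF Esc[OF x, of \<i>] ab] unfolding ix by simp
    have "(\<xi> x + of_real \<delta> *\<^sub>C \<gamma>' (\<phi> x)) $$ (a, b) = \<xi> x $$ (a, b) + of_real \<delta> * \<gamma>' (\<phi> x) $$ (a, b)"
      using ab c[of "\<phi> x"] \<xi>'(2)[OF x] by simp
    also have "\<dots> = of_real (1 + \<delta>) * \<gamma> (\<phi> x) $$ (a, b)"
      unfolding dg g 1 2 by (simp add: complex_eq_iff)
    also have "\<dots> = (of_real (1 + \<delta>) *\<^sub>C \<gamma> (\<phi> x)) $$ (a, b)" using ab c[of "\<phi> x"] by simp
    finally show "(\<xi> x + of_real \<delta> *\<^sub>C \<gamma>' (\<phi> x)) $$ (a, b) = (of_real (1 + \<delta>) *\<^sub>C \<gamma> (\<phi> x)) $$ (a, b)" .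
  qed (use \<xi>'(2)[OF x] in \<open>auto simp: \<gamma>_def \<gamma>'_def\<close>)
  then show ?thesis using u u' by blast
qed

lemma ucp_mono: "ucp (op_sys E) T \<phi> \<Longrightarrow> E' \<subseteq> E \<Longrightarrow> ucp (op_sys E') T \<phi>"
  unfolding ucp_def linear_map_def matrices_over_def by (auto simp: op_sys_def subset_iff)

lemma ucp_range: "ucp (op_sys E) (op_sys F) \<phi> \<Longrightarrow> \<phi> ` E \<subseteq> F' \<Longrightarrow> ucp (op_sys E) (op_sys F') \<phi>"
  unfolding ucp_def linear_map_def by (auto simp: op_sys_def)

lemma arveson:
  fixes E :: "('h::chilbert_space \<Rightarrow>\<^sub>L 'h) set"
  assumes E: "osys E" and \<xi>: "ucp (op_sys E) (mat_sys m) \<xi>" and m: "0 < m"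
  shows "\<exists>\<gamma>. ucp (op_sys {T :: 'h \<Rightarrow>\<^sub>L 'h. clinear_op T}) (mat_sys m) \<gamma> \<and> (\<forall>x\<in>E. \<gamma> x = \<xi> x)"
proof -
  have "rucp E (\<lambda>x. x)" unfolding rucp_def using osysD[OF E] by simp
  from ucp_pair_extension[OF E this \<xi> m order_refl]
  obtain \<gamma> \<gamma>' where g: "ucp (op_sys {T :: 'h \<Rightarrow>\<^sub>L 'h. clinear_op T}) (mat_sys m) \<gamma>"
    "ucp (op_sys {T :: 'h \<Rightarrow>\<^sub>L 'h. clinear_op T}) (mat_sys m) \<gamma>'"
    "\<forall>x\<in>E. \<xi> x + of_real 0 *\<^sub>C \<gamma>' x = of_real (1 + 0) *\<^sub>C \<gamma> x" by auto
  have "\<gamma> x = \<xi> x" if x: "x \<in> E" for x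
  proof (rule eq_matI)
    have "\<gamma> x \<in> carrier_mat m m" "\<gamma>' x \<in> carrier_mat m m"
      using g(1,2) osysD(1)[OF E x] by (auto simp: ucp_def linear_map_def op_sys_def mat_sys_def)
    moreover have c: "\<xi> x \<in> carrier_mat m m" using \<xi> x by (auto simp: ucp_def linear_map_def op_sys_def mat_sys_def)
    ultimately show "dim_row (\<gamma> x) = dim_row (\<xi> x)" "dim_col (\<gamma> x) = dim_col (\<xi> x)" by auto
    fix a b assume "a < dim_row (\<xi> x)" "b < dim_col (\<xi> x)"
    then show "\<gamma> x $$ (a, b) = \<xi> x $$ (a, b)"
      using arg_cong[OF bspec[OF g(3) x], of "\<lambda>M. M $$ (a, b)"] c \<open>\<gamma> x \<in> _\<close> \<open>\<gamma>' x \<in> _\<close> by simp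
  qed
  then show ?thesis using g(1) by blast
qed

section \<open>Matrix norms and 1-exactness\<close>

lemma L2_set_nsq: "L2_set (\<lambda>j. norm (h j)) {..<k} = sqrt (nsq k h)"
  by (simp add: L2_set_def nsq_def)

lemma rform_cauchy_schwarz:
  "rform k x h g \<le> sqrt (nsq k (\<lambda>i. \<Sum>j<k. blinfun_apply (x i j) (h j))) * sqrt (nsq k g)"
proof -
  let ?u = "\<lambda>i. \<Sum>j<k. blinfun_apply (x i j) (h j)"
  have "rform k x h g = (\<Sum>i<k. inner (?u i) (g i))"
    by (simp add: rform_def inner_sum_left)
  also have "\<dots> \<le> (\<Sum>i<k. \<bar>norm (?u i)\<bar> * \<bar>norm (g i)\<bar>)"
    by (intro sum_mono) (simp add: norm_cauchy_schwarz)
  also have "\<dots> \<le> L2_set (\<lambda>i. norm (?u i)) {..<k} * L2_set (\<lambda>i. norm (g i)) {..<k}"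
    by (rule L2_set_mult_ineq)
  finally show ?thesis unfolding L2_set_nsq .
qed

lemma rbnd_vec:
  assumes "rbnd k x c" "0 \<le> c"
  shows "sqrt (nsq k (\<lambda>i. \<Sum>j<k. blinfun_apply (x i j) (h j))) \<le> c * sqrt (nsq k h)"
proof -
  let ?u = "\<lambda>i. \<Sum>j<k. blinfun_apply (x i j) (h j)"
  have "rform k x h ?u = nsq k ?u" by (simp add: rform_def nsq_inner inner_sum_left)
  then have "sqrt (nsq k ?u) * sqrt (nsq k ?u) \<le> c * sqrt (nsq k h) * sqrt (nsq k ?u)"
    using rform_bound[OF assms, of h ?u] by (simp add: mult.assoc)
  then show ?thesis
  proof (cases "sqrt (nsq k ?u) = 0")
    case False
    then have "0 < sqrt (nsq k ?u)" using nsq_nonneg[of k ?u] by (metis less_eq_real_def real_sqrt_ge_zero)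
    with \<open>sqrt (nsq k ?u) * sqrt (nsq k ?u) \<le> c * sqrt (nsq k h) * sqrt (nsq k ?u)\<close> show ?thesis
      by (rule mult_right_le_imp_le)
  qed (use assms(2) in simp)
qed

lemma op_mnorm_le_iff:
  fixes x :: "nat \<Rightarrow> nat \<Rightarrow> 'h::chilbert_space \<Rightarrow>\<^sub>L 'h"
  assumes c: "0 \<le> c" shows "op_mnorm k x \<le> c \<longleftrightarrow> rbnd k x c"
proof
  let ?u = "\<lambda>(h :: nat \<Rightarrow> 'h) i. \<Sum>j<k. blinfun_apply (x i j) (h j)"
  have mn: "op_mnorm k x = (SUP h \<in> {h. sqrt (nsq k h) \<le> 1}. sqrt (nsq k (?u h)))"
    unfolding op_mnorm_def L2_set_nsq ..
  show "op_mnorm k x \<le> c" if b: "rbnd k x c"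
    unfolding mn
  proof (rule cSUP_least)
    have "nsq k (\<lambda>_. 0) \<le> 1" by (simp add: nsq_def)
    then show "{h. sqrt (nsq k h) \<le> 1} \<noteq> {}" using real_sqrt_le_1_iff by blast
    fix h :: "nat \<Rightarrow> 'h" assume "h \<in> {h. sqrt (nsq k h) \<le> 1}"
    then have "c * sqrt (nsq k h) \<le> c" using c by (auto intro: mult_left_le)
    then show "sqrt (nsq k (?u h)) \<le> c" using rbnd_vec[OF b c, of h] by linarith
  qed
  assume L: "op_mnorm k x \<le> c"
  obtain d where d: "0 \<le> d" "rbnd k x d" using rbnd_ex by blast
  \<comment> \<open>A real supremum is informative for bounded sets only; the crude constant d
    secures this.\<close>
  have bdd: "bdd_above ((\<lambda>h. sqrt (nsq k (?u h))) ` {h. sqrt (nsq k h) \<le> 1})"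
  proof (rule bdd_aboveI2)
    fix h :: "nat \<Rightarrow> 'h" assume "h \<in> {h. sqrt (nsq k h) \<le> 1}"
    then have "d * sqrt (nsq k h) \<le> d" using d by (auto intro: mult_left_le)
    then show "sqrt (nsq k (?u h)) \<le> d" using rbnd_vec[OF d(2,1), of h] by linarith
  qed
  have 1: "sqrt (nsq k (?u h)) \<le> c" if "sqrt (nsq k h) \<le> 1" for h
    using cSUP_upper[OF _ bdd, of h] that L unfolding mn by auto
  show "rbnd k x c"
  proof (rule rbndI[OF _ c])
    fix h g :: "nat \<Rightarrow> 'h"
    have "sqrt (nsq k (?u h)) \<le> c * sqrt (nsq k h)"
    proof (cases "nsq k h = 0")
      case True
      have "d * sqrt (nsq k h) = 0" using True by simp
      then have "sqrt (nsq k (?u h)) \<le> 0" using rbnd_vec[OF d(2,1), of h] by linarith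
      then show ?thesis using True by simp
    next
      case False
      then have "0 < nsq k h" using nsq_nonneg[of k h] by linarith
      then have s: "0 < sqrt (nsq k h)" by simp
      let ?s = "sqrt (nsq k h)"
      have "nsq k (\<lambda>i. (1 / ?s) *\<^sub>R h i) = 1" unfolding nsq_scale using s by (simp add: power_divide)
      then have "sqrt (nsq k (?u (\<lambda>i. (1 / ?s) *\<^sub>R h i))) \<le> c" by (intro 1) simp
      also have "?u (\<lambda>i. (1 / ?s) *\<^sub>R h i) = (\<lambda>i. (1 / ?s) *\<^sub>R ?u h i)"
        by (simp add: blinfun.scaleR_right scaleR_sum_right)
      also have "sqrt (nsq k \<dots>) = (1 / ?s) * sqrt (nsq k (?u h))"
        unfolding nsq_scale real_sqrt_mult using s by simp
      finally show ?thesis using s by (simp add: field_simps)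
    qed
    then have "sqrt (nsq k (?u h)) * sqrt (nsq k g) \<le> c * sqrt (nsq k h) * sqrt (nsq k g)"
      by (rule mult_right_mono) simp
    then show "rform k x h g \<le> c * (sqrt (nsq k h) * sqrt (nsq k g))"
      using rform_cauchy_schwarz[of k x h g] by (simp add: mult.assoc)
  qed
qed

lemma vec_norm_msq: "vec_norm n k v = sqrt (msq n k v)"
  unfolding vec_norm_def msq_def L2_set_def sum.cartesian_product by (simp add: case_prod_unfold)

lemma msq_nonneg [simp]: "0 \<le> msq n k v"
  unfolding msq_def by (intro sum_nonneg) auto

lemma mat_act_scale: "mat_act n k A (\<lambda>j b. c * v j b) = (\<lambda>i a. c * mat_act n k A v i a)"
  by (simp add: mat_act_def sum_distrib_left mult.left_commute fun_eq_iff)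

lemma msq_scale: "msq n k (\<lambda>j b. c * v j b) = (cmod c)\<^sup>2 * msq n k v"
  by (simp add: msq_def norm_mult power_mult_distrib sum_distrib_left)

lemma mform_le_norms: "Re (mform n k A v w) \<le> vec_norm n k (mat_act n k A v) * vec_norm n k w"
proof -
  let ?u = "mat_act n k A v"
  have "Re (mform n k A v w) = (\<Sum>(i, a) \<in> {..<k} \<times> {..<n}. Re (?u i a * cnj (w i a)))"
    unfolding mform_def sum.cartesian_product Re_sum
    by (intro sum.cong refl) (auto simp: case_prod_unfold simp del: times_complex.sel)
  also have "\<dots> \<le> (\<Sum>p \<in> {..<k} \<times> {..<n}. \<bar>case p of (i, a) \<Rightarrow> cmod (?u i a)\<bar> * \<bar>case p of (i, a) \<Rightarrow> cmod (w i a)\<bar>)"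
  proof (rule sum_mono)
    fix p :: "nat \<times> nat"
    show "(case p of (i, a) \<Rightarrow> Re (?u i a * cnj (w i a))) \<le> \<bar>case p of (i, a) \<Rightarrow> cmod (?u i a)\<bar> * \<bar>case p of (i, a) \<Rightarrow> cmod (w i a)\<bar>"
      using complex_Re_le_cmod[of "?u (fst p) (snd p) * cnj (w (fst p) (snd p))"]
      by (simp add: case_prod_unfold norm_mult del: times_complex.sel)
  qed
  also have "\<dots> \<le> vec_norm n k ?u * vec_norm n k w"
    unfolding vec_norm_def by (rule L2_set_mult_ineq)
  finally show ?thesis .
qed

lemma mbd_vec:
  assumes "mbd n k A c" "0 \<le> c" "msq n k v \<le> 1"
  shows "vec_norm n k (mat_act n k A v) \<le> c"
proof (rule ccontr)
  let ?u = "mat_act n k A v"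
  assume "\<not> vec_norm n k ?u \<le> c"
  then have s: "c < sqrt (msq n k ?u)" by (simp add: vec_norm_msq)
  let ?s = "sqrt (msq n k ?u)"
  have s0: "0 < ?s" using s assms(2) by linarith
  have "mform n k A v (\<lambda>i a. of_real (1 / ?s) * ?u i a) = of_real (1 / ?s) * (\<Sum>i<k. \<Sum>a<n. ?u i a * cnj (?u i a))"
    by (simp add: mform_def sum_distrib_left mult.left_commute)
  then have "Re (mform n k A v (\<lambda>i a. of_real (1 / ?s) * ?u i a)) = 1 / ?s * msq n k ?u"
    by (simp only: Re_of_real_mult Re_sum Re_mult_cnj msq_def)
  also have "\<dots> = ?s" using s0 by (simp add: real_div_sqrt)
  finally have "2 * ?s \<le> c * (msq n k v + msq n k (\<lambda>i a. of_real (1 / ?s) * ?u i a))"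
    using assms(1) unfolding mbd_def by metis
  also have "msq n k (\<lambda>i a. of_real (1 / ?s) * ?u i a) = 1"
    unfolding msq_scale using s0 by (simp add: norm_divide power_divide)
  also have "c * (msq n k v + 1) \<le> c * 2" using assms(2,3) by (intro mult_left_mono) auto
  finally show False using s by simp
qed

text \<open>The counterpart of \<open>op_mnorm_le_iff\<close>. That the supremum is finite is
  borrowed from \<open>rbnd_ex\<close> through \<open>emb\<close>.\<close>

lemma mat_mnorm_le_iff:
  assumes c: "0 \<le> c" and n: "0 < n" and A: "\<And>i j. i < k \<Longrightarrow> j < k \<Longrightarrow> A i j \<in> carrier_mat n n"
  shows "mat_mnorm n k A \<le> c \<longleftrightarrow> mbd n k A c"
proof
  have one: "sqrt (msq n k v) \<le> 1 \<longleftrightarrow> msq n k v \<le> 1" for v by simp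
  have mn: "mat_mnorm n k A = (SUP v \<in> {v. msq n k v \<le> 1}. vec_norm n k (mat_act n k A v))"
    unfolding mat_mnorm_def by (simp only: vec_norm_msq one)
  show "mat_mnorm n k A \<le> c" if b: "mbd n k A c"
    unfolding mn
  proof (rule cSUP_least)
    have "msq n k (\<lambda>_ _. 0) \<le> 1" by (simp add: msq_def)
    then show "{v. msq n k v \<le> 1} \<noteq> {}" by blast
  qed (use mbd_vec[OF b c] in auto)
  assume L: "mat_mnorm n k A \<le> c"
  obtain d where d: "0 \<le> d" "rbnd k (\<lambda>i j. emb n (A i j)) d" using rbnd_ex by blast
  have "rbnd k (\<lambda>i j. emb n (A i j)) d \<longleftrightarrow> mbd n k A d" by (rule rbnd_emb[OF n]) (rule A)
  then have d2: "mbd n k A d" using d(2) by simp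
  have bdd: "bdd_above ((\<lambda>v. vec_norm n k (mat_act n k A v)) ` {v. msq n k v \<le> 1})"
    by (rule bdd_aboveI2[of _ _ d]) (use mbd_vec[OF d2 d(1)] in auto)
  have 1: "vec_norm n k (mat_act n k A v) \<le> c" if "msq n k v \<le> 1" for v
    using cSUP_upper[OF _ bdd, of v] that L unfolding mn by auto
  show "mbd n k A c" unfolding mbd_def
  proof (intro allI)
    fix v w
    have "vec_norm n k (mat_act n k A v) \<le> c * sqrt (msq n k v)"
    proof (cases "msq n k v = 0")
      case True
      \<comment> \<open>All multiples of such a v lie in the unit ball, so its image is smaller than
        any e.\<close>
      have "vec_norm n k (mat_act n k A v) \<le> e" if "e > 0" for e
      proof -
        have "msq n k (\<lambda>j b. of_real (c / e) * v j b) \<le> 1" unfolding msq_scale True by simp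
        then have "vec_norm n k (mat_act n k A (\<lambda>j b. of_real (c / e) * v j b)) \<le> c" by (rule 1)
        moreover have "msq n k (\<lambda>j b. of_real (d / e) * v j b) \<le> 1" unfolding msq_scale True by simp
        then have "vec_norm n k (mat_act n k A (\<lambda>j b. of_real (d / e) * v j b)) \<le> d" by (rule mbd_vec[OF d2 d(1)])
        then have "\<bar>d / e\<bar> * vec_norm n k (mat_act n k A v) \<le> d"
          unfolding mat_act_scale vec_norm_msq msq_scale real_sqrt_mult by (simp add: norm_divide)
        moreover have "vec_norm n k (mat_act n k A v) \<le> d" using True by (intro mbd_vec[OF d2 d(1)]) simp
        ultimately show ?thesis using that d(1) by (cases "d = 0") (auto simp: field_simps)
      qed
      then show ?thesis using True by (simp add: field_le_epsilon)
    next
      case False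
      then have "0 < msq n k v" using msq_nonneg[of n k v] by linarith
      then have s: "0 < sqrt (msq n k v)" by simp
      let ?s = "sqrt (msq n k v)"
      have "msq n k (\<lambda>j b. of_real (1 / ?s) * v j b) = 1" unfolding msq_scale using s by (simp add: norm_divide power_divide)
      then have "vec_norm n k (mat_act n k A (\<lambda>j b. of_real (1 / ?s) * v j b)) \<le> c" by (intro 1) simp
      then have "(1 / ?s) * vec_norm n k (mat_act n k A v) \<le> c"
        unfolding mat_act_scale vec_norm_msq msq_scale real_sqrt_mult using s by (simp add: norm_divide)
      then show ?thesis using s by (simp add: field_simps)
    qed
    then have "vec_norm n k (mat_act n k A v) * sqrt (msq n k w) \<le> c * sqrt (msq n k v) * sqrt (msq n k w)"
      by (rule mult_right_mono) simp
    then have "2 * Re (mform n k A v w) \<le> c * (2 * sqrt (msq n k v) * sqrt (msq n k w))"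
      using mform_le_norms[of n k A v w] by (simp add: vec_norm_msq[of n k w] mult_ac)
    also have "\<dots> \<le> c * (msq n k v + msq n k w)"
      using sum_squares_bound[of "sqrt (msq n k v)" "sqrt (msq n k w)"] by (intro mult_left_mono c) simp
    finally show "2 * Re (mform n k A v w) \<le> c * (msq n k v + msq n k w)" .
  qed
qed

text \<open>The inverse of \<phi> has completely bounded norm at most K. Letting c vary makes the
  condition homogeneous and includes injectivity, as the case c = 0, without naming the
  inverse.\<close>

definition expands :: "('h::chilbert_space \<Rightarrow>\<^sub>L 'h) set \<Rightarrow> (('h \<Rightarrow>\<^sub>L 'h) \<Rightarrow> ('k::chilbert_space \<Rightarrow>\<^sub>L 'k)) \<Rightarrow> real \<Rightarrow> bool" where
  "expands E \<phi> K \<longleftrightarrow> (\<forall>k x c. (\<forall>i<k. \<forall>j<k. x i j \<in> E) \<longrightarrow> 0 \<le> c \<longrightarrow> rbnd k (\<lambda>i j. \<phi> (x i j)) c \<longrightarrow> rbnd k x (K * c))"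

lemma expandsD: "expands E \<phi> K \<Longrightarrow> (\<And>i j. i < k \<Longrightarrow> j < k \<Longrightarrow> x i j \<in> E) \<Longrightarrow> 0 \<le> c \<Longrightarrow> rbnd k (\<lambda>i j. \<phi> (x i j)) c \<Longrightarrow> rbnd k x (K * c)"
  unfolding expands_def by blast

lemma rbnd_limit:
  assumes "\<And>e. 0 < e \<Longrightarrow> rbnd k x (c + e)" shows "rbnd k x c"
  unfolding rbnd_def
proof (intro allI)
  fix h g
  show "2 * rform k x h g \<le> c * (nsq k h + nsq k g)"
  proof (rule field_le_epsilon)
    fix e :: real assume e: "0 < e"
    let ?N = "nsq k h + nsq k g"
    have N: "0 \<le> ?N" by simp
    have "2 * rform k x h g \<le> (c + e / (?N + 1)) * ?N"
      using assms[of "e / (?N + 1)"] e N unfolding rbnd_def by auto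
    also have "\<dots> = c * ?N + e * (?N / (?N + 1))" by (simp add: field_simps)
    also have "?N / (?N + 1) \<le> 1" using N by (subst divide_le_eq_1_pos) linarith+
    then have "c * ?N + e * (?N / (?N + 1)) \<le> c * ?N + e" using e by (intro add_left_mono mult_left_le) auto
    finally show "2 * rform k x h g \<le> c * ?N + e" .
  qed
qed

lemma rbnd_zero: "rbnd k (\<lambda>i j. 0) 0"
  by (simp add: rbnd_def rform_def)

lemma one_exact_fd_iff:
  assumes E: "osys E"
  shows "one_exact_fd E \<longleftrightarrow> (\<forall>\<epsilon>>0. \<exists>n>0. \<exists>\<phi>. ucp (op_sys E) (mat_sys n) \<phi> \<and> expands E (\<lambda>x. emb n (\<phi> x)) (1 + \<epsilon>))"
proof -
  note E' = osysD[OF E]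
  have "(inj_on \<phi> E \<and> cb_norm (subsystem (mat_sys n) (\<phi> ` E)) (op_sys E) (inv_into E \<phi>) \<le> ennreal (1 + \<epsilon>))
      \<longleftrightarrow> expands E (\<lambda>x. emb n (\<phi> x)) (1 + \<epsilon>)"
    if n: "0 < n" and \<epsilon>: "0 < \<epsilon>" and \<phi>: "ucp (op_sys E) (mat_sys n) \<phi>" for n \<epsilon> and \<phi> :: "('a \<Rightarrow>\<^sub>L 'a) \<Rightarrow> complex mat"
  proof -
    have r: "rucp E (\<lambda>x. emb n (\<phi> x))" and car: "\<And>x. x \<in> E \<Longrightarrow> \<phi> x \<in> carrier_mat n n"
      using ucp_mat_rucp[OF n \<phi> E] by blast+
    have mb: "rbnd k (\<lambda>i j. emb n (\<phi> (x i j))) c \<longleftrightarrow> mbd n k (\<lambda>i j. \<phi> (x i j)) c" if "\<forall>i<k. \<forall>j<k. x i j \<in> E" for k x c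
      by (rule rbnd_emb[OF n]) (use that car in auto)
    have cb: "cb_norm (subsystem (mat_sys n) (\<phi> ` E)) (op_sys E) (inv_into E \<phi>) \<le> ennreal (1 + \<epsilon>) \<longleftrightarrow>
        (\<forall>k x. (\<forall>i<k. \<forall>j<k. x i j \<in> \<phi> ` E) \<longrightarrow> mat_mnorm n k x \<le> 1 \<longrightarrow> op_mnorm k (\<lambda>i j. inv_into E \<phi> (x i j)) \<le> 1 + \<epsilon>)"
      unfolding cb_norm_def SUP_le_iff using \<epsilon>
      by (auto simp: subsystem_def mat_sys_def op_sys_def matrices_over_def amplify_def ennreal_le_iff simp del: ennreal_plus)
    show ?thesis
    proof (intro iffI conjI)
      assume L: "inj_on \<phi> E \<and> cb_norm (subsystem (mat_sys n) (\<phi> ` E)) (op_sys E) (inv_into E \<phi>) \<le> ennreal (1 + \<epsilon>)"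
      \<comment> \<open>\<open>cb_norm\<close> speaks of the unit ball, so x is scaled to c = 1. The
        case c = 0 is reached afterwards through \<open>rbnd_limit\<close>.\<close>
      have pos: "rbnd k x ((1 + \<epsilon>) * c)" if x: "\<forall>i<k. \<forall>j<k. x i j \<in> E" and c: "0 < c" and b: "rbnd k (\<lambda>i j. emb n (\<phi> (x i j))) c" for k x c
      proof -
        define y where "y i j = (1 / c) *\<^sub>R x i j" for i j
        have y: "\<forall>i<k. \<forall>j<k. y i j \<in> E" unfolding y_def using x subspace_scaleR[OF E'(2)] by auto
        have "rbnd k (\<lambda>i j. (1 / c) *\<^sub>R emb n (\<phi> (x i j))) (\<bar>1 / c\<bar> * c)" by (rule rbnd_scaleR[OF b])
        then have "rbnd k (\<lambda>i j. emb n (\<phi> (y i j))) 1"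
          using c rbnd_cong[of k "\<lambda>i j. emb n (\<phi> (y i j))" "\<lambda>i j. (1 / c) *\<^sub>R emb n (\<phi> (x i j))" 1] x
          unfolding y_def by (simp add: rucp_scaleR[OF r])
        then have "mbd n k (\<lambda>i j. \<phi> (y i j)) 1" using mb[OF y] by simp
        moreover have "mat_mnorm n k (\<lambda>i j. \<phi> (y i j)) \<le> 1 \<longleftrightarrow> mbd n k (\<lambda>i j. \<phi> (y i j)) 1"
          by (rule mat_mnorm_le_iff) (use n y car in auto)
        ultimately have "op_mnorm k (\<lambda>i j. inv_into E \<phi> (\<phi> (y i j))) \<le> 1 + \<epsilon>"
          using L unfolding cb using y by simp
        then have "rbnd k (\<lambda>i j. inv_into E \<phi> (\<phi> (y i j))) (1 + \<epsilon>)" using \<epsilon> by (subst (asm) op_mnorm_le_iff) auto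
        then have "rbnd k y (1 + \<epsilon>)"
          using rbnd_cong[of k "\<lambda>i j. inv_into E \<phi> (\<phi> (y i j))" y] y L by (simp add: inv_into_f_f)
        from rbnd_scaleR[OF this, of c] show ?thesis using c by (simp add: y_def mult.commute)
      qed
      show "expands E (\<lambda>x. emb n (\<phi> x)) (1 + \<epsilon>)"
        unfolding expands_def
      proof (intro allI impI)
        fix k x and c :: real
        assume x: "\<forall>i<k. \<forall>j<k. x i j \<in> E" and c: "0 \<le> c" and b: "rbnd k (\<lambda>i j. emb n (\<phi> (x i j))) c"
        show "rbnd k x ((1 + \<epsilon>) * c)"
        proof (rule rbnd_limit)
          fix e :: real assume e: "0 < e"
          have "rbnd k x ((1 + \<epsilon>) * (c + e / (1 + \<epsilon>)))"
            by (rule pos[OF x _ rbnd_mono[OF b]]) (use c e \<epsilon> in \<open>auto simp: add_nonneg_pos\<close>)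
          then show "rbnd k x ((1 + \<epsilon>) * c + e)" using \<epsilon> by (simp add: distrib_left)
        qed
      qed
    next
      assume R: "expands E (\<lambda>x. emb n (\<phi> x)) (1 + \<epsilon>)"
      show inj: "inj_on \<phi> E"
      proof (rule inj_onI)
        fix x y assume xy: "x \<in> E" "y \<in> E" "\<phi> x = \<phi> y"
        have "emb n (\<phi> (x - y)) = 0" using rucp_diff[OF r E'(2) xy(1,2)] xy(3) by simp
        then have "rbnd 1 (\<lambda>i j. x - y) ((1 + \<epsilon>) * 0)"
          by (intro expandsD[OF R]) (use xy op_space.subspace_diff[OF E'(2)] rbnd_zero in auto)
        then have "norm (x - y) \<le> 0" by (intro norm_le_rbnd) auto
        then show "x = y" by simp
      qed
      show "cb_norm (subsystem (mat_sys n) (\<phi> ` E)) (op_sys E) (inv_into E \<phi>) \<le> ennreal (1 + \<epsilon>)"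
        unfolding cb
      proof (intro allI impI)
        fix k and x :: "nat \<Rightarrow> nat \<Rightarrow> complex mat"
        assume x: "\<forall>i<k. \<forall>j<k. x i j \<in> \<phi> ` E" and b: "mat_mnorm n k x \<le> 1"
        define y where "y i j = inv_into E \<phi> (x i j)" for i j
        have y: "\<forall>i<k. \<forall>j<k. y i j \<in> E" unfolding y_def using x by (auto intro: inv_into_into)
        have xy: "\<phi> (y i j) = x i j" if "i < k" "j < k" for i j unfolding y_def using x that by (auto intro: f_inv_into_f)
        have "x i j \<in> carrier_mat n n" if "i < k" "j < k" for i j using xy[OF that] car y that by metis
        then have "mat_mnorm n k x \<le> 1 \<longleftrightarrow> mbd n k x 1" by (intro mat_mnorm_le_iff) (use n in auto)
        then have "mbd n k (\<lambda>i j. \<phi> (y i j)) 1" using b mbd_cong[of k n "\<lambda>i j. \<phi> (y i j)" x 1] xy by simp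
        then have "rbnd k y ((1 + \<epsilon>) * 1)" using y mb[OF y] by (intro expandsD[OF R]) auto
        then show "op_mnorm k (\<lambda>i j. inv_into E \<phi> (x i j)) \<le> 1 + \<epsilon>"
          using \<epsilon> op_mnorm_le_iff[of "1 + \<epsilon>" k y] unfolding y_def[abs_def] by simp
      qed
    qed
  qed
  then show ?thesis unfolding one_exact_fd_def by blast
qed

lemma norm_ket: "norm (ket i) = 1"
proof -
  have "complex_of_real ((norm (ket i))\<^sup>2) = 1" unfolding cinner_self[symmetric] cinner_ket ket_nth by simp
  then have "(norm (ket i))\<^sup>2 = 1" by (simp only: of_real_eq_1_iff)
  then show ?thesis using norm_ge_zero[of "ket i"] unfolding power2_eq_1_iff by linarith
qed

section \<open>Almost positive inverses\<close>

text \<open>The form of a scalar matrix on scalar vectors. Orthonormalising with respect to it turns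
  a scalar order bound into the unit; this takes the place of an inverse square root.\<close>

definition sform :: "nat \<Rightarrow> (nat \<Rightarrow> nat \<Rightarrow> complex) \<Rightarrow> (nat \<Rightarrow> complex) \<Rightarrow> (nat \<Rightarrow> complex) \<Rightarrow> complex" where
  "sform N a v w = (\<Sum>i<N. \<Sum>j<N. a i j * v j * cnj (w i))"

lemma sform_lin_left: "sform N a (\<lambda>j. v j + c * u j) w = sform N a v w + c * sform N a u w"
  by (simp add: sform_def algebra_simps sum.distrib sum_distrib_left)

lemma sform_lin_right: "sform N a v (\<lambda>j. w j + c * u j) = sform N a v w + cnj c * sform N a v u"
  by (simp add: sform_def algebra_simps sum.distrib sum_distrib_left)

lemma sform_zero: "sform N a (\<lambda>_. 0) v = 0" "sform N a v (\<lambda>_. 0) = 0"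
  by (simp_all add: sform_def)

lemma sform_sum_left: "finite A \<Longrightarrow> sform N a (\<lambda>j. \<Sum>l\<in>A. f l * t l j) w = (\<Sum>l\<in>A. f l * sform N a (t l) w)"
proof (induction A rule: finite_induct)
  case empty show ?case by (simp add: sform_def)
next
  case (insert l A)
  have "(\<lambda>j. \<Sum>l\<in>insert l A. f l * t l j) = (\<lambda>j. (\<Sum>l\<in>A. f l * t l j) + f l * t l j)"
    using insert by (simp add: add.commute)
  then have "sform N a (\<lambda>j. \<Sum>l\<in>insert l A. f l * t l j) w = (\<Sum>l\<in>A. f l * sform N a (t l) w) + f l * sform N a (t l) w"
    by (simp only: sform_lin_left insert.IH)
  then show ?case using insert by (simp add: add.commute)
qed

lemma sform_commute:
  assumes "\<And>i j. i < N \<Longrightarrow> j < N \<Longrightarrow> a j i = cnj (a i j)"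
  shows "sform N a w v = cnj (sform N a v w)"
proof -
  have "sform N a w v = (\<Sum>i<N. \<Sum>j<N. a j i * w i * cnj (v j))"
    unfolding sform_def by (rule sum.swap)
  also have "\<dots> = cnj (sform N a v w)"
    unfolding sform_def cnj_sum
  proof (intro sum.cong refl)
    fix i j assume "i \<in> {..<N}" "j \<in> {..<N}"
    then have "a j i = cnj (a i j)" by (intro assms) auto
    then show "a j i * w i * cnj (v j) = cnj (a i j * v j * cnj (w i))" by simp
  qed
  finally show ?thesis .
qed

text \<open>Orthonormalising the standard basis in order keeps T triangular with nonzero diagonal.
  This is the form of invertibility that \<open>triangular_solve\<close> exploits.\<close>

lemma gram_schmidt_form:
  assumes herm: "\<And>i j. i < N \<Longrightarrow> j < N \<Longrightarrow> a j i = cnj (a i j)"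
    and pd: "\<And>v. \<exists>i<N. v i \<noteq> 0 \<Longrightarrow> 0 < Re (sform N a v v)"
  shows "k \<le> N \<Longrightarrow> \<exists>T. (\<forall>l<k. T l l \<noteq> 0 \<and> (\<forall>i>l. T l i = 0)) \<and>
    (\<forall>l<k. \<forall>m<k. sform N a (T l) (T m) = (if l = m then 1 else 0))"
proof (induction k)
  case (Suc k)
  then obtain T where T: "\<forall>l<k. T l l \<noteq> 0 \<and> (\<forall>i>l. T l i = 0)"
    "\<forall>l<k. \<forall>m<k. sform N a (T l) (T m) = (if l = m then 1 else 0)"
    using Suc_leD by blast
  then have tri: "\<And>l. l < k \<Longrightarrow> T l l \<noteq> 0" "\<And>l i. l < k \<Longrightarrow> l < i \<Longrightarrow> T l i = 0"
    and orth: "\<And>l m. l < k \<Longrightarrow> m < k \<Longrightarrow> sform N a (T l) (T m) = (if l = m then 1 else 0)"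
    by auto
  define e :: "nat \<Rightarrow> complex" where "e = (\<lambda>i. if i = k then 1 else 0)"
  \<comment> \<open>The earlier vectors vanish at index k, so u has entry 1 there; it is nonzero and
    can be normalised.\<close>
  define u where "u = (\<lambda>i. e i + (- 1) * (\<Sum>l<k. sform N a e (T l) * T l i))"
  have uT: "sform N a u (T m) = 0" if "m < k" for m
  proof -
    have "(\<Sum>l<k. sform N a e (T l) * sform N a (T l) (T m)) = (\<Sum>l<k. if l = m then sform N a e (T l) else 0)"
      using that orth by (intro sum.cong refl) auto
    then show ?thesis unfolding u_def sform_lin_left using that by (simp add: sform_sum_left)
  qed
  have uk: "u k = 1" using tri(2) by (simp add: u_def e_def)
  have u0: "u i = 0" if "k < i" for i using tri(2) that by (simp add: u_def e_def)
  define r where "r = Re (sform N a u u)"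
  have r: "0 < r" unfolding r_def using Suc.prems uk by (intro pd exI[of _ k]) auto
  have "Im (sform N a u u) = 0" using arg_cong[OF sform_commute[of N a u u, OF herm], of Im] by simp
  then have ur: "sform N a u u = of_real r" by (simp add: r_def complex_eq_iff)
  define w where "w = (\<lambda>i. of_real (1 / sqrt r) * u i)"
  have w1: "sform N a w v = of_real (1 / sqrt r) * sform N a u v" for v
    using sform_lin_left[of N a "\<lambda>_. 0" "of_real (1 / sqrt r)" u v] by (simp only: w_def add_0_left sform_zero)
  have w2: "sform N a v w = of_real (1 / sqrt r) * sform N a v u" for v
    using sform_lin_right[of N a v "\<lambda>_. 0" "of_real (1 / sqrt r)" u] by (simp only: w_def add_0_left sform_zero complex_cnj_complex_of_real)
  have ww: "sform N a w w = 1"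
    unfolding w1 w2 ur of_real_mult[symmetric] using r by (simp add: real_div_sqrt)
  have Tw: "sform N a (T m) w = 0" if "m < k" for m
    unfolding w2 using sform_commute[of N a "T m" u, OF herm] uT[OF that] by simp
  show ?case
  proof (intro exI[of _ "\<lambda>l. if l = k then w else T l"] conjI allI impI)
    fix l assume l: "l < Suc k"
    show "(if l = k then w else T l) l \<noteq> 0" using l tri(1) r uk by (auto simp: w_def)
    show "(if l = k then w else T l) i = 0" if "l < i" for i using l tri(2) u0 that by (auto simp: w_def)
    fix m assume m: "m < Suc k"
    show "sform N a (if l = k then w else T l) (if m = k then w else T m) = (if l = m then 1 else 0)"
      using l m ww Tw uT orth by (auto simp: w1)
  qed
qed simp

text \<open>Back substitution: at the last index only the last column contributes, which determines
  the last g; subtract its share and recurse.\<close>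

lemma triangular_solve:
  fixes h :: "nat \<Rightarrow> 'h::chilbert_space"
  assumes "\<And>l. l < k \<Longrightarrow> T l l \<noteq> (0 :: complex)" "\<And>l i. l < k \<Longrightarrow> l < i \<Longrightarrow> T l i = 0"
  shows "\<exists>g. \<forall>i<k. h i = (\<Sum>l<k. T l i *\<^sub>C g l)"
  using assms
proof (induction k arbitrary: h)
  case (Suc k)
  define y where "y = (1 / T k k) *\<^sub>C h k"
  obtain g where g: "\<forall>i<k. h i - T k i *\<^sub>C y = (\<Sum>l<k. T l i *\<^sub>C g l)"
    using Suc.IH[of "\<lambda>i. h i - T k i *\<^sub>C y"] Suc.prems by auto
  define g' where "g' l = (if l = k then y else g l)" for l
  have s: "(\<Sum>l<k. T l i *\<^sub>C g' l) = (\<Sum>l<k. T l i *\<^sub>C g l)" for i by (intro sum.cong refl) (auto simp: g'_def)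
  have "h i = (\<Sum>l<Suc k. T l i *\<^sub>C g' l)" if "i < Suc k" for i
  proof (cases "i = k")
    case True
    have "(\<Sum>l<k. T l k *\<^sub>C g l) = 0" using Suc.prems(2) by (intro sum.neutral) auto
    then show ?thesis using True Suc.prems(1)[of k] by (simp add: s g'_def y_def scaleC_scaleC scaleC_one)
  next
    case False
    then have "h i - T k i *\<^sub>C y = (\<Sum>l<k. T l i *\<^sub>C g l)" using g that by auto
    then show ?thesis by (simp add: s g'_def algebra_simps)
  qed
  then show ?case by blast
qed simp

text \<open>\<open>V\<^sup>* x V\<close> for the matrix \<open>V\<close> whose columns are the vectors \<open>T l\<close>.\<close>

definition compress :: "nat \<Rightarrow> (nat \<Rightarrow> nat \<Rightarrow> complex) \<Rightarrow> (nat \<Rightarrow> nat \<Rightarrow> 'h::chilbert_space \<Rightarrow>\<^sub>L 'h) \<Rightarrow> nat \<Rightarrow> nat \<Rightarrow> 'h \<Rightarrow>\<^sub>L 'h" where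
  "compress k T x = (\<lambda>l m. \<Sum>i<k. \<Sum>j<k. (T m j * cnj (T l i)) *\<^sub>C x i j)"

lemma rform_compress:
  assumes "\<And>i j. i < k \<Longrightarrow> j < k \<Longrightarrow> clinear_op (x i j)"
  shows "rform k (compress k T x) g g' = rform k x (\<lambda>i. \<Sum>l<k. T l i *\<^sub>C g l) (\<lambda>i. \<Sum>l<k. T l i *\<^sub>C g' l)"
proof -
  have "rform k (compress k T x) g g' = Re (\<Sum>l<k. \<Sum>m<k. \<Sum>i<k. \<Sum>j<k. T m j * cnj (T l i) * cinner (blinfun_apply (x i j) (g m)) (g' l))"
    by (simp add: rform_def compress_def inner_eq_Re_cinner Re_sum blinfun.sum_left cinner_sum_left cinner_scaleC_left del: times_complex.sel)
  also have "(\<Sum>l<k. \<Sum>m<k. \<Sum>i<k. \<Sum>j<k. T m j * cnj (T l i) * cinner (blinfun_apply (x i j) (g m)) (g' l))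
     = (\<Sum>l<k. \<Sum>i<k. \<Sum>m<k. \<Sum>j<k. T m j * cnj (T l i) * cinner (blinfun_apply (x i j) (g m)) (g' l))"
    by (intro sum.cong refl sum.swap)
  also have "\<dots> = (\<Sum>i<k. \<Sum>l<k. \<Sum>j<k. \<Sum>m<k. T m j * cnj (T l i) * cinner (blinfun_apply (x i j) (g m)) (g' l))"
    by (subst sum.swap) (intro sum.cong refl sum.swap)
  also have "\<dots> = (\<Sum>i<k. \<Sum>j<k. \<Sum>l<k. \<Sum>m<k. T m j * cnj (T l i) * cinner (blinfun_apply (x i j) (g m)) (g' l))"
    by (intro sum.cong refl sum.swap)
  also have "\<dots> = (\<Sum>i<k. \<Sum>j<k. cinner (blinfun_apply (x i j) (\<Sum>l<k. T l j *\<^sub>C g l)) (\<Sum>l<k. T l i *\<^sub>C g' l))"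
  proof (intro sum.cong refl)
    fix i j assume "i \<in> {..<k}" "j \<in> {..<k}"
    then have "blinfun_apply (x i j) (\<Sum>l<k. T l j *\<^sub>C g l) = (\<Sum>l<k. T l j *\<^sub>C blinfun_apply (x i j) (g l))"
      using assms[of i j] by (simp add: blinfun.sum_right clinear_op_def)
    then show "(\<Sum>l<k. \<Sum>m<k. T m j * cnj (T l i) * cinner (blinfun_apply (x i j) (g m)) (g' l))
      = cinner (blinfun_apply (x i j) (\<Sum>l<k. T l j *\<^sub>C g l)) (\<Sum>l<k. T l i *\<^sub>C g' l)"
      by (simp add: cinner_sum_left cinner_sum_right cinner_scaleC_left cinner_scaleC_right sum_distrib_left mult_ac)
  qed
  also have "Re \<dots> = rform k x (\<lambda>i. \<Sum>l<k. T l i *\<^sub>C g l) (\<lambda>i. \<Sum>l<k. T l i *\<^sub>C g' l)"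
    by (simp add: rform_def inner_eq_Re_cinner Re_sum)
  finally show ?thesis .
qed

lemma compress_scal: "compress k T (scal a) l m = scal (\<lambda>l m. sform k a (T m) (T l)) l m"
  by (simp add: compress_def scal_def sform_def op_space.scale_sum_left mult_ac)

lemma rform_adjoint:
  assumes "\<And>i j. i < k \<Longrightarrow> j < k \<Longrightarrow> is_adjoint (y i j) (x j i)"
  shows "rform k y h g = rform k x g h"
proof -
  have "rform k y h g = (\<Sum>i<k. \<Sum>j<k. inner (blinfun_apply (x j i) (g i)) (h j))"
  proof -
    have "inner (blinfun_apply (y i j) (h j)) (g i) = inner (blinfun_apply (x j i) (g i)) (h j)" if "i < k" "j < k" for i j
      using assms[OF that] unfolding is_adjoint_def inner_eq_Re_cinner by (metis cinner_commute complex_cnj_cancel_iff cnj.simps(1))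
    then show ?thesis unfolding rform_def by (intro sum.cong refl) auto
  qed
  also have "\<dots> = rform k x g h" unfolding rform_def by (rule sum.swap)
  finally show ?thesis .
qed

lemma rform_unit: "rform k (unit_scal 1) h g = (\<Sum>i<k. inner (h i) (g i))"
  using rform_scal_diag[of k 1 h g] unfolding of_real_1 mult_1 .

text \<open>The norm of a self-adjoint matrix is its numerical radius. Four times the form at (h, g)
  is the difference of the diagonal values at h + g and h - g, and the parallelogram law adds up the
  two bounds.\<close>

lemma hermitian_rbnd:
  assumes sym: "\<And>h g. rform k w h g = rform k w g h" and b: "\<And>g. \<bar>rform k w g g\<bar> \<le> nsq k g"
  shows "rbnd k w 1"
  unfolding rbnd_def
proof (intro allI)
  fix h g
  have e1: "rform k w (\<lambda>i. h i + g i) (\<lambda>i. h i + g i) = rform k w h h + rform k w g g + 2 * rform k w h g"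
    unfolding rform_vec_add_left rform_vec_add_right using sym[of g h] by simp
  have e2: "rform k w (\<lambda>i. h i + (-1) *\<^sub>R g i) (\<lambda>i. h i + (-1) *\<^sub>R g i) = rform k w h h + rform k w g g - 2 * rform k w h g"
    unfolding rform_vec_add_left rform_vec_add_right rform_vec_scale_left rform_vec_scale_right using sym[of g h] by simp
  have e3: "nsq k (\<lambda>i. h i + g i) + nsq k (\<lambda>i. h i + (-1) *\<^sub>R g i) = 2 * (nsq k h + nsq k g)"
    by (simp add: nsq_inner inner_add_left inner_add_right inner_diff_left inner_diff_right sum.distrib sum_subtractf)
  show "2 * rform k w h g \<le> 1 * (nsq k h + nsq k g)"
    using b[of "\<lambda>i. h i + g i"] b[of "\<lambda>i. h i + (-1) *\<^sub>R g i"] e1 e2 e3 by linarith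
qed

text \<open>The Hermitian part of \<alpha>, raised by \<eta>. An order bound \<alpha> is only known
  to have nonnegative real form, so it may be neither Hermitian nor invertible. The real form on the
  diagonal grows just by \<eta> times the square norm.\<close>

definition reg :: "(nat \<Rightarrow> nat \<Rightarrow> complex) \<Rightarrow> real \<Rightarrow> nat \<Rightarrow> nat \<Rightarrow> complex" where
  "reg \<alpha> \<eta> i j = (\<alpha> i j + cnj (\<alpha> j i)) / 2 + (if i = j then of_real \<eta> else 0)"

lemma rform_reg: "rform k (scal (reg \<alpha> \<eta>)) h h = rform k (scal \<alpha>) h h + \<eta> * nsq k (h :: nat \<Rightarrow> 'l::chilbert_space)"
proof -
  have "is_adjoint (scal (\<lambda>i j. cnj (\<alpha> j i)) i j :: 'l \<Rightarrow>\<^sub>L 'l) (scal \<alpha> j i)" for i j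
    unfolding is_adjoint_def by (simp add: cinner_scaleC_left cinner_scaleC_right)
  then have 1: "rform k (scal (\<lambda>i j. cnj (\<alpha> j i))) h h = rform k (scal \<alpha>) h h" by (intro rform_adjoint)
  have "scal (reg \<alpha> \<eta>) i j = (1/2) *\<^sub>R (scal \<alpha> i j + scal (\<lambda>i j. cnj (\<alpha> j i)) i j) + unit_scal (of_real \<eta>) i j" for i j
    unfolding scal_add scal_scaleR by (simp add: reg_def scal_def)
  then have "rform k (scal (reg \<alpha> \<eta>)) h h = rform k (\<lambda>i j. (1/2) *\<^sub>R (scal \<alpha> i j + scal (\<lambda>i j. cnj (\<alpha> j i)) i j) + unit_scal (of_real \<eta>) i j) h h"
    by (intro rform_cong) auto
  then show ?thesis by (simp add: rform_add rform_scaleR rform_scal_diag nsq_inner 1)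
qed

lemma sform_ket: "Re (sform k a v v) = rform k (scal a) (\<lambda>i. v i *\<^sub>C ket 0) (\<lambda>i. v i *\<^sub>C ket 0)"
  by (simp add: sform_def rform_def inner_eq_Re_cinner Re_sum cinner_scaleC_left cinner_scaleC_right cinner_ket ket_nth mult_ac del: times_complex.sel)

lemma reg_basis:
  assumes psd: "\<And>v. 0 \<le> Re (sform k \<alpha> v v)" and \<eta>: "0 < \<eta>"
  shows "\<exists>T. (\<forall>l<k. T l l \<noteq> 0 \<and> (\<forall>i>l. T l i = 0)) \<and>
    (\<forall>l<k. \<forall>m<k. sform k (reg \<alpha> \<eta>) (T l) (T m) = (if l = m then 1 else 0))"
proof (rule gram_schmidt_form)
  show "reg \<alpha> \<eta> j i = cnj (reg \<alpha> \<eta> i j)" for i j by (simp add: reg_def add.commute)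
  fix v :: "nat \<Rightarrow> complex" assume v: "\<exists>i<k. v i \<noteq> 0"
  let ?h = "\<lambda>i. v i *\<^sub>C ket 0"
  obtain i where i: "i < k" "v i \<noteq> 0" using v by blast
  have "0 < (norm (?h i))\<^sup>2" using i by (simp add: norm_scaleC norm_ket)
  then have "0 < nsq k ?h" unfolding nsq_def using i(1) by (intro sum_pos2[of _ i]) auto
  then show "0 < Re (sform k (reg \<alpha> \<eta>) v v)"
    unfolding sform_ket rform_reg using psd[of v] \<eta> unfolding sform_ket by (simp add: add_nonneg_pos)
qed simp

lemma rform_orthonormal:
  fixes g :: "nat \<Rightarrow> 'l::chilbert_space"
  assumes "\<And>l m. l < k \<Longrightarrow> m < k \<Longrightarrow> sform k a (T l) (T m) = (if l = m then 1 else 0)"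
  shows "rform k (scal a) (\<lambda>i. \<Sum>l<k. T l i *\<^sub>C g l) (\<lambda>i. \<Sum>l<k. T l i *\<^sub>C g l) = nsq k g"
proof -
  have "rform k (scal a) (\<lambda>i. \<Sum>l<k. T l i *\<^sub>C g l) (\<lambda>i. \<Sum>l<k. T l i *\<^sub>C g l) = rform k (compress k T (scal a)) g g"
    by (rule rform_compress[symmetric]) (simp add: clinear_op_def scaleC_scaleC mult.commute)
  also have "\<dots> = rform k (unit_scal (of_real 1)) g g"
    unfolding rform_def compress_scal using assms by (intro sum.cong refl) auto
  finally show ?thesis unfolding rform_scal_diag nsq_inner by simp
qed

lemma rpos_limit:
  assumes "\<And>h \<eta>. 0 < \<eta> \<Longrightarrow> 0 \<le> rform k x h h + \<eta> * c h" "\<And>h. 0 \<le> c h"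
  shows "rpos k x"
  unfolding rpos_def
proof (intro allI, rule field_le_epsilon)
  fix h and \<epsilon> :: real assume \<epsilon>: "0 < \<epsilon>"
  have "\<epsilon> / (c h + 1) * c h \<le> \<epsilon>" using \<epsilon> assms(2)[of h] by (simp add: field_simps)
  moreover have "0 < \<epsilon> / (c h + 1)" using \<epsilon> assms(2)[of h] by (intro divide_pos_pos) linarith+
  ultimately show "0 \<le> rform k x h h + \<epsilon>" using assms(1)[of "\<epsilon> / (c h + 1)" h] by linarith
qed

text \<open>In the basis of \<open>reg_basis\<close> the regularised form is a sum of squares on
  every Hilbert space, so testing on scalar vectors is enough; then \<eta> tends to 0.\<close>

lemma rpos_scal:
  assumes psd: "\<And>v. 0 \<le> Re (sform k \<alpha> v v)"
  shows "rpos k (scal \<alpha> :: nat \<Rightarrow> nat \<Rightarrow> 'k::chilbert_space \<Rightarrow>\<^sub>L 'k)"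
proof (rule rpos_limit[where c = "nsq k"])
  fix h :: "nat \<Rightarrow> 'k" and \<eta> :: real assume \<eta>: "0 < \<eta>"
  obtain T where T: "\<forall>l<k. T l l \<noteq> 0 \<and> (\<forall>i>l. T l i = 0)"
    "\<forall>l<k. \<forall>m<k. sform k (reg \<alpha> \<eta>) (T l) (T m) = (if l = m then 1 else 0)"
    using reg_basis[OF psd \<eta>] by blast
  obtain g where g: "\<forall>i<k. h i = (\<Sum>l<k. T l i *\<^sub>C g l)" using triangular_solve[of k T h] T(1) by blast
  have "rform k (scal (reg \<alpha> \<eta>)) h h = rform k (scal (reg \<alpha> \<eta>)) (\<lambda>i. \<Sum>l<k. T l i *\<^sub>C g l) (\<lambda>i. \<Sum>l<k. T l i *\<^sub>C g l)"
    using g by (intro rform_cong) auto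
  also have "\<dots> = nsq k g" by (rule rform_orthonormal) (use T(2) in auto)
  finally show "0 \<le> rform k (scal \<alpha>) h h + \<eta> * nsq k h" unfolding rform_reg by simp
qed simp

text \<open>If \<alpha> is the unit, this is a norm estimate for 1 - 2 x. The general case is
  reduced to it by a change of basis T carrying the regularised \<alpha> to the unit. Since T has
  scalar entries, compression by T commutes with \<phi>, and \<delta> is not affected by k.\<close>

lemma expands_almost_positive:
  fixes E :: "('h::chilbert_space \<Rightarrow>\<^sub>L 'h) set" and \<phi> :: "('h \<Rightarrow>\<^sub>L 'h) \<Rightarrow> (ell2 \<Rightarrow>\<^sub>L ell2)"
  assumes E: "osys E" and \<phi>: "rucp E \<phi>" and X: "expands E \<phi> (1 + 2 * \<delta>)" and \<delta>: "0 \<le> \<delta>"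
    and x: "\<And>i j. x i j \<in> E" and p1: "rpos k (\<lambda>i j. \<phi> (x i j))" and p2: "rpos k (\<lambda>i j. scal \<alpha> i j - \<phi> (x i j))"
  shows "rpos k (\<lambda>i j. x i j + \<delta> *\<^sub>R scal \<alpha> i j)"
proof -
  note E' = osysD[OF E]
  note Eadd = op_space.subspace_add[OF E'(2)] and Esc = op_space.subspace_scale[OF E'(2)]
  have main: "0 \<le> rform k x h h + \<delta> * (rform k (scal \<alpha>) h h + \<eta> * nsq k h)" if \<eta>: "0 < \<eta>" for \<eta> h
  proof -
    define a where "a = reg \<alpha> \<eta>"
    have fa: "rform k (scal a) h h = rform k (scal \<alpha>) h h + \<eta> * nsq k h" for h :: "nat \<Rightarrow> 'l::chilbert_space"
      unfolding a_def by (rule rform_reg)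
    have psd: "0 \<le> Re (sform k \<alpha> v v)" for v
    proof -
      have "rpos k (\<lambda>i j. \<phi> (x i j) + (scal \<alpha> i j - \<phi> (x i j)))" by (rule rpos_add[OF p1 p2])
      then show ?thesis unfolding sform_ket rpos_def by simp
    qed
    obtain T where tri: "\<And>l. l < k \<Longrightarrow> T l l \<noteq> 0" "\<And>l i. l < k \<Longrightarrow> l < i \<Longrightarrow> T l i = 0"
      and orth: "\<And>l m. l < k \<Longrightarrow> m < k \<Longrightarrow> sform k a (T l) (T m) = (if l = m then 1 else 0)"
      using reg_basis[OF psd \<eta>] unfolding a_def by metis
    have na: "rform k (scal a) (\<lambda>i. \<Sum>l<k. T l i *\<^sub>C g l) (\<lambda>i. \<Sum>l<k. T l i *\<^sub>C g l) = nsq k g" for g :: "nat \<Rightarrow> 'l::chilbert_space"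
      using orth by (rule rform_orthonormal)
    obtain ad where ad: "\<And>T. T \<in> E \<Longrightarrow> ad T \<in> E" "\<And>T. T \<in> E \<Longrightarrow> is_adjoint (ad T) T"
      using E'(4) by metis
    define x' where "x' = compress k T x"
    have x'E: "x' l m \<in> E" for l m
      unfolding x'_def compress_def by (intro op_space.subspace_sum[OF E'(2)] Esc x)
    \<comment> \<open>The self-adjoint part has the same real form on the diagonal and is symmetric,
      as \<open>hermitian_rbnd\<close> demands.\<close>
    define z where "z l m = (1/2) *\<^sub>R (x' l m + ad (x' m l))" for l m
    have zE: "z l m \<in> E" for l m unfolding z_def by (intro subspace_scaleR[OF E'(2)] Eadd x'E ad)
    have fz: "rform k z g g' = (rform k x' g g' + rform k x' g' g) / 2" for g g'
    proof -
      have "rform k (\<lambda>l m. ad (x' m l)) g g' = rform k x' g' g" by (rule rform_adjoint) (rule ad(2)[OF x'E])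
      then show ?thesis unfolding z_def rform_scaleR rform_add by simp
    qed
    have \<phi>z: "\<phi> (z l m) = (1/2) *\<^sub>R (\<phi> (x' l m) + \<phi> (ad (x' m l)))" for l m
      unfolding z_def using x'E ad(1) by (simp add: rucp_scaleR[OF \<phi>] rucpD(2)[OF \<phi>] Eadd)
    have f\<phi>z: "rform k (\<lambda>l m. \<phi> (z l m)) g g' = (rform k (\<lambda>l m. \<phi> (x' l m)) g g' + rform k (\<lambda>l m. \<phi> (x' l m)) g' g) / 2" for g g'
    proof -
      have "rform k (\<lambda>l m. \<phi> (ad (x' m l))) g g' = rform k (\<lambda>l m. \<phi> (x' l m)) g' g"
        by (rule rform_adjoint) (intro rucp_adjoint[OF \<phi> E'(2)] ad x'E)
      then show ?thesis unfolding \<phi>z rform_scaleR rform_add by simp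
    qed
    have \<phi>x': "\<phi> (x' l m) = compress k T (\<lambda>i j. \<phi> (x i j)) l m" for l m
    proof -
      have s: "\<phi> (\<Sum>i\<in>A. f i) = (\<Sum>i\<in>A. \<phi> (f i))" if "\<And>i. f i \<in> E" for A :: "nat set" and f
        using that by (induction A rule: infinite_finite_induct)
          (auto simp: rucp_zero[OF \<phi> E'(2)] rucpD(2)[OF \<phi>] op_space.subspace_sum[OF E'(2)])
      show ?thesis unfolding x'_def compress_def
        by (simp add: s op_space.subspace_sum[OF E'(2)] Esc x rucpD(3)[OF \<phi> x])
    qed
    have bnd: "0 \<le> rform k (\<lambda>l m. \<phi> (z l m)) g g" "rform k (\<lambda>l m. \<phi> (z l m)) g g \<le> nsq k g" for g
    proof -
      let ?h = "\<lambda>i. \<Sum>l<k. T l i *\<^sub>C g l"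
      have "rform k (\<lambda>l m. \<phi> (z l m)) g g = rform k (compress k T (\<lambda>i j. \<phi> (x i j))) g g"
        unfolding f\<phi>z \<phi>x' by simp
      also have "\<dots> = rform k (\<lambda>i j. \<phi> (x i j)) ?h ?h" by (rule rform_compress) (rule rucpD(1)[OF \<phi> x])
      finally have e: "rform k (\<lambda>l m. \<phi> (z l m)) g g = rform k (\<lambda>i j. \<phi> (x i j)) ?h ?h" .
      show "0 \<le> rform k (\<lambda>l m. \<phi> (z l m)) g g" unfolding e using p1 unfolding rpos_def by blast
      have "rform k (\<lambda>i j. \<phi> (x i j)) ?h ?h \<le> rform k (scal \<alpha>) ?h ?h"
        using p2 unfolding rpos_def rform_diff by simp
      also have "\<dots> \<le> rform k (scal a) ?h ?h" unfolding fa using \<eta> by simp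
      also have "\<dots> = nsq k g" by (rule na)
      finally show "rform k (\<lambda>l m. \<phi> (z l m)) g g \<le> nsq k g" unfolding e .
    qed
    \<comment> \<open>Since \<phi> z lies between 0 and 1, its transform 1 - 2 \<phi> z is a
      contraction. Pulling back costs the factor 1 + 2 \<delta>, and 1 - 2 z \<le> 1 + 2 \<delta>
      reads z + \<delta> \<ge> 0. This is the origin of the 2 in the assumption on \<phi>.\<close>
    define w where "w l m = unit_scal 1 l m + (-2) *\<^sub>R z l m" for l m
    have uE: "unit_scal 1 l m \<in> E" for l m unfolding scal_def by (intro Esc E'(3))
    have wE: "w l m \<in> E" for l m unfolding w_def by (intro Eadd uE subspace_scaleR[OF E'(2)] zE)
    have \<phi>w: "\<phi> (w l m) = unit_scal 1 l m + (-2) *\<^sub>R \<phi> (z l m)" for l m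
    proof -
      have "\<phi> (unit_scal 1 l m) = unit_scal 1 l m"
        unfolding scal_def by (simp add: rucpD(3)[OF \<phi> E'(3)] rucpD(4)[OF \<phi>])
      then show ?thesis unfolding w_def
        by (simp only: rucpD(2)[OF \<phi> uE subspace_scaleR[OF E'(2) zE]] rucp_scaleR[OF \<phi> zE])
    qed
    have "rbnd k (\<lambda>l m. \<phi> (w l m)) 1"
    proof (rule hermitian_rbnd)
      show "rform k (\<lambda>l m. \<phi> (w l m)) h g = rform k (\<lambda>l m. \<phi> (w l m)) g h" for h g
        unfolding \<phi>w rform_add rform_scaleR rform_unit f\<phi>z by (simp add: inner_commute)
      show "\<bar>rform k (\<lambda>l m. \<phi> (w l m)) g g\<bar> \<le> nsq k g" for g
        unfolding \<phi>w rform_add rform_scaleR rform_unit nsq_inner[symmetric] using bnd[of g] by linarith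
    qed
    then have "rbnd k w ((1 + 2 * \<delta>) * 1)" by (intro expandsD[OF X] wE) auto
    obtain g where g: "\<forall>i<k. h i = (\<Sum>l<k. T l i *\<^sub>C g l)" using triangular_solve[of k T h, OF tri] by blast
    let ?h = "\<lambda>i. \<Sum>l<k. T l i *\<^sub>C g l"
    have "2 * rform k w g g \<le> (1 + 2 * \<delta>) * (nsq k g + nsq k g)"
      using \<open>rbnd k w ((1 + 2 * \<delta>) * 1)\<close> unfolding rbnd_def by (metis mult.right_neutral)
    then have "0 \<le> rform k z g g + \<delta> * nsq k g"
      unfolding w_def rform_add rform_scaleR rform_unit nsq_inner[symmetric] by (simp add: algebra_simps)
    also have "rform k z g g = rform k x ?h ?h"
      unfolding fz x'_def using rform_compress[of k x T g g] osysD(1)[OF E x] by simp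
    also have "rform k x ?h ?h = rform k x h h" using g by (intro rform_cong) auto
    also have "nsq k g = rform k (scal a) h h"
      unfolding na[symmetric] using g by (intro rform_cong) auto
    finally show ?thesis unfolding fa .
  qed
  show ?thesis
  proof (rule rpos_limit[where c = "\<lambda>h. \<delta> * nsq k h"])
    show "0 \<le> rform k (\<lambda>i j. x i j + \<delta> *\<^sub>R scal \<alpha> i j) h h + \<eta> * (\<delta> * nsq k h)" if "0 < \<eta>" for h \<eta>
      using main[OF that, of h] by (simp add: rform_add rform_scaleR algebra_simps)
  qed (use \<delta> in simp)
qed

section \<open>Finite-dimensional operator systems and embeddings\<close>

lemma norm_op_scaleC: "norm (c *\<^sub>C T) = cmod c * norm (T :: 'a::real_normed_vector \<Rightarrow>\<^sub>L 'b::chilbert_space)"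
proof -
  have le: "norm (c *\<^sub>C T) \<le> cmod c * norm T" for c and T :: "'a \<Rightarrow>\<^sub>L 'b"
  proof (rule norm_blinfun_bound)
    fix v
    have "cmod c * norm (blinfun_apply T v) \<le> cmod c * (norm T * norm v)"
      by (intro mult_left_mono norm_blinfun) simp
    then show "norm (blinfun_apply (c *\<^sub>C T) v) \<le> cmod c * norm T * norm v"
      by (simp add: norm_scaleC mult.assoc)
  qed simp
  show ?thesis
  proof (cases "c = 0")
    case False
    have "norm ((1 / c) *\<^sub>C (c *\<^sub>C T)) \<le> cmod (1 / c) * norm (c *\<^sub>C T)" by (rule le)
    then have "cmod c * norm T \<le> norm (c *\<^sub>C T)" using False by (simp add: norm_divide field_simps)
    then show ?thesis using le[of c T] by simp
  qed simp
qed

text \<open>Induction on the generators. A vector b outside the closed span V has positive distance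
  d from it, which bounds the coefficient of b. Along a convergent sequence these coefficients are
  Cauchy, and subtracting the b part leads back to V.\<close>

lemma closed_span_finite:
  fixes B :: "('a::real_normed_vector \<Rightarrow>\<^sub>L 'b::chilbert_space) set"
  assumes "finite B" shows "closed (op_space.span B)"
  using assms
proof (induction B rule: finite_induct)
  case (insert b B)
  let ?V = "op_space.span B"
  have V: "op_space.subspace ?V" by (rule op_space.subspace_span)
  show ?case
  proof (cases "b \<in> ?V")
    case True then show ?thesis using insert op_space.span_redundant by metis
  next
    case False
    then have "b \<in> - ?V" "open (- ?V)" using insert by auto
    then obtain d where d: "0 < d" "ball b d \<subseteq> - ?V" using openE by metis
    have lower: "cmod k * d \<le> norm (x + k *\<^sub>C b)" if "x \<in> ?V" for x k
    proof (cases "k = 0")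
      case k: False
      have "(- 1 / k) *\<^sub>C x \<in> ?V" using that by (intro op_space.subspace_scale[OF V])
      then have "(- 1 / k) *\<^sub>C x \<notin> ball b d" using d(2) by blast
      then have "d \<le> norm (b - (- 1 / k) *\<^sub>C x)" by (simp add: dist_norm)
      then have "cmod k * d \<le> norm (k *\<^sub>C (b - (- 1 / k) *\<^sub>C x))"
        unfolding norm_op_scaleC by (intro mult_left_mono) auto
      also have "k *\<^sub>C (b - (- 1 / k) *\<^sub>C x) = x + k *\<^sub>C b"
        using k by (simp add: op_space.scale_right_distrib op_space.scale_right_diff_distrib op_space.scale_scale add.commute)
      finally show ?thesis .
    qed simp
    show ?thesis
      unfolding closed_sequential_limits
    proof (intro allI impI, elim conjE)
      fix x l assume x: "\<forall>n. x n \<in> op_space.span (insert b B)" and l: "x \<longlonglongrightarrow> l"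
      then have "\<forall>n. \<exists>k. x n - k *\<^sub>C b \<in> ?V" unfolding op_space.span_insert by blast
      then obtain k where k: "\<And>n. x n - k n *\<^sub>C b \<in> ?V" by metis
      have "Cauchy k"
        unfolding Cauchy_def
      proof (intro allI impI)
        fix e :: real assume e: "0 < e"
        have "Cauchy x" using l by (intro convergent_Cauchy convergentI)
        then obtain M where M: "\<And>m n. M \<le> m \<Longrightarrow> M \<le> n \<Longrightarrow> dist (x m) (x n) < e * d"
          using e d(1) unfolding Cauchy_def by (metis mult_pos_pos)
        have "dist (k m) (k n) < e" if "M \<le> m" "M \<le> n" for m n
        proof -
          have "cmod (k m - k n) * d \<le> norm ((x m - k m *\<^sub>C b) - (x n - k n *\<^sub>C b) + (k m - k n) *\<^sub>C b)"
            by (intro lower op_space.subspace_diff[OF V] k)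
          also have "\<dots> = dist (x m) (x n)"
            by (simp add: dist_norm op_space.scale_left_diff_distrib algebra_simps)
          also have "\<dots> < e * d" by (rule M[OF that])
          finally show ?thesis using d(1) by (simp add: dist_norm)
        qed
        then show "\<exists>M. \<forall>m\<ge>M. \<forall>n\<ge>M. dist (k m) (k n) < e" by blast
      qed
      then obtain c where c: "k \<longlonglongrightarrow> c" using Cauchy_convergent_iff convergent_def by metis
      have "(\<lambda>n. (k n - c) *\<^sub>C b) \<longlonglongrightarrow> 0"
      proof (rule tendsto_norm_zero_cancel)
        have "(\<lambda>n. cmod (k n - c) * norm b) \<longlonglongrightarrow> cmod (c - c) * norm b"
          by (intro tendsto_intros c)
        then show "(\<lambda>n. norm ((k n - c) *\<^sub>C b)) \<longlonglongrightarrow> 0" by (simp add: norm_op_scaleC)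
      qed
      from tendsto_diff[OF tendsto_diff[OF l this] tendsto_const[of "c *\<^sub>C b"]]
      have "(\<lambda>n. x n - k n *\<^sub>C b) \<longlonglongrightarrow> l - c *\<^sub>C b"
        by (simp add: op_space.scale_left_diff_distrib)
      then have "l - c *\<^sub>C b \<in> ?V" by (rule closed_sequentially[OF insert.IH k])
      then show "l \<in> op_space.span (insert b B)" unfolding op_space.span_insert by blast
    qed
  qed
qed simp

section \<open>Operator systems generated by finite sets\<close>

lemma is_adjoint_sym: "is_adjoint S T \<Longrightarrow> is_adjoint T S"
  unfolding is_adjoint_def by (metis cinner_commute)

lemma is_adjoint_add: "is_adjoint S T \<Longrightarrow> is_adjoint S' T' \<Longrightarrow> is_adjoint (S + S') (T + T')"
  unfolding is_adjoint_def by (simp add: blinfun.add_left cinner_add_left cinner_add_right)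

lemma is_adjoint_scaleC: "is_adjoint S T \<Longrightarrow> is_adjoint (cnj c *\<^sub>C S) (c *\<^sub>C T)"
  unfolding is_adjoint_def by (simp add: cinner_scaleC_left cinner_scaleC_right)

lemma is_adjoint_zero: "is_adjoint 0 0"
  by (simp add: is_adjoint_def)

lemma osys_span:
  assumes cl: "\<And>T. T \<in> B \<Longrightarrow> clinear_op T" and adj: "\<And>T. T \<in> B \<Longrightarrow> \<exists>S\<in>op_space.span B. is_adjoint S T"
    and id: "id_blinfun \<in> op_space.span B"
  shows "osys (op_space.span B)"
proof -
  have "op_space.span B \<subseteq> {T. clinear_op T}"
    using cl by (intro op_space.span_minimal subspace_clinear) auto
  moreover have "\<exists>S\<in>op_space.span B. is_adjoint S T" if "T \<in> op_space.span B" for T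
  proof -
    have "op_space.subspace {T. \<exists>S\<in>op_space.span B. is_adjoint S T}"
    proof (rule op_space.subspaceI)
      show "0 \<in> {T. \<exists>S\<in>op_space.span B. is_adjoint S T}"
        using op_space.span_zero is_adjoint_zero by blast
      show "S + T \<in> {T. \<exists>S\<in>op_space.span B. is_adjoint S T}"
        if "S \<in> {T. \<exists>S\<in>op_space.span B. is_adjoint S T}" "T \<in> {T. \<exists>S\<in>op_space.span B. is_adjoint S T}" for S T
        using that op_space.span_add is_adjoint_add by blast
      show "c *\<^sub>C T \<in> {T. \<exists>S\<in>op_space.span B. is_adjoint S T}"
        if "T \<in> {T. \<exists>S\<in>op_space.span B. is_adjoint S T}" for c T
        using that op_space.span_scale is_adjoint_scaleC by blast
    qed
    then have "op_space.span B \<subseteq> {T. \<exists>S\<in>op_space.span B. is_adjoint S T}"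
      using adj by (intro op_space.span_minimal) auto
    then show ?thesis using that by blast
  qed
  ultimately show ?thesis unfolding osys_def using id op_space.subspace_span by blast
qed

lemma finite_subsystem:
  assumes G: "osys G" and B: "finite B" "B \<subseteq> G"
  obtains E where "operator_system E" "finite_dim E" "B \<subseteq> E" "E \<subseteq> G"
proof -
  obtain ad where ad: "\<And>T. T \<in> G \<Longrightarrow> ad T \<in> G" "\<And>T. T \<in> G \<Longrightarrow> is_adjoint (ad T) T"
    using osysD(4)[OF G] by metis
  let ?C = "insert id_blinfun (B \<union> ad ` B)"
  have CG: "?C \<subseteq> G" using B ad osysD(3)[OF G] by blast
  have fin: "finite ?C" using B by simp
  have "osys (op_space.span ?C)"
  proof (rule osys_span)
    show "clinear_op T" if "T \<in> ?C" for T using that CG osysD(1)[OF G] by blast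
    show "\<exists>S\<in>op_space.span ?C. is_adjoint S T" if T: "T \<in> ?C" for T
    proof -
      have "\<exists>S\<in>?C. is_adjoint S T"
      proof -
        have "is_adjoint (id_blinfun :: 'a \<Rightarrow>\<^sub>L 'a) id_blinfun" by (simp add: is_adjoint_def)
        have "is_adjoint (ad b) b" "is_adjoint b (ad b)" if "b \<in> B" for b
          using ad(2) B that is_adjoint_sym by blast+
        then show ?thesis using T \<open>is_adjoint id_blinfun id_blinfun\<close> by (elim insertE UnE imageE) auto
      qed
      then obtain S where "S \<in> ?C" "is_adjoint S T" by blast
      then show ?thesis using op_space.span_base[of S ?C] by blast
    qed
    show "id_blinfun \<in> op_space.span ?C" by (intro op_space.span_base) simp
  qed
  then have "operator_system (op_space.span ?C)"
    using closed_span_finite[OF fin] by (simp add: operator_system_iff)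
  moreover have "finite_dim (op_space.span ?C)" unfolding finite_dim_def using fin by blast
  moreover have "B \<subseteq> op_space.span ?C" using op_space.span_superset by fastforce
  moreover have "op_space.span ?C \<subseteq> G" using CG osysD(2)[OF G] by (rule op_space.span_minimal)
  ultimately show ?thesis using that by blast
qed

section \<open>Images of operator systems and complete order embeddings\<close>

lemma rucp_image_subspace:
  assumes \<phi>: "rucp E \<phi>" and E: "op_space.subspace E" shows "op_space.subspace (\<phi> ` E)"
proof (rule op_space.subspaceI)
  show "0 \<in> \<phi> ` E" using rucp_zero[OF \<phi> E] op_space.subspace_0[OF E] by (metis imageI)
  show "S + T \<in> \<phi> ` E" if "S \<in> \<phi> ` E" "T \<in> \<phi> ` E" for S T
    using that op_space.subspace_add[OF E] by (auto simp: rucpD(2)[OF \<phi>, symmetric])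
  show "c *\<^sub>C T \<in> \<phi> ` E" if "T \<in> \<phi> ` E" for c T
    using that op_space.subspace_scale[OF E] by (auto simp: rucpD(3)[OF \<phi>, symmetric])
qed

lemma rucp_image_osys:
  assumes \<phi>: "rucp E \<phi>" and E: "osys E" shows "osys (\<phi> ` E)"
  unfolding osys_def
proof (intro conjI ballI)
  show "clinear_op T" if "T \<in> \<phi> ` E" for T using that rucpD(1)[OF \<phi>] by blast
  show "op_space.subspace (\<phi> ` E)" by (rule rucp_image_subspace[OF \<phi> osysD(2)[OF E]])
  show "id_blinfun \<in> \<phi> ` E" using rucpD(4)[OF \<phi>] osysD(3)[OF E] by (metis imageI)
  show "\<exists>S\<in>\<phi> ` E. is_adjoint S T" if T: "T \<in> \<phi> ` E" for T
  proof -
    obtain x where x: "x \<in> E" "T = \<phi> x" using T by blast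
    obtain y where y: "y \<in> E" "is_adjoint y x" using osysD(4)[OF E x(1)] by blast
    then show ?thesis using rucp_adjoint[OF \<phi> osysD(2)[OF E] y(1) x(1) y(2)] x by blast
  qed
qed

lemma rucp_image_span:
  assumes \<phi>: "rucp (op_space.span B) \<phi>" shows "\<phi> ` op_space.span B = op_space.span (\<phi> ` B)"
proof
  let ?E = "op_space.span B"
  have E: "op_space.subspace ?E" by (rule op_space.subspace_span)
  show "op_space.span (\<phi> ` B) \<subseteq> \<phi> ` ?E"
    by (intro op_space.span_minimal rucp_image_subspace[OF \<phi> E] image_mono op_space.span_superset)
  have "op_space.subspace {x \<in> ?E. \<phi> x \<in> op_space.span (\<phi> ` B)}"
    by (rule op_space.subspaceI)
      (auto simp: op_space.span_zero op_space.span_add op_space.span_scale rucp_zero[OF \<phi> E] rucpD(2,3)[OF \<phi>])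
  then have "?E \<subseteq> {x \<in> ?E. \<phi> x \<in> op_space.span (\<phi> ` B)}"
    by (rule op_space.span_minimal[rotated]) (auto intro: op_space.span_base)
  then show "\<phi> ` ?E \<subseteq> op_space.span (\<phi> ` B)" by blast
qed

lemma subsystem_op_sys: "subsystem (op_sys G) Y = op_sys Y"
  by (simp add: subsystem_def op_sys_def)

text \<open>\<open>pos\<close> is complete positivity of the inverse, phrased on the source so that
  its users need not mention the inverse.\<close>

lemma complete_order_embeddingI:
  assumes \<phi>: "rucp E \<phi>" and E: "osys E" and inj: "inj_on \<phi> E" and G: "\<phi> ` E \<subseteq> G"
    and pos: "\<And>k x. (\<And>i j. x i j \<in> E) \<Longrightarrow> rpos k (\<lambda>i j. \<phi> (x i j)) \<Longrightarrow> rpos k x"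
  shows "complete_order_embedding (op_sys E) (op_sys G) \<phi>"
proof -
  note E' = osysD[OF E]
  let ?g = "inv_into E \<phi>"
  have g: "?g (\<phi> x) = x" if "x \<in> E" for x using inj that by simp
  have "rucp (\<phi> ` E) ?g"
    unfolding rucp_def
  proof (intro conjI ballI allI impI)
    show "clinear_op (?g y)" if "y \<in> \<phi> ` E" for y using that E'(1) by (auto simp: g)
    show "?g (y + z) = ?g y + ?g z" if "y \<in> \<phi> ` E" "z \<in> \<phi> ` E" for y z
      using that by (auto simp: g rucpD(2)[OF \<phi>, symmetric] op_space.subspace_add[OF E'(2)])
    show "?g (c *\<^sub>C y) = c *\<^sub>C ?g y" if "y \<in> \<phi> ` E" for y c
      using that by (auto simp: g rucpD(3)[OF \<phi>, symmetric] op_space.subspace_scale[OF E'(2)])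
    show "?g id_blinfun = id_blinfun" using g[OF E'(3)] rucpD(4)[OF \<phi>] by simp
    fix k y assume y: "\<forall>i<k. \<forall>j<k. y i j \<in> \<phi> ` E" "rpos k y"
    define x where "x i j = (if i < k \<and> j < k then ?g (y i j) else 0)" for i j
    have xE: "x i j \<in> E" for i j unfolding x_def using y(1) E'(2) op_space.subspace_0 by (auto simp: inv_into_into)
    have "\<phi> (x i j) = y i j" if "i < k" "j < k" for i j using y(1) that by (auto simp: x_def f_inv_into_f)
    then have "rpos k (\<lambda>i j. \<phi> (x i j))" using y(2) rpos_cong[of k "\<lambda>i j. \<phi> (x i j)" y] by simp
    then have "rpos k x" by (intro pos xE)
    then show "rpos k (\<lambda>i j. ?g (y i j))" using rpos_cong[of k x "\<lambda>i j. ?g (y i j)"] by (simp add: x_def)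
  qed
  then have "ucp (op_sys (\<phi> ` E)) (op_sys E) ?g"
    by (rule rucp_ucp) (use rucp_image_subspace[OF \<phi> E'(2)] g in auto)
  moreover have "ucp (op_sys E) (op_sys (\<phi> ` E)) \<phi>" by (rule rucp_ucp[OF \<phi> E'(2)]) simp
  moreover have "bij_betw \<phi> E (\<phi> ` E)" using inj by (simp add: bij_betw_def)
  ultimately show ?thesis
    unfolding complete_order_embedding_def complete_order_iso_def subsystem_op_sys using G
    by (simp add: op_sys_def)
qed

lemma complete_order_embeddingD:
  assumes "complete_order_embedding (op_sys E) (op_sys G) \<phi>"
  shows "inj_on \<phi> E" "\<phi> ` E \<subseteq> G" "ucp (op_sys E) (op_sys (\<phi> ` E)) \<phi>"
    "ucp (op_sys (\<phi> ` E)) (op_sys E) (inv_into E \<phi>)" "ucp (op_sys E) (op_sys G) \<phi>"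
proof -
  show "inj_on \<phi> E" "\<phi> ` E \<subseteq> G" and u: "ucp (op_sys E) (op_sys (\<phi> ` E)) \<phi>"
    and "ucp (op_sys (\<phi> ` E)) (op_sys E) (inv_into E \<phi>)"
    using assms unfolding complete_order_embedding_def complete_order_iso_def subsystem_op_sys
    by (auto simp: op_sys_def bij_betw_def)
  show "ucp (op_sys E) (op_sys G) \<phi>" using u \<open>\<phi> ` E \<subseteq> G\<close> by (rule ucp_range)
qed

lemma rucp_compose:
  assumes "rucp E f" "f ` E \<subseteq> E'" "rucp E' g" shows "rucp E (\<lambda>x. g (f x))"
  using assms unfolding rucp_def by (simp add: image_subset_iff)

lemma rucp_id: "(\<And>T. T \<in> E \<Longrightarrow> clinear_op T) \<Longrightarrow> rucp E (\<lambda>x. x)"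
  by (simp add: rucp_def)

lemma rucp_convex:
  assumes f: "rucp E f" and g: "rucp E g" and t: "0 \<le> t" "t \<le> 1"
  shows "rucp E (\<lambda>x. t *\<^sub>R f x + (1 - t) *\<^sub>R g x)"
  unfolding rucp_def
proof (intro conjI ballI allI impI)
  show "clinear_op (t *\<^sub>R f x + (1 - t) *\<^sub>R g x)" if "x \<in> E" for x
    using rucpD(1)[OF f that] rucpD(1)[OF g that] op_space.subspace_add[OF subspace_clinear] subspace_scaleR[OF subspace_clinear]
    by blast
  show "t *\<^sub>R f (x + y) + (1 - t) *\<^sub>R g (x + y) = t *\<^sub>R f x + (1 - t) *\<^sub>R g x + (t *\<^sub>R f y + (1 - t) *\<^sub>R g y)" if "x \<in> E" "y \<in> E" for x y
    using that by (simp add: rucpD(2)[OF f] rucpD(2)[OF g] scaleR_add_right)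
  show "t *\<^sub>R f (c *\<^sub>C x) + (1 - t) *\<^sub>R g (c *\<^sub>C x) = c *\<^sub>C (t *\<^sub>R f x + (1 - t) *\<^sub>R g x)" if "x \<in> E" for x c
    using that by (simp add: rucpD(3)[OF f] rucpD(3)[OF g] op_scaleR_scaleC op_space.scale_right_distrib mult.commute)
  show "t *\<^sub>R f id_blinfun + (1 - t) *\<^sub>R g id_blinfun = id_blinfun"
    by (simp add: rucpD(4)[OF f] rucpD(4)[OF g] flip: scaleR_add_left)
  show "rpos k (\<lambda>i j. t *\<^sub>R f (x i j) + (1 - t) *\<^sub>R g (x i j))" if "\<forall>i<k. \<forall>j<k. x i j \<in> E" "rpos k x" for k x
    using that t by (intro rpos_add rpos_scaleR rucpD(5)[OF f] rucpD(5)[OF g]) auto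
qed

text \<open>A vector state times the unit. Evaluating a matrix with positive real form at the state
  gives a scalar matrix with positive real form, which \<open>rpos_scal\<close> carries over to the
  target space. Besides the state in block 0, this supplies ucp maps to start the iteration.\<close>

lemma rucp_state:
  fixes e :: "'h::chilbert_space"
  assumes cl: "\<And>T. T \<in> E \<Longrightarrow> clinear_op T" and e: "norm e = 1"
  shows "rucp E (\<lambda>T. cinner (blinfun_apply T e) e *\<^sub>C (id_blinfun :: 'k::chilbert_space \<Rightarrow>\<^sub>L 'k))"
  unfolding rucp_def
proof (intro conjI ballI allI impI)
  show "clinear_op (c *\<^sub>C (id_blinfun :: 'k \<Rightarrow>\<^sub>L 'k))" for c
    by (simp add: clinear_op_def scaleC_scaleC mult.commute)
  show "cinner (blinfun_apply (S + T) e) e *\<^sub>C (id_blinfun :: 'k \<Rightarrow>\<^sub>L 'k) = cinner (blinfun_apply S e) e *\<^sub>C id_blinfun + cinner (blinfun_apply T e) e *\<^sub>C id_blinfun" for S T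
    by (simp add: blinfun.add_left cinner_add_left op_space.scale_left_distrib)
  show "cinner (blinfun_apply (c *\<^sub>C T) e) e *\<^sub>C (id_blinfun :: 'k \<Rightarrow>\<^sub>L 'k) = c *\<^sub>C cinner (blinfun_apply T e) e *\<^sub>C id_blinfun" for c T
    by (simp add: cinner_scaleC_left)
  show "cinner (blinfun_apply id_blinfun e) e *\<^sub>C (id_blinfun :: 'k \<Rightarrow>\<^sub>L 'k) = id_blinfun"
    by (simp add: cinner_self e)
  fix k x assume x: "\<forall>i<k. \<forall>j<k. x i j \<in> E" and p: "rpos k x"
  define \<alpha> where "\<alpha> i j = cinner (blinfun_apply (x i j) e) e" for i j
  have sp: "0 \<le> Re (sform k \<alpha> v v)" for v
  proof -
    have "inner (blinfun_apply (x i j) (v j *\<^sub>C e)) (v i *\<^sub>C e) = Re (\<alpha> i j * v j * cnj (v i))" if "i < k" "j < k" for i j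
      using x cl that by (simp add: \<alpha>_def clinear_op_def inner_eq_Re_cinner cinner_scaleC_left cinner_scaleC_right mult_ac del: times_complex.sel)
    then have "rform k x (\<lambda>i. v i *\<^sub>C e) (\<lambda>i. v i *\<^sub>C e) = Re (sform k \<alpha> v v)"
      unfolding rform_def sform_def Re_sum by (intro sum.cong refl) auto
    then show ?thesis using p unfolding rpos_def by metis
  qed
  have "rpos k (scal \<alpha> :: nat \<Rightarrow> nat \<Rightarrow> 'k \<Rightarrow>\<^sub>L 'k)" by (rule rpos_scal[OF sp])
  then show "rpos k (\<lambda>i j. cinner (blinfun_apply (x i j) e) e *\<^sub>C (id_blinfun :: 'k \<Rightarrow>\<^sub>L 'k))"
    unfolding scal_def \<alpha>_def .
qed

definition mat_dsum :: "nat \<Rightarrow> nat \<Rightarrow> complex mat \<Rightarrow> complex mat \<Rightarrow> complex mat" where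
  "mat_dsum n m A B = mat (n + m) (n + m) (\<lambda>(a, b). if a < n \<and> b < n then A $$ (a, b)
     else if n \<le> a \<and> n \<le> b then B $$ (a - n, b - n) else 0)"

lemma mat_dsum_carrier [simp]: "mat_dsum n m A B \<in> carrier_mat (n + m) (n + m)"
  by (simp add: mat_dsum_def)

lemma mform_mat_dsum:
  "mform (n + m) k (\<lambda>i j. mat_dsum n m (A i j) (B i j)) v w
   = mform n k A v w + mform m k B (\<lambda>i a. v i (n + a)) (\<lambda>i a. w i (n + a))"
proof -
  have 1: "mat_act (n + m) k (\<lambda>i j. mat_dsum n m (A i j) (B i j)) v i a = mat_act n k A v i a" if "a < n" for i a
    using that unfolding mat_act_def sum_lessThan_add by (intro sum.cong refl) (simp add: mat_dsum_def)
  have 2: "mat_act (n + m) k (\<lambda>i j. mat_dsum n m (A i j) (B i j)) v i (n + a) = mat_act m k B (\<lambda>i a. v i (n + a)) i a" if "a < m" for i a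
    using that unfolding mat_act_def sum_lessThan_add by (intro sum.cong refl) (simp add: mat_dsum_def)
  show ?thesis unfolding mform_def sum_lessThan_add sum.distrib by (simp add: 1 2)
qed

lemma ucp_mat_dsum:
  assumes \<phi>: "ucp S (mat_sys n) \<phi>" and \<tau>: "ucp S (mat_sys m) \<tau>"
  shows "ucp S (mat_sys (n + m)) (\<lambda>x. mat_dsum n m (\<phi> x) (\<tau> x))"
proof -
  have car: "\<phi> x \<in> carrier_mat n n" "\<tau> x \<in> carrier_mat m m" if "x \<in> elems S" for x
    using assms that by (auto simp: ucp_def linear_map_def mat_sys_def)
  have "mat_mpos (n + m) k (\<lambda>i j. mat_dsum n m (\<phi> (x i j)) (\<tau> (x i j)))" if "x \<in> matrices_over S k" "mpos S k x" for k x
  proof -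
    have "mat_mpos n k (\<lambda>i j. \<phi> (x i j))" "mat_mpos m k (\<lambda>i j. \<tau> (x i j))"
      using assms that by (auto simp: ucp_def mat_sys_def amplify_def)
    then show ?thesis unfolding mat_mpos_mform mform_mat_dsum by (simp add: complex_nonneg_Reals_iff)
  qed
  moreover have "mat_dsum n m (\<phi> (x + y)) (\<tau> (x + y)) = mat_dsum n m (\<phi> x) (\<tau> x) + mat_dsum n m (\<phi> y) (\<tau> y)" if "x \<in> elems S" "y \<in> elems S" for x y
  proof -
    have "\<phi> (x + y) = \<phi> x + \<phi> y" "\<tau> (x + y) = \<tau> x + \<tau> y" using assms that by (auto simp: ucp_def linear_map_def)
    then show ?thesis using car[OF that(1)] car[OF that(2)] by (intro eq_matI) (auto simp: mat_dsum_def)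
  qed
  moreover have "mat_dsum n m (\<phi> (c *\<^sub>C x)) (\<tau> (c *\<^sub>C x)) = c *\<^sub>C mat_dsum n m (\<phi> x) (\<tau> x)" if "x \<in> elems S" for x c
  proof -
    have "\<phi> (c *\<^sub>C x) = c *\<^sub>C \<phi> x" "\<tau> (c *\<^sub>C x) = c *\<^sub>C \<tau> x" using assms that by (auto simp: ucp_def linear_map_def)
    then show ?thesis using car[OF that] by (intro eq_matI) (auto simp: mat_dsum_def)
  qed
  moreover have "mat_dsum n m (\<phi> (unit_elem S)) (\<tau> (unit_elem S)) = 1\<^sub>m (n + m)"
  proof -
    have "\<phi> (unit_elem S) = 1\<^sub>m n" "\<tau> (unit_elem S) = 1\<^sub>m m" using assms by (auto simp: ucp_def mat_sys_def)
    then show ?thesis by (intro eq_matI) (auto simp: mat_dsum_def)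
  qed
  ultimately show ?thesis
    unfolding ucp_def linear_map_def by (auto simp: mat_sys_def amplify_def)
qed

lemma mbd_mat_dsum:
  assumes "mbd (n + m) k (\<lambda>i j. mat_dsum n m (A i j) (B i j)) c" shows "mbd n k A c"
  unfolding mbd_def
proof (intro allI)
  fix v w :: "nat \<Rightarrow> nat \<Rightarrow> complex"
  let ?e = "\<lambda>v :: nat \<Rightarrow> nat \<Rightarrow> complex. \<lambda>i a. if a < n then v i a else 0"
  have "mform (n + m) k (\<lambda>i j. mat_dsum n m (A i j) (B i j)) (?e v) (?e w) = mform n k A v w"
    unfolding mform_mat_dsum using mform_cong[of k n A A "?e v" v "?e w" w] by simp
  moreover have "msq (n + m) k (?e v) = msq n k v" for v
    unfolding msq_def sum_lessThan_add by simp
  ultimately show "2 * Re (mform n k A v w) \<le> c * (msq n k v + msq n k w)"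
    using assms[unfolded mbd_def, rule_format, of "?e v" "?e w"] by simp
qed

lemma emb_inj: "0 < n \<Longrightarrow> A \<in> carrier_mat n n \<Longrightarrow> B \<in> carrier_mat n n \<Longrightarrow> emb n A = emb n B \<Longrightarrow> A = B"
  by (metis comp_emb)

lemma rucp_cong:
  assumes "\<And>x. x \<in> E \<Longrightarrow> f x = g x" "rucp E f" "op_space.subspace E" "id_blinfun \<in> E"
  shows "rucp E g"
  unfolding rucp_def
proof (intro conjI ballI allI impI)
  show "clinear_op (g x)" if "x \<in> E" for x using assms(1)[OF that] rucpD(1)[OF assms(2) that] by simp
  show "g (x + y) = g x + g y" if "x \<in> E" "y \<in> E" for x y
    using rucpD(2)[OF assms(2) that] assms(1)[OF that(1)] assms(1)[OF that(2)]
      assms(1)[OF op_space.subspace_add[OF assms(3) that]] by simp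
  show "g (c *\<^sub>C x) = c *\<^sub>C g x" if "x \<in> E" for x c
    using rucpD(3)[OF assms(2) that] assms(1)[OF that] assms(1)[OF op_space.subspace_scale[OF assms(3) that]] by simp
  show "g id_blinfun = id_blinfun" using rucpD(4)[OF assms(2)] assms(1)[OF assms(4)] by simp
  fix k x assume x: "\<forall>i<k. \<forall>j<k. x i j \<in> E" "rpos k x"
  then have "rpos k (\<lambda>i j. f (x i j))" by (intro rucpD(5)[OF assms(2)]) auto
  moreover have "rpos k (\<lambda>i j. f (x i j)) \<longleftrightarrow> rpos k (\<lambda>i j. g (x i j))"
    using x(1) assms(1) by (intro rpos_cong) auto
  ultimately show "rpos k (\<lambda>i j. g (x i j))" by blast
qed

section \<open>An approximate pushout\<close>

text \<open>The uniform bound in \<open>blocks\<close> is automatic: all components are contractive,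
  so the blocks of x have norm at most that of x, and \<open>norm x + 1\<close> is a strictly
  positive bound.\<close>

lemma rucp_bop:
  assumes E: "osys E" and d: "\<forall>k. 0 < d k" and car: "\<And>x k. x \<in> E \<Longrightarrow> z x k \<in> carrier_mat (d k) (d k)"
    and r: "\<And>k. rucp E (\<lambda>x. emb (d k) (z x k))"
  shows "x \<in> E \<Longrightarrow> blocks d (z x)" "rucp E (\<lambda>x. bop d (z x))"
proof -
  note E' = osysD[OF E]
  have dk: "0 < d k" for k using d by blast
  have b: "blocks d (z x)" if x: "x \<in> E" for x
  proof (rule blocks_mbd)
    show "z x k \<in> carrier_mat (d k) (d k)" for k by (rule car[OF x])
    show "mbd (d k) 1 (\<lambda>_ _. z x k) (norm x + 1)" for k
    proof -
      have "rbnd 1 (\<lambda>i j. emb (d k) (z x k)) (norm x + 1)"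
        using x by (intro rucp_rbnd[OF r E'(2,3)] rbnd_mono[OF rbnd_one]) auto
      moreover have "rbnd 1 (\<lambda>i j. emb (d k) (z x k)) (norm x + 1) \<longleftrightarrow> mbd (d k) 1 (\<lambda>_ _. z x k) (norm x + 1)"
        by (rule rbnd_emb[OF dk]) (rule car[OF x])
      ultimately show ?thesis by blast
    qed
    show "0 < norm x + 1" by (simp add: add_nonneg_pos)
  qed
  then show "x \<in> E \<Longrightarrow> blocks d (z x)" .
  show "rucp E (\<lambda>x. bop d (z x))"
    unfolding rucp_def
  proof (intro conjI ballI allI impI)
    show "clinear_op (bop d (z x))" if "x \<in> E" for x by (rule clinear_bop[OF d b[OF that]])
    show "bop d (z (x + y)) = bop d (z x) + bop d (z y)" if xy: "x \<in> E" "y \<in> E" for x y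
    proof -
      have "z (x + y) k = z x k + z y k" for k
      proof (rule emb_inj[OF dk])
        show "emb (d k) (z (x + y) k) = emb (d k) (z x k + z y k)"
          unfolding emb_add[OF dk car[OF xy(1)] car[OF xy(2)]] by (rule rucpD(2)[OF r xy])
      qed (use car xy op_space.subspace_add[OF E'(2)] in auto)
      then show ?thesis unfolding blocks_add(2)[OF d b[OF xy(1)] b[OF xy(2)], symmetric] by (metis ext)
    qed
    show "bop d (z (c *\<^sub>C x)) = c *\<^sub>C bop d (z x)" if x: "x \<in> E" for c x
    proof -
      have "z (c *\<^sub>C x) k = c *\<^sub>C z x k" for k
      proof (rule emb_inj[OF dk])
        show "emb (d k) (z (c *\<^sub>C x) k) = emb (d k) (c *\<^sub>C z x k)"
          unfolding emb_scaleC[OF dk car[OF x]] by (rule rucpD(3)[OF r x])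
      qed (use car x op_space.subspace_scale[OF E'(2)] in auto)
      then show ?thesis unfolding blocks_scaleC(2)[OF d b[OF x], symmetric] by (metis ext)
    qed
    show "bop d (z id_blinfun) = id_blinfun"
    proof -
      have "z id_blinfun k = 1\<^sub>m (d k)" for k
      proof (rule emb_inj[OF dk])
        show "emb (d k) (z id_blinfun k) = emb (d k) (1\<^sub>m (d k))"
          unfolding emb_one[OF dk] by (rule rucpD(4)[OF r])
      qed (use car E'(3) in auto)
      then show ?thesis unfolding blocks_one(2)[OF d, symmetric] by (metis ext)
    qed
    fix k x assume x: "\<forall>i<k. \<forall>j<k. x i j \<in> E" "rpos k x"
    have "mrp (d m) k (\<lambda>i j. z (x i j) m)" for m
    proof -
      have "rpos k (\<lambda>i j. emb (d m) (z (x i j) m))" using x by (intro rucpD(5)[OF r]) auto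
      moreover have "rpos k (\<lambda>i j. emb (d m) (z (x i j) m)) \<longleftrightarrow> mrp (d m) k (\<lambda>i j. z (x i j) m)"
        by (rule rpos_emb[OF dk]) (use x car in auto)
      ultimately show ?thesis by blast
    qed
    moreover have "rpos k (\<lambda>i j. bop d (z (x i j))) \<longleftrightarrow> (\<forall>m. mrp (d m) k (\<lambda>i j. z (x i j) m))"
      by (rule rpos_bop[OF d]) (use x b in auto)
    ultimately show "rpos k (\<lambda>i j. bop d (z (x i j)))" by blast
  qed
qed

lemma rbnd_bop_emb:
  assumes d: "\<forall>k. 0 < d k" and z: "\<And>i j. i < k \<Longrightarrow> j < k \<Longrightarrow> blocks d (z i j)"
  shows "rbnd k (\<lambda>i j. bop d (z i j)) c \<longleftrightarrow> (\<forall>m. rbnd k (\<lambda>i j. emb (d m) (z i j m)) c)"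
proof -
  have "rbnd k (\<lambda>i j. emb (d m) (z i j m)) c \<longleftrightarrow> mbd (d m) k (\<lambda>i j. z i j m) c" for m
    by (rule rbnd_emb) (use d z in \<open>auto simp: blocks_def\<close>)
  moreover have "rbnd k (\<lambda>i j. bop d (z i j)) c \<longleftrightarrow> (\<forall>m. mbd (d m) k (\<lambda>i j. z i j m) c)"
    by (rule rbnd_bop[OF d]) (rule z)
  ultimately show ?thesis by simp
qed

lemma finite_dim_alg: "0 < n \<Longrightarrow> \<exists>B. finite B \<and> alg n = op_space.span B"
proof -
  assume n: "0 < n"
  let ?u = "\<lambda>a b. mat n n (\<lambda>(i, j). if i = a \<and> j = b then 1 else 0 :: complex)"
  let ?B = "(\<lambda>(a, b). emb n (?u a b)) ` ({..<n} \<times> {..<n})"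
  have sub: "op_space.subspace (alg n)" by (rule osysD(2)[OF osys_alg[OF n]])
  have "?B \<subseteq> alg n" unfolding alg_def by auto
  then have 1: "op_space.span ?B \<subseteq> alg n" using sub by (rule op_space.span_minimal)
  have "emb n A \<in> op_space.span ?B" if A: "A \<in> carrier_mat n n" for A
  proof -
    let ?T = "\<Sum>a<n. \<Sum>b<n. A $$ (a, b) *\<^sub>C emb n (?u a b)"
    have T: "?T \<in> op_space.span ?B"
      by (intro op_space.span_sum op_space.span_scale op_space.span_base) auto
    then have "?T \<in> alg n" using 1 by blast
    then have "?T = emb n (comp_mat 0 n ?T)" using alg_carrier[OF n] by blast
    moreover have "comp_mat 0 n ?T = A"
    proof (rule eq_matI)
      fix i j assume "i < dim_row A" "j < dim_col A"
      then have ij: "i < n" "j < n" using A by auto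
      have "ell2_nth (blinfun_apply (emb n (?u a b)) (ket j)) i = (if i = a \<and> j = b then 1 else 0)" if "a < n" "b < n" for a b
        using comp_mat_index[OF ij, of 0 "emb n (?u a b)"] comp_emb[OF n, of "?u a b"] ij by simp
      then have "ell2_nth (blinfun_apply ?T (ket j)) i = (\<Sum>a<n. \<Sum>b<n. if a = i then (if b = j then A $$ (i, j) else 0) else 0)"
        unfolding blinfun.sum_left ell2_nth_sum by (intro sum.cong refl) auto
      also have "\<dots> = (\<Sum>a<n. if a = i then A $$ (i, j) else 0)" using ij by (intro sum.cong refl) auto
      also have "\<dots> = A $$ (i, j)" using ij by simp
      finally show "comp_mat 0 n ?T $$ (i, j) = A $$ (i, j)" using comp_mat_index[OF ij, of 0 ?T] by simp
    qed (use A in \<open>auto simp: comp_mat_def\<close>)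
    ultimately show ?thesis using T by simp
  qed
  then have "alg n = op_space.span ?B" using 1 unfolding alg_def by blast
  then show ?thesis by (intro exI[of _ ?B]) auto
qed

text \<open>The last assumption makes \<open>\<gamma> k \<circ> \<Theta> k\<close> close to \<open>\<Theta> (k + 1)\<close>: the difference of the two is
  \<open>\<delta> / 2 ^ k\<close> times \<open>(\<gamma> k - \<gamma>' k) \<circ> \<Theta> k\<close>, which vanishes on scalars.\<close>

locale matrix_chain =
  fixes E :: "('g::chilbert_space \<Rightarrow>\<^sub>L 'g) set" and N :: "nat \<Rightarrow> nat" and \<Theta> :: "nat \<Rightarrow> ('g \<Rightarrow>\<^sub>L 'g) \<Rightarrow> complex mat"
    and \<gamma> \<gamma>' :: "nat \<Rightarrow> (ell2 \<Rightarrow>\<^sub>L ell2) \<Rightarrow> complex mat" and \<delta> :: real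
  assumes E: "osys E" and Efin: "finite_dim E" and N: "\<And>k. 0 < N k" and \<delta>: "0 < \<delta>" "\<delta> \<le> 1"
    and \<Theta>: "\<And>k. ucp (op_sys E) (mat_sys (N k)) (\<Theta> k)"
    and \<Theta>x: "\<And>k. expands E (\<lambda>x. emb (N k) (\<Theta> k x)) (1 + 2 * (\<delta> / 2 ^ k))"
    and \<gamma>: "\<And>k. ucp (op_sys {T. clinear_op T}) (mat_sys (N (Suc k))) (\<gamma> k)"
    and \<gamma>': "\<And>k. ucp (op_sys {T. clinear_op T}) (mat_sys (N (Suc k))) (\<gamma>' k)"
    and step: "\<And>k x. x \<in> E \<Longrightarrow> \<Theta> (Suc k) x + of_real (\<delta> / 2 ^ k) *\<^sub>C \<gamma>' k (emb (N k) (\<Theta> k x))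
      = of_real (1 + \<delta> / 2 ^ k) *\<^sub>C \<gamma> k (emb (N k) (\<Theta> k x))"
begin

definition \<beta> :: "nat \<Rightarrow> (ell2 \<Rightarrow>\<^sub>L ell2) \<Rightarrow> complex mat" where
  "\<beta> k = rec_nat (comp_mat 0 (N 0)) (\<lambda>k f T. \<gamma> k (emb (N k) (f T))) k"

lemma \<beta>_simps: "\<beta> 0 T = comp_mat 0 (N 0) T" "\<beta> (Suc k) T = \<gamma> k (emb (N k) (\<beta> k T))"
  by (simp_all add: \<beta>_def)

definition th :: "nat \<Rightarrow> ('g \<Rightarrow>\<^sub>L 'g) \<Rightarrow> ell2 \<Rightarrow>\<^sub>L ell2" where "th k x = emb (N k) (\<Theta> k x)"
definition be :: "nat \<Rightarrow> (ell2 \<Rightarrow>\<^sub>L ell2) \<Rightarrow> ell2 \<Rightarrow>\<^sub>L ell2" where "be k T = emb (N k) (\<beta> k T)"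
definition ga :: "nat \<Rightarrow> (ell2 \<Rightarrow>\<^sub>L ell2) \<Rightarrow> ell2 \<Rightarrow>\<^sub>L ell2" where "ga k T = emb (N (Suc k)) (\<gamma> k T)"
definition ga' :: "nat \<Rightarrow> (ell2 \<Rightarrow>\<^sub>L ell2) \<Rightarrow> ell2 \<Rightarrow>\<^sub>L ell2" where "ga' k T = emb (N (Suc k)) (\<gamma>' k T)"
text \<open>A fixed state. Subtracting its value removes the scalar part of an element, on which all
  ucp maps agree.\<close>

definition \<sigma> :: "(ell2 \<Rightarrow>\<^sub>L ell2) \<Rightarrow> complex" where "\<sigma> T = cinner (blinfun_apply T (ket 0)) (ket 0)"

abbreviation "A \<equiv> alg (N 0)"

lemmas E' = osysD[OF E]
lemmas alg' = osysD[OF osys_alg[OF N]]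

lemma alg_cl: "T \<in> alg (N k) \<Longrightarrow> T \<in> {T. clinear_op T}"
  using alg'(1) by blast

lemma \<Theta>_car: "x \<in> E \<Longrightarrow> \<Theta> k x \<in> carrier_mat (N k) (N k)"
  by (rule ucp_mat_rucp(2)[OF N \<Theta> E])

lemma rucp_th: "rucp E (th k)"
  unfolding th_def[abs_def] by (rule ucp_mat_rucp(1)[OF N \<Theta> E])

lemma th_alg: "x \<in> E \<Longrightarrow> th k x \<in> alg (N k)"
  unfolding th_def alg_def using \<Theta>_car by blast

lemma expands_th: "expands E (th k) (1 + 2 * (\<delta> / 2 ^ k))"
  unfolding th_def[abs_def] by (rule \<Theta>x)

lemma \<gamma>_car: "T \<in> alg (N k) \<Longrightarrow> \<gamma> k T \<in> carrier_mat (N (Suc k)) (N (Suc k))"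
  "T \<in> alg (N k) \<Longrightarrow> \<gamma>' k T \<in> carrier_mat (N (Suc k)) (N (Suc k))"
  using \<gamma>[of k] \<gamma>'[of k] alg_cl[of T k] by (auto simp: ucp_def linear_map_def op_sys_def mat_sys_def)

lemma rucp_ga: "rucp (alg (N k)) (ga k)" "rucp (alg (N k)) (ga' k)"
  unfolding ga_def[abs_def] ga'_def[abs_def]
  using ucp_mono[OF \<gamma>, of "alg (N k)" k] ucp_mono[OF \<gamma>', of "alg (N k)" k] alg_cl
  by (auto intro!: ucp_mat_rucp(1)[OF N _ osys_alg[OF N]])

lemma th_Suc:
  assumes x: "x \<in> E"
  shows "th (Suc k) x = ga k (th k x) + (\<delta> / 2 ^ k) *\<^sub>R (ga k (th k x) - ga' k (th k x))"
proof -
  let ?g = "\<gamma> k (emb (N k) (\<Theta> k x))" and ?g' = "\<gamma>' k (emb (N k) (\<Theta> k x))"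
  have c: "?g \<in> carrier_mat (N (Suc k)) (N (Suc k))" "?g' \<in> carrier_mat (N (Suc k)) (N (Suc k))"
    using \<gamma>_car[of "th k x" k] th_alg[OF x] by (auto simp: th_def)
  have "emb (N (Suc k)) (\<Theta> (Suc k) x + of_real (\<delta> / 2 ^ k) *\<^sub>C ?g') = emb (N (Suc k)) (of_real (1 + \<delta> / 2 ^ k) *\<^sub>C ?g)"
    unfolding step[OF x] ..
  then have "th (Suc k) x + (\<delta> / 2 ^ k) *\<^sub>R ga' k (th k x) = (1 + \<delta> / 2 ^ k) *\<^sub>R ga k (th k x)"
    using c \<Theta>_car[OF x, of "Suc k"]
    by (simp only: emb_add[OF N] emb_scaleC[OF N] scaleC_mat_carrier th_def ga_def ga'_def op_scaleR_scaleC)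
  then show ?thesis by (simp add: algebra_simps)
qed

lemma \<beta>_car: "T \<in> A \<Longrightarrow> \<beta> k T \<in> carrier_mat (N k) (N k)"
proof (induction k)
  case (Suc k)
  then have "emb (N k) (\<beta> k T) \<in> alg (N k)" unfolding alg_def by blast
  then show ?case unfolding \<beta>_simps by (rule \<gamma>_car)
qed (simp add: \<beta>_simps)

lemma be_alg: "T \<in> A \<Longrightarrow> be k T \<in> alg (N k)"
  unfolding be_def alg_def[of "N k"] by (rule imageI) (rule \<beta>_car)

lemma be_0: "T \<in> A \<Longrightarrow> be 0 T = T"
  unfolding be_def \<beta>_simps using alg_carrier[OF N] by metis

lemma be_Suc: "be (Suc k) T = ga k (be k T)"
  unfolding be_def ga_def \<beta>_simps ..

lemma rucp_be: "rucp A (be k)"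
proof (induction k)
  case 0
  have "rucp A (\<lambda>T. T)" by (rule rucp_id) (rule alg'(1))
  then show ?case by (rule rucp_cong[rotated]) (use alg'(2,3) be_0 in auto)
next
  case (Suc k)
  have "rucp A (\<lambda>T. ga k (be k T))"
    by (rule rucp_compose[OF Suc _ rucp_ga(1)]) (use be_alg in blast)
  then show ?case unfolding be_Suc[abs_def] .
qed

lemma \<sigma>_lin: "\<sigma> (S + T) = \<sigma> S + \<sigma> T" "\<sigma> id_blinfun = 1"
  by (simp_all add: \<sigma>_def blinfun.add_left cinner_add_left cinner_self norm_ket)

lemma rucp_\<sigma>: "rucp A (\<lambda>T. \<sigma> T *\<^sub>C (id_blinfun :: 'k::chilbert_space \<Rightarrow>\<^sub>L 'k))"
  unfolding \<sigma>_def by (rule rucp_state[OF alg'(1) norm_ket])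

lemma emb_\<sigma>: "0 < n \<Longrightarrow> emb n (\<sigma> T *\<^sub>C 1\<^sub>m n) = \<sigma> T *\<^sub>C id_blinfun"
  by (simp add: emb_scaleC emb_one)

text \<open>Block \<open>0\<close> is there so that blocks \<open>0\<close> and \<open>1\<close> of \<open>I x + J T\<close> already control \<open>x\<close> up to scalars.\<close>

definition bdim :: "nat \<Rightarrow> nat" where "bdim k = (case k of 0 \<Rightarrow> N 0 | Suc k \<Rightarrow> N k)"
text \<open>Block 0 is a convex combination and hence still ucp. Subtracting the state of block 1
  from block 0 cancels \<open>T\<close> in \<open>I x + J T\<close> and leaves \<delta> times
  \<open>th 0 x\<close> modulo scalars. The small weight \<delta> keeps block 0 within 2 \<delta>
  \<open>norm x\<close> of that of \<open>J (th 0 x)\<close>.\<close>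

definition iz :: "('g \<Rightarrow>\<^sub>L 'g) \<Rightarrow> nat \<Rightarrow> complex mat" where
  "iz x k = (case k of 0 \<Rightarrow> of_real \<delta> *\<^sub>C \<Theta> 0 x + of_real (1 - \<delta>) *\<^sub>C (\<sigma> (th 0 x) *\<^sub>C 1\<^sub>m (N 0)) | Suc k \<Rightarrow> \<Theta> k x)"
definition jz :: "(ell2 \<Rightarrow>\<^sub>L ell2) \<Rightarrow> nat \<Rightarrow> complex mat" where
  "jz T k = (case k of 0 \<Rightarrow> \<sigma> T *\<^sub>C 1\<^sub>m (N 0) | Suc k \<Rightarrow> \<beta> k T)"

definition I :: "('g \<Rightarrow>\<^sub>L 'g) \<Rightarrow> ell2 \<Rightarrow>\<^sub>L ell2" where "I x = bop bdim (iz x)"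
definition J :: "(ell2 \<Rightarrow>\<^sub>L ell2) \<Rightarrow> ell2 \<Rightarrow>\<^sub>L ell2" where "J T = bop bdim (jz T)"

lemma bdim: "\<forall>k. 0 < bdim k" using N by (simp add: bdim_def split: nat.split)

lemma iz_car: "x \<in> E \<Longrightarrow> iz x k \<in> carrier_mat (bdim k) (bdim k)"
  using \<Theta>_car by (auto simp: iz_def bdim_def split: nat.split)

lemma jz_car: "T \<in> A \<Longrightarrow> jz T k \<in> carrier_mat (bdim k) (bdim k)"
  using \<beta>_car by (auto simp: jz_def bdim_def split: nat.split)

lemma emb_iz: "x \<in> E \<Longrightarrow> emb (bdim 0) (iz x 0) = \<delta> *\<^sub>R th 0 x + (1 - \<delta>) *\<^sub>R (\<sigma> (th 0 x) *\<^sub>C id_blinfun)"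
  "emb (bdim (Suc k)) (iz x (Suc k)) = th k x"
  using \<Theta>_car[of x 0] N[of 0]
  by (simp_all only: iz_def bdim_def nat.case emb_add emb_scaleC scaleC_mat_carrier one_carrier_mat emb_one th_def op_scaleR_scaleC)

lemma emb_jz: "emb (bdim 0) (jz T 0) = \<sigma> T *\<^sub>C id_blinfun" "emb (bdim (Suc k)) (jz T (Suc k)) = be k T"
  using N by (simp_all add: jz_def bdim_def be_def emb_\<sigma>)

lemma rucp_\<sigma>_th: "rucp E (\<lambda>x. \<sigma> (th 0 x) *\<^sub>C (id_blinfun :: 'k::chilbert_space \<Rightarrow>\<^sub>L 'k))"
  by (rule rucp_compose[OF rucp_th _ rucp_\<sigma>]) (use th_alg in blast)

lemma rucp_emb_iz: "rucp E (\<lambda>x. emb (bdim k) (iz x k))"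
proof (cases k)
  case 0
  have "rucp E (\<lambda>x. \<delta> *\<^sub>R th 0 x + (1 - \<delta>) *\<^sub>R (\<sigma> (th 0 x) *\<^sub>C id_blinfun))"
    using \<delta> by (intro rucp_convex rucp_th rucp_\<sigma>_th) auto
  then show ?thesis unfolding 0 by (rule rucp_cong[rotated]) (use E'(2,3) emb_iz(1) in auto)
next
  case (Suc l) show ?thesis unfolding Suc emb_iz(2) by (rule rucp_th)
qed

lemma rucp_emb_jz: "rucp A (\<lambda>T. emb (bdim k) (jz T k))"
proof (cases k)
  case 0 show ?thesis unfolding 0 emb_jz by (rule rucp_\<sigma>)
next
  case (Suc l) show ?thesis unfolding Suc emb_jz by (rule rucp_be)
qed

lemma blocks_iz: "x \<in> E \<Longrightarrow> blocks bdim (iz x)"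
  by (rule rucp_bop(1)[OF E bdim iz_car rucp_emb_iz])

lemma blocks_jz: "T \<in> A \<Longrightarrow> blocks bdim (jz T)"
  by (rule rucp_bop(1)[OF osys_alg[OF N] bdim jz_car rucp_emb_jz])

lemma rucp_I: "rucp E I"
  unfolding I_def[abs_def] by (rule rucp_bop(2)[OF E bdim iz_car rucp_emb_iz])

lemma rucp_J: "rucp A J"
  unfolding J_def[abs_def] by (rule rucp_bop(2)[OF osys_alg[OF N] bdim jz_car rucp_emb_jz])

lemma J_block: "T \<in> A \<Longrightarrow> emb (N 0) (comp_mat (N 0) (N 0) (J T)) = T"
proof -
  assume T: "T \<in> A"
  have "comp_mat (offs bdim 1) (bdim 1) (bop bdim (jz T)) = jz T 1"
    by (rule comp_mat_bop[OF bdim blocks_jz[OF T]])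
  then show ?thesis unfolding J_def using be_0[OF T] by (simp add: offs_def bdim_def jz_def be_def)
qed

lemma half_power_sum: "(\<Sum>r<k. c / 2 ^ r) \<le> 2 * (c :: real)" if "0 \<le> c"
proof -
  have "(\<Sum>r<k. c / 2 ^ r) = 2 * c - 2 * c / 2 ^ k"
    by (induction k) (simp_all add: field_simps)
  then show ?thesis using that by simp
qed

text \<open>By \<open>th_Suc\<close>, passing from \<open>ga k (th k x)\<close> to
  \<open>th (Suc k) x\<close> costs at most 2 \<delta> / 2^k times the norm of x. The maps
  \<open>ga k\<close> are contractive, so earlier errors are not magnified and the total is at most
  4 \<delta> times the norm.\<close>

lemma I_close:
  assumes x: "x \<in> E" shows "norm (I x - J (th 0 x)) \<le> 4 * \<delta> * norm x"
proof -
  have T: "th 0 x \<in> A" by (rule th_alg[OF x])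
  have sub: "op_space.subspace (alg (N k))" for k by (rule alg'(2))
  have nth: "norm (th k x) \<le> norm x" for k by (rule rucp_norm_le[OF rucp_th E'(2,3) x])
  have nb: "norm (th k x - be k (th 0 x)) \<le> (\<Sum>r<k. 2 * \<delta> * norm x / 2 ^ r)" for k
  proof (induction k)
    case 0 show ?case using be_0[OF T] by simp
  next
    case (Suc k)
    have e: "th (Suc k) x - be (Suc k) (th 0 x) = ga k (th k x - be k (th 0 x)) + (\<delta> / 2 ^ k) *\<^sub>R (ga k (th k x) - ga' k (th k x))"
      unfolding th_Suc[OF x] be_Suc rucp_diff[OF rucp_ga(1) sub th_alg[OF x] be_alg[OF T]] by simp
    have "norm (th (Suc k) x - be (Suc k) (th 0 x)) \<le> norm (ga k (th k x - be k (th 0 x))) + \<bar>\<delta> / 2 ^ k\<bar> * norm (ga k (th k x) - ga' k (th k x))"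
      unfolding e norm_scaleR[symmetric] by (rule norm_triangle_ineq)
    also have "\<dots> \<le> norm (th k x - be k (th 0 x)) + \<bar>\<delta> / 2 ^ k\<bar> * (2 * norm x)"
    proof (intro add_mono mult_left_mono)
      show "norm (ga k (th k x - be k (th 0 x))) \<le> norm (th k x - be k (th 0 x))"
        by (rule rucp_norm_le[OF rucp_ga(1) alg'(2,3)]) (intro op_space.subspace_diff[OF sub] th_alg[OF x] be_alg[OF T])
      have "norm (ga k (th k x)) \<le> norm x" "norm (ga' k (th k x)) \<le> norm x"
        using rucp_norm_le[OF rucp_ga(1) alg'(2,3) th_alg[OF x]] rucp_norm_le[OF rucp_ga(2) alg'(2,3) th_alg[OF x]] nth[of k]
        by (metis order_trans)+
      then show "norm (ga k (th k x) - ga' k (th k x)) \<le> 2 * norm x"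
        using norm_triangle_ineq4[of "ga k (th k x)" "ga' k (th k x)"] by linarith
    qed simp
    finally have "norm (th (Suc k) x - be (Suc k) (th 0 x)) \<le> norm (th k x - be k (th 0 x)) + \<bar>\<delta> / 2 ^ k\<bar> * (2 * norm x)" .
    moreover have "\<bar>\<delta> / 2 ^ k\<bar> * (2 * norm x) = 2 * \<delta> * norm x / 2 ^ k" using \<delta>(1) by simp
    ultimately show ?case using Suc unfolding sum.lessThan_Suc by linarith
  qed
  have nb4: "norm (th k x - be k (th 0 x)) \<le> 4 * \<delta> * norm x" for k
    using nb[of k] half_power_sum[of "2 * \<delta> * norm x" k] \<delta>(1) by simp
  have n0: "norm (\<sigma> (th 0 x) *\<^sub>C (id_blinfun :: ell2 \<Rightarrow>\<^sub>L ell2)) \<le> norm x"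
    by (rule rucp_norm_le[OF rucp_\<sigma>_th E'(2,3) x])
  have e0: "emb (bdim 0) (iz x 0) - emb (bdim 0) (jz (th 0 x) 0) = \<delta> *\<^sub>R (th 0 x - \<sigma> (th 0 x) *\<^sub>C id_blinfun)"
    unfolding emb_iz(1)[OF x] emb_jz by (simp add: algebra_simps)
  have nbl: "norm (emb (bdim k) (iz x k) - emb (bdim k) (jz (th 0 x) k)) \<le> 4 * \<delta> * norm x" for k
  proof (cases k)
    case 0
    have "norm (th 0 x - \<sigma> (th 0 x) *\<^sub>C id_blinfun) \<le> norm x + norm x"
      by (rule order_trans[OF norm_triangle_ineq4]) (intro add_mono nth n0)
    then have "norm (\<delta> *\<^sub>R (th 0 x - \<sigma> (th 0 x) *\<^sub>C id_blinfun)) \<le> \<delta> * (norm x + norm x)"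
      using \<delta>(1) by simp
    also have "\<dots> \<le> 4 * \<delta> * norm x" using \<delta>(1) by simp
    finally show ?thesis unfolding 0 e0 .
  next
    case (Suc l) show ?thesis unfolding Suc emb_iz(2) emb_jz(2) by (rule nb4)
  qed
  have "I x - J (th 0 x) = bop bdim (\<lambda>k. iz x k + (-1) *\<^sub>C jz (th 0 x) k)"
    unfolding I_def J_def blocks_add(2)[OF bdim blocks_iz[OF x] blocks_scaleC(1)[OF bdim blocks_jz[OF T]]] blocks_scaleC(2)[OF bdim blocks_jz[OF T]]
    by simp
  moreover have "rbnd 1 (\<lambda>i j. bop bdim (\<lambda>k. iz x k + (-1) *\<^sub>C jz (th 0 x) k)) (4 * \<delta> * norm x)"
  proof -
    have "emb (bdim k) (iz x k + (-1) *\<^sub>C jz (th 0 x) k) = emb (bdim k) (iz x k) - emb (bdim k) (jz (th 0 x) k)" for k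
      using bdim iz_car[OF x, of k] jz_car[OF T, of k] by (simp add: emb_add emb_scaleC del: op_space.scale_minus_left) simp
    then have "rbnd 1 (\<lambda>i j. emb (bdim k) (iz x k + (-1) *\<^sub>C jz (th 0 x) k)) (4 * \<delta> * norm x)" for k
      using rbnd_mono[OF rbnd_one nbl[of k]] by simp
    moreover have bl: "blocks bdim (\<lambda>k. iz x k + (-1) *\<^sub>C jz (th 0 x) k)"
      by (rule blocks_add(1)[OF bdim blocks_iz[OF x] blocks_scaleC(1)[OF bdim blocks_jz[OF T]]])
    have "rbnd 1 (\<lambda>i j. bop bdim (\<lambda>k. iz x k + (-1) *\<^sub>C jz (th 0 x) k)) (4 * \<delta> * norm x)
        \<longleftrightarrow> (\<forall>m. rbnd 1 (\<lambda>i j. emb (bdim m) (iz x m + (-1) *\<^sub>C jz (th 0 x) m)) (4 * \<delta> * norm x))"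
      by (rule rbnd_bop_emb[OF bdim]) (rule bl)
    ultimately show ?thesis by blast
  qed
  ultimately show ?thesis using \<delta>(1) by (intro norm_le_rbnd) auto
qed

lemma I_inj: "inj_on I E"
proof (rule inj_onI)
  fix x y assume xy: "x \<in> E" "y \<in> E" "I x = I y"
  have d: "x - y \<in> E" using xy op_space.subspace_diff[OF E'(2)] by blast
  have "comp_mat (offs bdim 1) (bdim 1) (I (x - y)) = iz (x - y) 1"
    unfolding I_def by (rule comp_mat_bop[OF bdim blocks_iz[OF d]])
  moreover have "I (x - y) = 0" using rucp_diff[OF rucp_I E'(2) xy(1,2)] xy(3) by simp
  moreover have "comp_mat (offs bdim 1) (bdim 1) 0 = 0\<^sub>m (bdim 1) (bdim 1)"
    by (rule eq_matI) (auto simp: comp_mat_def)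
  ultimately have "\<Theta> 0 (x - y) = 0\<^sub>m (N 0) (N 0)" by (simp add: iz_def bdim_def)
  moreover have "emb (N 0) (0\<^sub>m (N 0) (N 0)) = 0"
  proof -
    have "0\<^sub>m (N 0) (N 0) = 0 *\<^sub>C (1\<^sub>m (N 0) :: complex mat)" by (rule eq_matI) auto
    then show ?thesis using emb_scaleC[OF N, of "1\<^sub>m (N 0)" 0 0] by simp
  qed
  ultimately have "th 0 (x - y) = 0" by (simp add: th_def)
  then have "rbnd 1 (\<lambda>i j. x - y) ((1 + 2 * (\<delta> / 2 ^ 0)) * 0)"
    by (intro expandsD[OF expands_th[of 0]]) (use d rbnd_zero in auto)
  then have "norm (x - y) \<le> 0" by (intro norm_le_rbnd) auto
  then show "x = y" by simp
qed

text \<open>This is where the infinite chain pays off. Positivity of block m + 1 gives, by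
  \<open>expands_almost_positive\<close> with the bound K, that x + (\<delta> / 2^m) K is positive.
  Letting m grow yields exact positivity, although each single block is only almost an
  embedding.\<close>

lemma I_pos:
  assumes x: "\<And>i j. x i j \<in> E" and p: "rpos k (\<lambda>i j. I (x i j))"
  shows "rpos k x"
proof -
  have b: "mrp (bdim m) k (\<lambda>i j. iz (x i j) m)" for m
    using p unfolding I_def by (subst (asm) rpos_bop[OF bdim]) (auto intro: blocks_iz x)
  have pt: "rpos k (\<lambda>i j. th m (x i j))" for m
  proof -
    have "rpos k (\<lambda>i j. emb (N m) (\<Theta> m (x i j))) \<longleftrightarrow> mrp (N m) k (\<lambda>i j. \<Theta> m (x i j))"
      by (rule rpos_emb[OF N]) (rule \<Theta>_car[OF x])
    then show ?thesis using b[of "Suc m"] by (simp add: th_def iz_def bdim_def)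
  qed
  obtain K where K: "0 \<le> K" "rbnd k x K" using rbnd_ex by blast
  have m: "rpos k (\<lambda>i j. x i j + (\<delta> / 2 ^ m) *\<^sub>R unit_scal (of_real K) i j)" for m
  proof (rule expands_almost_positive[OF E rucp_th expands_th _ x pt])
    show "0 \<le> \<delta> / 2 ^ m" using \<delta> by simp
    show "rpos k (\<lambda>i j. unit_scal (of_real K) i j - th m (x i j))"
      by (intro rpos_unit_diff rucp_rbnd[OF rucp_th E'(2,3) x K(2)])
  qed
  show ?thesis
  proof (rule rpos_limit[where c = "\<lambda>h. K * nsq k h"])
    fix h and \<eta> :: real assume \<eta>: "0 < \<eta>"
    obtain m where "1 / 2 ^ m < \<eta> / \<delta>" using \<eta> \<delta> real_arch_pow_inv[of "\<eta> / \<delta>" "1/2"] by (auto simp: power_one_over)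
    then have le: "\<delta> / 2 ^ m \<le> \<eta>" using \<delta> by (simp add: field_simps)
    have "0 \<le> rform k x h h + \<delta> / 2 ^ m * (K * nsq k h)"
      using m[of m] unfolding rpos_def rform_add rform_scaleR rform_scal_diag nsq_inner[symmetric] by blast
    also have "\<dots> \<le> rform k x h h + \<eta> * (K * nsq k h)"
      using le K(1) by (intro add_left_mono mult_right_mono) auto
    finally show "0 \<le> rform k x h h + \<eta> * (K * nsq k h)" .
  qed (use K(1) in simp)
qed

end

section \<open>The amalgam F and its 1-exactness\<close>

context matrix_chain
begin

definition F :: "(ell2 \<Rightarrow>\<^sub>L ell2) set" where "F = op_space.span (I ` E \<union> J ` A)"

lemma span_image_I: "op_space.span (I ` E) = I ` E"
  using rucp_image_subspace[OF rucp_I E'(2)] by (simp add: op_space.span_eq_iff)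

lemma span_image_J: "op_space.span (J ` A) = J ` A"
  using rucp_image_subspace[OF rucp_J alg'(2)] by (simp add: op_space.span_eq_iff)

lemma F_elem: "z \<in> F \<Longrightarrow> \<exists>x T. x \<in> E \<and> T \<in> A \<and> z = I x + J T"
  unfolding F_def op_space.span_Un span_image_I span_image_J by blast

lemma I_F: "I ` E \<subseteq> F" and J_F: "J ` A \<subseteq> F"
  unfolding F_def using op_space.span_superset[of "I ` E \<union> J ` A"] by blast+

lemma osys_F: "osys F"
  unfolding F_def
proof (rule osys_span)
  have o: "osys (I ` E)" "osys (J ` A)"
    using rucp_image_osys[OF rucp_I E] rucp_image_osys[OF rucp_J osys_alg[OF N]] .
  fix T assume T: "T \<in> I ` E \<union> J ` A"
  then show "clinear_op T" using osysD(1)[OF o(1)] osysD(1)[OF o(2)] by blast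
  have "\<exists>S\<in>I ` E \<union> J ` A. is_adjoint S T" using T osysD(4)[OF o(1)] osysD(4)[OF o(2)] by blast
  then show "\<exists>S\<in>op_space.span (I ` E \<union> J ` A). is_adjoint S T"
    using op_space.span_superset[of "I ` E \<union> J ` A"] by blast
next
  have "id_blinfun \<in> I ` E" using rucpD(4)[OF rucp_I] E'(3) by (metis imageI)
  then show "id_blinfun \<in> op_space.span (I ` E \<union> J ` A)"
    using op_space.span_superset[of "I ` E \<union> J ` A"] by blast
qed

lemma finite_F: "\<exists>B. finite B \<and> F = op_space.span B"
proof -
  obtain B where B: "finite B" "E = op_space.span B" using Efin unfolding finite_dim_def by blast
  obtain B' where B': "finite B'" "A = op_space.span B'" using finite_dim_alg[OF N] by blast
  have 1: "I ` E = op_space.span (I ` B)" using rucp_image_span[of B I] rucp_I unfolding B(2) by blast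
  have 2: "J ` A = op_space.span (J ` B')" using rucp_image_span[of B' J] rucp_J unfolding B'(2) by blast
  have "F = op_space.span (I ` B \<union> J ` B')"
    unfolding F_def op_space.span_Un span_image_I span_image_J unfolding 1 2 ..
  moreover have "finite (I ` B \<union> J ` B')" using B(1) B'(1) by simp
  ultimately show ?thesis by metis
qed

lemma operator_system_F: "operator_system F" "finite_dim F"
proof -
  obtain B where B: "finite B" "F = op_space.span B" using finite_F by metis
  show "operator_system F" using osys_F closed_span_finite[OF B(1)] unfolding operator_system_iff B(2) by simp
  show "finite_dim F" unfolding finite_dim_def using B by metis
qed

lemma operator_system_I: "operator_system (I ` E)" "finite_dim (I ` E)"
proof -
  obtain B where B: "finite B" "E = op_space.span B" using Efin unfolding finite_dim_def by blast
  have "I ` E = op_space.span (I ` B)" using rucp_image_span[of B I] rucp_I unfolding B(2) by blast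
  moreover have "osys (I ` E)" by (rule rucp_image_osys[OF rucp_I E])
  moreover have "finite (I ` B)" using B(1) by simp
  ultimately show "operator_system (I ` E)" "finite_dim (I ` E)"
    using closed_span_finite[of "I ` B"] unfolding operator_system_iff finite_dim_def by metis+
qed

text \<open>\<open>U m\<close> is block m of I X + J T. Bounds on blocks 0 and 1 control X modulo
  scalars up to a factor of order 1 / \<delta>. Each later block is a ucp image of its predecessor
  plus an error that depends on X modulo scalars and carries a factor \<delta>, so \<delta> cancels
  and the tail is geometric.\<close>

lemma blocks_bound:
  fixes X :: "nat \<Rightarrow> nat \<Rightarrow> 'g \<Rightarrow>\<^sub>L 'g" and T :: "nat \<Rightarrow> nat \<Rightarrow> ell2 \<Rightarrow>\<^sub>L ell2"
  defines "U \<equiv> \<lambda>m i j. emb (bdim m) (iz (X i j) m + jz (T i j) m)"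
  assumes X: "\<And>i j. i < k \<Longrightarrow> j < k \<Longrightarrow> X i j \<in> E" and T: "\<And>i j. i < k \<Longrightarrow> j < k \<Longrightarrow> T i j \<in> A"
    and c: "0 \<le> c" and b: "\<And>m. m < K + 2 \<Longrightarrow> rbnd k (U m) c"
  shows "rbnd k (U m) ((1 + 24 / 2 ^ K) * c)"
proof -
  note sub = alg'(2)
  have U0: "U 0 i j = \<delta> *\<^sub>R th 0 (X i j) + (1 - \<delta>) *\<^sub>R (\<sigma> (th 0 (X i j)) *\<^sub>C id_blinfun) + \<sigma> (T i j) *\<^sub>C id_blinfun"
    if "i < k" "j < k" for i j
    unfolding U_def using bdim iz_car[OF X[OF that], of 0] jz_car[OF T[OF that], of 0]
    by (simp only: emb_add emb_iz(1)[OF X[OF that]] emb_jz(1))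
  have US: "U (Suc m) i j = th m (X i j) + be m (T i j)" if "i < k" "j < k" for i j m
    unfolding U_def using bdim iz_car[OF X[OF that], of "Suc m"] jz_car[OF T[OF that], of "Suc m"]
    by (simp only: emb_add emb_iz(2) emb_jz(2))
  have Ualg: "U (Suc m) i j \<in> alg (N m)" if "i < k" "j < k" for i j m
    unfolding US[OF that] by (intro op_space.subspace_add[OF sub] th_alg be_alg X T that)
  define s where "s i j = \<sigma> (th 0 (X i j))" for i j
  \<comment> \<open>The scalar part may be dropped: \<open>ga m\<close> and \<open>ga' m\<close>
    agree on scalars, so their difference sees X modulo scalars only.\<close>
  define X' where "X' i j = X i j - s i j *\<^sub>C id_blinfun" for i j
  have sE: "s i j *\<^sub>C id_blinfun \<in> E" for i j by (intro op_space.subspace_scale[OF E'(2)] E'(3))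
  have X': "X' i j \<in> E" if "i < k" "j < k" for i j
    unfolding X'_def by (intro op_space.subspace_diff[OF E'(2)] X that sE)
  have thX': "th m (X' i j) = th m (X i j) - s i j *\<^sub>C id_blinfun" if "i < k" "j < k" for i j m
    unfolding X'_def rucp_diff[OF rucp_th E'(2) X[OF that] sE] by (simp add: rucpD(3)[OF rucp_th E'(3)] rucpD(4)[OF rucp_th])
  have b1: "rbnd k (\<lambda>i j. \<sigma> (U (Suc 0) i j) *\<^sub>C (id_blinfun :: ell2 \<Rightarrow>\<^sub>L ell2)) c"
    by (rule rucp_rbnd[OF rucp_\<sigma> alg'(2,3)]) (use Ualg b[of "Suc 0"] in auto)
  \<comment> \<open>Block 1 contains T unchanged, so subtracting its state removes T from block
    0.\<close>
  have "rbnd k (\<lambda>i j. (1 / \<delta>) *\<^sub>R (U 0 i j - \<sigma> (U (Suc 0) i j) *\<^sub>C id_blinfun)) (\<bar>1 / \<delta>\<bar> * (c + c))"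
    by (intro rbnd_scaleR rbnd_diff b b1) simp
  also have "?this \<longleftrightarrow> rbnd k (\<lambda>i j. th 0 (X' i j)) (\<bar>1 / \<delta>\<bar> * (c + c))"
  proof (rule rbnd_cong)
    fix i j assume ij: "i < k" "j < k"
    have "\<sigma> (U (Suc 0) i j) = s i j + \<sigma> (T i j)"
      unfolding US[OF ij] \<sigma>_lin s_def be_0[OF T[OF ij]] ..
    then have "U 0 i j - \<sigma> (U (Suc 0) i j) *\<^sub>C id_blinfun = \<delta> *\<^sub>R (th 0 (X i j) - s i j *\<^sub>C id_blinfun)"
      unfolding U0[OF ij] s_def[symmetric] by (simp add: op_space.scale_left_distrib algebra_simps)
    then show "(1 / \<delta>) *\<^sub>R (U 0 i j - \<sigma> (U (Suc 0) i j) *\<^sub>C id_blinfun) = th 0 (X' i j)"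
      unfolding thX'[OF ij] using \<delta> by simp
  qed
  finally have "rbnd k X' ((1 + 2 * (\<delta> / 2 ^ 0)) * (\<bar>1 / \<delta>\<bar> * (c + c)))"
    using X' c by (intro expandsD[OF expands_th]) auto
  \<comment> \<open>From \<delta> \<le> 1: the factor 1 + 2 \<delta> is at most 3, applied to 2 c /
    \<delta>.\<close>
  then have bX': "rbnd k X' (6 * c / \<delta>)"
  proof (rule rbnd_mono)
    have "(1 + 2 * \<delta>) * (2 * c / \<delta>) \<le> 3 * (2 * c / \<delta>)" using \<delta> c by (intro mult_right_mono) auto
    then show "(1 + 2 * (\<delta> / 2 ^ 0)) * (\<bar>1 / \<delta>\<bar> * (c + c)) \<le> 6 * c / \<delta>" using \<delta> by simp
  qed
  \<comment> \<open>The difference of \<open>ga m\<close> and \<open>ga' m\<close> on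
    \<open>th m X'\<close> is at most 12 c / \<delta>; the weight \<delta> / 2^m turns this into 12
    c / 2^m.\<close>
  have step: "rbnd k (U (Suc (Suc m))) (r + 12 * c / 2 ^ m)" if r: "rbnd k (U (Suc m)) r" for m r
  proof -
    have g1: "rbnd k (\<lambda>i j. ga m (U (Suc m) i j)) r"
      by (rule rucp_rbnd[OF rucp_ga(1) alg'(2,3)]) (use Ualg r in auto)
    have tb: "rbnd k (\<lambda>i j. th m (X' i j)) (6 * c / \<delta>)"
      by (rule rucp_rbnd[OF rucp_th E'(2,3)]) (use X' bX' in auto)
    have g2: "rbnd k (\<lambda>i j. ga m (th m (X' i j))) (6 * c / \<delta>)" "rbnd k (\<lambda>i j. ga' m (th m (X' i j))) (6 * c / \<delta>)"
      by (rule rucp_rbnd[OF rucp_ga(1) alg'(2,3)], use th_alg X' tb in auto,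
          rule rucp_rbnd[OF rucp_ga(2) alg'(2,3)], use th_alg X' tb in auto)
    have "rbnd k (\<lambda>i j. ga m (U (Suc m) i j) + (\<delta> / 2 ^ m) *\<^sub>R (ga m (th m (X' i j)) - ga' m (th m (X' i j)))) (r + \<bar>\<delta> / 2 ^ m\<bar> * (6 * c / \<delta> + 6 * c / \<delta>))"
      by (intro rbnd_add rbnd_scaleR rbnd_diff g1 g2)
    also have "?this \<longleftrightarrow> rbnd k (U (Suc (Suc m))) (r + \<bar>\<delta> / 2 ^ m\<bar> * (6 * c / \<delta> + 6 * c / \<delta>))"
    proof (rule rbnd_cong)
      fix i j assume ij: "i < k" "j < k"
      have th: "th m (X i j) \<in> alg (N m)" "be m (T i j) \<in> alg (N m)" by (intro th_alg be_alg X T ij)+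
      have sa: "s i j *\<^sub>C id_blinfun \<in> alg (N m)" by (intro op_space.subspace_scale[OF sub] alg'(3))
      have 1: "ga m (th m (X' i j)) = ga m (th m (X i j)) - s i j *\<^sub>C id_blinfun"
        unfolding thX'[OF ij] rucp_diff[OF rucp_ga(1) sub th(1) sa] by (simp add: rucpD(3)[OF rucp_ga(1) alg'(3)] rucpD(4)[OF rucp_ga(1)])
      have 2: "ga' m (th m (X' i j)) = ga' m (th m (X i j)) - s i j *\<^sub>C id_blinfun"
        unfolding thX'[OF ij] rucp_diff[OF rucp_ga(2) sub th(1) sa] by (simp add: rucpD(3)[OF rucp_ga(2) alg'(3)] rucpD(4)[OF rucp_ga(2)])
      show "ga m (U (Suc m) i j) + (\<delta> / 2 ^ m) *\<^sub>R (ga m (th m (X' i j)) - ga' m (th m (X' i j))) = U (Suc (Suc m)) i j"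
        unfolding 1 2 US[OF ij] rucpD(2)[OF rucp_ga(1) th] th_Suc[OF X[OF ij]] be_Suc by simp
    qed
    finally show ?thesis using \<delta> by (simp add: field_simps abs_if)
  qed
  \<comment> \<open>The last block bounded by assumption is K + 1; from there the errors sum to at
    most twice 12 c / 2^K, which is the 24 in the statement.\<close>
  have tail: "rbnd k (U (Suc (K + r))) (c + (\<Sum>q<r. 12 * c / 2 ^ K / 2 ^ q))" for r
  proof (induction r)
    case 0 show ?case using b[of "Suc K"] by simp
  next
    case (Suc r)
    from step[OF Suc] show ?case by (simp add: power_add add.assoc)
  qed
  show ?thesis
  proof (cases "m < K + 2")
    case True
    have "c \<le> (1 + 24 / 2 ^ K) * c" using c by (simp add: distrib_right)
    then show ?thesis using b[OF True] rbnd_mono by blast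
  next
    case False
    then obtain r where r: "m = Suc (K + r)" using le_Suc_ex[of "Suc K" m] by auto
    have "(\<Sum>q<r. 12 * c / 2 ^ K / 2 ^ q) \<le> 2 * (12 * c / 2 ^ K)" using c by (intro half_power_sum) simp
    then have "c + (\<Sum>q<r. 12 * c / 2 ^ K / 2 ^ q) \<le> (1 + 24 / 2 ^ K) * c" by (simp add: distrib_right)
    then show ?thesis unfolding r using tail[of r] rbnd_mono by blast
  qed
qed

text \<open>Compression to the first K + 2 blocks is ucp, and by \<open>blocks_bound\<close> it
  loses at most the factor 1 + 24 / 2^K of the norm.\<close>

lemma one_exact_F: "one_exact_fd F"
  unfolding one_exact_fd_iff[OF osys_F]
proof (intro allI impI)
  fix \<epsilon> :: real assume \<epsilon>: "0 < \<epsilon>"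
  obtain K where "(1 / 2) ^ K < \<epsilon> / 24" using \<epsilon> real_arch_pow_inv[of "\<epsilon> / 24" "1/2"] by auto
  then have K: "24 / 2 ^ K \<le> \<epsilon>" by (simp add: power_one_over field_simps)
  define n where "n = offs bdim (K + 2)"
  have n: "0 < n" unfolding n_def using offs_ge[OF bdim, of "K + 2"] by linarith
  have "expands F (\<lambda>z. emb n (comp_mat 0 n z)) (1 + \<epsilon>)"
    unfolding expands_def
  proof (intro allI impI)
    fix k z and c :: real
    assume z: "\<forall>i<k. \<forall>j<k. z i j \<in> F" and c: "0 \<le> c" and b: "rbnd k (\<lambda>i j. emb n (comp_mat 0 n (z i j))) c"
    have "\<forall>z\<in>F. \<exists>x T. x \<in> E \<and> T \<in> A \<and> z = I x + J T" using F_elem by blast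
    \<comment> \<open>The decomposition need not be unique; \<open>blocks_bound\<close> holds for
      every choice of x and T.\<close>
    then obtain px pT where p: "\<And>z. z \<in> F \<Longrightarrow> px z \<in> E" "\<And>z. z \<in> F \<Longrightarrow> pT z \<in> A" "\<And>z. z \<in> F \<Longrightarrow> z = I (px z) + J (pT z)"
      by metis
    define X T where "X i j = px (z i j)" and "T i j = pT (z i j)" for i j
    have X: "X i j \<in> E" and T: "T i j \<in> A" if "i < k" "j < k" for i j
      using z that p(1,2) by (auto simp: X_def T_def)
    define Z where "Z i j m = iz (X i j) m + jz (T i j) m" for i j m
    have Zb: "blocks bdim (Z i j)" and zZ: "z i j = bop bdim (Z i j)" if "i < k" "j < k" for i j
    proof -
      show "blocks bdim (Z i j)" unfolding Z_def[abs_def] by (intro blocks_add(1)[OF bdim] blocks_iz blocks_jz X T that)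
      show "z i j = bop bdim (Z i j)"
        unfolding Z_def[abs_def] blocks_add(2)[OF bdim blocks_iz[OF X[OF that]] blocks_jz[OF T[OF that]]]
        using p(3)[of "z i j"] z that by (simp add: X_def T_def I_def J_def)
    qed
    have "rbnd k (\<lambda>i j. emb n (comp_mat 0 n (z i j))) c \<longleftrightarrow> mbd n k (\<lambda>i j. comp_mat 0 n (z i j)) c"
      by (rule rbnd_emb[OF n]) simp
    also have "\<dots> \<longleftrightarrow> mbd n k (\<lambda>i j. comp_mat 0 n (bop bdim (Z i j))) c"
      by (rule mbd_cong) (simp add: zZ)
    finally have mb: "mbd (offs bdim (K + 2)) k (\<lambda>i j. comp_mat 0 (offs bdim (K + 2)) (bop bdim (Z i j))) c"
      using b unfolding n_def by blast
    have U: "rbnd k (\<lambda>i j. emb (bdim m) (Z i j m)) c" if "m < K + 2" for m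
    proof -
      have "mbd (bdim m) k (\<lambda>i j. Z i j m) c" by (rule mbd_comp_mat_bop[OF bdim _ mb that]) (rule Zb)
      moreover have "rbnd k (\<lambda>i j. emb (bdim m) (Z i j m)) c \<longleftrightarrow> mbd (bdim m) k (\<lambda>i j. Z i j m) c"
        by (rule rbnd_emb) (use bdim Zb in \<open>auto simp: blocks_def\<close>)
      ultimately show ?thesis by blast
    qed
    have "rbnd k (\<lambda>i j. emb (bdim m) (Z i j m)) ((1 + 24 / 2 ^ K) * c)" for m
      using blocks_bound[of k X T c K m, OF X T c] U unfolding Z_def by blast
    then have "rbnd k (\<lambda>i j. emb (bdim m) (Z i j m)) ((1 + \<epsilon>) * c)" for m
      by (rule rbnd_mono) (use K c in \<open>auto intro: mult_right_mono\<close>)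
    moreover have "rbnd k (\<lambda>i j. bop bdim (Z i j)) ((1 + \<epsilon>) * c) \<longleftrightarrow> (\<forall>m. rbnd k (\<lambda>i j. emb (bdim m) (Z i j m)) ((1 + \<epsilon>) * c))"
      by (rule rbnd_bop_emb[OF bdim]) (rule Zb)
    moreover have "rbnd k z ((1 + \<epsilon>) * c) \<longleftrightarrow> rbnd k (\<lambda>i j. bop bdim (Z i j)) ((1 + \<epsilon>) * c)"
      by (rule rbnd_cong) (rule zZ)
    ultimately show "rbnd k z ((1 + \<epsilon>) * c)" by blast
  qed
  moreover have "ucp (op_sys F) (mat_sys n) (comp_mat 0 n)"
    by (rule ucp_comp_mat) (rule osysD(1)[OF osys_F])
  ultimately show "\<exists>n>0. \<exists>\<phi>. ucp (op_sys F) (mat_sys n) \<phi> \<and> expands F (\<lambda>x. emb n (\<phi> x)) (1 + \<epsilon>)"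
    using n by blast
qed

lemma one_exact_I: "one_exact_fd (I ` E)"
proof -
  have o: "osys (I ` E)" by (rule rucp_image_osys[OF rucp_I E])
  show ?thesis unfolding one_exact_fd_iff[OF o]
  proof (intro allI impI)
    fix \<epsilon> :: real assume "0 < \<epsilon>"
    then obtain n \<phi> where n: "0 < n" "ucp (op_sys F) (mat_sys n) \<phi>" "expands F (\<lambda>x. emb n (\<phi> x)) (1 + \<epsilon>)"
      using one_exact_F unfolding one_exact_fd_iff[OF osys_F] by blast
    have "expands (I ` E) (\<lambda>x. emb n (\<phi> x)) (1 + \<epsilon>)"
      using n(3) I_F unfolding expands_def by (meson subsetD)
    moreover have "ucp (op_sys (I ` E)) (mat_sys n) \<phi>" using n(2) I_F by (rule ucp_mono)
    ultimately show "\<exists>n>0. \<exists>\<phi>. ucp (op_sys (I ` E)) (mat_sys n) \<phi> \<and> expands (I ` E) (\<lambda>x. emb n (\<phi> x)) (1 + \<epsilon>)"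
      using n(1) by blast
  qed
qed

end

section \<open>The Gurarij operator system\<close>

lemma op_mpos_cong: "(\<And>i j. i < k \<Longrightarrow> j < k \<Longrightarrow> x i j = y i j) \<Longrightarrow> op_mpos k x \<longleftrightarrow> op_mpos k y"
  unfolding op_mpos_def by simp

lemma ucp_op_cong:
  assumes "\<And>x. x \<in> E \<Longrightarrow> \<phi> x = \<psi> x" "ucp (op_sys E) (op_sys F) \<phi>" "op_space.subspace E" "id_blinfun \<in> E"
  shows "ucp (op_sys E) (op_sys F) \<psi>"
proof (rule ucp_cong[OF _ assms(2)])
  show "mpos (op_sys F) k y" if "\<And>i j. i < k \<Longrightarrow> j < k \<Longrightarrow> x i j = y i j" "mpos (op_sys F) k x" for k x y
    using op_mpos_cong[of k x y] that by (simp add: op_sys_def)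
qed (use assms in \<open>auto simp: op_sys_def intro: op_space.subspace_add op_space.subspace_scale\<close>)

lemma complete_order_embedding_inverse:
  assumes e: "complete_order_embedding (op_sys E) (op_sys G) \<phi>" and E: "osys E" and G: "E \<subseteq> G'"
  shows "complete_order_embedding (op_sys (\<phi> ` E)) (op_sys G') (inv_into E \<phi>)"
proof -
  let ?g = "inv_into E \<phi>"
  note d = complete_order_embeddingD[OF e]
  have g: "?g (\<phi> x) = x" if "x \<in> E" for x using d(1) that by simp
  have im: "?g ` \<phi> ` E = E" using g by force
  have inj: "inj_on ?g (\<phi> ` E)" using g by (auto simp: inj_on_def)
  have inv: "inv_into (\<phi> ` E) ?g x = \<phi> x" if "x \<in> E" for x
    using inv_into_f_f[OF inj, of "\<phi> x"] that g by simp
  have "ucp (op_sys E) (op_sys (\<phi> ` E)) (inv_into (\<phi> ` E) ?g)"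
    by (rule ucp_op_cong[OF _ d(3) osysD(2,3)[OF E]]) (simp add: inv)
  then show ?thesis
    unfolding complete_order_embedding_def complete_order_iso_def subsystem_op_sys
    using d(4) G inj im by (simp add: op_sys_def bij_betw_def)
qed

text \<open>The first summand is a corner of the direct sum, so adding a second one can only
  increase norms in the image.\<close>

lemma expands_mat_dsum:
  assumes n: "0 < n" and \<phi>: "ucp (op_sys E) (mat_sys n) \<phi>" and E: "osys E" and X: "expands E (\<lambda>x. emb n (\<phi> x)) K"
  shows "expands E (\<lambda>x. emb (n + m) (mat_dsum n m (\<phi> x) (\<tau> x))) K"
  unfolding expands_def
proof (intro allI impI)
  fix k x and c :: real
  assume x: "\<forall>i<k. \<forall>j<k. x i j \<in> E" and c: "0 \<le> c" and b: "rbnd k (\<lambda>i j. emb (n + m) (mat_dsum n m (\<phi> (x i j)) (\<tau> (x i j)))) c"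
  have "rbnd k (\<lambda>i j. emb (n + m) (mat_dsum n m (\<phi> (x i j)) (\<tau> (x i j)))) c \<longleftrightarrow> mbd (n + m) k (\<lambda>i j. mat_dsum n m (\<phi> (x i j)) (\<tau> (x i j))) c"
    by (rule rbnd_emb) (use n in auto)
  then have "mbd n k (\<lambda>i j. \<phi> (x i j)) c" using b mbd_mat_dsum[of n m k "\<lambda>i j. \<phi> (x i j)" "\<lambda>i j. \<tau> (x i j)" c] by blast
  moreover have "rbnd k (\<lambda>i j. emb n (\<phi> (x i j))) c \<longleftrightarrow> mbd n k (\<lambda>i j. \<phi> (x i j)) c"
    by (rule rbnd_emb[OF n]) (use x ucp_mat_rucp(2)[OF n \<phi> E] in auto)
  ultimately show "rbnd k x (K * c)" using x c by (intro expandsD[OF X]) auto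
qed

text \<open>1-exactness with \<epsilon> = 2 \<delta> / 2^k gives the members of the chain. Each is
  compared with the next by \<open>ucp_pair_extension\<close>, whose order hypothesis is the
  conclusion of \<open>expands_almost_positive\<close>.\<close>

lemma matrix_chain_exists:
  fixes E :: "('g::chilbert_space \<Rightarrow>\<^sub>L 'g) set"
  assumes E: "osys E" "finite_dim E" "one_exact_fd E" and \<tau>: "ucp (op_sys E) (mat_sys m) \<tau>" and \<delta>: "0 < \<delta>" "\<delta> \<le> 1"
  shows "\<exists>n \<rho> N \<Theta> \<gamma> \<gamma>'. 0 < n \<and> ucp (op_sys E) (mat_sys n) \<rho> \<and> N 0 = n + m \<and> \<Theta> 0 = (\<lambda>x. mat_dsum n m (\<rho> x) (\<tau> x)) \<and>
    matrix_chain E N \<Theta> \<gamma> \<gamma>' \<delta>"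
proof -
  have "\<forall>k. \<exists>n \<phi>. 0 < n \<and> ucp (op_sys E) (mat_sys n) \<phi> \<and> expands E (\<lambda>x. emb n (\<phi> x)) (1 + 2 * (\<delta> / 2 ^ k))"
  proof
    fix k :: nat
    have "0 < 2 * (\<delta> / 2 ^ k)" using \<delta> by simp
    then show "\<exists>n \<phi>. 0 < n \<and> ucp (op_sys E) (mat_sys n) \<phi> \<and> expands E (\<lambda>x. emb n (\<phi> x)) (1 + 2 * (\<delta> / 2 ^ k))"
      using E(3) unfolding one_exact_fd_iff[OF E(1)] by blast
  qed
  then obtain n \<phi> where n: "\<And>k. 0 < n k" and \<phi>: "\<And>k. ucp (op_sys E) (mat_sys (n k)) (\<phi> k)"
    and x: "\<And>k. expands E (\<lambda>x. emb (n k) (\<phi> k x)) (1 + 2 * (\<delta> / 2 ^ k))"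
    by metis
  \<comment> \<open>Only the first term carries \<tau>; the later ones are plain almost
    isometries.\<close>
  define N where "N k = (if k = 0 then n 0 + m else n k)" for k :: nat
  define \<Theta> where "\<Theta> k = (if k = 0 then (\<lambda>x. mat_dsum (n 0) m (\<phi> 0 x) (\<tau> x)) else \<phi> k)" for k :: nat
  have N: "0 < N k" for k using n[of k] n[of 0] by (simp add: N_def)
  have \<Theta>: "ucp (op_sys E) (mat_sys (N k)) (\<Theta> k)" for k
    using \<phi>[of k] ucp_mat_dsum[OF \<phi>[of 0] \<tau>] by (simp add: N_def \<Theta>_def)
  have X: "expands E (\<lambda>x. emb (N k) (\<Theta> k x)) (1 + 2 * (\<delta> / 2 ^ k))" for k
    using x[of k] expands_mat_dsum[OF n \<phi> E(1) x, of 0 m \<tau>] by (cases "k = 0") (simp_all add: N_def \<Theta>_def)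
  have "\<forall>k. \<exists>\<gamma> \<gamma>'. ucp (op_sys {T :: ell2 \<Rightarrow>\<^sub>L ell2. clinear_op T}) (mat_sys (N (Suc k))) \<gamma> \<and>
    ucp (op_sys {T :: ell2 \<Rightarrow>\<^sub>L ell2. clinear_op T}) (mat_sys (N (Suc k))) \<gamma>' \<and>
    (\<forall>x\<in>E. \<Theta> (Suc k) x + of_real (\<delta> / 2 ^ k) *\<^sub>C \<gamma>' (emb (N k) (\<Theta> k x)) = of_real (1 + \<delta> / 2 ^ k) *\<^sub>C \<gamma> (emb (N k) (\<Theta> k x)))"
  proof
    fix k
    have r: "rucp E (\<lambda>x. emb (N k) (\<Theta> k x))" by (rule ucp_mat_rucp(1)[OF N \<Theta> E(1)])
    have d: "0 \<le> \<delta> / 2 ^ k" using \<delta> by simp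
    show "\<exists>\<gamma> \<gamma>'. ucp (op_sys {T :: ell2 \<Rightarrow>\<^sub>L ell2. clinear_op T}) (mat_sys (N (Suc k))) \<gamma> \<and>
      ucp (op_sys {T :: ell2 \<Rightarrow>\<^sub>L ell2. clinear_op T}) (mat_sys (N (Suc k))) \<gamma>' \<and>
      (\<forall>x\<in>E. \<Theta> (Suc k) x + of_real (\<delta> / 2 ^ k) *\<^sub>C \<gamma>' (emb (N k) (\<Theta> k x)) = of_real (1 + \<delta> / 2 ^ k) *\<^sub>C \<gamma> (emb (N k) (\<Theta> k x)))"
      by (rule ucp_pair_extension[OF E(1) r \<Theta> N d]) (rule expands_almost_positive[OF E(1) r X d])
  qed
  then obtain \<gamma> \<gamma>' where g: "\<And>k. ucp (op_sys {T :: ell2 \<Rightarrow>\<^sub>L ell2. clinear_op T}) (mat_sys (N (Suc k))) (\<gamma> k)"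
    "\<And>k. ucp (op_sys {T :: ell2 \<Rightarrow>\<^sub>L ell2. clinear_op T}) (mat_sys (N (Suc k))) (\<gamma>' k)"
    "\<And>k x. x \<in> E \<Longrightarrow> \<Theta> (Suc k) x + of_real (\<delta> / 2 ^ k) *\<^sub>C \<gamma>' k (emb (N k) (\<Theta> k x)) = of_real (1 + \<delta> / 2 ^ k) *\<^sub>C \<gamma> k (emb (N k) (\<Theta> k x))"
    by metis
  have "matrix_chain E N \<Theta> \<gamma> \<gamma>' \<delta>"
    by (unfold_locales) (rule E N \<delta> \<Theta> X g | assumption)+
  moreover have "N 0 = n 0 + m" "\<Theta> 0 = (\<lambda>x. mat_dsum (n 0) m (\<phi> 0 x) (\<tau> x))" by (simp_all add: N_def \<Theta>_def)
  ultimately show ?thesis using n \<phi> by blast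
qed

text \<open>The copy I(E) inside F is embedded in G by the inverse of I, and the Gurarij property
  extends this approximately to \<psi> on F. With \<Psi> as \<psi> after J, the images of
  \<open>th 0 b\<close> under I's counterpart J and of b under I are close in F, whence \<Psi>
  almost undoes the start of the chain. The left inverse is exact because \<psi> is a complete order
  embedding and J keeps its argument in block 1.\<close>

lemma gurarij_matrix_extension:
  fixes G :: "('g::chilbert_space \<Rightarrow>\<^sub>L 'g) set"
  assumes G: "gurarij_operator_system G" and B: "finite B" "B \<subseteq> G" and \<tau>: "ucp (op_sys G) (mat_sys m) \<tau>" and \<epsilon>: "0 < \<epsilon>"
  shows "\<exists>n \<rho> \<Psi> L. 0 < n \<and> ucp (op_sys G) (mat_sys n) \<rho> \<and> ucp (mat_sys (n + m)) (op_sys G) \<Psi> \<and>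
    ucp (op_sys G) (mat_sys (n + m)) L \<and> (\<forall>M\<in>carrier_mat (n + m) (n + m). L (\<Psi> M) = M) \<and>
    (\<forall>b\<in>B. norm (\<Psi> (mat_dsum n m (\<rho> b) (\<tau> b)) - b) \<le> \<epsilon>)"
proof -
  have oG: "osys G" and ex: "one_exact G" using G unfolding gurarij_operator_system_def operator_system_iff by blast+
  obtain E where E: "operator_system E" "finite_dim E" "B \<subseteq> E" "E \<subseteq> G" using finite_subsystem[OF oG B] by blast
  have oE: "osys E" using E(1) unfolding operator_system_iff by blast
  have eE: "one_exact_fd E" using ex E unfolding one_exact_def by blast
  obtain K where K: "0 < K" "\<And>b. b \<in> B \<Longrightarrow> norm b \<le> K"
  proof -
    have "bounded B" using B(1) by (rule finite_imp_bounded)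
    then show ?thesis using that unfolding bounded_pos by blast
  qed
  \<comment> \<open>K bounds the norms on B. Half of \<epsilon> is spent on \<open>I_close\<close>,
    that is 4 \<delta> K; the other half on the Gurarij property, with relative tolerance \<epsilon>
    / (2 K).\<close>
  define \<delta> where "\<delta> = min 1 (\<epsilon> / (8 * K))"
  have \<delta>: "0 < \<delta>" "\<delta> \<le> 1" "4 * \<delta> * K \<le> \<epsilon> / 2"
    using \<epsilon> K(1) by (auto simp: \<delta>_def min_def field_simps)
  obtain n \<rho>0 N \<Theta> \<gamma> \<gamma>' where n: "0 < n" and \<rho>0: "ucp (op_sys E) (mat_sys n) \<rho>0" and N0: "N 0 = n + m"
    and \<Theta>0: "\<Theta> 0 = (\<lambda>x. mat_dsum n m (\<rho>0 x) (\<tau> x))" and mc: "matrix_chain E N \<Theta> \<gamma> \<gamma>' \<delta>"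
    using matrix_chain_exists[OF oE E(2) eE ucp_mono[OF \<tau> E(4)] \<delta>(1,2)] by metis
  interpret mc: matrix_chain E N \<Theta> \<gamma> \<gamma>' \<delta> by (rule mc)
  let ?I = "mc.I" and ?J = "mc.J" and ?F = "mc.F"
  have cI: "complete_order_embedding (op_sys E) (op_sys (?I ` E)) ?I"
    by (rule complete_order_embeddingI[OF mc.rucp_I oE mc.I_inj order_refl]) (rule mc.I_pos)
  have cg: "complete_order_embedding (op_sys (?I ` E)) (op_sys G) (inv_into E ?I)"
    by (rule complete_order_embedding_inverse[OF cI oE E(4)])
  have e0: "0 < \<epsilon> / (2 * K)" using \<epsilon> K by simp
  have "operator_system (?I ` E) \<and> finite_dim (?I ` E) \<and> one_exact_fd (?I ` E) \<and>
      operator_system ?F \<and> finite_dim ?F \<and> one_exact_fd ?F \<and> ?I ` E \<subseteq> ?F \<and>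
      complete_order_embedding (op_sys (?I ` E)) (op_sys G) (inv_into E ?I) \<and> 0 < \<epsilon> / (2 * K)"
    using mc.operator_system_I mc.operator_system_F mc.one_exact_I mc.one_exact_F mc.I_F cg e0 by blast
  then obtain \<psi> where c\<psi>: "complete_order_embedding (op_sys ?F) (op_sys G) \<psi>"
    and \<psi>I: "\<forall>y\<in>?I ` E. norm (\<psi> y - inv_into E ?I y) \<le> \<epsilon> / (2 * K) * norm y"
    using G unfolding gurarij_operator_system_def by meson
  note d = complete_order_embeddingD[OF c\<psi>]
  have r\<psi>: "rucp ?F \<psi>" by (rule ucp_rucp[OF d(5) mc.osys_F osysD(1)[OF oG]])
  have uJ: "ucp (op_sys (alg (N 0))) (op_sys ?F) ?J"
    by (rule rucp_ucp[OF mc.rucp_J osysD(2)[OF osys_alg[OF mc.N]] mc.J_F])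
  define \<Psi> where "\<Psi> M = \<psi> (?J (emb (N 0) M))" for M
  have u\<Psi>: "ucp (mat_sys (n + m)) (op_sys G) \<Psi>"
    unfolding \<Psi>_def[abs_def] N0[symmetric] by (rule ucp_from_mat[OF mc.N ucp_compose[OF uJ d(5)]])
  have o\<psi>: "osys (\<psi> ` ?F)" by (rule rucp_image_osys[OF r\<psi> mc.osys_F])
  \<comment> \<open>Blocks 0 and 1 both have size n + m, so this compression reads block 1. It is
    defined on the range of \<psi> only and is extended by \<open>arveson\<close>.\<close>
  have "ucp (op_sys (\<psi> ` ?F)) (mat_sys (n + m)) (\<lambda>y. comp_mat (n + m) (n + m) (inv_into ?F \<psi> y))"
    by (rule ucp_compose[OF d(4) ucp_comp_mat]) (rule osysD(1)[OF mc.osys_F])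
  from arveson[OF o\<psi> this] obtain L where L: "ucp (op_sys {T :: 'g \<Rightarrow>\<^sub>L 'g. clinear_op T}) (mat_sys (n + m)) L"
    "\<And>y. y \<in> \<psi> ` ?F \<Longrightarrow> L y = comp_mat (n + m) (n + m) (inv_into ?F \<psi> y)"
    using n by auto
  from arveson[OF oE \<rho>0 n] obtain \<rho> where \<rho>: "ucp (op_sys {T :: 'g \<Rightarrow>\<^sub>L 'g. clinear_op T}) (mat_sys n) \<rho>"
    "\<And>x. x \<in> E \<Longrightarrow> \<rho> x = \<rho>0 x" by auto
  have Gcl: "G \<subseteq> {T. clinear_op T}" using osysD(1)[OF oG] by blast
  have "L (\<Psi> M) = M" if M: "M \<in> carrier_mat (n + m) (n + m)" for M
  proof -
    have T: "emb (N 0) M \<in> alg (N 0)" using M unfolding alg_def N0 by blast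
    then have JF: "?J (emb (N 0) M) \<in> ?F" using mc.J_F by blast
    have "L (\<Psi> M) = comp_mat (n + m) (n + m) (?J (emb (N 0) M))"
      unfolding \<Psi>_def using L(2)[of "\<psi> (?J (emb (N 0) M))"] JF d(1) by simp
    moreover have "comp_mat (N 0) (N 0) (?J (emb (N 0) M)) = M"
      by (rule emb_inj[OF mc.N _ _ mc.J_block[OF T]]) (use M N0 in auto)
    ultimately show ?thesis by (simp add: N0)
  qed
  moreover have "norm (\<Psi> (mat_dsum n m (\<rho> b) (\<tau> b)) - b) \<le> \<epsilon>" if b: "b \<in> B" for b
  proof -
    have bE: "b \<in> E" using b E(3) by blast
    have mem: "?J (mc.th 0 b) \<in> ?F" "?I b \<in> ?F" using mc.J_F mc.I_F mc.th_alg[OF bE] bE by blast+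
    have sF: "op_space.subspace ?F" "id_blinfun \<in> ?F" using osysD(2,3)[OF mc.osys_F] .
    have "\<Psi> (mat_dsum n m (\<rho> b) (\<tau> b)) = \<psi> (?J (mc.th 0 b))"
      unfolding \<Psi>_def mc.th_def \<Theta>0 \<rho>(2)[OF bE] ..
    moreover have "norm (\<psi> (?J (mc.th 0 b)) - \<psi> (?I b)) \<le> \<epsilon> / 2"
    proof -
      have "norm (\<psi> (?J (mc.th 0 b) - ?I b)) \<le> norm (?J (mc.th 0 b) - ?I b)"
        by (rule rucp_norm_le[OF r\<psi> sF]) (rule op_space.subspace_diff[OF sF(1) mem])
      also have "\<dots> \<le> 4 * \<delta> * norm b" using mc.I_close[OF bE] by (simp add: norm_minus_commute)
      also have "\<dots> \<le> 4 * \<delta> * K" using K(2)[OF b] \<delta>(1) by (intro mult_left_mono) auto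
      finally show ?thesis unfolding rucp_diff[OF r\<psi> sF(1) mem] using \<delta>(3) by simp
    qed
    moreover have "norm (\<psi> (?I b) - b) \<le> \<epsilon> / 2"
    proof -
      have "norm (\<psi> (?I b) - inv_into E ?I (?I b)) \<le> \<epsilon> / (2 * K) * norm (?I b)" using \<psi>I bE by blast
      moreover have "inv_into E ?I (?I b) = b" using mc.I_inj bE by simp
      moreover have "norm (?I b) \<le> K"
        using rucp_norm_le[OF mc.rucp_I osysD(2,3)[OF oE] bE] K(2)[OF b] by linarith
      then have "\<epsilon> / (2 * K) * norm (?I b) \<le> \<epsilon> / (2 * K) * K" using e0 by (intro mult_left_mono) auto
      ultimately show ?thesis using K(1) by simp
    qed
    ultimately show ?thesis using norm_triangle_ineq[of "\<psi> (?J (mc.th 0 b)) - \<psi> (?I b)" "\<psi> (?I b) - b"] by simp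
  qed
  ultimately show ?thesis
    using n u\<Psi> ucp_mono[OF \<rho>(1) Gcl] ucp_mono[OF L(1) Gcl] by blast
qed

section \<open>Nuclearity of the Gurarij system and of its retracts\<close>

lemma gurarij_nuclear:
  fixes G :: "('g::chilbert_space \<Rightarrow>\<^sub>L 'g) set"
  assumes G: "gurarij_operator_system G" shows "nuclear G"
  unfolding nuclear_def
proof (intro allI impI)
  fix A and \<epsilon> :: real assume A: "A \<subseteq> G" "finite A" and \<epsilon>: "0 < \<epsilon>"
  \<comment> \<open>The empty matrix is both zero and unit of its algebra, so the constant map is
    linear, unital and completely positive.\<close>
  have "ucp (op_sys G) (mat_sys 0) (\<lambda>_. 0\<^sub>m 0 0)"
  proof -
    have "(0\<^sub>m 0 0 :: complex mat) = 0\<^sub>m 0 0 + 0\<^sub>m 0 0" "1\<^sub>m 0 = (0\<^sub>m 0 0 :: complex mat)" by auto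
    moreover have "0\<^sub>m 0 0 = c *\<^sub>C (0\<^sub>m 0 0 :: complex mat)" for c by (rule eq_matI) auto
    ultimately show ?thesis
      unfolding ucp_def linear_map_def mat_sys_def by (simp add: mat_mpos_def)
  qed
  from gurarij_matrix_extension[OF G A(2,1) this \<epsilon>]
  obtain n \<rho> \<Psi> where n: "0 < n" "ucp (op_sys G) (mat_sys n) \<rho>" "ucp (mat_sys (n + 0)) (op_sys G) \<Psi>"
    "\<forall>b\<in>A. norm (\<Psi> (mat_dsum n 0 (\<rho> b) (0\<^sub>m 0 0)) - b) \<le> \<epsilon>" by blast
  have "ucp (op_sys G) (mat_sys (n + 0)) (\<lambda>x. mat_dsum n 0 (\<rho> x) (0\<^sub>m 0 0))"
    by (rule ucp_mat_dsum[OF n(2)]) fact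
  then show "\<exists>n>0. \<exists>\<phi> \<psi>. ucp (op_sys G) (mat_sys n) \<phi> \<and> ucp (mat_sys n) (op_sys G) \<psi> \<and> (\<forall>x\<in>A. norm (\<psi> (\<phi> x) - x) \<le> \<epsilon>)"
    using n by (intro exI[of _ "n + 0"] conjI exI[of _ "\<lambda>x. mat_dsum n 0 (\<rho> x) (0\<^sub>m 0 0)"] exI[of _ \<Psi>]) auto
qed

text \<open>The inverse of \<phi> after P is a ucp left inverse of \<phi> on all of G;
  factorizations of the identity of G are composed with \<phi> and this map.\<close>

lemma nuclear_retract:
  assumes X: "osys X" and G: "osys G" "nuclear G" and e: "complete_order_embedding (op_sys X) (op_sys G) \<phi>"
    and P: "ucp_projection_onto (op_sys G) (\<phi> ` X) P"
  shows "nuclear X"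
  unfolding nuclear_def
proof (intro allI impI)
  fix A and \<epsilon> :: real assume A: "A \<subseteq> X" "finite A" and \<epsilon>: "0 < \<epsilon>"
  note d = complete_order_embeddingD[OF e]
  have Pim: "P ` G = \<phi> ` X" and PP: "\<And>y. y \<in> G \<Longrightarrow> P (P y) = P y" and uP: "ucp (op_sys G) (op_sys G) P"
    using P unfolding ucp_projection_onto_def by (auto simp: op_sys_def)
  have uR: "ucp (op_sys G) (op_sys X) (\<lambda>y. inv_into X \<phi> (P y))"
    by (rule ucp_compose[OF ucp_range[OF uP] d(4)]) (simp add: Pim)
  have rR: "rucp G (\<lambda>y. inv_into X \<phi> (P y))" by (rule ucp_rucp[OF uR G(1) osysD(1)[OF X]])
  have R\<phi>: "inv_into X \<phi> (P (\<phi> x)) = x" if x: "x \<in> X" for x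
  proof -
    obtain y where "y \<in> G" "\<phi> x = P y" using Pim x by blast
    then have "P (\<phi> x) = \<phi> x" using PP by simp
    then show ?thesis using d(1) x by simp
  qed
  have "finite (\<phi> ` A)" "\<phi> ` A \<subseteq> G" using A d(2) by auto
  then obtain n \<phi>1 \<psi>1 where n: "0 < n" "ucp (op_sys G) (mat_sys n) \<phi>1" "ucp (mat_sys n) (op_sys G) \<psi>1"
    "\<forall>y\<in>\<phi> ` A. norm (\<psi>1 (\<phi>1 y) - y) \<le> \<epsilon>"
    using G(2) \<epsilon> unfolding nuclear_def by meson
  have "norm (inv_into X \<phi> (P (\<psi>1 (\<phi>1 (\<phi> x)))) - x) \<le> \<epsilon>" if x: "x \<in> A" for x
  proof -
    have m: "\<phi> x \<in> G" "\<psi>1 (\<phi>1 (\<phi> x)) \<in> G"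
    proof -
      show "\<phi> x \<in> G" using d(2) x A by blast
      then show "\<psi>1 (\<phi>1 (\<phi> x)) \<in> G" using n(2,3) by (auto simp: ucp_def linear_map_def op_sys_def mat_sys_def)
    qed
    have "inv_into X \<phi> (P (\<psi>1 (\<phi>1 (\<phi> x)))) - x = inv_into X \<phi> (P (\<psi>1 (\<phi>1 (\<phi> x)) - \<phi> x))"
      unfolding rucp_diff[OF rR osysD(2)[OF G(1)] m(2,1)] using R\<phi>[of x] x A by auto
    also have "norm \<dots> \<le> norm (\<psi>1 (\<phi>1 (\<phi> x)) - \<phi> x)"
      by (rule rucp_norm_le[OF rR osysD(2,3)[OF G(1)]]) (rule op_space.subspace_diff[OF osysD(2)[OF G(1)] m(2,1)])
    also have "\<dots> \<le> \<epsilon>" using n(4) x by blast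
    finally show ?thesis .
  qed
  moreover have "ucp (op_sys X) (mat_sys n) (\<lambda>x. \<phi>1 (\<phi> x))" by (rule ucp_compose[OF d(5) n(2)])
  moreover have "ucp (mat_sys n) (op_sys X) (\<lambda>M. inv_into X \<phi> (P (\<psi>1 M)))" by (rule ucp_compose[OF n(3) uR])
  ultimately show "\<exists>n>0. \<exists>\<phi> \<psi>. ucp (op_sys X) (mat_sys n) \<phi> \<and> ucp (mat_sys n) (op_sys X) \<psi> \<and> (\<forall>x\<in>A. norm (\<psi> (\<phi> x) - x) \<le> \<epsilon>)"
    using n(1) by (intro exI[of _ n] conjI exI[of _ "\<lambda>x. \<phi>1 (\<phi> x)"] exI[of _ "\<lambda>M. inv_into X \<phi> (P (\<psi>1 M))"]) auto
qed

section \<open>From nuclearity to a retraction\<close>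

lemma ucp_op_mem: "ucp (op_sys E) (op_sys F) \<phi> \<Longrightarrow> x \<in> E \<Longrightarrow> \<phi> x \<in> F"
  by (auto simp: ucp_def linear_map_def op_sys_def)

lemma ucp_op_mat_mem: "ucp (op_sys E) (mat_sys n) \<phi> \<Longrightarrow> x \<in> E \<Longrightarrow> \<phi> x \<in> carrier_mat n n"
  by (auto simp: ucp_def linear_map_def op_sys_def mat_sys_def)

lemma ucp_mat_op_mem: "ucp (mat_sys n) (op_sys F) \<phi> \<Longrightarrow> M \<in> carrier_mat n n \<Longrightarrow> \<phi> M \<in> F"
  by (auto simp: ucp_def linear_map_def op_sys_def mat_sys_def)

text \<open>Placing a matrix in the second corner is not unital, so \<open>rucp_norm_le\<close>
  cannot be used for the composite. The norm is first estimated in the matrix algebra and then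
  carried through \<Psi>.\<close>

lemma norm_mat_dsum_zero_le:
  assumes n: "0 < n" and E: "osys E" and r: "ucp (op_sys E) (mat_sys m) r" and y: "y \<in> E"
    and \<Psi>: "ucp (mat_sys (n + m)) (op_sys F) \<Psi>" and F: "\<And>T. T \<in> F \<Longrightarrow> clinear_op T"
  shows "norm (\<Psi> (mat_dsum n m (0\<^sub>m n n) (r y))) \<le> norm y"
proof -
  have nm: "0 < n + m" using n by simp
  let ?M = "mat_dsum n m (0\<^sub>m n n) (r y)"
  have "mbd m 1 (\<lambda>_ _. r y) (norm y)"
  proof (cases "m = 0")
    case True then show ?thesis by (simp add: mbd_def mform_def msq_def)
  next
    case False
    then have m: "0 < m" by simp
    have "rbnd 1 (\<lambda>i j. emb m (r y)) (norm y)"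
      by (rule rucp_rbnd[OF ucp_mat_rucp(1)[OF m r E] osysD(2,3)[OF E]]) (use y rbnd_one in auto)
    moreover have "rbnd 1 (\<lambda>i j. emb m (r y)) (norm y) \<longleftrightarrow> mbd m 1 (\<lambda>_ _. r y) (norm y)"
      by (rule rbnd_emb[OF m]) (rule ucp_op_mat_mem[OF r y])
    ultimately show ?thesis by blast
  qed
  then have "mbd (n + m) 1 (\<lambda>_ _. ?M) (norm y)"
    unfolding mbd_def
  proof (intro allI)
    fix v w :: "nat \<Rightarrow> nat \<Rightarrow> complex"
    assume *: "\<forall>v w. 2 * Re (mform m 1 (\<lambda>_ _. r y) v w) \<le> norm y * (msq m 1 v + msq m 1 w)"
    have 0: "mform n 1 (\<lambda>_ _. 0\<^sub>m n n) v w = 0" by (simp add: mform_def mat_act_def)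
    have le: "msq m 1 (\<lambda>i a. v i (n + a)) \<le> msq (n + m) 1 v" for v
      unfolding msq_def sum_lessThan_add by (simp add: sum_nonneg)
    have "2 * Re (mform m 1 (\<lambda>_ _. r y) (\<lambda>i a. v i (n + a)) (\<lambda>i a. w i (n + a)))
      \<le> norm y * (msq m 1 (\<lambda>i a. v i (n + a)) + msq m 1 (\<lambda>i a. w i (n + a)))" using * by blast
    also have "\<dots> \<le> norm y * (msq (n + m) 1 v + msq (n + m) 1 w)" by (intro mult_left_mono add_mono le) simp
    finally show "2 * Re (mform (n + m) 1 (\<lambda>_ _. ?M) v w) \<le> norm y * (msq (n + m) 1 v + msq (n + m) 1 w)"
      unfolding mform_mat_dsum 0 by simp
  qed
  moreover have "rbnd 1 (\<lambda>i j. emb (n + m) ?M) (norm y) \<longleftrightarrow> mbd (n + m) 1 (\<lambda>_ _. ?M) (norm y)"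
    by (rule rbnd_emb[OF nm]) simp
  ultimately have "norm (emb (n + m) ?M) \<le> norm y" by (intro norm_le_rbnd) auto
  moreover have T: "emb (n + m) ?M \<in> alg (n + m)" unfolding alg_def by (rule imageI) simp
  have "norm (\<Psi> (comp_mat 0 (n + m) (emb (n + m) ?M))) \<le> norm (emb (n + m) ?M)"
    by (rule rucp_norm_le[OF mat_ucp_rucp[OF nm \<Psi> F] osysD(2,3)[OF osys_alg[OF nm]] T])
  ultimately show ?thesis by (simp add: comp_emb[OF nm])
qed

text \<open>The defect \<eta> of the old pair enters only through how far \<phi> moves: replacing r
  (Q (\<phi> a)) by r a changes the second corner by r of an element of norm at most \<eta>. The new
  composite is exactly \<open>s\<close> after \<open>r\<close>, so its defect is \<epsilon> on any
  prescribed finite set, independently of \<eta>.\<close>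

lemma approx_retract_step:
  fixes X :: "('h::chilbert_space \<Rightarrow>\<^sub>L 'h) set" and G :: "('g::chilbert_space \<Rightarrow>\<^sub>L 'g) set"
  assumes X: "osys X" "nuclear X" and G: "gurarij_operator_system G"
    and \<phi>: "ucp (op_sys X) (op_sys G) \<phi>" and Q: "ucp (op_sys G) (op_sys X) Q"
    and A: "finite A" "A \<subseteq> X" and A': "finite A'" "A' \<subseteq> X" and B: "finite B" "B \<subseteq> G" and \<epsilon>: "0 < \<epsilon>"
    and inv: "\<And>a. a \<in> A \<Longrightarrow> norm (Q (\<phi> a) - a) \<le> \<eta>"
  shows "\<exists>\<phi>' Q'. ucp (op_sys X) (op_sys G) \<phi>' \<and> ucp (op_sys G) (op_sys X) Q' \<and>
    (\<forall>a\<in>A. norm (\<phi>' a - \<phi> a) \<le> \<eta> + \<epsilon>) \<and> (\<forall>b\<in>B. norm (Q' b - Q b) \<le> \<epsilon>) \<and>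
    (\<forall>a\<in>A'. norm (Q' (\<phi>' a) - a) \<le> \<epsilon>)"
proof -
  have oG: "osys G" using G unfolding gurarij_operator_system_def operator_system_iff by blast
  note sX = osysD(2)[OF X(1)] and sG = osysD(2)[OF oG]
  \<comment> \<open>The images of A join B so that \<Psi> also reproduces the points \<phi> a, near
    which \<phi>' has to stay.\<close>
  define B' where "B' = B \<union> \<phi> ` A"
  have B': "finite B'" "B' \<subseteq> G" using A B ucp_op_mem[OF \<phi>] by (auto simp: B'_def)
  \<comment> \<open>\<open>s\<close> after \<open>r\<close> must be near the identity on A' for the
    new defect, and on images under Q so that Q' stays near Q.\<close>
  have fin: "finite (A' \<union> Q ` B')" "A' \<union> Q ` B' \<subseteq> X" using A' B' ucp_op_mem[OF Q] by auto
  have e2: "0 < \<epsilon> / 2" using \<epsilon> by simp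
  obtain m r s where m: "0 < m" and r: "ucp (op_sys X) (mat_sys m) r" and s: "ucp (mat_sys m) (op_sys X) s"
    and sr: "\<And>x. x \<in> A' \<union> Q ` B' \<Longrightarrow> norm (s (r x) - x) \<le> \<epsilon> / 2"
    using X(2) fin e2 unfolding nuclear_def by meson
  obtain n \<rho> \<Psi> L where n: "0 < n" and \<rho>: "ucp (op_sys G) (mat_sys n) \<rho>" and \<Psi>: "ucp (mat_sys (n + m)) (op_sys G) \<Psi>"
    and L: "ucp (op_sys G) (mat_sys (n + m)) L" and L\<Psi>: "\<And>M. M \<in> carrier_mat (n + m) (n + m) \<Longrightarrow> L (\<Psi> M) = M"
    and close: "\<And>b. b \<in> B' \<Longrightarrow> norm (\<Psi> (mat_dsum n m (\<rho> b) (r (Q b))) - b) \<le> \<epsilon> / 2"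
    using gurarij_matrix_extension[OF G B' ucp_compose[OF Q r] e2] by blast
  have nm: "0 < n + m" using n by simp
  \<comment> \<open>Reads the lower right corner, where \<open>mat_dsum\<close> puts its second
    matrix. After L has undone \<Psi>, it returns r of the argument.\<close>
  define p where "p M = comp_mat n m (emb (n + m) M)" for M
  have up: "ucp (mat_sys (n + m)) (mat_sys m) p"
    unfolding p_def[abs_def] by (rule ucp_compose[OF ucp_emb[OF nm] ucp_comp_mat]) (rule osysD(1)[OF osys_alg[OF nm]])
  have p: "p (mat_dsum n m M M') = M'" if M': "M' \<in> carrier_mat m m" for M M'
  proof (rule eq_matI)
    fix a b assume "a < dim_row M'" "b < dim_col M'"
    then have ab: "a < m" "b < m" using M' by auto
    have "p (mat_dsum n m M M') $$ (a, b) = comp_mat 0 (n + m) (emb (n + m) (mat_dsum n m M M')) $$ (n + a, n + b)"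
      unfolding p_def using ab by (simp add: comp_mat_index)
    also have "\<dots> = M' $$ (a, b)" using ab by (simp add: comp_emb[OF nm]) (simp add: mat_dsum_def)
    finally show "p (mat_dsum n m M M') $$ (a, b) = M' $$ (a, b)" .
  qed (use M' in \<open>auto simp: p_def comp_mat_def\<close>)
  define \<phi>' where "\<phi>' a = \<Psi> (mat_dsum n m (\<rho> (\<phi> a)) (r a))" for a
  define Q' where "Q' g = s (p (L g))" for g
  have u\<phi>': "ucp (op_sys X) (op_sys G) \<phi>'"
    unfolding \<phi>'_def[abs_def] by (rule ucp_compose[OF ucp_mat_dsum[OF ucp_compose[OF \<phi> \<rho>] r] \<Psi>])
  have uQ': "ucp (op_sys G) (op_sys X) Q'"
    unfolding Q'_def[abs_def] by (rule ucp_compose[OF ucp_compose[OF L up] s])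
  have rQ': "rucp G Q'" by (rule ucp_rucp[OF uQ' oG osysD(1)[OF X(1)]])
  have Q'\<Psi>: "Q' (\<Psi> (mat_dsum n m M (r x))) = s (r x)" if "x \<in> X" for M x
    unfolding Q'_def using ucp_op_mat_mem[OF r that] by (simp add: L\<Psi> p)
  have c3: "norm (Q' (\<phi>' a) - a) \<le> \<epsilon>" if a: "a \<in> A'" for a
  proof -
    have "Q' (\<phi>' a) = s (r a)" unfolding \<phi>'_def using a A' by (intro Q'\<Psi>) auto
    then show ?thesis using sr[of a] a \<epsilon> by simp
  qed
  have c2: "norm (Q' b - Q b) \<le> \<epsilon>" if b: "b \<in> B" for b
  proof -
    have bG: "b \<in> G" "b \<in> B'" using b B by (auto simp: B'_def)
    let ?y = "\<Psi> (mat_dsum n m (\<rho> b) (r (Q b)))"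
    have yG: "?y \<in> G" by (rule ucp_mat_op_mem[OF \<Psi>]) simp
    have "norm (Q' (?y - b)) \<le> norm (?y - b)"
      by (rule rucp_norm_le[OF rQ' osysD(2,3)[OF oG]]) (rule op_space.subspace_diff[OF sG yG bG(1)])
    then have "norm (Q' ?y - Q' b) \<le> \<epsilon> / 2"
      unfolding rucp_diff[OF rQ' sG yG bG(1)] using close[OF bG(2)] by linarith
    moreover have "Q' ?y = s (r (Q b))" by (rule Q'\<Psi>[OF ucp_op_mem[OF Q bG(1)]])
    moreover have "norm (s (r (Q b)) - Q b) \<le> \<epsilon> / 2" using sr bG(2) by blast
    ultimately show ?thesis
      using norm_triangle_ineq[of "Q' b - s (r (Q b))" "s (r (Q b)) - Q b"] by (simp add: norm_minus_commute)
  qed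
  have c1: "norm (\<phi>' a - \<phi> a) \<le> \<eta> + \<epsilon>" if a: "a \<in> A" for a
  proof -
    have aX: "a \<in> X" using a A by blast
    have g: "\<phi> a \<in> G" "\<phi> a \<in> B'" using ucp_op_mem[OF \<phi> aX] a by (auto simp: B'_def)
    have qX: "Q (\<phi> a) \<in> X" by (rule ucp_op_mem[OF Q g(1)])
    define y where "y = a - Q (\<phi> a)"
    have yX: "y \<in> X" unfolding y_def by (rule op_space.subspace_diff[OF sX aX qX])
    let ?M = "mat_dsum n m (\<rho> (\<phi> a)) (r (Q (\<phi> a)))" and ?M' = "mat_dsum n m (0\<^sub>m n n) (r y)"
    have "r (Q (\<phi> a) + y) = r (Q (\<phi> a)) + r y" using r qX yX by (auto simp: ucp_def linear_map_def op_sys_def)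
    then have ra: "r a = r (Q (\<phi> a)) + r y" by (simp add: y_def)
    have "mat_dsum n m (\<rho> (\<phi> a)) (r a) = ?M + ?M'"
      unfolding ra using ucp_op_mat_mem[OF \<rho> g(1)] ucp_op_mat_mem[OF r qX] ucp_op_mat_mem[OF r yX]
      by (intro eq_matI) (auto simp: mat_dsum_def)
    moreover have "\<Psi> (?M + ?M') = \<Psi> ?M + \<Psi> ?M'" using \<Psi> by (auto simp: ucp_def linear_map_def mat_sys_def)
    ultimately have e: "\<phi>' a - \<phi> a = (\<Psi> ?M - \<phi> a) + \<Psi> ?M'" unfolding \<phi>'_def by simp
    have "norm (\<phi>' a - \<phi> a) \<le> norm (\<Psi> ?M - \<phi> a) + norm (\<Psi> ?M')" unfolding e by (rule norm_triangle_ineq)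
    moreover have "norm (\<Psi> ?M') \<le> \<eta>"
      using norm_mat_dsum_zero_le[OF n X(1) r yX \<Psi> osysD(1)[OF oG]] inv[OF a] by (simp add: y_def norm_minus_commute)
    moreover have "norm (\<Psi> ?M - \<phi> a) \<le> \<epsilon> / 2" by (rule close[OF g(2)])
    ultimately show ?thesis using \<epsilon> by linarith
  qed
  show ?thesis using u\<phi>' uQ' c1 c2 c3 by blast
qed

text \<open>Each point of the dense sequence moves by a summable amount once k exceeds its index.
  The maps are contractive, so convergence spreads to X, and positivity survives because forms are
  continuous in the entries.\<close>

lemma ucp_limit:
  fixes f :: "nat \<Rightarrow> ('h::chilbert_space \<Rightarrow>\<^sub>L 'h) \<Rightarrow> ('g::chilbert_space \<Rightarrow>\<^sub>L 'g)"
  assumes X: "osys X" and G: "operator_system G" and f: "\<And>k. ucp (op_sys X) (op_sys G) (f k)"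
    and d: "\<And>j. d j \<in> X" "X \<subseteq> closure (range d)"
    and step: "\<And>j k. j < k \<Longrightarrow> norm (f (Suc k) (d j) - f k (d j)) \<le> c / 2 ^ k"
  shows "\<exists>g. ucp (op_sys X) (op_sys G) g \<and> (\<forall>x\<in>X. (\<lambda>k. f k x) \<longlonglongrightarrow> g x)"
proof -
  note sX = osysD(2)[OF X]
  have oG: "osys G" "closed G" using G unfolding operator_system_iff by auto
  have rf: "rucp X (f k)" for k by (rule ucp_rucp[OF f X osysD(1)[OF oG(1)]])
  have lip: "norm (f k x - f k y) \<le> norm (x - y)" if "x \<in> X" "y \<in> X" for k x y
    unfolding rucp_diff[OF rf sX that, symmetric]
    by (rule rucp_norm_le[OF rf osysD(2,3)[OF X]]) (rule op_space.subspace_diff[OF sX that])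
  have conv_d: "Cauchy (\<lambda>k. f k (d j))" for j
  proof -
    have "summable (\<lambda>k. c * (1 / 2) ^ k :: real)" by (intro summable_mult summable_geometric) simp
    moreover have "\<forall>\<^sub>F k in sequentially. norm (f (Suc k) (d j) - f k (d j)) \<le> c * (1 / 2) ^ k"
      by (rule eventually_sequentiallyI[of "Suc j"]) (use step[of j] in \<open>simp add: power_one_over\<close>)
    ultimately have "summable (\<lambda>k. f (Suc k) (d j) - f k (d j))"
      by (rule summable_comparison_test_ev[rotated])
    then have "(\<lambda>n. \<Sum>k<n. f (Suc k) (d j) - f k (d j)) \<longlonglongrightarrow> (\<Sum>k. f (Suc k) (d j) - f k (d j))"
      by (rule summable_LIMSEQ)
    moreover have tele: "(\<Sum>k<n. f (Suc k) (d j) - f k (d j)) + f 0 (d j) = f n (d j)" for n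
      using sum_lessThan_telescope[of "\<lambda>k. f k (d j)" n] by simp
    ultimately have "(\<lambda>n. (\<Sum>k<n. f (Suc k) (d j) - f k (d j)) + f 0 (d j)) \<longlonglongrightarrow> (\<Sum>k. f (Suc k) (d j) - f k (d j)) + f 0 (d j)"
      by (intro tendsto_intros)
    then have "(\<lambda>n. f n (d j)) \<longlonglongrightarrow> (\<Sum>k. f (Suc k) (d j) - f k (d j)) + f 0 (d j)"
      by (simp only: tele)
    then show ?thesis by (intro convergent_Cauchy convergentI)
  qed
  have "\<exists>l. (\<lambda>k. f k x) \<longlonglongrightarrow> l" if x: "x \<in> X" for x
  proof -
    have "Cauchy (\<lambda>k. f k x)"
      unfolding Cauchy_def
    proof (intro allI impI)
      fix e :: real assume e: "0 < e"
      obtain j where j: "dist (d j) x < e / 3"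
        using d(2) x e closure_approachable[of x "range d"] by (metis divide_pos_pos rangeE subsetD zero_less_numeral)
      obtain M where M: "\<And>m n. M \<le> m \<Longrightarrow> M \<le> n \<Longrightarrow> dist (f m (d j)) (f n (d j)) < e / 3"
        using conv_d[of j] e unfolding Cauchy_def by (metis divide_pos_pos zero_less_numeral)
      have "dist (f m x) (f n x) < e" if "M \<le> m" "M \<le> n" for m n
      proof -
        have a: "dist (f k x) (f k (d j)) < e / 3" for k
          using lip[OF x d(1), of k j] j by (simp add: dist_norm norm_minus_commute)
        have "dist (f m x) (f n x) \<le> dist (f m x) (f m (d j)) + dist (f m (d j)) (f n (d j)) + dist (f n x) (f n (d j))"
          using dist_triangle[of "f m x" "f n x" "f m (d j)"] dist_triangle[of "f m (d j)" "f n x" "f n (d j)"]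
          by (simp add: dist_commute)
        then show ?thesis using a[of m] a[of n] M[OF that] by linarith
      qed
      then show "\<exists>M. \<forall>m\<ge>M. \<forall>n\<ge>M. dist (f m x) (f n x) < e" by blast
    qed
    then show ?thesis using Cauchy_convergent_iff convergent_def by metis
  qed
  then obtain g where g: "\<And>x. x \<in> X \<Longrightarrow> (\<lambda>k. f k x) \<longlonglongrightarrow> g x" by metis
  have gG: "g x \<in> G" if "x \<in> X" for x
    by (rule closed_sequentially[OF oG(2) _ g[OF that]]) (rule ucp_op_mem[OF f that])
  have "rucp X g"
    unfolding rucp_def
  proof (intro conjI ballI allI impI)
    show "clinear_op (g x)" if "x \<in> X" for x using gG[OF that] osysD(1)[OF oG(1)] by blast
    show "g (x + y) = g x + g y" if xy: "x \<in> X" "y \<in> X" for x y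
    proof (rule LIMSEQ_unique[OF g])
      show "x + y \<in> X" by (rule op_space.subspace_add[OF sX xy])
      show "(\<lambda>k. f k (x + y)) \<longlonglongrightarrow> g x + g y"
        unfolding rucpD(2)[OF rf xy] by (intro tendsto_add g xy)
    qed
    show "g (z *\<^sub>C x) = z *\<^sub>C g x" if x: "x \<in> X" for z x
    proof (rule LIMSEQ_unique[OF g])
      show "z *\<^sub>C x \<in> X" by (rule op_space.subspace_scale[OF sX x])
      have "(\<lambda>k. norm (z *\<^sub>C (f k x - g x))) \<longlonglongrightarrow> cmod z * 0"
        unfolding norm_op_scaleC by (intro tendsto_mult tendsto_const) (use g[OF x] in \<open>simp add: tendsto_norm_zero_iff LIM_zero_iff\<close>)
      then have "(\<lambda>k. z *\<^sub>C (f k x - g x)) \<longlonglongrightarrow> 0" by (simp add: tendsto_norm_zero_iff)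
      then show "(\<lambda>k. f k (z *\<^sub>C x)) \<longlonglongrightarrow> z *\<^sub>C g x"
        unfolding rucpD(3)[OF rf x] op_space.scale_right_diff_distrib by (simp add: LIM_zero_iff)
    qed
    show "g id_blinfun = id_blinfun"
      by (rule LIMSEQ_unique[OF g[OF osysD(3)[OF X]]]) (simp add: rucpD(4)[OF rf])
    fix k x assume x: "\<forall>i<k. \<forall>j<k. x i j \<in> X" "rpos k x"
    show "rpos k (\<lambda>i j. g (x i j))"
      unfolding rpos_def
    proof
      fix h
      have "(\<lambda>q. rform k (\<lambda>i j. f q (x i j)) h h) \<longlonglongrightarrow> rform k (\<lambda>i j. g (x i j)) h h"
        unfolding rform_def using x(1) by (intro tendsto_sum tendsto_inner tendsto_const blinfun.tendsto g) auto
      moreover have "0 \<le> rform k (\<lambda>i j. f q (x i j)) h h" for q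
        using rucpD(5)[OF rf, of k x q] x unfolding rpos_def by blast
      ultimately show "0 \<le> rform k (\<lambda>i j. g (x i j)) h h" by (intro LIMSEQ_le_const) auto
    qed
  qed
  then have "ucp (op_sys X) (op_sys G) g" by (rule rucp_ucp[OF _ sX]) (use gG in auto)
  then show ?thesis using g by blast
qed

lemma dense_sequence:
  fixes X :: "'a::metric_space set"
  assumes "separable_space (top_of_set X)" "X \<noteq> {}"
  shows "\<exists>d :: nat \<Rightarrow> 'a. (\<forall>j. d j \<in> X) \<and> X \<subseteq> closure (range d)"
proof -
  obtain C where C: "countable C" "C \<subseteq> X" "top_of_set X closure_of C = X"
    using assms(1) unfolding separable_space_def by auto
  then have ne: "C \<noteq> {}" using assms(2) by auto
  have "X \<inter> closure (X \<inter> C) = X" using C(3) by (simp add: closure_of_subtopology)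
  then have "X \<subseteq> closure C" using closure_mono[of "X \<inter> C" C] by blast
  then have "X \<subseteq> closure (range (from_nat_into C))" using C(1) ne by simp
  moreover have "from_nat_into C j \<in> X" for j using from_nat_into[OF ne] C(2) by blast
  ultimately show ?thesis by blast
qed

text \<open>On the zero Hilbert space the unit is 0, and a unital linear map into matrices of
  positive size would give 1 = 0; exactness rules this out. The unit vector yields the state that
  starts the iteration.\<close>

lemma one_exact_unit_vector:
  fixes X :: "('h::chilbert_space \<Rightarrow>\<^sub>L 'h) set"
  assumes X: "osys X" "one_exact X" shows "\<exists>e :: 'h. norm e = 1"
proof (rule ccontr)
  assume none: "\<nexists>e :: 'h. norm e = 1"
  have z: "v = 0" for v :: 'h
  proof (rule ccontr)
    assume "v \<noteq> 0"
    then have "norm ((1 / norm v) *\<^sub>R v) = 1" by simp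
    then show False using none by blast
  qed
  have id0: "(id_blinfun :: 'h \<Rightarrow>\<^sub>L 'h) = 0" by (rule blinfun_eqI) (simp add: z)
  obtain E where E: "operator_system E" "finite_dim E" "E \<subseteq> X" using finite_subsystem[OF X(1), of "{}"] by auto
  have oE: "osys E" using E(1) unfolding operator_system_iff by blast
  have "one_exact_fd E" using X(2) E unfolding one_exact_def by blast
  then have "\<exists>n>0. \<exists>\<phi>. ucp (op_sys E) (mat_sys n) \<phi> \<and> expands E (\<lambda>x. emb n (\<phi> x)) (1 + 1)"
    unfolding one_exact_fd_iff[OF oE] by (elim allE[of _ 1]) simp
  then obtain n \<phi> where n: "0 < n" "ucp (op_sys E) (mat_sys n) \<phi>" by blast
  have r: "rucp E (\<lambda>x. emb n (\<phi> x))" by (rule ucp_mat_rucp(1)[OF n(1,2) oE])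
  have "(id_blinfun :: ell2 \<Rightarrow>\<^sub>L ell2) = 0"
    using rucpD(4)[OF r] rucp_zero[OF r osysD(2)[OF oE]] unfolding id0 by simp
  then have "blinfun_apply (id_blinfun :: ell2 \<Rightarrow>\<^sub>L ell2) (ket 0) = 0" by simp
  then show False using norm_ket[of 0] by simp
qed

lemma ucp_scalar_exists:
  fixes X :: "('h::chilbert_space \<Rightarrow>\<^sub>L 'h) set" and G :: "('g::chilbert_space \<Rightarrow>\<^sub>L 'g) set"
  assumes X: "osys X" "one_exact X" and G: "osys G"
  shows "\<exists>\<phi>. ucp (op_sys X) (op_sys G) \<phi>"
proof -
  obtain e :: 'h where e: "norm e = 1" using one_exact_unit_vector[OF X] by blast
  have "rucp X (\<lambda>T. cinner (blinfun_apply T e) e *\<^sub>C (id_blinfun :: 'g \<Rightarrow>\<^sub>L 'g))"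
    by (rule rucp_state[OF osysD(1)[OF X(1)] e])
  then have "ucp (op_sys X) (op_sys G) (\<lambda>T. cinner (blinfun_apply T e) e *\<^sub>C (id_blinfun :: 'g \<Rightarrow>\<^sub>L 'g))"
    by (rule rucp_ucp[OF _ osysD(2)[OF X(1)]])
      (use osysD(2,3)[OF G] in \<open>auto intro: op_space.subspace_scale\<close>)
  then show ?thesis by blast
qed

text \<open>Stage k controls only the first k members of the two dense sequences, with tolerances of
  order 1 / 2^k. Both maps then converge, and the defect of the composite vanishes in the
  limit.\<close>

lemma nuclear_retract_exists:
  fixes X :: "('h::chilbert_space \<Rightarrow>\<^sub>L 'h) set" and G :: "('g::chilbert_space \<Rightarrow>\<^sub>L 'g) set"
  assumes X: "operator_system X" "separable_space (top_of_set X)" "one_exact X" "nuclear X"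
    and G: "gurarij_operator_system G"
  shows "\<exists>\<phi> Q. ucp (op_sys X) (op_sys G) \<phi> \<and> ucp (op_sys G) (op_sys X) Q \<and> (\<forall>x\<in>X. Q (\<phi> x) = x)"
proof -
  have oX: "osys X" using X(1) unfolding operator_system_iff by blast
  have G': "operator_system G" "separable_space (top_of_set G)" "one_exact G"
    using G unfolding gurarij_operator_system_def by blast+
  have oG: "osys G" using G'(1) unfolding operator_system_iff by blast
  obtain xs :: "nat \<Rightarrow> 'h \<Rightarrow>\<^sub>L 'h" where xs: "\<And>j. xs j \<in> X" "X \<subseteq> closure (range xs)"
    using dense_sequence[OF X(2)] osysD(3)[OF oX] by (metis empty_iff)
  obtain gs :: "nat \<Rightarrow> 'g \<Rightarrow>\<^sub>L 'g" where gs: "\<And>j. gs j \<in> G" "G \<subseteq> closure (range gs)"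
    using dense_sequence[OF G'(2)] osysD(3)[OF oG] by (metis empty_iff)
  \<comment> \<open>The defect condition is void for k = 0, so any pair of ucp maps can start the
    recursion.\<close>
  define P where "P k p \<longleftrightarrow> ucp (op_sys X) (op_sys G) (fst p) \<and> ucp (op_sys G) (op_sys X) (snd p) \<and>
    (\<forall>j<k. norm (snd p (fst p (xs j)) - xs j) \<le> 1 / 2 ^ k)"
    for k :: nat and p :: "(('h \<Rightarrow>\<^sub>L 'h) \<Rightarrow> ('g \<Rightarrow>\<^sub>L 'g)) \<times> (('g \<Rightarrow>\<^sub>L 'g) \<Rightarrow> ('h \<Rightarrow>\<^sub>L 'h))"
  \<comment> \<open>2 / 2^k covers the movement \<eta> + \<epsilon> = 1 / 2^k + 1 / 2^(k+1) allowed
    by \<open>approx_retract_step\<close>.\<close>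
  define R where "R k p p' \<longleftrightarrow> (\<forall>j<k. norm (fst p' (xs j) - fst p (xs j)) \<le> 2 / 2 ^ k \<and> norm (snd p' (gs j) - snd p (gs j)) \<le> 2 / 2 ^ k)"
    for k :: nat and p p' :: "(('h \<Rightarrow>\<^sub>L 'h) \<Rightarrow> ('g \<Rightarrow>\<^sub>L 'g)) \<times> (('g \<Rightarrow>\<^sub>L 'g) \<Rightarrow> ('h \<Rightarrow>\<^sub>L 'h))"
  have "\<exists>q. \<forall>k. P k (q k) \<and> R k (q k) (q (Suc k))"
  proof (rule dependent_nat_choice)
    obtain \<phi>0 where "ucp (op_sys X) (op_sys G) \<phi>0" using ucp_scalar_exists[OF oX X(3) oG] by blast
    moreover obtain Q0 where "ucp (op_sys G) (op_sys X) Q0" using ucp_scalar_exists[OF oG G'(3) oX] by blast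
    ultimately show "\<exists>p. P 0 p" unfolding P_def by (intro exI[of _ "(\<phi>0, Q0)"]) simp
  next
    fix p k assume p: "P k p"
    have "finite (xs ` {..<k})" "xs ` {..<k} \<subseteq> X" "finite (xs ` {..<Suc k})" "xs ` {..<Suc k} \<subseteq> X"
      "finite (gs ` {..<k})" "gs ` {..<k} \<subseteq> G" using xs(1) gs(1) by auto
    moreover have "(0 :: real) < 1 / 2 ^ Suc k" by simp
    moreover have "norm (snd p (fst p a) - a) \<le> 1 / 2 ^ k" if "a \<in> xs ` {..<k}" for a
      using p that unfolding P_def by auto
    ultimately have "\<exists>\<phi>' Q'. ucp (op_sys X) (op_sys G) \<phi>' \<and> ucp (op_sys G) (op_sys X) Q' \<and>
      (\<forall>a\<in>xs ` {..<k}. norm (\<phi>' a - fst p a) \<le> 1 / 2 ^ k + 1 / 2 ^ Suc k) \<and> (\<forall>b\<in>gs ` {..<k}. norm (Q' b - snd p b) \<le> 1 / 2 ^ Suc k) \<and>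
      (\<forall>a\<in>xs ` {..<Suc k}. norm (Q' (\<phi>' a) - a) \<le> 1 / 2 ^ Suc k)"
      using p unfolding P_def by (intro approx_retract_step[OF oX X(4) G]) auto
    then obtain \<phi>' Q' where n: "ucp (op_sys X) (op_sys G) \<phi>'" "ucp (op_sys G) (op_sys X) Q'"
      "\<forall>a\<in>xs ` {..<k}. norm (\<phi>' a - fst p a) \<le> 1 / 2 ^ k + 1 / 2 ^ Suc k" "\<forall>b\<in>gs ` {..<k}. norm (Q' b - snd p b) \<le> 1 / 2 ^ Suc k"
      "\<forall>a\<in>xs ` {..<Suc k}. norm (Q' (\<phi>' a) - a) \<le> 1 / 2 ^ Suc k" by blast
    have "(1 :: real) / 2 ^ k + 1 / 2 ^ Suc k \<le> 2 / 2 ^ k" "(1 :: real) / 2 ^ Suc k \<le> 2 / 2 ^ k"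
      by (simp_all add: field_simps)
    then have "R k p (\<phi>', Q')" unfolding R_def using n(3,4) by (auto intro: order_trans)
    moreover have "P (Suc k) (\<phi>', Q')" unfolding P_def using n(1,2,5) by auto
    ultimately show "\<exists>p'. P (Suc k) p' \<and> R k p p'" by blast
  qed
  then obtain q where q: "\<And>k. P k (q k)" "\<And>k. R k (q k) (q (Suc k))" by blast
  define f where "f k = fst (q k)" for k
  define h where "h k = snd (q k)" for k
  have uf: "ucp (op_sys X) (op_sys G) (f k)" and uh: "ucp (op_sys G) (op_sys X) (h k)" for k
    using q(1)[of k] by (auto simp: P_def f_def h_def)
  have sf: "norm (f (Suc k) (xs j) - f k (xs j)) \<le> 2 / 2 ^ k" and sh: "norm (h (Suc k) (gs j) - h k (gs j)) \<le> 2 / 2 ^ k"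
    if "j < k" for j k
    using q(2)[of k] that by (simp_all add: R_def f_def h_def)
  obtain \<phi> where \<phi>: "ucp (op_sys X) (op_sys G) \<phi>" "\<And>x. x \<in> X \<Longrightarrow> (\<lambda>k. f k x) \<longlonglongrightarrow> \<phi> x"
    using ucp_limit[OF oX G'(1) uf xs sf] by blast
  obtain Q where Q: "ucp (op_sys G) (op_sys X) Q" "\<And>x. x \<in> G \<Longrightarrow> (\<lambda>k. h k x) \<longlonglongrightarrow> Q x"
    using ucp_limit[OF oG X(1) uh gs sh] by blast
  have rh: "rucp G (h k)" for k by (rule ucp_rucp[OF uh oG osysD(1)[OF oX]])
  have Qd: "Q (\<phi> (xs j)) = xs j" for j
  proof -
    have gj: "\<phi> (xs j) \<in> G" "f k (xs j) \<in> G" for k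
      using ucp_op_mem[OF \<phi>(1) xs(1)] ucp_op_mem[OF uf xs(1)] by blast+
    \<comment> \<open>Both maps vary with k; contractivity of \<open>h k\<close> lets its argument
      be replaced by the limit point, where \<open>h k\<close> is known to converge.\<close>
    have "(\<lambda>k. h k (f k (xs j)) - h k (\<phi> (xs j))) \<longlonglongrightarrow> 0"
    proof (rule Lim_null_comparison)
      show "\<forall>\<^sub>F k in sequentially. norm (h k (f k (xs j)) - h k (\<phi> (xs j))) \<le> norm (f k (xs j) - \<phi> (xs j))"
      proof (rule always_eventually, rule allI)
        fix k
        show "norm (h k (f k (xs j)) - h k (\<phi> (xs j))) \<le> norm (f k (xs j) - \<phi> (xs j))"
          unfolding rucp_diff[OF rh osysD(2)[OF oG] gj(2,1), symmetric]
          by (rule rucp_norm_le[OF rh osysD(2,3)[OF oG]]) (rule op_space.subspace_diff[OF osysD(2)[OF oG] gj(2,1)])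
      qed
      show "(\<lambda>k. norm (f k (xs j) - \<phi> (xs j))) \<longlonglongrightarrow> 0"
        using \<phi>(2)[OF xs(1)] by (simp add: tendsto_norm_zero_iff LIM_zero_iff)
    qed
    from tendsto_add[OF this Q(2)[OF gj(1)]] have 1: "(\<lambda>k. h k (f k (xs j))) \<longlonglongrightarrow> Q (\<phi> (xs j))" by simp
    have "(\<lambda>k. h k (f k (xs j)) - xs j) \<longlonglongrightarrow> 0"
    proof (rule Lim_null_comparison)
      show "\<forall>\<^sub>F k in sequentially. norm (h k (f k (xs j)) - xs j) \<le> (1 / 2) ^ k"
        using q(1) unfolding P_def f_def h_def by (intro eventually_sequentiallyI[of "Suc j"]) (auto simp: power_one_over)
      show "(\<lambda>k. (1 / 2 :: real) ^ k) \<longlonglongrightarrow> 0" by (rule LIMSEQ_power_zero) simp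
    qed
    then have "(\<lambda>k. h k (f k (xs j))) \<longlonglongrightarrow> xs j" by (simp add: LIM_zero_iff)
    then show ?thesis using LIMSEQ_unique[OF 1] by blast
  qed
  have "Q (\<phi> x) = x" if x: "x \<in> X" for x
  proof -
    have r: "rucp X (\<lambda>x. Q (\<phi> x))" by (rule ucp_rucp[OF ucp_compose[OF \<phi>(1) Q(1)] oX osysD(1)[OF oX]])
    have "norm (Q (\<phi> x) - x) \<le> e" if e: "0 < e" for e
    proof -
      obtain j where j: "dist (xs j) x < e / 2"
        using xs(2) x e closure_approachable[of x "range xs"] by (metis divide_pos_pos rangeE subsetD zero_less_numeral)
      have "norm (Q (\<phi> (x - xs j))) \<le> norm (x - xs j)"
        by (rule rucp_norm_le[OF r osysD(2,3)[OF oX]]) (rule op_space.subspace_diff[OF osysD(2)[OF oX] x xs(1)])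
      then have "norm (Q (\<phi> x) - xs j) \<le> norm (x - xs j)"
        unfolding rucp_diff[OF r osysD(2)[OF oX] x xs(1)] Qd .
      then show ?thesis using j norm_triangle_ineq[of "Q (\<phi> x) - xs j" "xs j - x"]
        by (simp add: dist_norm norm_minus_commute)
    qed
    then have "norm (Q (\<phi> x) - x) \<le> 0" by (rule field_le_epsilon) simp
    then show ?thesis by simp
  qed
  then show ?thesis using \<phi>(1) Q(1) by blast
qed

theorem theorem3p3:
  fixes X :: "('h :: chilbert_space \<Rightarrow>\<^sub>L 'h) set"
    and GS :: "('g :: chilbert_space \<Rightarrow>\<^sub>L 'g) set"
  assumes "operator_system X"
    and "separable_space (top_of_set X)"
    and "one_exact X"
    and "gurarij_operator_system GS"
  shows "nuclear X \<longleftrightarrow>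
    (\<exists>\<phi> P. complete_order_embedding (op_sys X) (op_sys GS) \<phi> \<and>
           ucp_projection_onto (op_sys GS) (\<phi> ` X) P)"
proof
  have oX: "osys X" using assms(1) unfolding operator_system_iff by blast
  have oG: "osys GS" using assms(4) unfolding gurarij_operator_system_def operator_system_iff by blast
  show "nuclear X" if "\<exists>\<phi> P. complete_order_embedding (op_sys X) (op_sys GS) \<phi> \<and> ucp_projection_onto (op_sys GS) (\<phi> ` X) P"
    using that nuclear_retract[OF oX oG gurarij_nuclear[OF assms(4)]] by blast
  assume "nuclear X"
  then obtain \<phi> Q where u: "ucp (op_sys X) (op_sys GS) \<phi>" "ucp (op_sys GS) (op_sys X) Q" and Q\<phi>: "\<And>x. x \<in> X \<Longrightarrow> Q (\<phi> x) = x"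
    using nuclear_retract_exists[OF assms(1-3) _ assms(4)] by blast
  have r: "rucp X \<phi>" by (rule ucp_rucp[OF u(1) oX osysD(1)[OF oG]])
  have rQ: "rucp GS Q" by (rule ucp_rucp[OF u(2) oG osysD(1)[OF oX]])
  have "complete_order_embedding (op_sys X) (op_sys GS) \<phi>"
  proof (rule complete_order_embeddingI[OF r oX])
    show "inj_on \<phi> X" using Q\<phi> by (metis inj_onI)
    show "\<phi> ` X \<subseteq> GS" using ucp_op_mem[OF u(1)] by blast
    fix k x assume x: "\<And>i j. x i j \<in> X" and p: "rpos k (\<lambda>i j. \<phi> (x i j))"
    \<comment> \<open>A ucp left inverse reflects positivity, which makes \<phi> a complete order
      embedding.\<close>
    have "rpos k (\<lambda>i j. Q (\<phi> (x i j)))" by (rule rucpD(5)[OF rQ _ p]) (rule ucp_op_mem[OF u(1) x])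
    then show "rpos k x" by (simp add: Q\<phi> x)
  qed
  moreover have "ucp_projection_onto (op_sys GS) (\<phi> ` X) (\<lambda>y. \<phi> (Q y))"
    unfolding ucp_projection_onto_def
  proof (intro conjI ballI)
    show "ucp (op_sys GS) (op_sys GS) (\<lambda>y. \<phi> (Q y))" by (rule ucp_compose[OF u(2,1)])
    show "\<phi> (Q (\<phi> (Q y))) = \<phi> (Q y)" if "y \<in> elems (op_sys GS)" for y
      using Q\<phi>[OF ucp_op_mem[OF u(2)], of y] that by (simp add: op_sys_def)
    have "Q ` GS = X"
    proof
      show "Q ` GS \<subseteq> X" using ucp_op_mem[OF u(2)] by blast
      show "X \<subseteq> Q ` GS" using Q\<phi> ucp_op_mem[OF u(1)] by (metis image_eqI subsetI)
    qed
    then show "(\<lambda>y. \<phi> (Q y)) ` elems (op_sys GS) = \<phi> ` X" by (simp add: op_sys_def flip: image_image)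
  qed
  ultimately show "\<exists>\<phi> P. complete_order_embedding (op_sys X) (op_sys GS) \<phi> \<and> ucp_projection_onto (op_sys GS) (\<phi> ` X) P"
    by blast
qed

end
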